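(* Let $(K,\partial)$ be a field with a derivation $\partial$, and let $k:=K^{\partial}=\{a\in K:\partial(a)=0\}$ be its field of constants, with $\operatorname{char} k=0$. Suppose that $k$ is existentially closed in $K$. Then, for any finite-dimensional differential module $(M,\nabla_M)$ over $(K,\partial)$, there exists a Picard--Vessiot extension for $M$.
   Context: A field $k$ is existentially closed in an extension field $F\supset k$ if for every finitely generated $k$-subalgebra $R\subset F$ there is a homomorphism of $k$-algebras $R\to k$. A finite-dimensional differential module over $(K,\partial)$ is a finite-dimensional $K$-vector space $M$ with an additive map $\nabla_M: M\to M$ such that $\nabla_M(am)=\partial(a)m+a\nabla_M(m)$ for $a\in K$, $m\in M$. For a differential field extension $(L,\partial)\supset (K,\partial)$, the space $M_L:=L\otimes_K M$ carries the induced structure $\nabla(a\otimes m)=\partial(a)\otimes m+a\otimes\nabla_M(m)$; a vector is horizontal if it is killed by this map. A Picard--Vessiot extension for $M$ is a differential field extension $(K,\partial)\subset(L,\partial)$ such that: (1) $L^{\partial}=K^{\partial}$; (2) there is a basis $m_1,\dots,m_n$ of $M_L$ over $L$ consisting of horizontal vectors; (3) there is no smaller differential subfield of $L$ containing $K$ and the coordinates of the $m_i$ with respect to a basis of $M$ over $K$. *)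

theory Defs
  imports "Jordan_Normal_Form.Missing_VectorSpace"
    "HOL-Algebra.Generated_Rings" "HOL-Algebra.Free_Abelian_Groups"
begin

section \<open>Differential fields\<close>

locale differential_field = field K for K (structure) +
  fixes d :: "'a \<Rightarrow> 'a"
  assumes d_closed: "a \<in> carrier K \<Longrightarrow> d a \<in> carrier K"
    and d_add: "a \<in> carrier K \<Longrightarrow> b \<in> carrier K \<Longrightarrow> d (a \<oplus> b) = d a \<oplus> d b"
    and d_mult: "a \<in> carrier K \<Longrightarrow> b \<in> carrier K \<Longrightarrow> d (a \<otimes> b) = d a \<otimes> b \<oplus> a \<otimes> d b"

definition constants :: "('a, 'r) ring_scheme \<Rightarrow> ('a \<Rightarrow> 'a) \<Rightarrow> 'a set" where
  "constants K d = {a \<in> carrier K. d a = \<zero>\<^bsub>K\<^esub>}"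

definition differential_subfield :: "'a set \<Rightarrow> ('a, 'r) ring_scheme \<Rightarrow> ('a \<Rightarrow> 'a) \<Rightarrow> bool" where
  "differential_subfield F L d \<longleftrightarrow> subfield F L \<and> d ` F \<subseteq> F"

text \<open>An extension \<open>K \<subset> L\<close> is given by an embedding \<open>h\<close> (a unital ring homomorphism of fields,
  hence injective) that is compatible with the derivations.\<close>

locale differential_field_extension =
  K: differential_field K dK + L: differential_field L dL
  for K :: "('a, 'r) ring_scheme" and dK and L :: "('b, 's) ring_scheme" and dL +
  fixes h :: "'a \<Rightarrow> 'b"
  assumes hom: "h \<in> ring_hom K L"
    and hom_d: "a \<in> carrier K \<Longrightarrow> h (dK a) = dL (h a)"

definition char_zero :: "('a, 'r) ring_scheme \<Rightarrow> bool" where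
  "char_zero R \<longleftrightarrow> (\<forall>n::nat. n > 0 \<longrightarrow> [n] \<cdot>\<^bsub>R\<^esub> \<one>\<^bsub>R\<^esub> \<noteq> \<zero>\<^bsub>R\<^esub>)"

text \<open>The finitely generated \<open>k\<close>-subalgebras of \<open>F\<close> are the subrings generated by \<open>k \<union> S\<close>
  with \<open>S\<close> finite.\<close>

definition existentially_closed_in :: "'a set \<Rightarrow> ('a, 'r) ring_scheme \<Rightarrow> bool" where
  "existentially_closed_in k F \<longleftrightarrow> field F \<and> subfield k F \<and>
     (\<forall>S. finite S \<and> S \<subseteq> carrier F \<longrightarrow>
        (\<exists>\<phi> \<in> ring_hom (F\<lparr>carrier := generate_ring F (k \<union> S)\<rparr>) (F\<lparr>carrier := k\<rparr>).
           \<forall>c\<in>k. \<phi> c = c))"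


section \<open>Differential modules\<close>

locale differential_module = differential_field K d + V: vectorspace K M
  for K :: "('a, 'r) ring_scheme" and d and M :: "('a, 'm, 's) module_scheme" +
  fixes nab :: "'m \<Rightarrow> 'm"
  assumes finite_dimensional: "V.fin_dim"
    and nab_closed: "x \<in> carrier M \<Longrightarrow> nab x \<in> carrier M"
    and nab_add: "x \<in> carrier M \<Longrightarrow> y \<in> carrier M \<Longrightarrow> nab (x \<oplus>\<^bsub>M\<^esub> y) = nab x \<oplus>\<^bsub>M\<^esub> nab y"
    and nab_smult: "a \<in> carrier K \<Longrightarrow> x \<in> carrier M \<Longrightarrow>
      nab (a \<odot>\<^bsub>M\<^esub> x) = d a \<odot>\<^bsub>M\<^esub> x \<oplus>\<^bsub>M\<^esub> a \<odot>\<^bsub>M\<^esub> nab x"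


section \<open>Base change\<close>

text \<open>\<open>L \<otimes>\<^sub>K M\<close> is the free abelian group on \<open>L \<times> M\<close> modulo the subgroup generated by the
  usual relators; \<open>L\<close> is a \<open>K\<close>-module via \<open>h\<close>.\<close>

abbreviation tensor_free ::
  "('b, 's) ring_scheme \<Rightarrow> ('a, 'm, 't) module_scheme \<Rightarrow> ('b \<times> 'm \<Rightarrow>\<^sub>0 int) monoid" where
  "tensor_free L M \<equiv> free_Abelian_group (carrier L \<times> carrier M)"

definition tensor_relators :: "('a, 'r) ring_scheme \<Rightarrow> ('b, 's) ring_scheme \<Rightarrow> ('a \<Rightarrow> 'b) \<Rightarrow>
    ('a, 'm, 't) module_scheme \<Rightarrow> ('b \<times> 'm \<Rightarrow>\<^sub>0 int) set" where
  "tensor_relators K L h M =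
     {frag_of (a \<oplus>\<^bsub>L\<^esub> b, x) - frag_of (a, x) - frag_of (b, x) | a b x.
        a \<in> carrier L \<and> b \<in> carrier L \<and> x \<in> carrier M} \<union>
     {frag_of (a, x \<oplus>\<^bsub>M\<^esub> y) - frag_of (a, x) - frag_of (a, y) | a x y.
        a \<in> carrier L \<and> x \<in> carrier M \<and> y \<in> carrier M} \<union>
     {frag_of (a \<otimes>\<^bsub>L\<^esub> h c, x) - frag_of (a, c \<odot>\<^bsub>M\<^esub> x) | a c x.
        a \<in> carrier L \<and> c \<in> carrier K \<and> x \<in> carrier M}"

definition tensor_null :: "('a, 'r) ring_scheme \<Rightarrow> ('b, 's) ring_scheme \<Rightarrow> ('a \<Rightarrow> 'b) \<Rightarrow>
    ('a, 'm, 't) module_scheme \<Rightarrow> ('b \<times> 'm \<Rightarrow>\<^sub>0 int) set" where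
  "tensor_null K L h M = generate (tensor_free L M) (tensor_relators K L h M)"

text \<open>The map induced on the quotient by the additive map that sends a generator \<open>(a, x)\<close> to
  \<open>f (a, x)\<close>: the image of a coset need not be a full coset, so the null subgroup is added.\<close>

definition tensor_induced :: "('a, 'r) ring_scheme \<Rightarrow> ('b, 's) ring_scheme \<Rightarrow> ('a \<Rightarrow> 'b) \<Rightarrow>
    ('a, 'm, 't) module_scheme \<Rightarrow> ('b \<times> 'm \<Rightarrow> ('b \<times> 'm \<Rightarrow>\<^sub>0 int)) \<Rightarrow>
    ('b \<times> 'm \<Rightarrow>\<^sub>0 int) set \<Rightarrow> ('b \<times> 'm \<Rightarrow>\<^sub>0 int) set" where
  "tensor_induced K L h M f X = tensor_null K L h M <#>\<^bsub>tensor_free L M\<^esub> (frag_extend f ` X)"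

definition tensor :: "('a, 'r) ring_scheme \<Rightarrow> ('b, 's) ring_scheme \<Rightarrow> ('a \<Rightarrow> 'b) \<Rightarrow>
    ('a, 'm, 't) module_scheme \<Rightarrow> 'b \<Rightarrow> 'm \<Rightarrow> ('b \<times> 'm \<Rightarrow>\<^sub>0 int) set" where
  "tensor K L h M a x = tensor_null K L h M #>\<^bsub>tensor_free L M\<^esub> frag_of (a, x)"

text \<open>The fields \<open>mult\<close> and \<open>one\<close> of a module record carry no meaning.\<close>

definition base_change :: "('a, 'r) ring_scheme \<Rightarrow> ('b, 's) ring_scheme \<Rightarrow> ('a \<Rightarrow> 'b) \<Rightarrow>
    ('a, 'm, 't) module_scheme \<Rightarrow> ('b, ('b \<times> 'm \<Rightarrow>\<^sub>0 int) set) module" where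
  "base_change K L h M =
     (let Q = tensor_free L M Mod tensor_null K L h M in
      \<lparr>carrier = carrier Q,
       mult = (\<lambda>X Y. \<one>\<^bsub>Q\<^esub>),
       one = \<one>\<^bsub>Q\<^esub>,
       ring.zero = \<one>\<^bsub>Q\<^esub>,
       add = monoid.mult Q,
       smult = (\<lambda>a. tensor_induced K L h M (\<lambda>(b, x). frag_of (a \<otimes>\<^bsub>L\<^esub> b, x)))\<rparr>)"

definition base_change_nab :: "('a, 'r) ring_scheme \<Rightarrow> ('b, 's) ring_scheme \<Rightarrow> ('b \<Rightarrow> 'b) \<Rightarrow>
    ('a \<Rightarrow> 'b) \<Rightarrow> ('a, 'm, 't) module_scheme \<Rightarrow> ('m \<Rightarrow> 'm) \<Rightarrow>
    ('b \<times> 'm \<Rightarrow>\<^sub>0 int) set \<Rightarrow> ('b \<times> 'm \<Rightarrow>\<^sub>0 int) set" where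
  "base_change_nab K L dL h M nab =
     tensor_induced K L h M (\<lambda>(a, x). frag_of (dL a, x) + frag_of (a, nab x))"


section \<open>Picard--Vessiot extensions\<close>

text \<open>The coordinates of the vectors in \<open>B\<close> with respect to the basis \<open>{1 \<otimes> e | e \<in> E}\<close> of
  \<open>L \<otimes>\<^sub>K M\<close>, where \<open>E\<close> is a basis of \<open>M\<close>; note that \<open>c \<cdot> (1 \<otimes> e) = c \<otimes> e\<close>.\<close>

definition coordinates :: "('a, 'r) ring_scheme \<Rightarrow> ('b, 's) ring_scheme \<Rightarrow> ('a \<Rightarrow> 'b) \<Rightarrow>
    ('a, 'm, 't) module_scheme \<Rightarrow> 'm set \<Rightarrow> ('b \<times> 'm \<Rightarrow>\<^sub>0 int) set set \<Rightarrow> 'b set" where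
  "coordinates K L h M E B =
     {c e | c e. e \<in> E \<and> c \<in> E \<rightarrow> carrier L \<and>
        (\<Oplus>\<^bsub>base_change K L h M\<^esub> u\<in>E. tensor K L h M (c u) u) \<in> B}"

text \<open>A Picard--Vessiot extension \<open>L\<close> of a finite-dimensional module is generated as a field by
  \<open>K\<close> and finitely many coordinates, so for infinite \<open>K\<close> (in particular in characteristic zero) it
  has the cardinality of \<open>K\<close>.  Asserting existence with \<open>L\<close> carried by the element type of \<open>K\<close>
  therefore loses no generality.  The minimality clause does not depend on the choice of \<open>E\<close>.\<close>

definition picard_vessiot_extension :: "('a, 'r) ring_scheme \<Rightarrow> ('a \<Rightarrow> 'a) \<Rightarrow>
    ('a, 'm, 't) module_scheme \<Rightarrow> ('m \<Rightarrow> 'm) \<Rightarrow>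
    ('b, 's) ring_scheme \<Rightarrow> ('b \<Rightarrow> 'b) \<Rightarrow> ('a \<Rightarrow> 'b) \<Rightarrow> bool" where
  "picard_vessiot_extension K dK M nab L dL h \<longleftrightarrow>
     differential_field_extension K dK L dL h \<and>
     constants L dL = h ` constants K dK \<and>
     (\<exists>B. vectorspace.basis L (base_change K L h M) B \<and>
          (\<forall>m\<in>B. base_change_nab K L dL h M nab m = \<zero>\<^bsub>base_change K L h M\<^esub>) \<and>
          (\<exists>E. vectorspace.basis K M E \<and>
               (\<forall>F. differential_subfield F L dL \<and> h ` carrier K \<subseteq> F \<and>
                    coordinates K L h M E B \<subseteq> F \<longrightarrow> F = carrier L)))"

end

theory Submission
  imports Defs "HOL-Algebra.Finite_Extensions" "HOL-Algebra.Generated_Fields"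
    "HOL-Algebra.Ring_Divisibility" "HOL-Algebra.Weak_Morphisms"
begin

text \<open>Choose a basis of \<open>M\<close>, so that horizontal vectors are the solutions of \<open>x' = A x\<close> for a matrix \<open>A\<close> over \<open>K\<close>.
 The rational function field \<open>L = K(x\<^sub>i\<^sub>j)\<close> of a generic matrix with the derivation \<open>x' = A x\<close> contains a fundamental matrix,
 but its field of constants \<open>C\<close> may be larger than \<open>k\<close>. As an intermediate field of a finitely generated extension,
 \<open>C\<close> is generated over \<open>k\<close> by finitely many elements. For such constants \<open>c = p(x) / q(x)\<close>, existential closedness of
 \<open>k\<close> in \<open>K\<close> yields \<open>k\<close>-rational values that avoid the zeros of any prescribed nonzero polynomial expression. For a suitable choice
 the specialisation of the constants leaves a proper differential ideal in the coordinate ring, and a prime differential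
 ideal above it gives a differential field \<open>E\<close> over \<open>K\<close> with a fundamental matrix \<open>X\<close>. For a generic matrix \<open>Z\<close> of constants, \<open>x \<mapsto> X Z\<close>
 embeds \<open>L\<close> into \<open>E(Z)\<close>; comparing constants there shows that \<open>E\<close> has no constants besides \<open>k\<close>.\<close>

text \<open>If \<open>k\<close> is not algebraically closed, a maximal differential ideal of the
  coordinate ring of the generic solution may lead to new constants, algebraic over
  \<open>k\<close>. This is the obstacle: the constants of \<open>L\<close> are therefore sent to
  \<open>k\<close> beforehand, and a prime differential ideal is only chosen above the result. Right
  multiplication of solutions by constant matrices acts on the constants of \<open>L\<close>. For
  each generator \<open>c\<close> the action is a formula \<open>P / Q\<close> in the matrix
  entries, with coefficients among the constants of \<open>L\<close>. These coefficients, and the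
  inverse of one value of \<open>Q\<close>, are specialised together with \<open>c\<close>, so that
  the formula persists over \<open>E\<close>, now with coefficients in \<open>k\<close>. For the
  ideal to stay proper, a single nonzero \<open>h\<close> in \<open>K[A]\<close> has to stay
  nonzero, where \<open>A\<close> is the ring of constants that is specialised. As \<open>K\<close>
  is linearly disjoint from the constants over \<open>k\<close>, this holds as soon as one nonzero
  \<open>u\<close> in \<open>A\<close> keeps a nonzero value, and that is a condition which a point
  over \<open>k\<close> can be made to satisfy.\<close>

no_notation var (\<open>X\<index>\<close>)

section \<open>Polynomial terms\<close>

text \<open>Polynomials are kept as terms because the same polynomial is evaluated over fields of
  different types, with different coefficient maps. Terms have no normal form; identities between
  them are tested by evaluation over infinite fields.\<close>

datatype (tconsts: 'a, tvars: 'v) pterm =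
 PConst 'a | PVar 'v | PAdd "('a, 'v) pterm" "('a, 'v) pterm" | PMul "('a, 'v) pterm" "('a, 'v) pterm"

primrec peval :: "('b, 's) ring_scheme \<Rightarrow> ('a \<Rightarrow> 'b) \<Rightarrow> ('v \<Rightarrow> 'b) \<Rightarrow> ('a, 'v) pterm \<Rightarrow> 'b" where
 "peval R f y (PConst c) = f c"
| "peval R f y (PVar v) = y v"
| "peval R f y (PAdd s t) = peval R f y s \<oplus>\<^bsub>R\<^esub> peval R f y t"
| "peval R f y (PMul s t) = peval R f y s \<otimes>\<^bsub>R\<^esub> peval R f y t"

definition pterms :: "'a set \<Rightarrow> 'v set \<Rightarrow> ('a, 'v) pterm set" where
 "pterms A V = {t. tconsts t \<subseteq> A \<and> tvars t \<subseteq> V}"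

lemma pterms_simps [simp]:
 "PConst c \<in> pterms A V \<longleftrightarrow> c \<in> A"
 "PVar v \<in> pterms A V \<longleftrightarrow> v \<in> V"
 "PAdd s t \<in> pterms A V \<longleftrightarrow> s \<in> pterms A V \<and> t \<in> pterms A V"
 "PMul s t \<in> pterms A V \<longleftrightarrow> s \<in> pterms A V \<and> t \<in> pterms A V"
 by (auto simp: pterms_def)

lemma pterms_mono: "t \<in> pterms A V \<Longrightarrow> A \<subseteq> A' \<Longrightarrow> V \<subseteq> V' \<Longrightarrow> t \<in> pterms A' V'"
 by (auto simp: pterms_def)

lemma finite_tconsts: "finite (tconsts t)"
 by (induction t) auto

lemma pterms_map: "t \<in> pterms A V \<Longrightarrow> f ` A \<subseteq> B \<Longrightarrow> map_pterm f id t \<in> pterms B V"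
 by (auto simp: pterms_def pterm.set_map)

lemma peval_map: "peval R f y (map_pterm g id t) = peval R (f \<circ> g) y t"
 by (induction t) auto

lemma peval_cong:
 assumes "t \<in> pterms A V" and "\<And>c. c \<in> A \<Longrightarrow> f c = f' c" and "\<And>v. v \<in> V \<Longrightarrow> y v = y' v"
 shows "peval R f y t = peval R f' y' t"
 using assms by (induction t) auto

lemma peval_carrier_update [simp]: "peval (R\<lparr>carrier := X\<rparr>) f y t = peval R f y t"
 by (induction t) auto

lemma (in ring) peval_in_subring:
 assumes "subring S R" "t \<in> pterms A V" "f \<in> A \<rightarrow> S" "y \<in> V \<rightarrow> S"
 shows "peval R f y t \<in> S"
 using assms(2-)
proof (induction t)
 case (PAdd s t)
 thus ?case using subringE(7)[OF assms(1)] by simp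
next
 case (PMul s t)
 thus ?case using subringE(6)[OF assms(1)] by simp
qed auto

lemma (in ring) peval_closed:
 assumes "t \<in> pterms A V" "f \<in> A \<rightarrow> carrier R" "y \<in> V \<rightarrow> carrier R"
 shows "peval R f y t \<in> carrier R"
 by (rule peval_in_subring[OF carrier_is_subring assms])

lemma peval_hom:
 assumes "g \<in> ring_hom R S" "ring R" "t \<in> pterms A V" "f \<in> A \<rightarrow> carrier R" "y \<in> V \<rightarrow> carrier R"
 shows "g (peval R f y t) = peval S (g \<circ> f) (g \<circ> y) t"
 using assms(3)
proof (induction t)
 case (PAdd s t)
 hence st: "s \<in> pterms A V" "t \<in> pterms A V" by auto
 show ?case
  using PAdd.IH(1)[OF st(1)] PAdd.IH(2)[OF st(2)]
   ring_hom_add[OF assms(1) ring.peval_closed[OF assms(2) st(1) assms(4,5)]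
    ring.peval_closed[OF assms(2) st(2) assms(4,5)]] by simp
next
 case (PMul s t)
 hence st: "s \<in> pterms A V" "t \<in> pterms A V" by auto
 show ?case
  using PMul.IH(1)[OF st(1)] PMul.IH(2)[OF st(2)]
   ring_hom_mult[OF assms(1) ring.peval_closed[OF assms(2) st(1) assms(4,5)]
    ring.peval_closed[OF assms(2) st(2) assms(4,5)]] by simp
qed auto

lemma peval_hom_on_subring:
 assumes "subring B R" "ring R" "g \<in> ring_hom (R\<lparr>carrier := B\<rparr>) S" "t \<in> pterms A V"
  "f \<in> A \<rightarrow> B" "y \<in> V \<rightarrow> B"
 shows "g (peval R f y t) = peval S (g \<circ> f) (g \<circ> y) t"
proof -
 have "f \<in> A \<rightarrow> carrier (R\<lparr>carrier := B\<rparr>)" "y \<in> V \<rightarrow> carrier (R\<lparr>carrier := B\<rparr>)"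
  using assms(5,6) by auto
 from peval_hom[OF assms(3) ring.subring_is_ring[OF assms(2,1)] assms(4) this]
 show ?thesis by (simp only: peval_carrier_update)
qed

primrec psubst :: "('v \<Rightarrow> ('a, 'w) pterm) \<Rightarrow> ('a, 'v) pterm \<Rightarrow> ('a, 'w) pterm" where
 "psubst \<sigma> (PConst c) = PConst c"
| "psubst \<sigma> (PVar v) = \<sigma> v"
| "psubst \<sigma> (PAdd s t) = PAdd (psubst \<sigma> s) (psubst \<sigma> t)"
| "psubst \<sigma> (PMul s t) = PMul (psubst \<sigma> s) (psubst \<sigma> t)"

lemma psubst_in_pterms:
 "t \<in> pterms A V \<Longrightarrow> (\<And>v. v \<in> V \<Longrightarrow> \<sigma> v \<in> pterms A W) \<Longrightarrow> psubst \<sigma> t \<in> pterms A W"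
 by (induction t) auto

lemma peval_psubst: "peval R f y (psubst \<sigma> t) = peval R f (\<lambda>v. peval R f y (\<sigma> v)) t"
 by (induction t) auto

text \<open>The coefficient type carries no zero of its own, so the constant \<open>z\<close> that
  plays this role is an argument.\<close>

definition psum :: "'a \<Rightarrow> (nat \<Rightarrow> ('a, 'v) pterm) \<Rightarrow> nat \<Rightarrow> ('a, 'v) pterm" where
 "psum z f n = rec_nat (PConst z) (\<lambda>i t. PAdd (f i) t) n"

lemma psum_in_pterms: "z \<in> A \<Longrightarrow> (\<And>i. i < n \<Longrightarrow> g i \<in> pterms A V) \<Longrightarrow> psum z g n \<in> pterms A V"
 by (induction n) (auto simp: psum_def)

lemma (in ring) peval_psum:
 assumes "f z = \<zero>" "\<And>i. i < n \<Longrightarrow> peval R f y (g i) \<in> carrier R"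
 shows "peval R f y (psum z g n) = (\<Oplus>i\<in>{..<n}. peval R f y (g i))"
 using assms(2)
proof (induction n)
 case 0
 thus ?case by (simp add: psum_def assms(1))
next
 case (Suc n)
 hence "(\<Oplus>i\<in>{..<Suc n}. peval R f y (g i))
   = peval R f y (g n) \<oplus> (\<Oplus>i\<in>{..<n}. peval R f y (g i))"
  unfolding lessThan_Suc by (subst finsum_insert) auto
 with Suc show ?case by (simp add: psum_def)
qed

section \<open>Polynomial functions of one variable\<close>

lemma (in field) poly_vanishing:
 assumes "p \<in> carrier (poly_ring R)" "infinite A" "A \<subseteq> carrier R" "\<And>s. s \<in> A \<Longrightarrow> ring.eval R p s = \<zero>"
 shows "p = []"
proof (rule ccontr)
 assume "p \<noteq> []"
 hence "A \<subseteq> {x. is_root p x}"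
  using assms(3,4) by (auto simp: is_root_def)
 thus False
  using finite_number_of_roots[OF assms(1)] assms(2) finite_subset by blast
qed

text \<open>The restriction of a polynomial in several variables to a line is such a function. In
  this way statements about several variables are reduced to the finiteness of the set of
  roots.\<close>

definition (in ring) poly_fun :: "('a \<Rightarrow> 'a) \<Rightarrow> bool" where
 "poly_fun g \<longleftrightarrow> (\<exists>p\<in>carrier (poly_ring R). \<forall>s\<in>carrier R. g s = ring.eval R p s)"

lemma (in field) poly_fun_const: "c \<in> carrier R \<Longrightarrow> poly_fun (\<lambda>s. c)"
proof -
 assume c: "c \<in> carrier R"
 show ?thesis
 proof (cases "c = \<zero>")
  case True
  have "[] \<in> carrier (poly_ring R)" by (simp add: univ_poly_zero_closed)
  with True show ?thesis unfolding poly_fun_def by (intro bexI[of _ "[]"]) auto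
 next
  case False
  with c have "[c] \<in> carrier (poly_ring R)"
   by (simp add: univ_poly_carrier[symmetric] polynomial_def)
  with c show ?thesis unfolding poly_fun_def by (intro bexI[of _ "[c]"]) auto
 qed
qed

lemma (in field) poly_fun_ident: "poly_fun (\<lambda>s. s)"
proof -
 have "[\<one>, \<zero>] \<in> carrier (poly_ring R)"
  by (simp add: univ_poly_carrier[symmetric] polynomial_def)
 thus ?thesis unfolding poly_fun_def by (intro bexI[of _ "[\<one>, \<zero>]"]) auto
qed

lemma (in field) poly_fun_add:
 assumes "poly_fun g" "poly_fun g'"
 shows "poly_fun (\<lambda>s. g s \<oplus> g' s)"
proof -
 obtain p q where p: "p \<in> carrier (poly_ring R)" "\<forall>s\<in>carrier R. g s = ring.eval R p s"
  and q: "q \<in> carrier (poly_ring R)" "\<forall>s\<in>carrier R. g' s = ring.eval R q s"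
  using assms unfolding poly_fun_def by auto
 have "\<And>s. s \<in> carrier R \<Longrightarrow> ring.eval R (p \<oplus>\<^bsub>poly_ring R\<^esub> q) s = ring.eval R p s \<oplus> ring.eval R q s"
  using eval_is_hom[OF carrier_is_subring] p q by (simp add: ring_hom_def)
 moreover have "p \<oplus>\<^bsub>poly_ring R\<^esub> q \<in> carrier (poly_ring R)"
  using p q ring.ring_simprules(1)[OF univ_poly_is_ring[OF carrier_is_subring]] by blast
 ultimately show ?thesis using p q unfolding poly_fun_def by (intro bexI) auto
qed

lemma (in field) poly_fun_mult:
 assumes "poly_fun g" "poly_fun g'"
 shows "poly_fun (\<lambda>s. g s \<otimes> g' s)"
proof -
 obtain p q where p: "p \<in> carrier (poly_ring R)" "\<forall>s\<in>carrier R. g s = ring.eval R p s"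
  and q: "q \<in> carrier (poly_ring R)" "\<forall>s\<in>carrier R. g' s = ring.eval R q s"
  using assms unfolding poly_fun_def by auto
 have "\<And>s. s \<in> carrier R \<Longrightarrow> ring.eval R (p \<otimes>\<^bsub>poly_ring R\<^esub> q) s = ring.eval R p s \<otimes> ring.eval R q s"
  using eval_is_hom[OF carrier_is_subring] p q by (simp add: ring_hom_def)
 moreover have "p \<otimes>\<^bsub>poly_ring R\<^esub> q \<in> carrier (poly_ring R)"
  using p q ring.ring_simprules(5)[OF univ_poly_is_ring[OF carrier_is_subring]] by blast
 ultimately show ?thesis using p q unfolding poly_fun_def by (intro bexI) auto
qed

lemma (in field) poly_fun_closed: "poly_fun g \<Longrightarrow> s \<in> carrier R \<Longrightarrow> g s \<in> carrier R"
 unfolding poly_fun_def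
 by (auto simp: univ_poly_carrier[symmetric] intro!: eval_poly_in_carrier[OF carrier_is_subring])

lemma (in field) poly_fun_zero:
 assumes "poly_fun g" "infinite A" "A \<subseteq> carrier R" "\<And>s. s \<in> A \<Longrightarrow> g s = \<zero>" "x \<in> carrier R"
 shows "g x = \<zero>"
proof -
 obtain p where p: "p \<in> carrier (poly_ring R)" "\<And>s. s \<in> carrier R \<Longrightarrow> g s = ring.eval R p s"
  using assms(1) unfolding poly_fun_def by auto
 have "p = []"
  by (rule poly_vanishing[OF p(1) assms(2,3)]) (use p(2)[symmetric] assms(3,4) in auto)
 thus ?thesis using p(2)[OF assms(5)] by simp
qed

text \<open>\<open>g\<close> has a nonzero value, hence finitely many zeros; \<open>g'\<close>
  vanishes at the infinitely many remaining points, hence everywhere.\<close>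

lemma (in field) poly_fun_integral:
 assumes "poly_fun g" "poly_fun g'" "infinite (carrier R)" "\<And>s. s \<in> carrier R \<Longrightarrow> g s \<otimes> g' s = \<zero>"
  and "x \<in> carrier R" "g x \<noteq> \<zero>" "z \<in> carrier R"
 shows "g' z = \<zero>"
proof -
 have "finite {s \<in> carrier R. g s = \<zero>}"
  using poly_fun_zero[OF assms(1) _ _ _ assms(5), of "{s \<in> carrier R. g s = \<zero>}"] assms(6) by blast
 hence inf: "infinite {s \<in> carrier R. g s \<noteq> \<zero>}"
  using assms(3) by (metis (no_types, lifting) Diff_infinite_finite finite_subset DiffD1 DiffD2 mem_Collect_eq subsetI)
 show ?thesis
 proof (rule poly_fun_zero[OF assms(2) inf _ _ assms(7)])
  fix s assume "s \<in> {s \<in> carrier R. g s \<noteq> \<zero>}"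
  thus "g' s = \<zero>"
   using assms(4)[of s] integral[of "g s" "g' s"] poly_fun_closed assms(1,2) by auto
 qed auto
qed

lemma (in field) peval_poly_fun:
 assumes "t \<in> pterms A V" "f \<in> A \<rightarrow> carrier R" "\<And>v. v \<in> V \<Longrightarrow> poly_fun (\<lambda>s. y s v)"
 shows "poly_fun (\<lambda>s. peval R f (y s) t)"
 using assms(1)
 by (induction t) (use assms(2,3) in \<open>auto intro: poly_fun_const poly_fun_add poly_fun_mult\<close>)

lemma (in field) poly_fun_line:
 "a \<in> carrier R \<Longrightarrow> b \<in> carrier R \<Longrightarrow> poly_fun (\<lambda>s. a \<oplus> s \<otimes> b)"
 by (intro poly_fun_add poly_fun_mult poly_fun_const poly_fun_ident)

lemma (in field) peval_vanishing:
 assumes A: "infinite A" "A \<subseteq> carrier R" and "finite V" and t: "t \<in> pterms C V" and f: "f \<in> C \<rightarrow> carrier R"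
  and 0: "\<And>y. y \<in> V \<rightarrow> A \<Longrightarrow> peval R f y t = \<zero>" and y: "y \<in> V \<rightarrow> carrier R"
 shows "peval R f y t = \<zero>"
proof -
 \<comment> \<open>The variables in \<open>V'\<close> are released from \<open>A\<close> to the
   whole field. Releasing one more is a statement about one variable, for which the infinitely many
   values in \<open>A\<close> suffice.\<close>
 have "V' \<subseteq> V \<Longrightarrow> (\<forall>y. (\<forall>v\<in>V'. y v \<in> carrier R) \<and> (\<forall>v\<in>V - V'. y v \<in> A) \<longrightarrow> peval R f y t = \<zero>)" for V'
 proof (induction V' rule: infinite_finite_induct)
  case (infinite V')
  thus ?case using \<open>finite V\<close> finite_subset by blast
 next
  case empty
  thus ?case using 0 by auto
 next
  case (insert v V')
  show ?case
  proof (intro allI impI)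
   fix y assume y: "(\<forall>u\<in>insert v V'. y u \<in> carrier R) \<and> (\<forall>u\<in>V - insert v V'. y u \<in> A)"
   have y': "y u \<in> carrier R" if "u \<in> V" for u using y A(2) that by auto
   have pf: "poly_fun (\<lambda>s. peval R f (y(v := s)) t)"
   proof (rule peval_poly_fun[OF t f])
    fix u assume "u \<in> V"
    thus "poly_fun (\<lambda>s. (y(v := s)) u)"
     using y' by (cases "u = v") (auto intro: poly_fun_const poly_fun_ident)
   qed
   have "peval R f (y(v := y v)) t = \<zero>"
   proof (rule poly_fun_zero[OF pf A])
    fix s assume "s \<in> A"
    thus "peval R f (y(v := s)) t = \<zero>"
     using insert y A(2) by auto
   qed (use y in auto)
   thus "peval R f y t = \<zero>" by simp
  qed
 qed
 from this[of V] show ?thesis using y by auto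
qed

section \<open>Derivations and fraction fields\<close>

definition derivation :: "('a, 'r) ring_scheme \<Rightarrow> ('a \<Rightarrow> 'a) \<Rightarrow> bool" where
 "derivation R D \<longleftrightarrow> (\<forall>a\<in>carrier R. D a \<in> carrier R) \<and>
  (\<forall>a\<in>carrier R. \<forall>b\<in>carrier R. D (a \<oplus>\<^bsub>R\<^esub> b) = D a \<oplus>\<^bsub>R\<^esub> D b \<and>
    D (a \<otimes>\<^bsub>R\<^esub> b) = D a \<otimes>\<^bsub>R\<^esub> b \<oplus>\<^bsub>R\<^esub> a \<otimes>\<^bsub>R\<^esub> D b)"

lemma differential_field_iff: "differential_field F d \<longleftrightarrow> field F \<and> derivation F d"
 by (auto simp: differential_field_def differential_field_axioms_def derivation_def)

lemma derivation_closed: "derivation R D \<Longrightarrow> a \<in> carrier R \<Longrightarrow> D a \<in> carrier R"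
 and derivation_add: "derivation R D \<Longrightarrow> a \<in> carrier R \<Longrightarrow> b \<in> carrier R
  \<Longrightarrow> D (a \<oplus>\<^bsub>R\<^esub> b) = D a \<oplus>\<^bsub>R\<^esub> D b"
 and derivation_mult: "derivation R D \<Longrightarrow> a \<in> carrier R \<Longrightarrow> b \<in> carrier R
  \<Longrightarrow> D (a \<otimes>\<^bsub>R\<^esub> b) = D a \<otimes>\<^bsub>R\<^esub> b \<oplus>\<^bsub>R\<^esub> a \<otimes>\<^bsub>R\<^esub> D b"
 by (simp_all add: derivation_def)

lemma (in cring) derivation_zero: "derivation R D \<Longrightarrow> D \<zero> = \<zero>"
 using derivation_add[of R D \<zero> \<zero>] derivation_closed[of R D \<zero>] add.l_cancel_one' by fastforce

lemma (in cring) derivation_one: "derivation R D \<Longrightarrow> D \<one> = \<zero>"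
 using derivation_mult[of R D \<one> \<one>] derivation_closed[of R D \<one>] add.l_cancel_one' by fastforce

lemma (in cring) derivation_a_inv:
 assumes D: "derivation R D" and a: "a \<in> carrier R"
 shows "D (\<ominus> a) = \<ominus> D a"
proof -
 have "D a \<oplus> D (\<ominus> a) = D (a \<oplus> \<ominus> a)"
  by (rule derivation_add[OF D, symmetric]) (use a in auto)
 also have "\<dots> = \<zero>" using a derivation_zero[OF D] by (simp add: r_neg)
 finally show ?thesis
  using a derivation_closed[OF D] by (metis a_inv_closed sum_zero_eq_neg add.m_comm)
qed

section \<open>The fraction field of a domain with its derivation\<close>

definition fcls :: "('a, 'r) ring_scheme \<Rightarrow> 'a \<Rightarrow> 'a \<Rightarrow> ('a \<times> 'a) set" where
 "fcls R a s = {(b, t). b \<in> carrier R \<and> t \<in> carrier R - {\<zero>\<^bsub>R\<^esub>} \<and> a \<otimes>\<^bsub>R\<^esub> t = b \<otimes>\<^bsub>R\<^esub> s}"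

text \<open>Operations on classes go through an arbitrary representative; \<open>frac_mult\<close>,
  \<open>frac_add\<close> and \<open>frac_deriv_fcls\<close> show that the choice does not
  matter.\<close>

definition fnum :: "('a \<times> 'a) set \<Rightarrow> 'a" where "fnum X = fst (SOME p. p \<in> X)"
definition fden :: "('a \<times> 'a) set \<Rightarrow> 'a" where "fden X = snd (SOME p. p \<in> X)"

definition frac_field :: "('a, 'r) ring_scheme \<Rightarrow> ('a \<times> 'a) set ring" where
 "frac_field R = \<lparr>carrier = {fcls R a s |a s. a \<in> carrier R \<and> s \<in> carrier R - {\<zero>\<^bsub>R\<^esub>}},
  monoid.mult = (\<lambda>X Y. fcls R (fnum X \<otimes>\<^bsub>R\<^esub> fnum Y) (fden X \<otimes>\<^bsub>R\<^esub> fden Y)),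
  monoid.one = fcls R \<one>\<^bsub>R\<^esub> \<one>\<^bsub>R\<^esub>,
  ring.zero = fcls R \<zero>\<^bsub>R\<^esub> \<one>\<^bsub>R\<^esub>,
  ring.add = (\<lambda>X Y. fcls R (fnum X \<otimes>\<^bsub>R\<^esub> fden Y \<oplus>\<^bsub>R\<^esub> fnum Y \<otimes>\<^bsub>R\<^esub> fden X) (fden X \<otimes>\<^bsub>R\<^esub> fden Y))\<rparr>"

definition frac_deriv :: "('a, 'r) ring_scheme \<Rightarrow> ('a \<Rightarrow> 'a) \<Rightarrow> ('a \<times> 'a) set \<Rightarrow> ('a \<times> 'a) set" where
 "frac_deriv R D X = fcls R (D (fnum X) \<otimes>\<^bsub>R\<^esub> fden X \<oplus>\<^bsub>R\<^esub> \<ominus>\<^bsub>R\<^esub> (fnum X \<otimes>\<^bsub>R\<^esub> D (fden X)))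
  (fden X \<otimes>\<^bsub>R\<^esub> fden X)"

context domain
begin

lemma fcls_subset:
 assumes "a \<in> carrier R" "b \<in> carrier R" "s \<in> carrier R" "t \<in> carrier R" "t \<noteq> \<zero>" "s \<noteq> \<zero>"
  and eq: "a \<otimes> t = b \<otimes> s"
 shows "fcls R a s \<subseteq> fcls R b t"
proof
 fix p assume "p \<in> fcls R a s"
 then obtain c u where p: "p = (c, u)" and c: "c \<in> carrier R" "u \<in> carrier R" "u \<noteq> \<zero>" "a \<otimes> u = c \<otimes> s"
  by (auto simp: fcls_def)
 have "s \<otimes> (b \<otimes> u) = (b \<otimes> s) \<otimes> u" using assms c by algebra
 also have "\<dots> = (a \<otimes> u) \<otimes> t" unfolding eq[symmetric] using assms(1-4) c(1,2) by algebra
 also have "\<dots> = (c \<otimes> s) \<otimes> t" by (simp only: c(4))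
 also have "\<dots> = s \<otimes> (c \<otimes> t)" using assms(1-4) c(1,2) by algebra
 finally have "b \<otimes> u = c \<otimes> t"
  using m_lcancel[of s "b \<otimes> u" "c \<otimes> t"] assms c by simp
 thus "p \<in> fcls R b t"
  unfolding p fcls_def using c by auto
qed

lemma fcls_eq_iff:
 assumes "a \<in> carrier R" "b \<in> carrier R" "s \<in> carrier R" "t \<in> carrier R" "s \<noteq> \<zero>" "t \<noteq> \<zero>"
 shows "fcls R a s = fcls R b t \<longleftrightarrow> a \<otimes> t = b \<otimes> s"
proof
 assume eq: "fcls R a s = fcls R b t"
 have "(b, t) \<in> fcls R b t" using assms by (auto simp: fcls_def)
 hence "(b, t) \<in> fcls R a s" using eq by simp
 thus "a \<otimes> t = b \<otimes> s" by (auto simp: fcls_def)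
next
 assume "a \<otimes> t = b \<otimes> s"
 with fcls_subset[of a b s t] fcls_subset[of b a t s] assms show "fcls R a s = fcls R b t" by auto
qed

lemma frep:
 assumes "a \<in> carrier R" "s \<in> carrier R" "s \<noteq> \<zero>"
 shows "fnum (fcls R a s) \<in> carrier R" "fden (fcls R a s) \<in> carrier R" "fden (fcls R a s) \<noteq> \<zero>"
  "a \<otimes> fden (fcls R a s) = fnum (fcls R a s) \<otimes> s"
proof -
 have "(SOME p. p \<in> fcls R a s) \<in> fcls R a s"
  by (rule someI[of _ "(a, s)"]) (use assms in \<open>auto simp: fcls_def\<close>)
 hence "(fnum (fcls R a s), fden (fcls R a s)) \<in> fcls R a s"
  by (simp add: fnum_def fden_def)
 thus "fnum (fcls R a s) \<in> carrier R" "fden (fcls R a s) \<in> carrier R" "fden (fcls R a s) \<noteq> \<zero>"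
  "a \<otimes> fden (fcls R a s) = fnum (fcls R a s) \<otimes> s"
  by (auto simp: fcls_def)
qed

lemma frac_carrier_iff:
 "X \<in> carrier (frac_field R) \<longleftrightarrow> (\<exists>a s. a \<in> carrier R \<and> s \<in> carrier R \<and> s \<noteq> \<zero> \<and> X = fcls R a s)"
 by (auto simp: frac_field_def)

lemma frac_mult:
 assumes "a \<in> carrier R" "s \<in> carrier R" "s \<noteq> \<zero>" "b \<in> carrier R" "t \<in> carrier R" "t \<noteq> \<zero>"
 shows "fcls R a s \<otimes>\<^bsub>frac_field R\<^esub> fcls R b t = fcls R (a \<otimes> b) (s \<otimes> t)"
proof -
 define a' s' b' t' where [simp]: "a' = fnum (fcls R a s)" "s' = fden (fcls R a s)"
  "b' = fnum (fcls R b t)" "t' = fden (fcls R b t)"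
 have *: "a' \<in> carrier R" "s' \<in> carrier R" "s' \<noteq> \<zero>" "a \<otimes> s' = a' \<otimes> s"
  "b' \<in> carrier R" "t' \<in> carrier R" "t' \<noteq> \<zero>" "b \<otimes> t' = b' \<otimes> t"
  using frep assms by auto
 have "a' \<otimes> b' \<otimes> (s \<otimes> t) = (a' \<otimes> s) \<otimes> (b' \<otimes> t)" using assms * by algebra
 also have "\<dots> = (a \<otimes> s') \<otimes> (b \<otimes> t')" using * by simp
 also have "\<dots> = a \<otimes> b \<otimes> (s' \<otimes> t')" using assms *(1-3,5-7) by algebra
 finally have "fcls R (a' \<otimes> b') (s' \<otimes> t') = fcls R (a \<otimes> b) (s \<otimes> t)"
  using assms * by (subst fcls_eq_iff) (auto simp: integral_iff)
 thus ?thesis by (simp add: frac_field_def)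
qed

lemma frac_add:
 assumes "a \<in> carrier R" "s \<in> carrier R" "s \<noteq> \<zero>" "b \<in> carrier R" "t \<in> carrier R" "t \<noteq> \<zero>"
 shows "fcls R a s \<oplus>\<^bsub>frac_field R\<^esub> fcls R b t = fcls R (a \<otimes> t \<oplus> b \<otimes> s) (s \<otimes> t)"
proof -
 define a' s' b' t' where [simp]: "a' = fnum (fcls R a s)" "s' = fden (fcls R a s)"
  "b' = fnum (fcls R b t)" "t' = fden (fcls R b t)"
 have *: "a' \<in> carrier R" "s' \<in> carrier R" "s' \<noteq> \<zero>" "a \<otimes> s' = a' \<otimes> s"
  "b' \<in> carrier R" "t' \<in> carrier R" "t' \<noteq> \<zero>" "b \<otimes> t' = b' \<otimes> t"
  using frep assms by auto
 have "(a' \<otimes> t' \<oplus> b' \<otimes> s') \<otimes> (s \<otimes> t) = (a' \<otimes> s) \<otimes> t' \<otimes> t \<oplus> (b' \<otimes> t) \<otimes> s' \<otimes> s"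
  using assms * by algebra
 also have "\<dots> = (a \<otimes> s') \<otimes> t' \<otimes> t \<oplus> (b \<otimes> t') \<otimes> s' \<otimes> s" using * by simp
 also have "\<dots> = (a \<otimes> t \<oplus> b \<otimes> s) \<otimes> (s' \<otimes> t')" using assms *(1-3,5-7) by algebra
 finally have "fcls R (a' \<otimes> t' \<oplus> b' \<otimes> s') (s' \<otimes> t') = fcls R (a \<otimes> t \<oplus> b \<otimes> s) (s \<otimes> t)"
  using assms * by (subst fcls_eq_iff) (auto simp: integral_iff)
 thus ?thesis by (simp add: frac_field_def)
qed

lemma frac_one: "\<one>\<^bsub>frac_field R\<^esub> = fcls R \<one> \<one>" and frac_zero: "\<zero>\<^bsub>frac_field R\<^esub> = fcls R \<zero> \<one>"
 by (simp_all add: frac_field_def)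

text \<open>Differentiating \<open>a t = b s\<close> gives \<open>a' t + a t' = b' s + b s'\<close>;
  multiplied by \<open>s t\<close>, this compares the numerators that the quotient rule assigns to
  the two representatives.\<close>

lemma frac_deriv_fcls:
 assumes D: "derivation R D" and as: "a \<in> carrier R" "s \<in> carrier R" "s \<noteq> \<zero>"
 shows "frac_deriv R D (fcls R a s) = fcls R (D a \<otimes> s \<oplus> \<ominus> (a \<otimes> D s)) (s \<otimes> s)"
proof -
 define b t where bt: "b = fnum (fcls R a s)" "t = fden (fcls R a s)"
 have *: "b \<in> carrier R" "t \<in> carrier R" "t \<noteq> \<zero>" "a \<otimes> t = b \<otimes> s"
  using frep as unfolding bt by auto
 note c = as(1,2) *(1,2) derivation_closed[OF D as(1)] derivation_closed[OF D as(2)]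
  derivation_closed[OF D *(1)] derivation_closed[OF D *(2)]
 have e: "D a \<otimes> t \<oplus> a \<otimes> D t = D b \<otimes> s \<oplus> b \<otimes> D s"
  using derivation_mult[OF D as(1) *(2)] derivation_mult[OF D *(1) as(2)] *(4) by simp
 \<comment> \<open>A numerator of the quotient rule with its subtracted term added back. It is used
   for \<open>a / s\<close> and, with \<open>s\<close> and \<open>t\<close> exchanged, for
   \<open>b / t\<close>.\<close>
 have A: "(x \<otimes> s \<oplus> \<ominus> (a \<otimes> y)) \<otimes> (t \<otimes> t) \<oplus> (a \<otimes> t) \<otimes> (y \<otimes> t) = (x \<otimes> t) \<otimes> (s \<otimes> t)"
  if "a \<in> carrier R" "s \<in> carrier R" "t \<in> carrier R" "x \<in> carrier R" "y \<in> carrier R" for a s t x y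
  using that by algebra
 have "(D a \<otimes> s \<oplus> \<ominus> (a \<otimes> D s)) \<otimes> (t \<otimes> t) \<oplus> ((a \<otimes> t) \<otimes> (D s \<otimes> t) \<oplus> (a \<otimes> D t) \<otimes> (s \<otimes> t))
   = (D a \<otimes> t) \<otimes> (s \<otimes> t) \<oplus> (a \<otimes> D t) \<otimes> (s \<otimes> t)"
  using c A[OF c(1,2,4), of "D a" "D s"] by (subst a_assoc[symmetric]) auto
 also have "\<dots> = (D b \<otimes> s \<oplus> b \<otimes> D s) \<otimes> (s \<otimes> t)"
  using c by (simp add: e[symmetric] l_distr r_distr)
 also have "\<dots> = (D b \<otimes> s) \<otimes> (t \<otimes> s) \<oplus> (b \<otimes> D s) \<otimes> (s \<otimes> t)"
  using c by (subst l_distr) (auto simp: m_comm[of s t])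
 also have "\<dots> = (D b \<otimes> t \<oplus> \<ominus> (b \<otimes> D t)) \<otimes> (s \<otimes> s) \<oplus> ((b \<otimes> s) \<otimes> (D t \<otimes> s) \<oplus> (b \<otimes> D s) \<otimes> (s \<otimes> t))"
  using c A[OF c(3,4,2), of "D b" "D t"] by (subst a_assoc[symmetric]) auto
 also have "(b \<otimes> s) \<otimes> (D t \<otimes> s) \<oplus> (b \<otimes> D s) \<otimes> (s \<otimes> t) = (a \<otimes> t) \<otimes> (D s \<otimes> t) \<oplus> (a \<otimes> D t) \<otimes> (s \<otimes> t)"
 proof -
  have "(b \<otimes> D s) \<otimes> (s \<otimes> t) = (b \<otimes> s) \<otimes> (D s \<otimes> t)" using c by algebra
  moreover have "(a \<otimes> D t) \<otimes> (s \<otimes> t) = (a \<otimes> t) \<otimes> (D t \<otimes> s)" using c by algebra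
  ultimately show ?thesis using c *(4) by (simp add: a_comm)
 qed
 finally have "(D a \<otimes> s \<oplus> \<ominus> (a \<otimes> D s)) \<otimes> (t \<otimes> t) = (D b \<otimes> t \<oplus> \<ominus> (b \<otimes> D t)) \<otimes> (s \<otimes> s)"
  using c by (subst (asm) add.right_cancel) auto
 hence "fcls R (D b \<otimes> t \<oplus> \<ominus> (b \<otimes> D t)) (t \<otimes> t) = fcls R (D a \<otimes> s \<oplus> \<ominus> (a \<otimes> D s)) (s \<otimes> s)"
  using c as * by (subst fcls_eq_iff) (auto simp: integral_iff)
 thus ?thesis by (simp add: frac_deriv_def bt)
qed

lemma frac_induct:
 assumes "X \<in> carrier (frac_field R)"
  "\<And>a s. \<lbrakk>a \<in> carrier R; s \<in> carrier R; s \<noteq> \<zero>\<rbrakk> \<Longrightarrow> P (fcls R a s)"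
 shows "P X"
proof -
 obtain a s where "a \<in> carrier R" "s \<in> carrier R" "s \<noteq> \<zero>" "X = fcls R a s"
  using assms(1) unfolding frac_carrier_iff by auto
 thus ?thesis using assms(2) by simp
qed

lemma frac_add_same:
 assumes "a \<in> carrier R" "s \<in> carrier R" "s \<noteq> \<zero>" "b \<in> carrier R"
 shows "fcls R a s \<oplus>\<^bsub>frac_field R\<^esub> fcls R b s = fcls R (a \<oplus> b) s"
proof -
 have "a \<otimes> s \<oplus> b \<otimes> s = (a \<oplus> b) \<otimes> s"
  using assms by (simp add: l_distr)
 thus ?thesis
  using assms by (simp add: frac_add fcls_eq_iff integral_iff m_assoc)
qed

lemma frac_common:
 assumes "X \<in> carrier (frac_field R)" "Y \<in> carrier (frac_field R)"
 shows "\<exists>a b s. X = fcls R a s \<and> Y = fcls R b s \<and> a \<in> carrier R \<and> b \<in> carrier R \<and> s \<in> carrier R \<and> s \<noteq> \<zero>"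
 using assms
proof (elim frac_induct)
 fix a s b t assume c: "a \<in> carrier R" "s \<in> carrier R" "b \<in> carrier R" "t \<in> carrier R"
  and nz: "s \<noteq> \<zero>" "t \<noteq> \<zero>"
 have "fcls R a s = fcls R (a \<otimes> t) (s \<otimes> t)" "fcls R b t = fcls R (b \<otimes> s) (s \<otimes> t)"
  using c nz by (simp_all add: fcls_eq_iff integral_iff m_ac)
 thus "\<exists>a' b' s'. fcls R a s = fcls R a' s' \<and> fcls R b t = fcls R b' s' \<and>
   a' \<in> carrier R \<and> b' \<in> carrier R \<and> s' \<in> carrier R \<and> s' \<noteq> \<zero>"
  using c nz by (intro exI[of _ "a \<otimes> t"] exI[of _ "b \<otimes> s"] exI[of _ "s \<otimes> t"]) (auto simp: integral_iff)
qed

lemma frac_is_field: "field (frac_field R)"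
proof -
 let ?F = "frac_field R"
 have fcl: "fcls R a s \<in> carrier ?F" if "a \<in> carrier R" "s \<in> carrier R" "s \<noteq> \<zero>" for a s
  using that unfolding frac_carrier_iff by auto
 have "cring ?F"
 proof (rule cringI)
  show "abelian_group ?F"
  proof (rule abelian_groupI)
   fix X Y assume XY: "X \<in> carrier ?F" "Y \<in> carrier ?F"
   thus "X \<oplus>\<^bsub>?F\<^esub> Y \<in> carrier ?F"
    by (elim frac_induct) (simp add: frac_add fcl integral_iff)
   from XY show "X \<oplus>\<^bsub>?F\<^esub> Y = Y \<oplus>\<^bsub>?F\<^esub> X"
    by (elim frac_induct) (simp add: frac_add m_comm a_comm)
  next
   show "\<zero>\<^bsub>?F\<^esub> \<in> carrier ?F" by (simp add: frac_zero fcl)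
  next
   fix X Y Z assume "X \<in> carrier ?F" "Y \<in> carrier ?F" "Z \<in> carrier ?F"
   thus "X \<oplus>\<^bsub>?F\<^esub> Y \<oplus>\<^bsub>?F\<^esub> Z = X \<oplus>\<^bsub>?F\<^esub> (Y \<oplus>\<^bsub>?F\<^esub> Z)"
   proof (elim frac_induct)
    fix a s b t c u
    assume c: "a \<in> carrier R" "s \<in> carrier R" "b \<in> carrier R" "t \<in> carrier R"
     "c \<in> carrier R" "u \<in> carrier R" and nz: "s \<noteq> \<zero>" "t \<noteq> \<zero>" "u \<noteq> \<zero>"
    have "c \<otimes> (s \<otimes> t) = c \<otimes> t \<otimes> s" "b \<otimes> s \<otimes> u = b \<otimes> u \<otimes> s"
     using c by (simp_all add: m_ac)
    moreover have "(a \<otimes> t \<oplus> b \<otimes> s) \<otimes> u \<oplus> c \<otimes> (s \<otimes> t)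
      = a \<otimes> (t \<otimes> u) \<oplus> (b \<otimes> s \<otimes> u \<oplus> c \<otimes> (s \<otimes> t))"
     using c by (simp add: l_distr m_assoc a_assoc)
    moreover have "(b \<otimes> u \<oplus> c \<otimes> t) \<otimes> s = b \<otimes> u \<otimes> s \<oplus> c \<otimes> t \<otimes> s"
     using c by (intro l_distr) auto
    ultimately have "(a \<otimes> t \<oplus> b \<otimes> s) \<otimes> u \<oplus> c \<otimes> (s \<otimes> t) = a \<otimes> (t \<otimes> u) \<oplus> (b \<otimes> u \<oplus> c \<otimes> t) \<otimes> s"
     by simp
    thus "fcls R a s \<oplus>\<^bsub>?F\<^esub> fcls R b t \<oplus>\<^bsub>?F\<^esub> fcls R c u
     = fcls R a s \<oplus>\<^bsub>?F\<^esub> (fcls R b t \<oplus>\<^bsub>?F\<^esub> fcls R c u)"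
     using c nz by (simp add: frac_add integral_iff m_assoc)
   qed
  next
   fix X assume X: "X \<in> carrier ?F"
   thus "\<zero>\<^bsub>?F\<^esub> \<oplus>\<^bsub>?F\<^esub> X = X"
    by (elim frac_induct) (simp add: frac_add frac_zero)
   from X show "\<exists>Y\<in>carrier ?F. Y \<oplus>\<^bsub>?F\<^esub> X = \<zero>\<^bsub>?F\<^esub>"
   proof (elim frac_induct)
    fix a s assume c: "a \<in> carrier R" "s \<in> carrier R" "s \<noteq> \<zero>"
    have "\<ominus> a \<otimes> s \<oplus> a \<otimes> s = \<zero>" using c by (simp add: l_minus l_neg)
    hence "fcls R (\<ominus> a) s \<oplus>\<^bsub>?F\<^esub> fcls R a s = \<zero>\<^bsub>?F\<^esub>"
     using c by (simp add: frac_add frac_zero fcls_eq_iff integral_iff)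
    thus "\<exists>Y\<in>carrier ?F. Y \<oplus>\<^bsub>?F\<^esub> fcls R a s = \<zero>\<^bsub>?F\<^esub>"
     by (rule bexI) (use c in \<open>auto intro: fcl\<close>)
   qed
  qed
  show "comm_monoid ?F"
  proof (rule comm_monoidI)
   fix X Y assume XY: "X \<in> carrier ?F" "Y \<in> carrier ?F"
   thus "X \<otimes>\<^bsub>?F\<^esub> Y \<in> carrier ?F"
    by (elim frac_induct) (simp add: frac_mult fcl integral_iff)
   from XY show "X \<otimes>\<^bsub>?F\<^esub> Y = Y \<otimes>\<^bsub>?F\<^esub> X"
    by (elim frac_induct) (simp add: frac_mult m_comm)
  next
   show "\<one>\<^bsub>?F\<^esub> \<in> carrier ?F" by (simp add: frac_one fcl)
  next
   fix X Y Z assume "X \<in> carrier ?F" "Y \<in> carrier ?F" "Z \<in> carrier ?F"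
   thus "X \<otimes>\<^bsub>?F\<^esub> Y \<otimes>\<^bsub>?F\<^esub> Z = X \<otimes>\<^bsub>?F\<^esub> (Y \<otimes>\<^bsub>?F\<^esub> Z)"
    by (elim frac_induct) (simp add: frac_mult integral_iff m_assoc)
  next
   fix X assume X: "X \<in> carrier ?F"
   thus "\<one>\<^bsub>?F\<^esub> \<otimes>\<^bsub>?F\<^esub> X = X"
    by (elim frac_induct) (simp add: frac_mult frac_one)
  qed
  fix X Y Z assume "X \<in> carrier ?F" "Y \<in> carrier ?F" "Z \<in> carrier ?F"
  thus "(X \<oplus>\<^bsub>?F\<^esub> Y) \<otimes>\<^bsub>?F\<^esub> Z = X \<otimes>\<^bsub>?F\<^esub> Z \<oplus>\<^bsub>?F\<^esub> Y \<otimes>\<^bsub>?F\<^esub> Z"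
  proof (elim frac_induct)
   fix a s b t c u
   assume c: "a \<in> carrier R" "s \<in> carrier R" "b \<in> carrier R" "t \<in> carrier R"
    "c \<in> carrier R" "u \<in> carrier R" and nz: "s \<noteq> \<zero>" "t \<noteq> \<zero>" "u \<noteq> \<zero>"
   have "(a \<otimes> t \<oplus> b \<otimes> s) \<otimes> c \<otimes> (s \<otimes> u \<otimes> (t \<otimes> u))
    = (a \<otimes> c \<otimes> (t \<otimes> u) \<oplus> b \<otimes> c \<otimes> (s \<otimes> u)) \<otimes> (s \<otimes> t \<otimes> u)"
    using c by algebra
   thus "(fcls R a s \<oplus>\<^bsub>?F\<^esub> fcls R b t) \<otimes>\<^bsub>?F\<^esub> fcls R c u
    = fcls R a s \<otimes>\<^bsub>?F\<^esub> fcls R c u \<oplus>\<^bsub>?F\<^esub> fcls R b t \<otimes>\<^bsub>?F\<^esub> fcls R c u"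
    using c nz by (simp add: frac_add frac_mult integral_iff fcls_eq_iff)
  qed
 qed
 then interpret F: cring ?F .
 show ?thesis
 proof (rule F.cring_fieldI2)
  show "\<zero>\<^bsub>?F\<^esub> \<noteq> \<one>\<^bsub>?F\<^esub>"
   by (simp add: frac_zero frac_one fcls_eq_iff)
  fix X assume "X \<in> carrier ?F" "X \<noteq> \<zero>\<^bsub>?F\<^esub>"
  then obtain a s where c: "a \<in> carrier R" "s \<in> carrier R" "s \<noteq> \<zero>" and X: "X = fcls R a s"
   and "fcls R a s \<noteq> \<zero>\<^bsub>?F\<^esub>"
   unfolding frac_carrier_iff by auto
  show "\<exists>Y\<in>carrier ?F. X \<otimes>\<^bsub>?F\<^esub> Y = \<one>\<^bsub>?F\<^esub>"
  proof -
   have "a \<noteq> \<zero>" using c \<open>fcls R a s \<noteq> _\<close> by (auto simp: frac_zero fcls_eq_iff)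
   hence "fcls R a s \<otimes>\<^bsub>?F\<^esub> fcls R s a = \<one>\<^bsub>?F\<^esub>"
    using c by (simp add: frac_mult frac_one fcls_eq_iff integral_iff m_comm)
   thus ?thesis
    unfolding X by (rule bexI) (use c \<open>a \<noteq> \<zero>\<close> in \<open>auto intro: fcl\<close>)
  qed
 qed
qed

lemma frac_deriv_derivation:
 assumes D: "derivation R D"
 shows "derivation (frac_field R) (frac_deriv R D)"
 unfolding derivation_def
proof (intro conjI ballI)
 fix X assume "X \<in> carrier (frac_field R)"
 then obtain a s where "a \<in> carrier R" "s \<in> carrier R" "s \<noteq> \<zero>" and X: "X = fcls R a s"
  unfolding frac_carrier_iff by auto
 thus "frac_deriv R D X \<in> carrier (frac_field R)"
  unfolding X frac_carrier_iff using derivation_closed[OF D]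
  by (intro exI[of _ "D a \<otimes> s \<oplus> \<ominus> (a \<otimes> D s)"] exI[of _ "s \<otimes> s"]) (simp add: frac_deriv_fcls[OF D] integral_iff)
next
 note Dc = derivation_closed[OF D]
 let ?F = "frac_field R"
 fix X Y assume X: "X \<in> carrier ?F" and Y: "Y \<in> carrier ?F"
 have fcl: "fcls R a s \<in> carrier ?F" if "a \<in> carrier R" "s \<in> carrier R" "s \<noteq> \<zero>" for a s
  using that unfolding frac_carrier_iff by auto
 \<comment> \<open>Over a common denominator the sum rule is an identity between numerators, and the
   product rule needs the cancellation of one factor \<open>s\<close>.\<close>
 from X Y obtain a b s where XY: "X = fcls R a s" "Y = fcls R b s"
  and c: "a \<in> carrier R" "s \<in> carrier R" "b \<in> carrier R" and nz: "s \<noteq> \<zero>"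
  using frac_common[OF X Y] by auto
 note c' = c Dc[OF c(1)] Dc[OF c(2)] Dc[OF c(3)]
 have e1: "D (a \<oplus> b) \<otimes> s \<oplus> \<ominus> ((a \<oplus> b) \<otimes> D s)
   = (D a \<otimes> s \<oplus> \<ominus> (a \<otimes> D s)) \<oplus> (D b \<otimes> s \<oplus> \<ominus> (b \<otimes> D s))"
  unfolding derivation_add[OF D c(1,3)] using c' by algebra
 show "frac_deriv R D (X \<oplus>\<^bsub>?F\<^esub> Y) = frac_deriv R D X \<oplus>\<^bsub>?F\<^esub> frac_deriv R D Y"
  unfolding XY using c' nz e1
  by (simp add: frac_add_same frac_deriv_fcls[OF D] integral_iff)
 have e2: "D (a \<otimes> b) \<otimes> (s \<otimes> s) \<oplus> \<ominus> (a \<otimes> b \<otimes> D (s \<otimes> s))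
   = ((D a \<otimes> s \<oplus> \<ominus> (a \<otimes> D s)) \<otimes> b \<oplus> a \<otimes> (D b \<otimes> s \<oplus> \<ominus> (b \<otimes> D s))) \<otimes> s"
  unfolding derivation_mult[OF D c(1,3)] derivation_mult[OF D c(2,2)] using c' by algebra
 let ?N = "(D a \<otimes> s \<oplus> \<ominus> (a \<otimes> D s)) \<otimes> b \<oplus> a \<otimes> (D b \<otimes> s \<oplus> \<ominus> (b \<otimes> D s))"
 have "frac_deriv R D (X \<otimes>\<^bsub>?F\<^esub> Y) = fcls R (?N \<otimes> s) (s \<otimes> s \<otimes> (s \<otimes> s))"
  unfolding XY using c' nz e2
  by (simp add: frac_mult frac_deriv_fcls[OF D] integral_iff)
 also have "\<dots> = fcls R ?N (s \<otimes> s \<otimes> s)"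
  using c' nz by (subst fcls_eq_iff) (auto simp: integral_iff m_ac)
 also have "\<dots> = frac_deriv R D X \<otimes>\<^bsub>?F\<^esub> Y \<oplus>\<^bsub>?F\<^esub> X \<otimes>\<^bsub>?F\<^esub> frac_deriv R D Y"
  unfolding XY using c' nz
  by (simp add: frac_mult frac_add_same frac_deriv_fcls[OF D] integral_iff m_assoc)
 finally show "frac_deriv R D (X \<otimes>\<^bsub>?F\<^esub> Y)
  = frac_deriv R D X \<otimes>\<^bsub>?F\<^esub> Y \<oplus>\<^bsub>?F\<^esub> X \<otimes>\<^bsub>?F\<^esub> frac_deriv R D Y" .
qed

lemma frac_embed:
 "(\<lambda>a. fcls R a \<one>) \<in> ring_hom R (frac_field R)"
proof (rule ring_hom_memI)
 fix a assume "a \<in> carrier R"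
 thus "fcls R a \<one> \<in> carrier (frac_field R)"
  unfolding frac_carrier_iff by (intro exI[of _ a] exI[of _ "\<one>"]) auto
qed (auto simp: frac_mult frac_add frac_one)

lemma frac_embed_zero: "a \<in> carrier R \<Longrightarrow> fcls R a \<one> = \<zero>\<^bsub>frac_field R\<^esub> \<longleftrightarrow> a = \<zero>"
 by (auto simp: frac_zero fcls_eq_iff)

lemma frac_embed_deriv:
 "derivation R D \<Longrightarrow> a \<in> carrier R \<Longrightarrow> frac_deriv R D (fcls R a \<one>) = fcls R (D a) \<one>"
 using derivation_closed[of R D a]
 by (simp add: frac_deriv_fcls derivation_one)

lemma frac_fraction:
 assumes "X \<in> carrier (frac_field R)"
 shows "\<exists>a\<in>carrier R. \<exists>s\<in>carrier R - {\<zero>}. X \<otimes>\<^bsub>frac_field R\<^esub> fcls R s \<one> = fcls R a \<one>"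
 using assms
proof (elim frac_induct)
 fix a s assume c: "a \<in> carrier R" "s \<in> carrier R" "s \<noteq> \<zero>"
 hence "fcls R a s \<otimes>\<^bsub>frac_field R\<^esub> fcls R s \<one> = fcls R a \<one>"
  by (simp add: frac_mult fcls_eq_iff)
 with c show "\<exists>b\<in>carrier R. \<exists>t\<in>carrier R - {\<zero>}. fcls R a s \<otimes>\<^bsub>frac_field R\<^esub> fcls R t \<one> = fcls R b \<one>"
  by blast
qed

end

section \<open>Prime differential ideals\<close>

lemma (in cring) exists_primeideal:
 assumes "ideal I R" "\<one> \<notin> I"
 obtains P where "primeideal P R" "I \<subseteq> P"
proof -
 define A where "A = {J. ideal J R \<and> I \<subseteq> J \<and> \<one> \<notin> J}"
 have "\<exists>M\<in>A. \<forall>J\<in>A. M \<subseteq> J \<longrightarrow> J = M"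
 proof (rule subset_Zorn_nonempty)
  show "A \<noteq> {}" using assms by (auto simp: A_def)
  fix C assume C: "C \<noteq> {}" "subset.chain A C"
  hence "subset.chain {J. ideal J R} C"
   by (auto simp: subset_chain_def A_def)
  from chain_Union_is_ideal[OF this] C(1) have "ideal (\<Union>C) R" by simp
  with C show "\<Union>C \<in> A" by (auto simp: subset_chain_def A_def)
 qed
 then obtain M where MA: "M \<in> A" and MJ: "\<forall>J\<in>A. M \<subseteq> J \<longrightarrow> J = M" by (elim bexE)
 hence M: "ideal M R" "I \<subseteq> M" "\<one> \<notin> M" by (auto simp: A_def)
 have max: "J = M" if "ideal J R" "\<one> \<notin> J" "M \<subseteq> J" for J
 proof -
  have "J \<in> A" using that M(2) by (auto simp: A_def)
  with MJ that(3) show ?thesis by auto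
 qed
 have "maximalideal M R"
 proof (rule maximalidealI[OF M(1)])
  show "carrier R \<noteq> M" using M(3) by auto
  fix J assume "ideal J R" "M \<subseteq> J" "J \<subseteq> carrier R"
  thus "J = M \<or> J = carrier R"
   using max[of J] ideal.one_imp_carrier[of J R] by (cases "\<one> \<in> J") auto
 qed
 hence "primeideal M R" by (rule maximalideal_prime)
 with M(2) that show thesis by blast
qed

text \<open>The largest differential ideal inside a prime ideal is prime: it is the kernel of the Taylor map
 into power series over the residue domain.\<close>

lemma (in cring) Leibniz_below:
 assumes D: "derivation R D" and P: "primeideal P R"
  and "a \<in> carrier R" "b \<in> carrier R"
  and "\<And>i. i < n \<Longrightarrow> (D ^^ i) a \<in> P" "\<And>j. j < m \<Longrightarrow> (D ^^ j) b \<in> P" "N < n + m"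
 shows "(D ^^ N) (a \<otimes> b) \<in> P"
 using assms(3-)
proof (induction N arbitrary: a b n m)
 interpret P: primeideal P R by (rule P)
 case 0
 hence "a \<in> P \<or> b \<in> P" using 0(3)[of 0] 0(4)[of 0] by (cases "n = 0") auto
 thus ?case using 0 P.I_l_closed P.I_r_closed by auto
next
 interpret P: primeideal P R by (rule P)
 have pc: "(D ^^ k) x \<in> carrier R" if "x \<in> carrier R" for k x
  using that derivation_closed[OF D] by (induction k) auto
 have pa: "(D ^^ k) (x \<oplus> y) = (D ^^ k) x \<oplus> (D ^^ k) y" if "x \<in> carrier R" "y \<in> carrier R" for k x y
  using that pc derivation_add[OF D] by (induction k) auto
 case (Suc N)
 note c = Suc.prems(1,2) derivation_closed[OF D Suc.prems(1)] derivation_closed[OF D Suc.prems(2)]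
 have "(D ^^ N) (D a \<otimes> b) \<in> P"
 proof (cases n)
  case 0
  thus ?thesis using Suc.IH[of "D a" b 0 m] Suc.prems c by auto
 next
  case (Suc n')
  have "(D ^^ i) (D a) \<in> P" if "i < n'" for i
   using Suc.prems(3)[of "Suc i"] that Suc by (simp add: funpow_swap1)
  thus ?thesis using Suc.IH[of "D a" b n' m] Suc.prems c Suc by auto
 qed
 moreover have "(D ^^ N) (a \<otimes> D b) \<in> P"
 proof (cases m)
  case 0
  thus ?thesis using Suc.IH[of a "D b" n 0] Suc.prems c by auto
 next
  case (Suc m')
  have "(D ^^ i) (D b) \<in> P" if "i < m'" for i
   using Suc.prems(4)[of "Suc i"] that Suc by (simp add: funpow_swap1)
  thus ?thesis using Suc.IH[of a "D b" n m'] Suc.prems c Suc by auto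
 qed
 ultimately have "(D ^^ N) (D a \<otimes> b) \<oplus> (D ^^ N) (a \<otimes> D b) \<in> P"
  by (rule P.a_closed)
 moreover have "(D ^^ Suc N) (a \<otimes> b) = (D ^^ N) (D a \<otimes> b) \<oplus> (D ^^ N) (a \<otimes> D b)"
  using c by (simp add: funpow_swap1 derivation_mult[OF D] pa)
 ultimately show ?case by simp
qed

text \<open>The lowest coefficient in a product of two Taylor series: \<open>c\<close> is the
  binomial coefficient of \<open>n + m\<close> over \<open>n\<close>, and the induction is Pascal's
  recursion modulo \<open>P\<close>.\<close>

lemma (in cring) Leibniz_leading:
 assumes D: "derivation R D" and P: "primeideal P R"
  and "a \<in> carrier R" "b \<in> carrier R"
  and "\<And>i. i < n \<Longrightarrow> (D ^^ i) a \<in> P" "\<And>j. j < m \<Longrightarrow> (D ^^ j) b \<in> P"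
 shows "\<exists>c>0. \<exists>z\<in>P. (D ^^ (n + m)) (a \<otimes> b) = [(c::nat)] \<cdot> ((D ^^ n) a \<otimes> (D ^^ m) b) \<oplus> z"
 using assms(3-)
proof (induction "n + m" arbitrary: a b n m)
 interpret P: primeideal P R by (rule P)
 case 0
 thus ?case
  by (intro exI[of _ 1] conjI bexI[of _ \<zero>]) (auto intro: additive_subgroup.zero_closed[OF P.is_additive_subgroup])
next
 interpret P: primeideal P R by (rule P)
 have pc: "(D ^^ k) x \<in> carrier R" if "x \<in> carrier R" for k x
  using that derivation_closed[OF D] by (induction k) auto
 have pa: "(D ^^ k) (x \<oplus> y) = (D ^^ k) x \<oplus> (D ^^ k) y" if "x \<in> carrier R" "y \<in> carrier R" for k x y
  using that pc derivation_add[OF D] by (induction k) auto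
 case (Suc k)
 note c = Suc.prems(1,2) derivation_closed[OF D Suc.prems(1)] derivation_closed[OF D Suc.prems(2)]
 let ?x = "(D ^^ n) a \<otimes> (D ^^ m) b"
 have x: "?x \<in> carrier R" using c pc by auto
 have 1: "\<exists>c. (n > 0 \<longrightarrow> c > 0) \<and> (\<exists>z\<in>P. (D ^^ k) (D a \<otimes> b) = [(c::nat)] \<cdot> ?x \<oplus> z)"
 proof (cases n)
  case 0
  \<comment> \<open>For \<open>n = 0\<close> this summand lies in \<open>P\<close> already, since
    \<open>k\<close> is smaller than the order \<open>m\<close> of \<open>b\<close>; its share of
    the coefficient is 0.\<close>
  have "(D ^^ k) (D a \<otimes> b) \<in> P"
   by (rule Leibniz_below[OF D P, where n = 0 and m = m]) (use Suc 0 c in auto)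
  thus ?thesis using 0 x pc c by (intro exI[of _ 0] conjI) auto
 next
  case (Suc n')
  have "(D ^^ i) (D a) \<in> P" if "i < n'" for i
   using Suc.prems(3)[of "Suc i"] that Suc by (simp add: funpow_swap1)
  moreover have "k = n' + m" using Suc.hyps(2) Suc by simp
  moreover have "(D ^^ n') (D a) = (D ^^ n) a" by (simp add: Suc funpow_swap1)
  ultimately have "\<exists>c>0. \<exists>z\<in>P. (D ^^ k) (D a \<otimes> b) = [(c::nat)] \<cdot> ?x \<oplus> z"
   using Suc.hyps(1)[of n' m "D a" b] Suc.prems(4) c by simp
  then obtain c' where "c' > 0" "\<exists>z\<in>P. (D ^^ k) (D a \<otimes> b) = [(c'::nat)] \<cdot> ?x \<oplus> z" by auto
  thus ?thesis by (intro exI[of _ c']) simp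
 qed
 have 2: "\<exists>c. (m > 0 \<longrightarrow> c > 0) \<and> (\<exists>z\<in>P. (D ^^ k) (a \<otimes> D b) = [(c::nat)] \<cdot> ?x \<oplus> z)"
 proof (cases m)
  case 0
  have "(D ^^ k) (a \<otimes> D b) \<in> P"
   by (rule Leibniz_below[OF D P, where n = n and m = 0]) (use Suc 0 c in auto)
  thus ?thesis using 0 x pc c by (intro exI[of _ 0] conjI) auto
 next
  case (Suc m')
  have "(D ^^ i) (D b) \<in> P" if "i < m'" for i
   using Suc.prems(4)[of "Suc i"] that Suc by (simp add: funpow_swap1)
  moreover have "k = n + m'" using Suc.hyps(2) Suc by simp
  moreover have "(D ^^ m') (D b) = (D ^^ m) b" by (simp add: Suc funpow_swap1)
  ultimately have "\<exists>c>0. \<exists>z\<in>P. (D ^^ k) (a \<otimes> D b) = [(c::nat)] \<cdot> ?x \<oplus> z"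
   using Suc.hyps(1)[of n m' a "D b"] Suc.prems(3) c by simp
  then obtain c' where "c' > 0" "\<exists>z\<in>P. (D ^^ k) (a \<otimes> D b) = [(c'::nat)] \<cdot> ?x \<oplus> z" by auto
  thus ?thesis by (intro exI[of _ c']) simp
 qed
 from 1 obtain c1 :: nat where c1: "n > 0 \<longrightarrow> c1 > 0"
  "\<exists>z\<in>P. (D ^^ k) (D a \<otimes> b) = [c1] \<cdot> ?x \<oplus> z" by (elim exE conjE) simp
 from c1(2) obtain z1 where "z1 \<in> P" "(D ^^ k) (D a \<otimes> b) = [c1] \<cdot> ?x \<oplus> z1" by (elim bexE) simp
 with c1(1) have 1: "n > 0 \<longrightarrow> c1 > 0" "z1 \<in> P" "(D ^^ k) (D a \<otimes> b) = [c1] \<cdot> ?x \<oplus> z1"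
  by simp_all
 from 2 obtain c2 :: nat where c2: "m > 0 \<longrightarrow> c2 > 0"
  "\<exists>z\<in>P. (D ^^ k) (a \<otimes> D b) = [c2] \<cdot> ?x \<oplus> z" by (elim exE conjE) simp
 from c2(2) obtain z2 where "z2 \<in> P" "(D ^^ k) (a \<otimes> D b) = [c2] \<cdot> ?x \<oplus> z2" by (elim bexE) simp
 with c2(1) have 2: "m > 0 \<longrightarrow> c2 > 0" "z2 \<in> P" "(D ^^ k) (a \<otimes> D b) = [c2] \<cdot> ?x \<oplus> z2"
  by simp_all
 have z: "z1 \<in> carrier R" "z2 \<in> carrier R" using 1 2 P.Icarr by auto
 have "(D ^^ (n + m)) (a \<otimes> b) = (D ^^ Suc k) (a \<otimes> b)" using Suc.hyps(2) by simp
 also have "\<dots> = (D ^^ k) (D a \<otimes> b) \<oplus> (D ^^ k) (a \<otimes> D b)"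
  using c by (simp add: funpow_swap1 derivation_mult[OF D] pa)
 also have "\<dots> = (([c1] \<cdot> ?x) \<oplus> ([c2] \<cdot> ?x)) \<oplus> (z1 \<oplus> z2)"
  unfolding 1(3) 2(3) using x z by (simp add: a_ac)
 also have "([c1] \<cdot> ?x) \<oplus> ([c2] \<cdot> ?x) = [(c1 + c2)] \<cdot> ?x"
  using x by (simp add: add.nat_pow_mult)
 finally have "(D ^^ (n + m)) (a \<otimes> b) = [(c1 + c2)] \<cdot> ?x \<oplus> (z1 \<oplus> z2)" .
 moreover have "c1 + c2 > 0" using 1 2 Suc.hyps(2) by (cases n) auto
 moreover have "z1 \<oplus> z2 \<in> P" using 1 2 P.a_closed by auto
 ultimately show ?case by blast
qed

text \<open>A prime \<open>M\<close> above \<open>I\<close> need not be stable under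
  \<open>D\<close>, but the elements all of whose derivatives lie in \<open>M\<close> form a stable
  ideal that still contains \<open>I\<close>. It is prime by comparison of lowest Taylor
  coefficients, where the positive integer \<open>c\<close> is cancelled because it is a
  unit.\<close>

lemma (in cring) exists_prime_differential_ideal:
 assumes D: "derivation R D" and I: "ideal I R" "\<one> \<notin> I" "\<And>a. a \<in> I \<Longrightarrow> D a \<in> I"
  and unit: "\<And>n::nat. n > 0 \<Longrightarrow> \<exists>u\<in>carrier R. u \<otimes> [n] \<cdot> \<one> = \<one>"
 obtains P where "primeideal P R" "I \<subseteq> P" "\<And>a. a \<in> P \<Longrightarrow> D a \<in> P"
proof -
 obtain M where M: "primeideal M R" "I \<subseteq> M" using exists_primeideal[OF I(1,2)] .
 interpret M: primeideal M R by (rule M(1))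
 interpret I: ideal I R by (rule I(1))
 have pc: "(D ^^ k) x \<in> carrier R" if "x \<in> carrier R" for k x
  using that derivation_closed[OF D] by (induction k) auto
 have pa: "(D ^^ k) (x \<oplus> y) = (D ^^ k) x \<oplus> (D ^^ k) y" if "x \<in> carrier R" "y \<in> carrier R" for k x y
  using that pc derivation_add[OF D] by (induction k) auto
 have pz: "(D ^^ k) \<zero> = \<zero>" for k
  using derivation_zero[OF D] by (induction k) auto
 have pm: "(D ^^ k) (\<ominus> x) = \<ominus> ((D ^^ k) x)" if "x \<in> carrier R" for k x
  using that pc derivation_a_inv[OF D] by (induction k) auto
 define P where "P = {a \<in> carrier R. \<forall>k. (D ^^ k) a \<in> M}"
 have "ideal P R"
 proof (rule idealI[OF ring_axioms])
  show "subgroup P (add_monoid R)"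
  proof (rule add.subgroupI)
   show "P \<noteq> {}" using pz additive_subgroup.zero_closed[OF M.is_additive_subgroup] by (auto simp: P_def intro!: exI[of _ \<zero>])
  qed (auto simp: P_def pa pm a_inv_def[symmetric])
  fix a x assume ax: "a \<in> P" "x \<in> carrier R"
  \<comment> \<open>Order at least \<open>Suc k\<close> for \<open>a\<close> and at least 0 for
    \<open>x\<close> give order greater than \<open>k\<close> for the product, whatever
    \<open>x\<close> is.\<close>
  have "(D ^^ k) (a \<otimes> x) \<in> M" for k
   by (rule Leibniz_below[OF D M(1), where n = "Suc k" and m = 0]) (use ax in \<open>auto simp: P_def\<close>)
  thus "a \<otimes> x \<in> P" "x \<otimes> a \<in> P"
   using ax by (auto simp: P_def m_comm[of x a])
 qed
 moreover have "a \<in> P \<or> b \<in> P" if ab: "a \<in> carrier R" "b \<in> carrier R" "a \<otimes> b \<in> P" for a b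
 proof (rule ccontr)
  assume "\<not> (a \<in> P \<or> b \<in> P)"
  hence ex: "\<exists>n. (D ^^ n) a \<notin> M" "\<exists>m. (D ^^ m) b \<notin> M" using ab by (auto simp: P_def)
  define n m where "n = (LEAST n. (D ^^ n) a \<notin> M)" and "m = (LEAST m. (D ^^ m) b \<notin> M)"
  have n: "(D ^^ n) a \<notin> M" "\<And>i. i < n \<Longrightarrow> (D ^^ i) a \<in> M"
   unfolding n_def using LeastI_ex[OF ex(1)] not_less_Least by blast+
  have m: "(D ^^ m) b \<notin> M" "\<And>i. i < m \<Longrightarrow> (D ^^ i) b \<in> M"
   unfolding m_def using LeastI_ex[OF ex(2)] not_less_Least by blast+
  let ?x = "(D ^^ n) a \<otimes> (D ^^ m) b"
  have x: "?x \<in> carrier R" using ab pc by auto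
  obtain c z where cz: "c > 0" "z \<in> M" "(D ^^ (n + m)) (a \<otimes> b) = [(c::nat)] \<cdot> ?x \<oplus> z"
   using Leibniz_leading[OF D M(1) ab(1,2) n(2) m(2)] by blast
  have zc: "z \<in> carrier R" using cz M.Icarr by auto
  have "[c] \<cdot> ?x \<oplus> z \<in> M" using ab(3) cz(3) unfolding P_def by (metis (mono_tags, lifting) mem_Collect_eq)
  hence "[c] \<cdot> ?x \<oplus> z \<oplus> \<ominus> z \<in> M"
   using additive_subgroup.a_inv_closed[OF M.is_additive_subgroup cz(2)] by (rule M.a_closed)
  hence cx: "[c] \<cdot> ?x \<in> M" using x zc by (simp add: a_assoc r_neg)
  obtain u where u: "u \<in> carrier R" "u \<otimes> [c] \<cdot> \<one> = \<one>" using unit[OF cz(1)] by blast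
  have "?x = (u \<otimes> [c] \<cdot> \<one>) \<otimes> ?x" using u x by simp
  also have "\<dots> = u \<otimes> ([c] \<cdot> ?x)" using u(1) x by (simp add: m_assoc add_pow_ldistr)
  finally have "?x \<in> M" using M.I_l_closed[OF cx u(1)] by simp
  thus False using M.I_prime n(1) m(1) pc ab by blast
 qed
 moreover have "carrier R \<noteq> P"
 proof
  assume "carrier R = P"
  hence "\<one> \<in> P" by (metis one_closed)
  hence "(D ^^ 0) \<one> \<in> M" unfolding P_def by blast
  thus False using M.I_notcarr M.one_imp_carrier by simp
 qed
 ultimately have "primeideal P R"
  by (intro primeidealI cring_axioms) auto
 moreover have "I \<subseteq> P"
 proof
  fix a assume "a \<in> I"
  hence "(D ^^ k) a \<in> I" for k using I(3) by (induction k) auto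
  with \<open>a \<in> I\<close> show "a \<in> P" using M(2) I.Icarr by (auto simp: P_def)
 qed
 moreover have "D a \<in> P" if "a \<in> P" for a
 proof -
  have "(D ^^ k) (D a) \<in> M" for k
   using that unfolding P_def by (auto simp: funpow_swap1 dest!: spec[of _ "Suc k"])
  thus ?thesis using that derivation_closed[OF D] by (auto simp: P_def)
 qed
 ultimately show thesis using that by blast
qed

text \<open>The field is the fraction field of \<open>R / P\<close>. Its elements are described by
  equations \<open>x h(s) = h(a)\<close>, so that generators of \<open>R\<close> become generators
  of the field.\<close>

lemma residue_field:
 fixes R :: "('r, 'm) ring_scheme"
 assumes P: "primeideal P R" and D: "derivation R D" and DP: "\<And>a. a \<in> P \<Longrightarrow> D a \<in> P"
 obtains F :: "('r set \<times> 'r set) set ring" and dF h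
 where "differential_field F dF" "h \<in> ring_hom R F"
  "\<And>a. a \<in> carrier R \<Longrightarrow> h a = \<zero>\<^bsub>F\<^esub> \<longleftrightarrow> a \<in> P"
  "\<And>a. a \<in> carrier R \<Longrightarrow> h (D a) = dF (h a)"
  "\<And>x. x \<in> carrier F \<Longrightarrow> \<exists>a\<in>carrier R. \<exists>s\<in>carrier R - P. x \<otimes>\<^bsub>F\<^esub> h s = h a"
proof -
 interpret P: primeideal P R by (rule P)
 let ?Q = "R Quot P"
 interpret Q: domain ?Q by (rule P.quotient_is_domain)
 note eqI = P.quotient_eq_iff_same_a_r_cos[OF P.is_ideal]
 have car: "X \<in> carrier ?Q \<longleftrightarrow> (\<exists>a\<in>carrier R. X = P +>\<^bsub>R\<^esub> a)" for X
  by (auto simp: FactRing_def A_RCOSETS_defs a_r_coset_def)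
 define D' where "D' X = P +>\<^bsub>R\<^esub> D (SOME a. a \<in> carrier R \<and> X = P +>\<^bsub>R\<^esub> a)" for X
 have hom: "(+>\<^bsub>R\<^esub>) P \<in> ring_hom R ?Q" by (rule P.rcos_ring_hom)
 \<comment> \<open>Two representatives of a coset differ by an element of \<open>P\<close>, and
   \<open>D\<close> maps \<open>P\<close> to itself.\<close>
 have D': "D' (P +>\<^bsub>R\<^esub> a) = P +>\<^bsub>R\<^esub> D a" if a: "a \<in> carrier R" for a
 proof -
  define b where "b = (SOME b. b \<in> carrier R \<and> P +>\<^bsub>R\<^esub> a = P +>\<^bsub>R\<^esub> b)"
  have b: "b \<in> carrier R" "P +>\<^bsub>R\<^esub> a = P +>\<^bsub>R\<^esub> b"
   using someI[of "\<lambda>b. b \<in> carrier R \<and> P +>\<^bsub>R\<^esub> a = P +>\<^bsub>R\<^esub> b" a] a unfolding b_def by auto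
  hence "b \<ominus>\<^bsub>R\<^esub> a \<in> P" using eqI[of b a] a by simp
  hence "D (b \<ominus>\<^bsub>R\<^esub> a) \<in> P" by (rule DP)
  moreover have "D (b \<ominus>\<^bsub>R\<^esub> a) = D b \<ominus>\<^bsub>R\<^esub> D a"
   using a b by (simp add: a_minus_def derivation_add[OF D] P.derivation_a_inv[OF D])
  ultimately have "P +>\<^bsub>R\<^esub> D b = P +>\<^bsub>R\<^esub> D a"
   using eqI[of "D b" "D a"] a b derivation_closed[OF D] by auto
  thus ?thesis by (simp add: D'_def b_def)
 qed
 have dQ: "derivation ?Q D'"
  unfolding derivation_def
 proof (intro conjI ballI)
  fix X assume "X \<in> carrier ?Q"
  then obtain a where a: "a \<in> carrier R" "X = P +>\<^bsub>R\<^esub> a" using car by auto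
  show "D' X \<in> carrier ?Q" using a D' car derivation_closed[OF D] by auto
 next
  fix X Y assume "X \<in> carrier ?Q" "Y \<in> carrier ?Q"
  then obtain a b where ab: "a \<in> carrier R" "X = P +>\<^bsub>R\<^esub> a" "b \<in> carrier R" "Y = P +>\<^bsub>R\<^esub> b"
   using car by auto
  note c = ab(1,3) derivation_closed[OF D ab(1)] derivation_closed[OF D ab(3)]
  show "D' (X \<oplus>\<^bsub>?Q\<^esub> Y) = D' X \<oplus>\<^bsub>?Q\<^esub> D' Y"
   unfolding ab(2,4) using c
   by (simp add: D' ring_hom_add[OF hom, symmetric] derivation_add[OF D])
  show "D' (X \<otimes>\<^bsub>?Q\<^esub> Y) = D' X \<otimes>\<^bsub>?Q\<^esub> Y \<oplus>\<^bsub>?Q\<^esub> X \<otimes>\<^bsub>?Q\<^esub> D' Y"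
   unfolding ab(2,4) using c
   by (simp add: D' ring_hom_add[OF hom, symmetric] ring_hom_mult[OF hom, symmetric] derivation_mult[OF D])
 qed
 define h where "h a = fcls ?Q (P +>\<^bsub>R\<^esub> a) \<one>\<^bsub>?Q\<^esub>" for a
 have zero: "P +>\<^bsub>R\<^esub> a = \<zero>\<^bsub>?Q\<^esub> \<longleftrightarrow> a \<in> P" if "a \<in> carrier R" for a
 proof -
  have "\<zero>\<^bsub>?Q\<^esub> = P +>\<^bsub>R\<^esub> \<zero>\<^bsub>R\<^esub>"
   using ring_hom_zero[OF hom P.ring_axioms Q.ring_axioms] by simp
  thus ?thesis using eqI[of a "\<zero>\<^bsub>R\<^esub>"] that by (simp add: a_minus_def)
 qed
 show thesis
 proof (rule that[of "frac_field ?Q" "frac_deriv ?Q D'" h])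
  show "differential_field (frac_field ?Q) (frac_deriv ?Q D')"
   using Q.frac_is_field Q.frac_deriv_derivation[OF dQ] by (simp add: differential_field_iff)
  show "h \<in> ring_hom R (frac_field ?Q)"
   using ring_hom_trans[OF hom Q.frac_embed] by (simp add: h_def[abs_def] o_def)
  fix a assume a: "a \<in> carrier R"
  hence aQ: "P +>\<^bsub>R\<^esub> a \<in> carrier ?Q" using car by auto
  show "h a = \<zero>\<^bsub>frac_field ?Q\<^esub> \<longleftrightarrow> a \<in> P"
   unfolding h_def Q.frac_embed_zero[OF aQ] by (rule zero[OF a])
  show "h (D a) = frac_deriv ?Q D' (h a)"
   unfolding h_def Q.frac_embed_deriv[OF dQ aQ] D'[OF a] ..
 next
  fix x assume "x \<in> carrier (frac_field ?Q)"
  from Q.frac_fraction[OF this] obtain A S where AS: "A \<in> carrier ?Q" "S \<in> carrier ?Q - {\<zero>\<^bsub>?Q\<^esub>}"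
   "x \<otimes>\<^bsub>frac_field ?Q\<^esub> fcls ?Q S \<one>\<^bsub>?Q\<^esub> = fcls ?Q A \<one>\<^bsub>?Q\<^esub>" by blast
  then obtain a s where "a \<in> carrier R" "s \<in> carrier R" "A = P +>\<^bsub>R\<^esub> a" "S = P +>\<^bsub>R\<^esub> s"
   using car by auto
  with AS show "\<exists>a\<in>carrier R. \<exists>s\<in>carrier R - P. x \<otimes>\<^bsub>frac_field ?Q\<^esub> h s = h a"
   unfolding h_def using zero by (intro bexI[of _ a] bexI[of _ s]) auto
 qed
qed

section \<open>Rational function fields\<close>

text \<open>Over an infinite field a polynomial is determined by its values, so the polynomial ring
  is realised by functions on \<open>F^V\<close>. Restriction to extensional points makes equality
  of these functions the same as agreement on \<open>F^V\<close>.\<close>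

definition pol_fun :: "('f, 'm) ring_scheme \<Rightarrow> 'v set \<Rightarrow> ('f, 'v) pterm \<Rightarrow> ('v \<Rightarrow> 'f) \<Rightarrow> 'f" where
 "pol_fun F V t = restrict (\<lambda>y. peval F (\<lambda>c. c) y t) (V \<rightarrow>\<^sub>E carrier F)"

definition pol_ring :: "('f, 'm) ring_scheme \<Rightarrow> 'v set \<Rightarrow> (('v \<Rightarrow> 'f) \<Rightarrow> 'f) ring" where
 "pol_ring F V = \<lparr>carrier = pol_fun F V ` pterms (carrier F) V,
  monoid.mult = (\<lambda>p q. restrict (\<lambda>y. p y \<otimes>\<^bsub>F\<^esub> q y) (V \<rightarrow>\<^sub>E carrier F)),
  monoid.one = restrict (\<lambda>y. \<one>\<^bsub>F\<^esub>) (V \<rightarrow>\<^sub>E carrier F),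
  ring.zero = restrict (\<lambda>y. \<zero>\<^bsub>F\<^esub>) (V \<rightarrow>\<^sub>E carrier F),
  ring.add = (\<lambda>p q. restrict (\<lambda>y. p y \<oplus>\<^bsub>F\<^esub> q y) (V \<rightarrow>\<^sub>E carrier F))\<rparr>"

lemma pol_fun_eq_iff:
 assumes "s \<in> pterms A V" "t \<in> pterms A V"
 shows "pol_fun F V s = pol_fun F V t \<longleftrightarrow>
  (\<forall>y\<in>V \<rightarrow> carrier F. peval F (\<lambda>c. c) y s = peval F (\<lambda>c. c) y t)"
proof
 assume eq: "pol_fun F V s = pol_fun F V t"
 show "\<forall>y\<in>V \<rightarrow> carrier F. peval F (\<lambda>c. c) y s = peval F (\<lambda>c. c) y t"
 proof
  fix y assume y: "y \<in> V \<rightarrow> carrier F"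
  let ?y = "restrict y V"
  have "?y \<in> V \<rightarrow>\<^sub>E carrier F" using y by auto
  hence "peval F (\<lambda>c. c) ?y s = peval F (\<lambda>c. c) ?y t"
   using fun_cong[OF eq, of ?y] by (simp add: pol_fun_def)
  moreover have "peval F (\<lambda>c. c) ?y u = peval F (\<lambda>c. c) y u" if "u \<in> pterms A V" for u
   by (rule peval_cong[OF that]) auto
  ultimately show "peval F (\<lambda>c. c) y s = peval F (\<lambda>c. c) y t" using assms by simp
 qed
next
 assume "\<forall>y\<in>V \<rightarrow> carrier F. peval F (\<lambda>c. c) y s = peval F (\<lambda>c. c) y t"
 thus "pol_fun F V s = pol_fun F V t"
  unfolding pol_fun_def by (intro restrict_ext) auto
qed

lemma pol_ops:
 "pol_fun F V s \<otimes>\<^bsub>pol_ring F V\<^esub> pol_fun F V t = pol_fun F V (PMul s t)"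
 "pol_fun F V s \<oplus>\<^bsub>pol_ring F V\<^esub> pol_fun F V t = pol_fun F V (PAdd s t)"
 "\<one>\<^bsub>pol_ring F V\<^esub> = pol_fun F V (PConst \<one>\<^bsub>F\<^esub>)"
 "\<zero>\<^bsub>pol_ring F V\<^esub> = pol_fun F V (PConst \<zero>\<^bsub>F\<^esub>)"
 by (auto simp: pol_ring_def pol_fun_def intro!: restrict_ext)

section \<open>Derivations on polynomial functions\<close>

primrec pder :: "('a \<Rightarrow> 'a) \<Rightarrow> ('v \<Rightarrow> ('a, 'v) pterm) \<Rightarrow> ('a, 'v) pterm \<Rightarrow> ('a, 'v) pterm" where
 "pder d w (PConst c) = PConst (d c)"
| "pder d w (PVar v) = w v"
| "pder d w (PAdd s t) = PAdd (pder d w s) (pder d w t)"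
| "pder d w (PMul s t) = PAdd (PMul (pder d w s) t) (PMul s (pder d w t))"

text \<open>The directional derivative of a polynomial at the point \<open>y\<close> along the
  vector \<open>u\<close>.\<close>

primrec pdir :: "('a, 'r) ring_scheme \<Rightarrow> ('v \<Rightarrow> 'a) \<Rightarrow> ('v \<Rightarrow> 'a) \<Rightarrow> ('a, 'v) pterm \<Rightarrow> 'a" where
 "pdir R u y (PConst c) = \<zero>\<^bsub>R\<^esub>"
| "pdir R u y (PVar v) = u v"
| "pdir R u y (PAdd s t) = pdir R u y s \<oplus>\<^bsub>R\<^esub> pdir R u y t"
| "pdir R u y (PMul s t) = pdir R u y s \<otimes>\<^bsub>R\<^esub> peval R (\<lambda>c. c) y t \<oplus>\<^bsub>R\<^esub> peval R (\<lambda>c. c) y s \<otimes>\<^bsub>R\<^esub> pdir R u y t"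

lemma pder_in_pterms:
 "t \<in> pterms A V \<Longrightarrow> d ` A \<subseteq> A \<Longrightarrow> (\<And>v. v \<in> V \<Longrightarrow> w v \<in> pterms A V) \<Longrightarrow> pder d w t \<in> pterms A V"
 by (induction t) auto

context field
begin

lemma pdir_closed:
 "t \<in> pterms (carrier R) V \<Longrightarrow> u \<in> V \<rightarrow> carrier R \<Longrightarrow> y \<in> V \<rightarrow> carrier R \<Longrightarrow> pdir R u y t \<in> carrier R"
 by (induction t) (auto intro!: peval_closed[where A = "carrier R" and V = V])

text \<open>The purpose is to see that \<open>pder\<close> descends from terms to functions:
  \<open>d\<close> of the value depends on the function only, and so does the directional
  derivative, by \<open>pdir_unique\<close>. The direction measures how far the prescribed
  derivatives \<open>w\<close> of the variables are from the derivatives of the coordinates of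
  \<open>y\<close>.\<close>

lemma peval_pder:
 assumes d: "derivation R d" and "t \<in> pterms (carrier R) V" and w: "\<And>v. v \<in> V \<Longrightarrow> w v \<in> pterms (carrier R) V"
  and y: "y \<in> V \<rightarrow> carrier R"
 shows "peval R (\<lambda>c. c) y (pder d w t) = d (peval R (\<lambda>c. c) y t)
  \<oplus> pdir R (\<lambda>v. peval R (\<lambda>c. c) y (w v) \<ominus> d (y v)) y t"
 using assms(2)
proof (induction t)
 let ?u = "\<lambda>v. peval R (\<lambda>c. c) y (w v) \<ominus> d (y v)"
 note dc = derivation_closed[OF d]
 have pc: "peval R (\<lambda>c. c) y t \<in> carrier R" if "t \<in> pterms (carrier R) V" for t
  by (rule peval_closed[OF that]) (use y in auto)
 have u: "?u \<in> V \<rightarrow> carrier R" by (intro funcsetI minus_closed pc w dc) (use y in auto)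
 {
  case (PConst c)
  thus ?case using dc by simp
 next
  case (PVar v)
  hence "y v \<in> carrier R" "peval R (\<lambda>c. c) y (w v) \<in> carrier R" using y w pc by auto
  hence "d (y v) \<oplus> (peval R (\<lambda>c. c) y (w v) \<ominus> d (y v)) = peval R (\<lambda>c. c) y (w v)"
   using dc[of "y v"] unfolding a_minus_def
   by (simp add: a_assoc[symmetric] a_comm[of "d (y v)"]) (simp add: a_assoc r_neg)
  thus ?case by simp
 next
  case (PAdd s t)
  hence "s \<in> pterms (carrier R) V" "t \<in> pterms (carrier R) V" by auto
  note c = pc[OF this(1)] pc[OF this(2)] pdir_closed[OF this(1) u y] pdir_closed[OF this(2) u y]
  show ?case using PAdd c dc[OF c(1)] dc[OF c(2)] by (simp add: derivation_add[OF d] a_ac)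
 next
  case (PMul s t)
  hence st: "s \<in> pterms (carrier R) V" "t \<in> pterms (carrier R) V" by auto
  note c = pc[OF this(1)] pc[OF this(2)] pdir_closed[OF this(1) u y] pdir_closed[OF this(2) u y]
  show ?case using PMul.IH(1)[OF st(1)] PMul.IH(2)[OF st(2)] c dc[OF c(1)] dc[OF c(2)]
   by (simp add: derivation_mult[OF d] l_distr r_distr a_ac)
 }
qed

text \<open>Taylor expansion along a line with a quadratic remainder that is again polynomial in the
  parameter. It exhibits \<open>pdir\<close> as the linear coefficient.\<close>

lemma peval_line:
 assumes "t \<in> pterms (carrier R) V" and u: "u \<in> V \<rightarrow> carrier R" and y: "y \<in> V \<rightarrow> carrier R"
 shows "\<exists>q. poly_fun q \<and> (\<forall>s\<in>carrier R. peval R (\<lambda>c. c) (\<lambda>v. y v \<oplus> s \<otimes> u v) t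
  = peval R (\<lambda>c. c) y t \<oplus> s \<otimes> (pdir R u y t \<oplus> s \<otimes> q s))"
 using assms(1)
proof (induction t)
 have pc: "peval R (\<lambda>c. c) y t \<in> carrier R" if "t \<in> pterms (carrier R) V" for t
  by (rule peval_closed[OF that]) (use y in auto)
 {
  case (PConst c)
  thus ?case by (intro exI[of _ "\<lambda>s. \<zero>"]) (auto intro: poly_fun_const)
 next
  case (PVar v)
  hence "u v \<in> carrier R" "y v \<in> carrier R" using u y by auto
  thus ?case by (intro exI[of _ "\<lambda>s. \<zero>"]) (auto intro: poly_fun_const)
 next
  case (PAdd t t')
  hence tt: "t \<in> pterms (carrier R) V" "t' \<in> pterms (carrier R) V" by auto
  obtain q q' where q: "poly_fun q" "poly_fun q'"
   and e: "\<And>s. s \<in> carrier R \<Longrightarrow> peval R (\<lambda>c. c) (\<lambda>v. y v \<oplus> s \<otimes> u v) t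
    = peval R (\<lambda>c. c) y t \<oplus> s \<otimes> (pdir R u y t \<oplus> s \<otimes> q s)"
   "\<And>s. s \<in> carrier R \<Longrightarrow> peval R (\<lambda>c. c) (\<lambda>v. y v \<oplus> s \<otimes> u v) t'
    = peval R (\<lambda>c. c) y t' \<oplus> s \<otimes> (pdir R u y t' \<oplus> s \<otimes> q' s)"
   using PAdd.IH(1)[OF tt(1)] PAdd.IH(2)[OF tt(2)] by auto
  note c = pc[OF tt(1)] pc[OF tt(2)] pdir_closed[OF tt(1) u y] pdir_closed[OF tt(2) u y]
  show ?case
  proof (intro exI[of _ "\<lambda>s. q s \<oplus> q' s"] conjI ballI poly_fun_add q)
   fix s assume s: "s \<in> carrier R"
   show "peval R (\<lambda>c. c) (\<lambda>v. y v \<oplus> s \<otimes> u v) (PAdd t t') = peval R (\<lambda>c. c) y (PAdd t t')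
    \<oplus> s \<otimes> (pdir R u y (PAdd t t') \<oplus> s \<otimes> (q s \<oplus> q' s))"
    using c s poly_fun_closed[OF q(1) s] poly_fun_closed[OF q(2) s]
    by (simp add: e[OF s] r_distr a_ac)
  qed
 next
  case (PMul t t')
  hence tt: "t \<in> pterms (carrier R) V" "t' \<in> pterms (carrier R) V" by auto
  obtain q q' where q: "poly_fun q" "poly_fun q'"
   and e: "\<And>s. s \<in> carrier R \<Longrightarrow> peval R (\<lambda>c. c) (\<lambda>v. y v \<oplus> s \<otimes> u v) t
    = peval R (\<lambda>c. c) y t \<oplus> s \<otimes> (pdir R u y t \<oplus> s \<otimes> q s)"
   "\<And>s. s \<in> carrier R \<Longrightarrow> peval R (\<lambda>c. c) (\<lambda>v. y v \<oplus> s \<otimes> u v) t'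
    = peval R (\<lambda>c. c) y t' \<oplus> s \<otimes> (pdir R u y t' \<oplus> s \<otimes> q' s)"
   using PMul.IH(1)[OF tt(1)] PMul.IH(2)[OF tt(2)] by auto
  define a a' b b' where ab: "a = peval R (\<lambda>c. c) y t" "a' = peval R (\<lambda>c. c) y t'"
   "b = pdir R u y t" "b' = pdir R u y t'"
  have c: "a \<in> carrier R" "a' \<in> carrier R" "b \<in> carrier R" "b' \<in> carrier R"
   unfolding ab using pc[OF tt(1)] pc[OF tt(2)] pdir_closed[OF tt(1) u y] pdir_closed[OF tt(2) u y] .
  show ?case
  proof (intro exI[of _ "\<lambda>s. a \<otimes> q' s \<oplus> q s \<otimes> a' \<oplus> (b \<oplus> s \<otimes> q s) \<otimes> (b' \<oplus> s \<otimes> q' s)"] conjI ballI)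
   show "poly_fun (\<lambda>s. a \<otimes> q' s \<oplus> q s \<otimes> a' \<oplus> (b \<oplus> s \<otimes> q s) \<otimes> (b' \<oplus> s \<otimes> q' s))"
    by (intro poly_fun_add poly_fun_mult poly_fun_const poly_fun_ident q c)
   fix s assume s: "s \<in> carrier R"
   define r r' where r: "r = b \<oplus> s \<otimes> q s" "r' = b' \<oplus> s \<otimes> q' s"
   have cc: "q s \<in> carrier R" "q' s \<in> carrier R"
    using poly_fun_closed[OF q(1) s] poly_fun_closed[OF q(2) s] .
   have rc: "r \<in> carrier R" "r' \<in> carrier R" using c s cc by (auto simp: r)
   have "(a \<oplus> s \<otimes> r) \<otimes> (a' \<oplus> s \<otimes> r')
    = a \<otimes> a' \<oplus> s \<otimes> (r \<otimes> a' \<oplus> a \<otimes> r' \<oplus> s \<otimes> (r \<otimes> r'))"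
    using c s rc by algebra
   moreover have "r \<otimes> a' \<oplus> a \<otimes> r' = b \<otimes> a' \<oplus> a \<otimes> b' \<oplus> s \<otimes> (a \<otimes> q' s \<oplus> q s \<otimes> a')"
    unfolding r using c s cc by algebra
   moreover have "b \<otimes> a' \<oplus> a \<otimes> b' \<oplus> s \<otimes> (a \<otimes> q' s \<oplus> q s \<otimes> a') \<oplus> s \<otimes> (r \<otimes> r')
    = b \<otimes> a' \<oplus> a \<otimes> b' \<oplus> s \<otimes> (a \<otimes> q' s \<oplus> q s \<otimes> a' \<oplus> r \<otimes> r')"
    using c s cc rc by (simp add: r_distr a_assoc)
   ultimately show "peval R (\<lambda>c. c) (\<lambda>v. y v \<oplus> s \<otimes> u v) (PMul t t') = peval R (\<lambda>c. c) y (PMul t t')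
    \<oplus> s \<otimes> (pdir R u y (PMul t t') \<oplus> s \<otimes> (a \<otimes> q' s \<oplus> q s \<otimes> a' \<oplus> (b \<oplus> s \<otimes> q s) \<otimes> (b' \<oplus> s \<otimes> q' s)))"
    by (simp add: e[OF s] ab[symmetric] r[symmetric])
  qed
 }
qed

lemma pdir_unique:
 assumes inf: "infinite (carrier R)"
  and t: "t \<in> pterms (carrier R) V" and t': "t' \<in> pterms (carrier R) V"
  and u: "u \<in> V \<rightarrow> carrier R" and y: "y \<in> V \<rightarrow> carrier R"
  and eq: "\<And>y. y \<in> V \<rightarrow> carrier R \<Longrightarrow> peval R (\<lambda>c. c) y t = peval R (\<lambda>c. c) y t'"
 shows "pdir R u y t = pdir R u y t'"
proof -
 obtain q where q: "poly_fun q" "\<And>s. s \<in> carrier R \<Longrightarrow> peval R (\<lambda>c. c) (\<lambda>v. y v \<oplus> s \<otimes> u v) t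
  = peval R (\<lambda>c. c) y t \<oplus> s \<otimes> (pdir R u y t \<oplus> s \<otimes> q s)"
  using peval_line[OF t u y] by auto
 obtain q' where q': "poly_fun q'" "\<And>s. s \<in> carrier R \<Longrightarrow> peval R (\<lambda>c. c) (\<lambda>v. y v \<oplus> s \<otimes> u v) t'
  = peval R (\<lambda>c. c) y t' \<oplus> s \<otimes> (pdir R u y t' \<oplus> s \<otimes> q' s)"
  using peval_line[OF t' u y] by auto
 define b b' where b: "b = pdir R u y t" "b' = pdir R u y t'"
 have bc: "b \<in> carrier R" "b' \<in> carrier R"
  unfolding b using pdir_closed[OF t u y] pdir_closed[OF t' u y] .
 \<comment> \<open>The difference of the two expansions, divided by \<open>s\<close>. It vanishes
   for all nonzero \<open>s\<close>, hence also at 0, where its value is the difference of the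
   linear coefficients.\<close>
 define g where "g s = (b \<oplus> s \<otimes> q s) \<oplus> \<ominus> \<one> \<otimes> (b' \<oplus> s \<otimes> q' s)" for s
 have "poly_fun g"
  unfolding g_def by (intro poly_fun_add poly_fun_mult poly_fun_const poly_fun_ident q q' bc) auto
 moreover have "g s = \<zero>" if s: "s \<in> carrier R - {\<zero>}" for s
 proof -
  have sc: "s \<in> carrier R" "s \<noteq> \<zero>" using s by auto
  have cc: "q s \<in> carrier R" "q' s \<in> carrier R"
   using poly_fun_closed[OF q(1) sc(1)] poly_fun_closed[OF q'(1) sc(1)] .
  have "peval R (\<lambda>c. c) y t \<oplus> s \<otimes> (b \<oplus> s \<otimes> q s) = peval R (\<lambda>c. c) y t \<oplus> s \<otimes> (b' \<oplus> s \<otimes> q' s)"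
  proof -
   have "(\<lambda>v. y v \<oplus> s \<otimes> u v) \<in> V \<rightarrow> carrier R" using u y sc by auto
   from eq[OF this] show ?thesis
    unfolding q(2)[OF sc(1)] q'(2)[OF sc(1)] b eq[OF y] .
  qed
  moreover have "peval R (\<lambda>c. c) y t \<in> carrier R"
   by (rule peval_closed[OF t]) (use y in auto)
  ultimately have "s \<otimes> (b \<oplus> s \<otimes> q s) = s \<otimes> (b' \<oplus> s \<otimes> q' s)"
   using cc bc sc by (subst (asm) add.l_cancel) auto
  hence "b \<oplus> s \<otimes> q s = b' \<oplus> s \<otimes> q' s"
   using cc bc sc by (subst (asm) m_lcancel) auto
  thus ?thesis unfolding g_def using cc bc sc by (simp add: l_minus r_neg)
 qed
 ultimately have "g \<zero> = \<zero>"
  using poly_fun_zero[of g "carrier R - {\<zero>}" \<zero>] inf by auto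
 hence "b \<oplus> \<ominus> b' = \<zero>"
  unfolding g_def using bc poly_fun_closed[OF q(1) zero_closed] poly_fun_closed[OF q'(1) zero_closed]
  by (simp add: l_minus)
 thus ?thesis using bc minus_equality[of b "\<ominus> b'"] unfolding b by (metis a_inv_closed minus_minus sum_zero_eq_neg)
qed

lemma pol_ring_domain:
 assumes inf: "infinite (carrier R)"
 shows "domain (pol_ring R V)"
proof -
 let ?P = "pol_ring R V" and ?T = "pterms (carrier R) V" and ?f = "pol_fun R V"
 have car: "carrier ?P = ?f ` ?T" by (simp add: pol_ring_def)
 have pc: "peval R (\<lambda>c. c) y t \<in> carrier R" if "t \<in> ?T" "y \<in> V \<rightarrow> carrier R" for t y
  by (rule peval_closed[OF that(1)]) (use that in auto)
 have eqI: "?f s = ?f t"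
  if "s \<in> ?T" "t \<in> ?T" "\<And>y. y \<in> V \<rightarrow> carrier R \<Longrightarrow> peval R (\<lambda>c. c) y s = peval R (\<lambda>c. c) y t" for s t
  using pol_fun_eq_iff[OF that(1,2), of R] that(3) by simp
 have "cring ?P"
 proof (rule cringI)
  show "abelian_group ?P"
  proof (rule abelian_groupI; unfold car; (elim imageE)?; (unfold pol_ops)?)
   fix p s assume "p = ?f s" and s: "s \<in> ?T"
   let ?m = "PMul (PConst (\<ominus> \<one>)) s"
   have "?f (PAdd ?m s) = ?f (PConst \<zero>)"
    by (rule eqI) (use s pc in \<open>auto simp: l_minus l_neg\<close>)
   thus "\<exists>y\<in>?f ` ?T. y \<oplus>\<^bsub>?P\<^esub> p = ?f (PConst \<zero>)"
    using s by (intro bexI[of _ "?f ?m"]) (auto simp: \<open>p = _\<close> pol_ops)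
  qed (auto simp: pol_ops intro!: eqI imageI simp: pc a_ac)
  show "comm_monoid ?P"
   by (rule comm_monoidI; unfold car; (elim imageE)?)
    (auto simp: pol_ops intro!: eqI imageI simp: pc m_ac)
  fix x y z assume "x \<in> carrier ?P" "y \<in> carrier ?P" "z \<in> carrier ?P"
  then obtain r s t where "x = ?f r" "y = ?f s" "z = ?f t" and T: "r \<in> ?T" "s \<in> ?T" "t \<in> ?T"
   unfolding car by auto
  thus "(x \<oplus>\<^bsub>?P\<^esub> y) \<otimes>\<^bsub>?P\<^esub> z = x \<otimes>\<^bsub>?P\<^esub> z \<oplus>\<^bsub>?P\<^esub> y \<otimes>\<^bsub>?P\<^esub> z"
   by (auto simp: pol_ops intro!: eqI simp: pc l_distr)
 qed
 then interpret P: cring ?P .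
 show ?thesis
 proof (intro domain.intro[OF P.cring_axioms] domain_axioms.intro)
  have "\<one> \<noteq> \<zero>" by simp
  moreover have "(\<lambda>_. \<zero>) \<in> V \<rightarrow> carrier R" by simp
  ultimately show "\<one>\<^bsub>?P\<^esub> \<noteq> \<zero>\<^bsub>?P\<^esub>"
   unfolding pol_ops
   by (subst pol_fun_eq_iff[where A = "carrier R"]) (auto intro: bexI[of _ "\<lambda>_. \<zero>"])
  fix p q assume "p \<otimes>\<^bsub>?P\<^esub> q = \<zero>\<^bsub>?P\<^esub>" "p \<in> carrier ?P" "q \<in> carrier ?P"
  then obtain s t where pq: "p = ?f s" "q = ?f t" and T: "s \<in> ?T" "t \<in> ?T"
   and "?f (PMul s t) = ?f (PConst \<zero>)"
   unfolding car by (auto simp: pol_ops)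
  hence 0: "peval R (\<lambda>c. c) y s \<otimes> peval R (\<lambda>c. c) y t = \<zero>" if "y \<in> V \<rightarrow> carrier R" for y
   using that by (subst (asm) pol_fun_eq_iff[where A = "carrier R"]) auto
  show "p = \<zero>\<^bsub>?P\<^esub> \<or> q = \<zero>\<^bsub>?P\<^esub>"
  proof (rule disjCI)
   assume "q \<noteq> \<zero>\<^bsub>?P\<^esub>"
   then obtain y where y: "y \<in> V \<rightarrow> carrier R" "peval R (\<lambda>c. c) y t \<noteq> \<zero>"
    unfolding pq pol_ops using T by (subst (asm) pol_fun_eq_iff[where A = "carrier R"]) auto
   show "p = \<zero>\<^bsub>?P\<^esub>"
    unfolding pq pol_ops
   proof (rule eqI)
    fix z assume z: "z \<in> V \<rightarrow> carrier R"
    \<comment> \<open>The line through \<open>y\<close> at parameter 0 and \<open>z\<close> at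
      parameter 1. Along it the product is zero, while the factor from \<open>t\<close> is nonzero
      at parameter 0; so the factor from \<open>s\<close> vanishes throughout, in particular at
      \<open>z\<close>.\<close>
    define l where "l s v = y v \<oplus> s \<otimes> (z v \<ominus> y v)" for s v
    have lc: "l s \<in> V \<rightarrow> carrier R" if "s \<in> carrier R" for s
     using y(1) z that by (auto simp: l_def Pi_iff)
    have lp: "poly_fun (\<lambda>s. peval R (\<lambda>c. c) (l s) u)" if "u \<in> ?T" for u
     by (rule peval_poly_fun[OF that]) (use y(1) z in \<open>auto simp: l_def Pi_iff intro!: poly_fun_line\<close>)
    have l0: "peval R (\<lambda>c. c) (l \<zero>) u = peval R (\<lambda>c. c) y u" if "u \<in> ?T" for u
     by (rule peval_cong[OF that]) (use y(1) z in \<open>auto simp: l_def Pi_iff\<close>)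
    have l1: "peval R (\<lambda>c. c) (l \<one>) u = peval R (\<lambda>c. c) z u" if "u \<in> ?T" for u
    proof (rule peval_cong[OF that])
     fix v assume "v \<in> V"
     hence "y v \<in> carrier R" "z v \<in> carrier R" using y z by auto
     thus "l \<one> v = z v" unfolding l_def by (simp add: a_minus_def) algebra
    qed auto
    have "peval R (\<lambda>c. c) (l \<one>) s = \<zero>"
    proof (rule poly_fun_integral[OF lp[OF T(2)] lp[OF T(1)] inf, where x = \<zero>])
     fix r assume "r \<in> carrier R"
     thus "peval R (\<lambda>c. c) (l r) t \<otimes> peval R (\<lambda>c. c) (l r) s = \<zero>"
      using 0[OF lc] pc[OF T(1) lc] pc[OF T(2) lc] by (simp add: m_comm)
    qed (use l0[OF T(2)] y in auto)
    thus "peval R (\<lambda>c. c) z s = peval R (\<lambda>c. c) z (PConst \<zero>)"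
     using l1[OF T(1)] by simp
   qed (use T in auto)
  qed
 qed
qed

lemma pol_derivation:
 assumes inf: "infinite (carrier R)" and d: "derivation R d"
  and w: "\<And>v. v \<in> V \<Longrightarrow> w v \<in> pterms (carrier R) V"
 obtains D where "derivation (pol_ring R V) D"
  "\<And>t. t \<in> pterms (carrier R) V \<Longrightarrow> D (pol_fun R V t) = pol_fun R V (pder d w t)"
proof -
 let ?P = "pol_ring R V" and ?T = "pterms (carrier R) V" and ?f = "pol_fun R V"
 have car: "carrier ?P = ?f ` ?T" by (simp add: pol_ring_def)
 have pc: "peval R (\<lambda>c. c) y t \<in> carrier R" if "t \<in> ?T" "y \<in> V \<rightarrow> carrier R" for t y
  by (rule peval_closed[OF that(1)]) (use that in auto)
 have pd: "pder d w t \<in> ?T" if "t \<in> ?T" for t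
  by (rule pder_in_pterms[OF that]) (use w derivation_closed[OF d] in auto)
 have well: "?f (pder d w s) = ?f (pder d w t)" if st: "s \<in> ?T" "t \<in> ?T" "?f s = ?f t" for s t
 proof (subst pol_fun_eq_iff[OF pd pd]; (intro ballI)?)
  have eq: "peval R (\<lambda>c. c) y s = peval R (\<lambda>c. c) y t" if "y \<in> V \<rightarrow> carrier R" for y
   using st that by (subst (asm) pol_fun_eq_iff[OF st(1,2)]) auto
  fix y assume y: "y \<in> V \<rightarrow> carrier R"
  have "(\<lambda>v. peval R (\<lambda>c. c) y (w v) \<ominus> d (y v)) \<in> V \<rightarrow> carrier R"
   by (intro funcsetI minus_closed pc w derivation_closed[OF d]) (use y in auto)
  from pdir_unique[OF inf st(1,2) this y eq]
  show "peval R (\<lambda>c. c) y (pder d w s) = peval R (\<lambda>c. c) y (pder d w t)"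
   using peval_pder[OF d st(1) w y] peval_pder[OF d st(2) w y] eq[OF y] by simp
 qed (use st in auto)
 define D where "D p = ?f (pder d w (SOME t. t \<in> ?T \<and> ?f t = p))" for p
 have D: "D (?f t) = ?f (pder d w t)" if "t \<in> ?T" for t
  unfolding D_def using someI[of "\<lambda>s. s \<in> ?T \<and> ?f s = ?f t" t] that by (intro well) auto
 have "derivation ?P D"
  unfolding derivation_def car
  by (auto simp: D pd pol_ops intro!: imageI)
 with D that show thesis by blast
qed

end

type_synonym ('v, 'f) ratfun = "((('v \<Rightarrow> 'f) \<Rightarrow> 'f) \<times> (('v \<Rightarrow> 'f) \<Rightarrow> 'f)) set"

text \<open>The field \<open>F(V)\<close> characterised by two properties: every element is a
  quotient of polynomial expressions, and such an expression is zero exactly when it vanishes on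
  \<open>F^V\<close>. For infinite \<open>F\<close> the latter is the algebraic independence of the
  variables.\<close>

locale rational_functions = F: field F + R: field R
 for F :: "('f, 'm) ring_scheme" and R :: "('r, 'n) ring_scheme" +
 fixes V :: "'v set" and h :: "'f \<Rightarrow> 'r" and x :: "'v \<Rightarrow> 'r"
 assumes infinite_carrier: "infinite (carrier F)"
  and finite_vars: "finite V"
  and hom: "h \<in> ring_hom F R"
  and vars_closed: "x \<in> V \<rightarrow> carrier R"
  and fraction: "a \<in> carrier R \<Longrightarrow> \<exists>s\<in>pterms (carrier F) V. \<exists>t\<in>pterms (carrier F) V.
   peval R h x t \<noteq> \<zero>\<^bsub>R\<^esub> \<and> a \<otimes>\<^bsub>R\<^esub> peval R h x t = peval R h x s"
  and vanishing: "t \<in> pterms (carrier F) V \<Longrightarrow>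
   peval R h x t = \<zero>\<^bsub>R\<^esub> \<longleftrightarrow> (\<forall>y\<in>V \<rightarrow> carrier F. peval F (\<lambda>c. c) y t = \<zero>\<^bsub>F\<^esub>)"

text \<open>The derivatives of the variables are prescribed by polynomials \<open>w\<close>. This
  serves for the generic solution of \<open>x' = A x\<close> as well as for a generic matrix of
  constants, with \<open>w = 0\<close>.\<close>

lemma rational_functions_exist:
 fixes F :: "('f, 'm) ring_scheme" and V :: "'v set"
 assumes F: "differential_field F d" and inf: "infinite (carrier F)" and "finite V"
  and w: "\<And>v. v \<in> V \<Longrightarrow> w v \<in> pterms (carrier F) V"
 obtains R :: "('v, 'f) ratfun ring" and dR h x
 where "rational_functions F R V h x" "differential_field_extension F d R dR h"
  "\<And>v. v \<in> V \<Longrightarrow> dR (x v) = peval R h x (w v)"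
proof -
 interpret F: field F using F by (simp add: differential_field_iff)
 have d: "derivation F d" using F by (simp add: differential_field_iff)
 let ?P = "pol_ring F V" and ?T = "pterms (carrier F) V" and ?f = "pol_fun F V"
 interpret P: domain ?P by (rule F.pol_ring_domain[OF inf])
 have car: "carrier ?P = ?f ` ?T" by (simp add: pol_ring_def)
 let ?R = "frac_field ?P"
 obtain D where D: "derivation ?P D" "\<And>t. t \<in> ?T \<Longrightarrow> D (?f t) = ?f (pder d w t)"
  by (rule F.pol_derivation[OF inf d, of V w]) (use w in auto)
 define i where "i p = fcls ?P p \<one>\<^bsub>?P\<^esub>" for p
 define h x where "h c = i (?f (PConst c))" and "x v = i (?f (PVar v))" for c v
 have i: "i \<in> ring_hom ?P ?R" unfolding i_def[abs_def] by (rule P.frac_embed)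
 have i0: "i p = \<zero>\<^bsub>?R\<^esub> \<longleftrightarrow> p = \<zero>\<^bsub>?P\<^esub>" if "p \<in> carrier ?P" for p
  unfolding i_def by (rule P.frac_embed_zero[OF that])
 have ev: "peval ?R h x t = i (?f t)" if "t \<in> ?T" for t
  using that
 proof (induction t)
  case (PAdd s t)
  thus ?case using ring_hom_add[OF i, of "?f s" "?f t"] by (simp add: car pol_ops)
 next
  case (PMul s t)
  thus ?case using ring_hom_mult[OF i, of "?f s" "?f t"] by (simp add: car pol_ops)
 qed (simp_all add: h_def x_def)
 have "(\<lambda>c. ?f (PConst c)) \<in> ring_hom F ?P"
 proof (rule ring_hom_memI)
  fix a b assume "a \<in> carrier F" "b \<in> carrier F"
  thus "?f (PConst (a \<otimes>\<^bsub>F\<^esub> b)) = ?f (PConst a) \<otimes>\<^bsub>?P\<^esub> ?f (PConst b)"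
   "?f (PConst (a \<oplus>\<^bsub>F\<^esub> b)) = ?f (PConst a) \<oplus>\<^bsub>?P\<^esub> ?f (PConst b)"
   unfolding pol_ops by (subst pol_fun_eq_iff[where A = "carrier F"]; simp)+
 qed (auto simp: car pol_ops)
 from ring_hom_trans[OF this i] have h: "h \<in> ring_hom F ?R"
  by (simp add: h_def[abs_def] o_def)
 have "rational_functions F ?R V h x"
 proof (intro rational_functions.intro rational_functions_axioms.intro)
  show "field F" by (rule F.field_axioms)
  show "field ?R" by (rule P.frac_is_field)
  show "x \<in> V \<rightarrow> carrier ?R" using ring_hom_closed[OF i] by (auto simp: x_def car)
  fix a assume "a \<in> carrier ?R"
  from P.frac_fraction[OF this] obtain p q where pq: "p \<in> carrier ?P" "q \<in> carrier ?P" "q \<noteq> \<zero>\<^bsub>?P\<^esub>"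
   "a \<otimes>\<^bsub>?R\<^esub> i q = i p" unfolding i_def by auto
  obtain s t where st: "s \<in> ?T" "t \<in> ?T" "p = ?f s" "q = ?f t" using pq(1,2) by (auto simp: car)
  thus "\<exists>s\<in>?T. \<exists>t\<in>?T. peval ?R h x t \<noteq> \<zero>\<^bsub>?R\<^esub> \<and> a \<otimes>\<^bsub>?R\<^esub> peval ?R h x t = peval ?R h x s"
   using pq i0[OF pq(2)] by (intro bexI[of _ s] bexI[of _ t]) (simp_all add: ev)
 next
  fix t assume t: "t \<in> ?T"
  hence ft: "?f t \<in> carrier ?P" by (simp add: car)
  show "peval ?R h x t = \<zero>\<^bsub>?R\<^esub> \<longleftrightarrow> (\<forall>y\<in>V \<rightarrow> carrier F. peval F (\<lambda>c. c) y t = \<zero>\<^bsub>F\<^esub>)"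
   unfolding ev[OF t] i0[OF ft] pol_ops using t
   by (subst pol_fun_eq_iff[where A = "carrier F"]) auto
 qed fact+
 moreover have "differential_field_extension F d ?R (frac_deriv ?P D) h"
 proof (intro differential_field_extension.intro differential_field_extension_axioms.intro F h)
  show "differential_field ?R (frac_deriv ?P D)"
   using P.frac_is_field P.frac_deriv_derivation[OF D(1)] by (simp add: differential_field_iff)
  fix a assume "a \<in> carrier F"
  thus "h (d a) = frac_deriv ?P D (h a)"
   unfolding h_def i_def by (subst P.frac_embed_deriv[OF D(1)]) (auto simp: car D(2))
 qed
 moreover have "frac_deriv ?P D (x v) = peval ?R h x (w v)" if "v \<in> V" for v
  unfolding ev[OF w[OF that]] x_def i_def using that
  by (subst P.frac_embed_deriv[OF D(1)]) (auto simp: car D(2))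
 ultimately show thesis by (rule that)
qed

section \<open>Evaluation of rational functions\<close>

lemma peval_derivation:
 assumes "cring G" "derivation G D" "t \<in> pterms A V" "f \<in> A \<rightarrow> carrier G" "y \<in> V \<rightarrow> carrier G"
  and "\<And>c. c \<in> A \<Longrightarrow> D (f c) = f (d c)" "\<And>v. v \<in> V \<Longrightarrow> D (y v) = peval G f y (w v)"
 shows "D (peval G f y t) = peval G f y (pder d w t)"
 using assms(3)
proof (induction t)
 interpret cring G by fact
 {
  case (PAdd s t)
  hence st: "s \<in> pterms A V" "t \<in> pterms A V" by auto
  show ?case using PAdd.IH(1)[OF st(1)] PAdd.IH(2)[OF st(2)]
   derivation_add[OF assms(2) peval_closed[OF st(1) assms(4,5)] peval_closed[OF st(2) assms(4,5)]] by simp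
 next
  case (PMul s t)
  hence st: "s \<in> pterms A V" "t \<in> pterms A V" by auto
  show ?case using PMul.IH(1)[OF st(1)] PMul.IH(2)[OF st(2)]
   derivation_mult[OF assms(2) peval_closed[OF st(1) assms(4,5)] peval_closed[OF st(2) assms(4,5)]] by simp
 }
qed (use assms in auto)

lemma field_hom_inj:
 assumes "field F" "field G" "f \<in> ring_hom F G"
 shows "inj_on f (carrier F)"
proof -
 interpret F: field F by fact
 interpret G: field G by fact
 interpret ring_hom_ring F G f
  using assms(3) by (intro ring_hom_ringI2 F.ring_axioms G.ring_axioms)
 show ?thesis
 proof (rule non_trivial_field_hom_imp_inj[OF F.field_axioms])
  show "f ` carrier F \<noteq> {\<zero>\<^bsub>G\<^esub>}"
   using ring_hom_one[OF assms(3)] G.one_not_zero F.one_closed by (metis image_eqI singletonD)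
 qed
qed

context rational_functions
begin

lemma h_closed: "h \<in> carrier F \<rightarrow> carrier R"
 using ring_hom_closed[OF hom] by auto

lemma ev_closed: "t \<in> pterms (carrier F) V \<Longrightarrow> peval R h x t \<in> carrier R"
 by (rule R.peval_closed[OF _ h_closed vars_closed])

text \<open>Such a term vanishes at all points over \<open>F\<close>, and the image of
  \<open>F\<close> in \<open>G\<close> is infinite, so \<open>peval_vanishing\<close> carries this
  over to points with coordinates in \<open>G\<close>.\<close>

lemma ev_zero_transfer:
 assumes G: "field G" "f \<in> ring_hom F G" "y \<in> V \<rightarrow> carrier G"
  and t: "t \<in> pterms (carrier F) V" "peval R h x t = \<zero>\<^bsub>R\<^esub>"
 shows "peval G f y t = \<zero>\<^bsub>G\<^esub>"
proof -
 interpret G: field G by (rule G(1))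
 have fc: "f \<in> carrier F \<rightarrow> carrier G" using ring_hom_closed[OF G(2)] by auto
 show ?thesis
 proof (rule G.peval_vanishing[where A = "f ` carrier F" and V = V and C = "carrier F"])
  show "infinite (f ` carrier F)"
   using finite_imageD[OF _ field_hom_inj[OF F.field_axioms G(1,2)]] infinite_carrier by auto
  fix z assume z: "z \<in> V \<rightarrow> f ` carrier F"
  hence "\<forall>v\<in>V. \<exists>c\<in>carrier F. z v = f c" by auto
  then obtain z' where z': "\<And>v. v \<in> V \<Longrightarrow> z' v \<in> carrier F \<and> z v = f (z' v)" by metis
  have "peval G f z t = peval G (f \<circ> (\<lambda>c. c)) (f \<circ> z') t"
   by (rule peval_cong[OF t(1)]) (use z' in auto)
  also have "\<dots> = f (peval F (\<lambda>c. c) z' t)"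
   by (rule peval_hom[OF G(2) F.ring_axioms t(1), symmetric]) (use z' in auto)
  also have "peval F (\<lambda>c. c) z' t = \<zero>\<^bsub>F\<^esub>" using vanishing[OF t(1)] t(2) z' by auto
  also have "f \<zero>\<^bsub>F\<^esub> = \<zero>\<^bsub>G\<^esub>" using ring_hom_zero[OF G(2) F.ring_axioms G.ring_axioms] .
  finally show "peval G f z t = \<zero>\<^bsub>G\<^esub>" .
 qed (use fc t(1) G(3) finite_vars in auto)
qed

text \<open>\<open>O\<^sub>y\<close> is the local ring at the point \<open>y\<close>: the fractions
  that admit a denominator with nonzero value there. Two such presentations of one element have the
  same value by \<open>ev_zero_transfer\<close>.\<close>

lemma local_evaluation:
 assumes G: "field G" "f \<in> ring_hom F G" "y \<in> V \<rightarrow> carrier G"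
 obtains O\<^sub>y ev where "subring O\<^sub>y R" "ev \<in> ring_hom (R\<lparr>carrier := O\<^sub>y\<rparr>) G"
  "\<And>a s t. \<lbrakk>a \<in> carrier R; s \<in> pterms (carrier F) V; t \<in> pterms (carrier F) V; peval G f y t \<noteq> \<zero>\<^bsub>G\<^esub>;
   a \<otimes>\<^bsub>R\<^esub> peval R h x t = peval R h x s\<rbrakk> \<Longrightarrow>
   a \<in> O\<^sub>y \<and> ev a \<otimes>\<^bsub>G\<^esub> peval G f y t = peval G f y s"
proof -
 interpret G: field G by (rule G(1))
 let ?T = "pterms (carrier F) V"
 let ?r = "peval R h x" and ?g = "peval G f y"
 have fc: "f \<in> carrier F \<rightarrow> carrier G" using ring_hom_closed[OF G(2)] by auto
 have gc: "?g t \<in> carrier G" if "t \<in> ?T" for t by (rule G.peval_closed[OF that fc G(3)])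
 define rep where "rep a s t \<longleftrightarrow> s \<in> ?T \<and> t \<in> ?T \<and> ?g t \<noteq> \<zero>\<^bsub>G\<^esub> \<and> a \<otimes>\<^bsub>R\<^esub> ?r t = ?r s" for a s t
 define O\<^sub>y where "O\<^sub>y = {a \<in> carrier R. \<exists>s t. rep a s t}"
 define ev where "ev a = (SOME b. b \<in> carrier G \<and> (\<exists>s t. rep a s t \<and> b \<otimes>\<^bsub>G\<^esub> ?g t = ?g s))" for a
 have neg: "PMul (PConst (\<ominus>\<^bsub>F\<^esub> \<one>\<^bsub>F\<^esub>)) t \<in> ?T" if "t \<in> ?T" for t using that by simp
 have rneg: "?r (PMul (PConst (\<ominus>\<^bsub>F\<^esub> \<one>\<^bsub>F\<^esub>)) t) = \<ominus>\<^bsub>R\<^esub> ?r t" if "t \<in> ?T" for t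
 proof -
  interpret H: ring_hom_cring F R h
   using hom by (intro ring_hom_cring.intro ring_hom_cring_axioms.intro F.cring_axioms R.cring_axioms)
  show ?thesis using ev_closed[OF that] by (simp add: R.l_minus)
 qed
 have gneg: "?g (PMul (PConst (\<ominus>\<^bsub>F\<^esub> \<one>\<^bsub>F\<^esub>)) t) = \<ominus>\<^bsub>G\<^esub> ?g t" if "t \<in> ?T" for t
 proof -
  interpret H: ring_hom_cring F G f
   using G(2) by (intro ring_hom_cring.intro ring_hom_cring_axioms.intro F.cring_axioms G.cring_axioms)
  show ?thesis using gc[OF that] by (simp add: G.l_minus)
 qed
 have unique: "b = b'" if a: "a \<in> carrier R" "rep a s t" "rep a s' t'"
  and b: "b \<in> carrier G" "b \<otimes>\<^bsub>G\<^esub> ?g t = ?g s" "b' \<in> carrier G" "b' \<otimes>\<^bsub>G\<^esub> ?g t' = ?g s'" for a b b' s s' t t'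
 proof -
  have T: "s \<in> ?T" "t \<in> ?T" "s' \<in> ?T" "t' \<in> ?T" using a by (auto simp: rep_def)
  note rc = ev_closed[OF T(1)] ev_closed[OF T(2)] ev_closed[OF T(3)] ev_closed[OF T(4)]
  note gc = gc[OF T(1)] gc[OF T(2)] gc[OF T(3)] gc[OF T(4)]
  \<comment> \<open>This is \<open>s t' - s' t\<close>, written as a term since
    \<open>ev_zero_transfer\<close> speaks about terms. It is zero in \<open>R\<close>, hence at
    \<open>y\<close>.\<close>
  let ?u = "PAdd (PMul s t') (PMul (PConst (\<ominus>\<^bsub>F\<^esub> \<one>\<^bsub>F\<^esub>)) (PMul s' t))"
  have u: "?u \<in> ?T" using T by simp
  have st: "PMul s' t \<in> ?T" using T by simp
  have "?r s \<otimes>\<^bsub>R\<^esub> ?r t' = a \<otimes>\<^bsub>R\<^esub> ?r t \<otimes>\<^bsub>R\<^esub> ?r t'" using a by (simp add: rep_def)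
  also have "\<dots> = (a \<otimes>\<^bsub>R\<^esub> ?r t') \<otimes>\<^bsub>R\<^esub> ?r t" using a(1) rc by (simp add: R.m_ac)
  also have "\<dots> = ?r s' \<otimes>\<^bsub>R\<^esub> ?r t" using a by (simp add: rep_def)
  finally have "?r ?u = \<zero>\<^bsub>R\<^esub>"
   using rneg[OF st] rc by (simp add: R.r_neg del: peval.simps(4)) (simp add: R.r_neg)
  hence "?g ?u = \<zero>\<^bsub>G\<^esub>" by (rule ev_zero_transfer[OF G u])
  hence "?g s \<otimes>\<^bsub>G\<^esub> ?g t' \<oplus>\<^bsub>G\<^esub> \<ominus>\<^bsub>G\<^esub> (?g s' \<otimes>\<^bsub>G\<^esub> ?g t) = \<zero>\<^bsub>G\<^esub>"
   using gneg[OF st] by simp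
  hence e: "?g s \<otimes>\<^bsub>G\<^esub> ?g t' = ?g s' \<otimes>\<^bsub>G\<^esub> ?g t"
   using gc by (metis G.a_inv_closed G.m_closed G.minus_minus G.sum_zero_eq_neg)
  have "b \<otimes>\<^bsub>G\<^esub> (?g t \<otimes>\<^bsub>G\<^esub> ?g t') = b' \<otimes>\<^bsub>G\<^esub> (?g t \<otimes>\<^bsub>G\<^esub> ?g t')"
   using e b gc by (metis G.m_assoc G.m_comm)
  moreover have "?g t \<otimes>\<^bsub>G\<^esub> ?g t' \<noteq> \<zero>\<^bsub>G\<^esub>" using a gc by (auto simp: rep_def G.integral_iff)
  ultimately show "b = b'" using b gc by (simp add: G.m_rcancel)
 qed
 have ev: "ev a \<in> carrier G \<and> ev a \<otimes>\<^bsub>G\<^esub> ?g t = ?g s" if a: "a \<in> carrier R" "rep a s t" for a s t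
 proof -
  have T: "s \<in> ?T" "t \<in> ?T" "?g t \<noteq> \<zero>\<^bsub>G\<^esub>" using a by (auto simp: rep_def)
  let ?b = "?g s \<otimes>\<^bsub>G\<^esub> inv\<^bsub>G\<^esub> ?g t"
  have ib: "inv\<^bsub>G\<^esub> ?g t \<in> carrier G" "inv\<^bsub>G\<^esub> ?g t \<otimes>\<^bsub>G\<^esub> ?g t = \<one>\<^bsub>G\<^esub>"
   using T gc[OF T(2)] G.field_Units by auto
  have b: "?b \<in> carrier G" "?b \<otimes>\<^bsub>G\<^esub> ?g t = ?g s"
   using ib gc[OF T(1)] gc[OF T(2)] by (auto simp: G.m_assoc)
  have "ev a \<in> carrier G \<and> (\<exists>s t. rep a s t \<and> ev a \<otimes>\<^bsub>G\<^esub> ?g t = ?g s)"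
   unfolding ev_def by (rule someI[of _ ?b]) (use a b in auto)
  then obtain s' t' where "ev a \<in> carrier G" "rep a s' t'" "ev a \<otimes>\<^bsub>G\<^esub> ?g t' = ?g s'" by auto
  with unique[OF a this(2) b] b show ?thesis by auto
 qed
 have rep_add: "rep (a \<oplus>\<^bsub>R\<^esub> b) (PAdd (PMul s t') (PMul s' t)) (PMul t t')"
  and rep_mult: "rep (a \<otimes>\<^bsub>R\<^esub> b) (PMul s s') (PMul t t')"
  if "a \<in> carrier R" "b \<in> carrier R" "rep a s t" "rep b s' t'" for a b s t s' t'
 proof -
  have T: "s \<in> ?T" "t \<in> ?T" "s' \<in> ?T" "t' \<in> ?T" "?g t \<noteq> \<zero>\<^bsub>G\<^esub>" "?g t' \<noteq> \<zero>\<^bsub>G\<^esub>"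
   and e: "a \<otimes>\<^bsub>R\<^esub> ?r t = ?r s" "b \<otimes>\<^bsub>R\<^esub> ?r t' = ?r s'" using that by (auto simp: rep_def)
  note rc = ev_closed[OF T(2)] ev_closed[OF T(4)] that(1,2)
  have "?g t \<otimes>\<^bsub>G\<^esub> ?g t' \<noteq> \<zero>\<^bsub>G\<^esub>" using T gc by (auto simp: G.integral_iff)
  moreover have "(a \<oplus>\<^bsub>R\<^esub> b) \<otimes>\<^bsub>R\<^esub> (?r t \<otimes>\<^bsub>R\<^esub> ?r t') = (a \<otimes>\<^bsub>R\<^esub> ?r t) \<otimes>\<^bsub>R\<^esub> ?r t' \<oplus>\<^bsub>R\<^esub> (b \<otimes>\<^bsub>R\<^esub> ?r t') \<otimes>\<^bsub>R\<^esub> ?r t"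
   using rc by (simp add: R.l_distr R.m_ac)
  moreover have "(a \<otimes>\<^bsub>R\<^esub> b) \<otimes>\<^bsub>R\<^esub> (?r t \<otimes>\<^bsub>R\<^esub> ?r t') = (a \<otimes>\<^bsub>R\<^esub> ?r t) \<otimes>\<^bsub>R\<^esub> (b \<otimes>\<^bsub>R\<^esub> ?r t')"
   using rc by (simp add: R.m_ac)
  ultimately show "rep (a \<oplus>\<^bsub>R\<^esub> b) (PAdd (PMul s t') (PMul s' t)) (PMul t t')"
   "rep (a \<otimes>\<^bsub>R\<^esub> b) (PMul s s') (PMul t t')"
   using T e by (simp_all add: rep_def)
 qed
 have rep_one: "rep \<one>\<^bsub>R\<^esub> (PConst \<one>\<^bsub>F\<^esub>) (PConst \<one>\<^bsub>F\<^esub>)"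
  using ring_hom_one[OF hom] ring_hom_one[OF G(2)] by (simp add: rep_def)
 have rep_neg: "rep (\<ominus>\<^bsub>R\<^esub> a) (PMul (PConst (\<ominus>\<^bsub>F\<^esub> \<one>\<^bsub>F\<^esub>)) s) t" if "a \<in> carrier R" "rep a s t" for a s t
 proof -
  have T: "s \<in> ?T" "t \<in> ?T" and e: "a \<otimes>\<^bsub>R\<^esub> ?r t = ?r s" using that by (auto simp: rep_def)
  show ?thesis unfolding rep_def rneg[OF T(1)]
   using that T e ev_closed[OF T(2)] by (simp add: rep_def R.l_minus)
 qed
 have sub: "subring O\<^sub>y R"
 proof (rule R.subringI)
  show "\<one>\<^bsub>R\<^esub> \<in> O\<^sub>y" using rep_one unfolding O\<^sub>y_def by auto
  fix a b assume "a \<in> O\<^sub>y" "b \<in> O\<^sub>y"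
  then obtain s t s' t' where ab: "a \<in> carrier R" "b \<in> carrier R" "rep a s t" "rep b s' t'"
   unfolding O\<^sub>y_def by auto
  show "a \<otimes>\<^bsub>R\<^esub> b \<in> O\<^sub>y" using rep_mult[OF ab] ab unfolding O\<^sub>y_def by auto
  show "a \<oplus>\<^bsub>R\<^esub> b \<in> O\<^sub>y" using rep_add[OF ab] ab unfolding O\<^sub>y_def by auto
 next
  fix a assume "a \<in> O\<^sub>y"
  then obtain s t where a: "a \<in> carrier R" "rep a s t" unfolding O\<^sub>y_def by auto
  show "\<ominus>\<^bsub>R\<^esub> a \<in> O\<^sub>y" using rep_neg[OF a] a unfolding O\<^sub>y_def by auto
 qed (auto simp: O\<^sub>y_def)
 have hom: "ev \<in> ring_hom (R\<lparr>carrier := O\<^sub>y\<rparr>) G"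
 proof (rule ring_hom_memI; simp)
  fix a assume "a \<in> O\<^sub>y"
  thus "ev a \<in> carrier G" using ev unfolding O\<^sub>y_def by auto
 next
  fix a b assume "a \<in> O\<^sub>y" "b \<in> O\<^sub>y"
  then obtain s t s' t' where ab: "a \<in> carrier R" "b \<in> carrier R" "rep a s t" "rep b s' t'"
   unfolding O\<^sub>y_def by auto
  have T: "s \<in> ?T" "t \<in> ?T" "s' \<in> ?T" "t' \<in> ?T" using ab by (auto simp: rep_def)
  note gcs = gc[OF T(1)] gc[OF T(2)] gc[OF T(3)] gc[OF T(4)]
  note ea = ev[OF ab(1,3)] and eb = ev[OF ab(2,4)]
  have "(ev a \<oplus>\<^bsub>G\<^esub> ev b) \<otimes>\<^bsub>G\<^esub> (?g t \<otimes>\<^bsub>G\<^esub> ?g t') = (ev a \<otimes>\<^bsub>G\<^esub> ?g t) \<otimes>\<^bsub>G\<^esub> ?g t' \<oplus>\<^bsub>G\<^esub> (ev b \<otimes>\<^bsub>G\<^esub> ?g t') \<otimes>\<^bsub>G\<^esub> ?g t"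
   using conjunct1[OF ea] conjunct1[OF eb] gcs by (simp add: G.l_distr G.r_distr G.m_ac)
  moreover have "(ev a \<otimes>\<^bsub>G\<^esub> ev b) \<otimes>\<^bsub>G\<^esub> (?g t \<otimes>\<^bsub>G\<^esub> ?g t') = (ev a \<otimes>\<^bsub>G\<^esub> ?g t) \<otimes>\<^bsub>G\<^esub> (ev b \<otimes>\<^bsub>G\<^esub> ?g t')"
   using conjunct1[OF ea] conjunct1[OF eb] gcs by (simp add: G.m_ac)
  ultimately have "(ev a \<oplus>\<^bsub>G\<^esub> ev b) \<otimes>\<^bsub>G\<^esub> ?g (PMul t t') = ?g (PAdd (PMul s t') (PMul s' t))"
   "(ev a \<otimes>\<^bsub>G\<^esub> ev b) \<otimes>\<^bsub>G\<^esub> ?g (PMul t t') = ?g (PMul s s')"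
   using ea eb by simp_all
  thus "ev (a \<otimes>\<^bsub>R\<^esub> b) = ev a \<otimes>\<^bsub>G\<^esub> ev b" "ev (a \<oplus>\<^bsub>R\<^esub> b) = ev a \<oplus>\<^bsub>G\<^esub> ev b"
   using unique[OF _ rep_mult[OF ab] rep_mult[OF ab]] unique[OF _ rep_add[OF ab] rep_add[OF ab]]
    ev[OF _ rep_mult[OF ab]] ev[OF _ rep_add[OF ab]] ea eb ab by auto
 next
  show "ev \<one>\<^bsub>R\<^esub> = \<one>\<^bsub>G\<^esub>"
   using unique[OF _ rep_one rep_one] ev[OF _ rep_one] ring_hom_one[OF G(2)] by auto
 qed
 show thesis
 proof (rule that[OF sub hom])
  fix a s t assume a: "a \<in> carrier R" "s \<in> ?T" "t \<in> ?T" "?g t \<noteq> \<zero>\<^bsub>G\<^esub>" "a \<otimes>\<^bsub>R\<^esub> ?r t = ?r s"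
  hence "rep a s t" by (auto simp: rep_def)
  with ev[OF a(1) this] a(1) show "a \<in> O\<^sub>y \<and> ev a \<otimes>\<^bsub>G\<^esub> ?g t = ?g s"
   by (auto simp: O\<^sub>y_def)
 qed
qed

text \<open>At a generic point no nonzero denominator vanishes, so the local ring is the whole
  field.\<close>

lemma generic_evaluation:
 assumes G: "field G" "f \<in> ring_hom F G" "y \<in> V \<rightarrow> carrier G"
  and generic: "\<And>t. t \<in> pterms (carrier F) V \<Longrightarrow> peval G f y t = \<zero>\<^bsub>G\<^esub> \<Longrightarrow> peval R h x t = \<zero>\<^bsub>R\<^esub>"
 obtains ev where "ev \<in> ring_hom R G"
  "\<And>t. t \<in> pterms (carrier F) V \<Longrightarrow> ev (peval R h x t) = peval G f y t"
proof -
 interpret G: field G by (rule G(1))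
 have fc: "f \<in> carrier F \<rightarrow> carrier G" using ring_hom_closed[OF G(2)] by auto
 obtain O\<^sub>y ev where O: "subring O\<^sub>y R" "ev \<in> ring_hom (R\<lparr>carrier := O\<^sub>y\<rparr>) G"
  and ev: "\<And>a s t. \<lbrakk>a \<in> carrier R; s \<in> pterms (carrier F) V; t \<in> pterms (carrier F) V; peval G f y t \<noteq> \<zero>\<^bsub>G\<^esub>;
   a \<otimes>\<^bsub>R\<^esub> peval R h x t = peval R h x s\<rbrakk> \<Longrightarrow>
   a \<in> O\<^sub>y \<and> ev a \<otimes>\<^bsub>G\<^esub> peval G f y t = peval G f y s"
  using local_evaluation[OF G] by metis
 have "carrier R \<subseteq> O\<^sub>y"
 proof
  fix a assume a: "a \<in> carrier R"
  from fraction[OF a] obtain s t where "s \<in> pterms (carrier F) V" "t \<in> pterms (carrier F) V"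
   "peval R h x t \<noteq> \<zero>\<^bsub>R\<^esub>" "a \<otimes>\<^bsub>R\<^esub> peval R h x t = peval R h x s" by auto
  with ev[OF a] generic show "a \<in> O\<^sub>y" by blast
 qed
 hence "O\<^sub>y = carrier R" using subringE(1)[OF O(1)] by auto
 hence "ev \<in> ring_hom R G" using O(2) by (simp add: ring_hom_def)
 moreover have "ev (peval R h x t) = peval G f y t" if t: "t \<in> pterms (carrier F) V" for t
 proof -
  have 1: "peval G f y (PConst \<one>\<^bsub>F\<^esub>) = \<one>\<^bsub>G\<^esub>" "peval R h x (PConst \<one>\<^bsub>F\<^esub>) = \<one>\<^bsub>R\<^esub>"
   using ring_hom_one[OF G(2)] ring_hom_one[OF hom] by auto
  have "ev (peval R h x t) \<otimes>\<^bsub>G\<^esub> peval G f y (PConst \<one>\<^bsub>F\<^esub>) = peval G f y t"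
   using ev[OF ev_closed[OF t] t, of "PConst \<one>\<^bsub>F\<^esub>"] 1 ev_closed[OF t] by simp
  thus ?thesis
   using 1 ring_hom_closed[OF \<open>ev \<in> ring_hom R G\<close> ev_closed[OF t]] by simp
 qed
 ultimately show thesis by (rule that)
qed

end

text \<open>The two composites agree on coefficients and variables, hence on polynomials; for a
  quotient the product rule is applied to \<open>a t = s\<close> and the value of \<open>t\<close>
  is cancelled.\<close>

lemma generic_evaluation_derivation:
 assumes RF: "rational_functions F R V h x" and R: "differential_field_extension F d R dR h"
  and w: "\<And>v. v \<in> V \<Longrightarrow> w v \<in> pterms (carrier F) V" "\<And>v. v \<in> V \<Longrightarrow> dR (x v) = peval R h x (w v)"
  and G: "differential_field_extension F d G dG f" "y \<in> V \<rightarrow> carrier G"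
   "\<And>v. v \<in> V \<Longrightarrow> dG (y v) = peval G f y (w v)"
  and ev: "ev \<in> ring_hom R G" "\<And>t. t \<in> pterms (carrier F) V \<Longrightarrow> ev (peval R h x t) = peval G f y t"
  and a: "a \<in> carrier R"
 shows "ev (dR a) = dG (ev a)"
proof -
 interpret rational_functions F R V h x by (rule RF)
 interpret R: differential_field_extension F d R dR h by (rule R)
 interpret G: differential_field_extension F d G dG f by (rule G(1))
 have dd: "derivation F d" "derivation R dR" "derivation G dG"
  using R.K.differential_field_axioms R.L.differential_field_axioms G.L.differential_field_axioms
  by (simp_all add: differential_field_iff)
 have fc: "f \<in> carrier F \<rightarrow> carrier G" using ring_hom_closed[OF G.hom] by auto
 have pd: "pder d w t \<in> pterms (carrier F) V" if "t \<in> pterms (carrier F) V" for t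
  by (rule pder_in_pterms[OF that]) (use w derivation_closed[OF dd(1)] in auto)
 have dr: "dR (peval R h x t) = peval R h x (pder d w t)" if "t \<in> pterms (carrier F) V" for t
  by (rule peval_derivation[OF _ dd(2) that h_closed vars_closed])
   (use R.hom_d w in \<open>auto intro: R.cring_axioms\<close>)
 have dg: "dG (peval G f y t) = peval G f y (pder d w t)" if "t \<in> pterms (carrier F) V" for t
  by (rule peval_derivation[OF _ dd(3) that fc G(2)])
   (use G.hom_d G(3) in \<open>auto intro: G.L.cring_axioms\<close>)
 have cmp: "ev (dR (peval R h x t)) = dG (ev (peval R h x t))" if "t \<in> pterms (carrier F) V" for t
  unfolding dr[OF that] ev(2)[OF that] ev(2)[OF pd[OF that]] dg[OF that] ..
 from fraction[OF a] obtain s t where st: "s \<in> pterms (carrier F) V" "t \<in> pterms (carrier F) V"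
  "peval R h x t \<noteq> \<zero>\<^bsub>R\<^esub>" "a \<otimes>\<^bsub>R\<^esub> peval R h x t = peval R h x s" by auto
 let ?t = "peval R h x t" and ?s = "peval R h x s"
 note c = ev_closed[OF st(2)] a derivation_closed[OF dd(2) ev_closed[OF st(2)]] derivation_closed[OF dd(2) a]
 note evc = c[THEN ring_hom_closed[OF ev(1)]]
 have "ev ?t \<noteq> \<zero>\<^bsub>G\<^esub>"
  using inj_onD[OF field_hom_inj[OF R.field_axioms G.L.field_axioms ev(1)], of ?t "\<zero>\<^bsub>R\<^esub>"] st(3) c
   ring_hom_zero[OF ev(1) R.ring_axioms G.L.ring_axioms] by auto
 have "ev (dR a) \<otimes>\<^bsub>G\<^esub> ev ?t \<oplus>\<^bsub>G\<^esub> ev a \<otimes>\<^bsub>G\<^esub> ev (dR ?t) = ev (dR (a \<otimes>\<^bsub>R\<^esub> ?t))"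
  using c by (simp add: derivation_mult[OF dd(2)] ring_hom_add[OF ev(1)] ring_hom_mult[OF ev(1)])
 also have "\<dots> = dG (ev (a \<otimes>\<^bsub>R\<^esub> ?t))" unfolding st(4) by (rule cmp[OF st(1)])
 also have "\<dots> = dG (ev a) \<otimes>\<^bsub>G\<^esub> ev ?t \<oplus>\<^bsub>G\<^esub> ev a \<otimes>\<^bsub>G\<^esub> ev (dR ?t)"
  using c evc by (simp add: ring_hom_mult[OF ev(1)] derivation_mult[OF dd(3)] cmp[OF st(2)])
 finally have "ev (dR a) \<otimes>\<^bsub>G\<^esub> ev ?t = dG (ev a) \<otimes>\<^bsub>G\<^esub> ev ?t"
  using evc derivation_closed[OF dd(3) evc(2)] by (subst (asm) G.L.add.right_cancel) auto
 thus ?thesis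
  using evc derivation_closed[OF dd(3) evc(2)] \<open>ev ?t \<noteq> _\<close> by (subst (asm) G.L.m_rcancel) auto
qed

section \<open>Generated fields and constants\<close>

text \<open>A list of pairs stands for an element of a tensor product and is mapped to a sum of
  products. It presents elements of a compositum in \<open>generate_ring_lcomb\<close> and elements
  of an extended ideal in \<open>lcomb_ideal\<close>.\<close>

primrec (in ring) lcomb :: "('a \<times> 'a) list \<Rightarrow> 'a" where
 "lcomb [] = \<zero>"
| "lcomb (z # zs) = fst z \<otimes> snd z \<oplus> lcomb zs"

context ring
begin

lemma lcomb_closed: "set zs \<subseteq> carrier R \<times> carrier R \<Longrightarrow> lcomb zs \<in> carrier R"
 by (induction zs) auto

lemma lcomb_append:
 "set zs \<subseteq> carrier R \<times> carrier R \<Longrightarrow> set ws \<subseteq> carrier R \<times> carrier R \<Longrightarrow>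
  lcomb (zs @ ws) = lcomb zs \<oplus> lcomb ws"
 by (induction zs) (auto simp: lcomb_closed a_assoc)

lemma lcomb_finsum:
 assumes "set zs \<subseteq> carrier R \<times> carrier R"
 shows "lcomb zs = (\<Oplus>i\<in>{..<length zs}. fst (zs ! i) \<otimes> snd (zs ! i))"
 using assms
proof (induction zs rule: rev_induct)
 case (snoc z zs)
 have "zs ! i \<in> carrier R \<times> carrier R" if "i < length zs" for i
  using snoc.prems that nth_mem[OF that] by auto
 hence c: "(\<lambda>i. fst (zs ! i) \<otimes> snd (zs ! i)) \<in> {..<length zs} \<rightarrow> carrier R"
  by (auto simp: mem_Times_iff)
 have z: "fst z \<otimes> snd z \<in> carrier R" using snoc.prems by auto
 have "(\<Oplus>i\<in>{..<length (zs @ [z])}. fst ((zs @ [z]) ! i) \<otimes> snd ((zs @ [z]) ! i))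
  = (\<Oplus>i\<in>insert (length zs) {..<length zs}. fst ((zs @ [z]) ! i) \<otimes> snd ((zs @ [z]) ! i))"
  by (simp add: lessThan_Suc)
 also have "\<dots> = fst z \<otimes> snd z \<oplus> (\<Oplus>i\<in>{..<length zs}. fst ((zs @ [z]) ! i) \<otimes> snd ((zs @ [z]) ! i))"
  using c z by (subst finsum_insert) (auto simp: nth_append Pi_iff)
 also have "(\<Oplus>i\<in>{..<length zs}. fst ((zs @ [z]) ! i) \<otimes> snd ((zs @ [z]) ! i))
  = (\<Oplus>i\<in>{..<length zs}. fst (zs ! i) \<otimes> snd (zs ! i))"
  by (rule finsum_cong') (use c in \<open>auto simp: nth_append\<close>)
 finally show ?case
  using snoc lcomb_append[of zs "[z]"] z finsum_closed[OF c] by (simp add: a_comm)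
qed simp

end

lemma (in cring) lcomb_mult:
 assumes "set zs \<subseteq> A \<times> B" "set ws \<subseteq> A \<times> B" and A: "subring A R" and B: "subring B R"
 shows "\<exists>us. set us \<subseteq> A \<times> B \<and> lcomb zs \<otimes> lcomb ws = lcomb us"
proof -
 note AB = subringE(1)[OF A] subringE(1)[OF B]
 have 1: "\<exists>us. set us \<subseteq> A \<times> B \<and> a \<otimes> b \<otimes> lcomb ws = lcomb us"
  if "a \<in> A" "b \<in> B" "set ws \<subseteq> A \<times> B" for a b ws
  using that(3)
 proof (induction ws)
  case Nil
  have "a \<in> carrier R" "b \<in> carrier R" using that AB by auto
  thus ?case by (intro exI[of _ "[]"]) auto
 next
  case (Cons w ws)
  then obtain us where us: "set us \<subseteq> A \<times> B" "a \<otimes> b \<otimes> lcomb ws = lcomb us" by auto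
  obtain c e where w: "w = (c, e)" "c \<in> A" "e \<in> B" using Cons.prems by (cases w) auto
  have c: "a \<in> carrier R" "b \<in> carrier R" "c \<in> carrier R" "e \<in> carrier R" using that w AB by auto
  have l: "lcomb ws \<in> carrier R" using Cons.prems AB by (intro lcomb_closed) auto
  show ?case
  proof (intro exI[of _ "(a \<otimes> c, b \<otimes> e) # us"] conjI)
   show "set ((a \<otimes> c, b \<otimes> e) # us) \<subseteq> A \<times> B"
    using us w that subringE(6)[OF A] subringE(6)[OF B] by auto
   have "a \<otimes> b \<otimes> (c \<otimes> e) = a \<otimes> c \<otimes> (b \<otimes> e)" using c by (simp add: m_ac)
   thus "a \<otimes> b \<otimes> lcomb (w # ws) = lcomb ((a \<otimes> c, b \<otimes> e) # us)"
    using us c l w by (simp add: r_distr)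
  qed
 qed
 show ?thesis
  using assms(1)
 proof (induction zs)
  case Nil
  thus ?case using assms(2) AB by (intro exI[of _ "[]"]) (auto intro!: l_null lcomb_closed)
 next
  case (Cons z zs)
  then obtain us where us: "set us \<subseteq> A \<times> B" "lcomb zs \<otimes> lcomb ws = lcomb us" by auto
  have z: "fst z \<in> A" "snd z \<in> B" using Cons.prems by auto
  obtain vs where vs: "set vs \<subseteq> A \<times> B" "fst z \<otimes> snd z \<otimes> lcomb ws = lcomb vs"
   using 1[OF z assms(2)] by auto
  have c: "lcomb zs \<in> carrier R" "lcomb ws \<in> carrier R" "fst z \<in> carrier R" "snd z \<in> carrier R"
   using Cons.prems assms(2) AB z by (auto intro!: lcomb_closed)
  have "A \<times> B \<subseteq> carrier R \<times> carrier R" using AB by auto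
  hence "lcomb (vs @ us) = lcomb vs \<oplus> lcomb us"
   using us(1) vs(1) by (intro lcomb_append) auto
  thus ?case
   using us vs c AB by (intro exI[of _ "vs @ us"]) (auto simp: l_distr)
 qed
qed

lemma (in cring) generate_ring_lcomb:
 assumes A: "subring A R" and B: "subring B R" and "a \<in> generate_ring R (A \<union> B)"
 shows "\<exists>zs. set zs \<subseteq> A \<times> B \<and> a = lcomb zs"
proof -
 note AB = subringE(1)[OF A] subringE(1)[OF B]
 show ?thesis
  using assms(3)
 proof induction
  case one
  show ?case using subringE(3)[OF A] subringE(3)[OF B] by (intro exI[of _ "[(\<one>, \<one>)]"]) auto
 next
  case (incl a)
  then consider "a \<in> A" | "a \<in> B" by auto
  thus ?case
  proof cases
   case 1
   thus ?thesis using subringE(3)[OF B] AB by (intro exI[of _ "[(a, \<one>)]"]) auto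
  next
   case 2
   thus ?thesis using subringE(3)[OF A] AB by (intro exI[of _ "[(\<one>, a)]"]) auto
  qed
 next
  case (a_inv a)
  then obtain zs where zs: "set zs \<subseteq> A \<times> B" "a = lcomb zs" by auto
  have m: "\<ominus> \<one> \<in> A" "\<one> \<in> B" using subringE(3,5)[OF A] subringE(3)[OF B] by auto
  obtain us where us: "set us \<subseteq> A \<times> B" "lcomb [(\<ominus> \<one>, \<one>)] \<otimes> lcomb zs = lcomb us"
   using lcomb_mult[OF _ zs(1) A B, of "[(\<ominus> \<one>, \<one>)]"] m by auto
  have "lcomb zs \<in> carrier R" using zs AB by (intro lcomb_closed) auto
  hence "\<ominus> a = lcomb us" using us(2) zs(2) by (simp add: l_minus)
  thus ?case using us(1) by blast
 next
  case (eng_add a b)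
  then obtain zs ws where z: "set zs \<subseteq> A \<times> B" "a = lcomb zs" "set ws \<subseteq> A \<times> B" "b = lcomb ws" by auto
  thus ?case using AB by (intro exI[of _ "zs @ ws"]) (auto simp: lcomb_append subset_iff)
 next
  case (eng_mult a b)
  then obtain zs ws where z: "set zs \<subseteq> A \<times> B" "a = lcomb zs" "set ws \<subseteq> A \<times> B" "b = lcomb ws" by auto
  thus ?case using lcomb_mult[OF z(1,3) A B] by auto
 qed
qed

section \<open>Fractions and finite generation in generated fields\<close>

context field
begin

lemma inv_closed_nonzero: "a \<in> carrier R \<Longrightarrow> a \<noteq> \<zero> \<Longrightarrow> inv a \<in> carrier R"
 and inv_mult: "a \<in> carrier R \<Longrightarrow> a \<noteq> \<zero> \<Longrightarrow> inv a \<otimes> a = \<one>"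
 and mult_inv: "a \<in> carrier R \<Longrightarrow> a \<noteq> \<zero> \<Longrightarrow> a \<otimes> inv a = \<one>"
 using field_Units by auto

lemma generate_field_fraction:
 assumes H: "H \<subseteq> carrier R" and "a \<in> generate_field R H"
 shows "\<exists>s\<in>generate_ring R H. \<exists>t\<in>generate_ring R H. t \<noteq> \<zero> \<and> a \<otimes> t = s"
proof -
 let ?S = "generate_ring R H"
 have Sc: "a \<in> carrier R" if "a \<in> ?S" for a using generate_ring_in_carrier[OF H that] .
 have Fc: "a \<in> carrier R" if "a \<in> generate_field R H" for a using generate_field_in_carrier[OF H that] .
 have S: "subring ?S R" by (rule generate_ring_is_subring[OF H])
 show ?thesis
  using assms(2)
 proof induction
  case one
  show ?case by (intro bexI[of _ \<one>] conjI) (auto intro: generate_ring.one)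
 next
  case (incl a)
  thus ?case using H by (intro bexI[of _ a] bexI[of _ \<one>]) (auto intro: generate_ring.intros)
 next
  case (a_inv a)
  then obtain s t where st: "s \<in> ?S" "t \<in> ?S" "t \<noteq> \<zero>" "a \<otimes> t = s" by auto
  hence "\<ominus> a \<otimes> t = \<ominus> s" using Fc[OF a_inv(1)] Sc by (simp add: l_minus)
  thus ?case using st generate_ring.a_inv[OF st(1)] by auto
 next
  case (m_inv a)
  then obtain s t where st: "s \<in> ?S" "t \<in> ?S" "t \<noteq> \<zero>" "a \<otimes> t = s" by auto
  have a: "a \<in> carrier R" using Fc m_inv by auto
  have "s \<noteq> \<zero>" using st a m_inv Sc by (auto simp: integral_iff)
  moreover have "inv a \<otimes> s = t"
   using st a Sc[OF st(2)] m_inv inv_mult[OF a] inv_closed_nonzero[OF a] by (auto simp: m_assoc[symmetric])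
  ultimately show ?case using st by auto
 next
  case (eng_add a b)
  then obtain s t s' t' where st: "s \<in> ?S" "t \<in> ?S" "t \<noteq> \<zero>" "a \<otimes> t = s"
   "s' \<in> ?S" "t' \<in> ?S" "t' \<noteq> \<zero>" "b \<otimes> t' = s'" by auto
  note c = Fc[OF eng_add(1)] Fc[OF eng_add(2)] Sc[OF st(2)] Sc[OF st(6)]
  have "(a \<oplus> b) \<otimes> (t \<otimes> t') = (a \<otimes> t) \<otimes> t' \<oplus> (b \<otimes> t') \<otimes> t" using c by (simp add: l_distr r_distr m_ac)
  hence "(a \<oplus> b) \<otimes> (t \<otimes> t') = s \<otimes> t' \<oplus> s' \<otimes> t" using st by simp
  moreover have "t \<otimes> t' \<noteq> \<zero>" using c st by (simp add: integral_iff)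
  ultimately show ?case using st by (intro bexI[of _ "s \<otimes> t' \<oplus> s' \<otimes> t"] bexI[of _ "t \<otimes> t'"])
   (auto intro: generate_ring.intros)
 next
  case (eng_mult a b)
  then obtain s t s' t' where st: "s \<in> ?S" "t \<in> ?S" "t \<noteq> \<zero>" "a \<otimes> t = s"
   "s' \<in> ?S" "t' \<in> ?S" "t' \<noteq> \<zero>" "b \<otimes> t' = s'" by auto
  note c = Fc[OF eng_mult(1)] Fc[OF eng_mult(2)] Sc[OF st(2)] Sc[OF st(6)]
  have "(a \<otimes> b) \<otimes> (t \<otimes> t') = (a \<otimes> t) \<otimes> (b \<otimes> t')" using c by (simp add: m_ac)
  hence "(a \<otimes> b) \<otimes> (t \<otimes> t') = s \<otimes> s'" using st by simp
  moreover have "t \<otimes> t' \<noteq> \<zero>" using c st by (simp add: integral_iff)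
  ultimately show ?case using st by (intro bexI[of _ "s \<otimes> s'"] bexI[of _ "t \<otimes> t'"])
   (auto intro: generate_ring.intros)
 qed
qed

lemma generate_field_finitary:
 assumes "a \<in> generate_field R H"
 shows "\<exists>Z. finite Z \<and> Z \<subseteq> H \<and> a \<in> generate_field R Z"
proof -
 have mono: "x \<in> generate_field R Z \<Longrightarrow> Z \<subseteq> Z' \<Longrightarrow> x \<in> generate_field R Z'" for x Z Z'
  by (induction rule: generate_field.induct) (auto intro: generate_field.intros)
 show ?thesis
  using assms
 proof induction
  case one
  show ?case by (intro exI[of _ "{}"]) (auto intro: generate_field.one)
 next
  case (incl a)
  thus ?case by (intro exI[of _ "{a}"]) (auto intro: generate_field.incl)
 next
  case (a_inv a)
  thus ?case by (metis generate_field.a_inv)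
 next
  case (m_inv a)
  thus ?case by (metis generate_field.m_inv)
 next
  case (eng_add a b)
  then obtain Z Z' where Z: "finite Z" "Z \<subseteq> H" "a \<in> generate_field R Z"
   "finite Z'" "Z' \<subseteq> H" "b \<in> generate_field R Z'" by auto
  thus ?case
   by (intro exI[of _ "Z \<union> Z'"]) (auto intro!: generate_field.eng_add intro: mono)
 next
  case (eng_mult a b)
  then obtain Z Z' where Z: "finite Z" "Z \<subseteq> H" "a \<in> generate_field R Z"
   "finite Z'" "Z' \<subseteq> H" "b \<in> generate_field R Z'" by auto
  thus ?case
   by (intro exI[of _ "Z \<union> Z'"]) (auto intro!: generate_field.eng_mult intro: mono)
 qed
qed

lemma generate_field_subset: "subfield M R \<Longrightarrow> H \<subseteq> M \<Longrightarrow> generate_field R H \<subseteq> M"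
 using generate_field_min_subfield1[of H M] subfieldE(3)[of M R] by (metis order_trans)

end

section \<open>Linear independence over the constants\<close>

context differential_field
begin

lemma derivation_d: "derivation K d"
 using differential_field_axioms by (simp add: differential_field_iff)

lemma constants_iff: "a \<in> constants K d \<longleftrightarrow> a \<in> carrier K \<and> d a = \<zero>"
 by (simp add: constants_def)

lemma constants_subfield: "subfield (constants K d) K"
proof (intro subfieldI' subringI)
 fix a b assume ab: "a \<in> constants K d" "b \<in> constants K d"
 thus "a \<otimes> b \<in> constants K d" "a \<oplus> b \<in> constants K d"
  by (auto simp: constants_iff d_add d_mult)
next
 fix a assume a: "a \<in> constants K d - {\<zero>}"
 hence c: "a \<in> carrier K" "d a = \<zero>" "a \<noteq> \<zero>" by (auto simp: constants_iff)
 note i = inv_closed_nonzero[OF c(1,3)]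
 have "d (inv a \<otimes> a) = \<zero>" using inv_mult[OF c(1,3)] derivation_one[OF derivation_d] by simp
 hence "d (inv a) \<otimes> a = \<zero>" using c i d_closed[OF i] by (simp add: d_mult)
 thus "inv a \<in> constants K d" using c i d_closed[OF i] by (simp add: constants_iff integral_iff)
qed (auto simp: constants_iff derivation_one[OF derivation_d] derivation_a_inv[OF derivation_d])

lemma d_finsum:
 "finite I \<Longrightarrow> f \<in> I \<rightarrow> carrier K \<Longrightarrow> d (\<Oplus>i\<in>I. f i) = (\<Oplus>i\<in>I. d (f i))"
proof (induction I rule: finite_induct)
 case (insert i I)
 hence "f i \<in> carrier K" "f \<in> I \<rightarrow> carrier K" by auto
 moreover have "(\<lambda>i. d (f i)) \<in> I \<rightarrow> carrier K" "d (f i) \<in> carrier K" using insert.prems d_closed by auto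
 ultimately show ?case using insert by (simp add: d_add)
qed (simp add: derivation_zero[OF derivation_d])

text \<open>Wronskian argument: divide by one of the coefficients and differentiate.\<close>

lemma independent_over_constants:
 assumes L: "subfield L K" "d ` L \<subseteq> L" and "finite I" "l \<in> I \<rightarrow> L" "c \<in> I \<rightarrow> constants K d"
  and indep: "\<And>g. g \<in> I \<rightarrow> L \<inter> constants K d \<Longrightarrow> (\<Oplus>i\<in>I. l i \<otimes> g i) = \<zero> \<Longrightarrow> \<forall>i\<in>I. g i = \<zero>"
  and rel: "(\<Oplus>i\<in>I. l i \<otimes> c i) = \<zero>"
 shows "\<forall>i\<in>I. c i = \<zero>"
 using assms(3-)
proof (induction I arbitrary: l rule: finite_induct)
 case (insert j I)
 note Lc = subfieldE(3)[OF L(1)]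
 have Lr: "subring L K" by (rule subfieldE(1)[OF L(1)])
 have LC: "subfield (L \<inter> constants K d) K"
  using L(1) constants_subfield subfield_m_inv(1)[OF L(1)] subfield_m_inv(1)[OF constants_subfield]
  by (intro subfieldI' subring_inter) (auto intro: subfieldE(1))
 have lj: "l j \<in> L" "l j \<in> carrier K" and l: "\<And>i. i \<in> I \<Longrightarrow> l i \<in> L" "\<And>i. i \<in> I \<Longrightarrow> l i \<in> carrier K"
  using insert.prems(1) Lc by auto
 have cj: "c j \<in> carrier K" "d (c j) = \<zero>" and c: "\<And>i. i \<in> I \<Longrightarrow> c i \<in> carrier K" "\<And>i. i \<in> I \<Longrightarrow> d (c i) = \<zero>"
  using insert.prems(2) by (auto simp: constants_iff Pi_iff)
 have ins: "(\<Oplus>i\<in>insert j I. f i) = f j \<oplus> (\<Oplus>i\<in>I. f i)" if "f \<in> insert j I \<rightarrow> carrier K" for f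
  using insert.hyps that by (subst finsum_insert) auto
 \<comment> \<open>If \<open>l j\<close> were zero, the coefficients with 1 at \<open>j\<close> and
   0 elsewhere would be a forbidden relation.\<close>
 have lj0: "l j \<noteq> \<zero>"
 proof
  assume 0: "l j = \<zero>"
  define g where "g i = (if i = j then \<one> else \<zero>)" for i
  have "g \<in> insert j I \<rightarrow> L \<inter> constants K d"
   using subringE(2,3)[OF subfieldE(1)[OF LC]] by (auto simp: g_def)
  moreover have "(\<Oplus>i\<in>insert j I. l i \<otimes> g i) = \<zero>"
  proof -
   have "(\<Oplus>i\<in>insert j I. l i \<otimes> g i) = (\<Oplus>i\<in>insert j I. \<zero>)"
    by (rule finsum_cong') (use 0 l in \<open>auto simp: g_def\<close>)
   thus ?thesis by simp
  qed
  ultimately have "\<forall>i\<in>insert j I. g i = \<zero>" by (rule insert.prems(3))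
  thus False by (auto simp: g_def)
 qed
 let ?v = "inv (l j)"
 have v: "?v \<in> L" "?v \<in> carrier K" "?v \<otimes> l j = \<one>"
  using subfield_m_inv(1)[OF L(1), of "l j"] lj lj0 Lc inv_mult by auto
 \<comment> \<open>After the division the coefficient of \<open>c j\<close> is 1, so differentiation
   removes \<open>c j\<close> and leaves a relation between the derivatives of the
   \<open>m i\<close> with the same constants.\<close>
 define m where "m i = l i \<otimes> ?v" for i
 have m: "m i \<in> L" "m i \<in> carrier K" if "i \<in> I" for i
  using l[OF that] v subringE(6)[OF Lr] by (auto simp: m_def)
 have dm: "d (m i) \<in> L" "d (m i) \<in> carrier K" if "i \<in> I" for i
  using L(2) m[OF that] d_closed by auto
 have "\<forall>i\<in>I. c i = \<zero>"
 proof (rule insert.IH[of "\<lambda>i. d (m i)"])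
  show "(\<lambda>i. d (m i)) \<in> I \<rightarrow> L" using dm by auto
  show "c \<in> I \<rightarrow> constants K d" using insert.prems by auto
  have s: "(\<Oplus>i\<in>I. m i \<otimes> c i) \<in> carrier K" using m c by (intro finsum_closed) auto
  have "\<zero> = (\<Oplus>i\<in>insert j I. l i \<otimes> c i) \<otimes> ?v" using insert.prems(4) v by simp
  also have "\<dots> = (\<Oplus>i\<in>insert j I. l i \<otimes> c i \<otimes> ?v)"
   by (rule finsum_ldistr) (use insert.hyps lj l cj c v in auto)
  also have "\<dots> = l j \<otimes> c j \<otimes> ?v \<oplus> (\<Oplus>i\<in>I. l i \<otimes> c i \<otimes> ?v)"
   by (rule ins) (use lj l cj c v in auto)
  also have "l j \<otimes> c j \<otimes> ?v = c j" using lj cj v by (metis m_assoc m_comm m_closed r_one)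
  also have "(\<Oplus>i\<in>I. l i \<otimes> c i \<otimes> ?v) = (\<Oplus>i\<in>I. m i \<otimes> c i)"
   by (rule finsum_cong') (use l c v m in \<open>auto simp: m_def m_ac\<close>)
  finally have "d (c j \<oplus> (\<Oplus>i\<in>I. m i \<otimes> c i)) = \<zero>"
   using derivation_zero[OF derivation_d] by simp
  hence "d (\<Oplus>i\<in>I. m i \<otimes> c i) = \<zero>"
   using cj s d_closed[OF s] by (simp add: d_add)
  also have "d (\<Oplus>i\<in>I. m i \<otimes> c i) = (\<Oplus>i\<in>I. d (m i \<otimes> c i))"
   using insert.hyps m c by (intro d_finsum) auto
  also have "\<dots> = (\<Oplus>i\<in>I. d (m i) \<otimes> c i)"
   by (rule finsum_cong') (use m c dm in \<open>auto simp: d_mult\<close>)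
  finally show "(\<Oplus>i\<in>I. d (m i) \<otimes> c i) = \<zero>" .
  fix g assume g: "g \<in> I \<rightarrow> L \<inter> constants K d" and g0: "(\<Oplus>i\<in>I. d (m i) \<otimes> g i) = \<zero>"
  have gc: "g i \<in> L" "g i \<in> carrier K" "d (g i) = \<zero>" if "i \<in> I" for i
   using g that by (auto simp: constants_iff Pi_iff)
  \<comment> \<open>A relation between the derivatives with coefficients \<open>g\<close> makes this
    sum a constant, and it lies in \<open>L\<close>. So its negative is an admissible coefficient
    for \<open>l j\<close>, and a relation between the \<open>l i\<close> results.\<close>
  let ?s = "\<Oplus>i\<in>I. m i \<otimes> g i"
  have sL: "?s \<in> L"
  proof -
   have "finite I \<Longrightarrow> I' \<subseteq> I \<Longrightarrow> (\<Oplus>i\<in>I'. m i \<otimes> g i) \<in> L" for I'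
   proof (induction I' rule: infinite_finite_induct)
    case (insert i I')
    hence "m i \<otimes> g i \<in> L" "(\<Oplus>i\<in>I'. m i \<otimes> g i) \<in> L"
     using subringE(6)[OF Lr] m gc by auto
    moreover have "(\<Oplus>i\<in>insert i I'. m i \<otimes> g i) = m i \<otimes> g i \<oplus> (\<Oplus>i\<in>I'. m i \<otimes> g i)"
     using insert m gc by (subst finsum_insert) auto
    ultimately show ?case using subringE(7)[OF Lr] by simp
   qed (use subringE(2)[OF Lr] finite_subset in auto)
   thus ?thesis using insert.hyps by auto
  qed
  have sc: "?s \<in> carrier K" using sL Lc by auto
  have "d ?s = (\<Oplus>i\<in>I. d (m i \<otimes> g i))"
   using insert.hyps m gc by (intro d_finsum) auto
  also have "\<dots> = (\<Oplus>i\<in>I. d (m i) \<otimes> g i)"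
   by (rule finsum_cong') (use m gc dm in \<open>auto simp: d_mult\<close>)
  finally have "d ?s = \<zero>" using g0 by simp
  define g' where "g' i = (if i = j then \<ominus> ?s else g i)" for i
  have g'I: "g' i = g i" if "i \<in> I" for i using that insert.hyps by (auto simp: g'_def)
  have "g' \<in> insert j I \<rightarrow> L \<inter> constants K d"
   using gc sL subringE(5)[OF Lr sL] sc \<open>d ?s = \<zero>\<close>
   by (auto simp: g'_def constants_iff derivation_a_inv[OF derivation_d])
  moreover have "(\<Oplus>i\<in>insert j I. l i \<otimes> g' i) = \<zero>"
  proof -
   have "(\<Oplus>i\<in>insert j I. l i \<otimes> g' i) = l j \<otimes> g' j \<oplus> (\<Oplus>i\<in>I. l i \<otimes> g' i)"
    by (rule ins) (use lj l gc sc in \<open>auto simp: g'_def\<close>)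
   also have "(\<Oplus>i\<in>I. l i \<otimes> g' i) = (\<Oplus>i\<in>I. l j \<otimes> (m i \<otimes> g i))"
   proof (rule finsum_cong')
    fix i assume i: "i \<in> I"
    have "l j \<otimes> (l i \<otimes> ?v \<otimes> g i) = (?v \<otimes> l j) \<otimes> (l i \<otimes> g i)"
     using l[OF i] gc[OF i] v(2) lj by (simp add: m_ac)
    thus "l i \<otimes> g' i = l j \<otimes> (m i \<otimes> g i)"
     using v(3) l[OF i] gc[OF i] by (simp add: g'I[OF i] m_def)
   qed (use lj m gc in auto)
   also have "\<dots> = l j \<otimes> ?s"
    by (rule finsum_rdistr[symmetric]) (use insert.hyps lj m gc in auto)
   also have "l j \<otimes> g' j \<oplus> l j \<otimes> ?s = \<zero>" using lj sc by (simp add: g'_def r_minus l_neg)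
   finally show ?thesis .
  qed
  ultimately have "\<forall>i\<in>insert j I. g' i = \<zero>" by (rule insert.prems(3))
  thus "\<forall>i\<in>I. g i = \<zero>" using g'I by auto
 qed
 moreover have "c j = \<zero>"
 proof -
  have "(\<Oplus>i\<in>insert j I. l i \<otimes> c i) = l j \<otimes> c j \<oplus> (\<Oplus>i\<in>I. l i \<otimes> c i)"
   by (rule ins) (use lj l cj c in auto)
  also have "(\<Oplus>i\<in>I. l i \<otimes> c i) = (\<Oplus>i\<in>I. \<zero>)"
   by (rule finsum_cong') (use \<open>\<forall>i\<in>I. c i = \<zero>\<close> l in auto)
  finally have "l j \<otimes> c j = \<zero>" using insert.prems(4) lj cj by simp
  thus ?thesis using lj cj lj0 by (simp add: integral_iff)
 qed
 ultimately show ?case by auto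
qed simp

end

context field
begin

text \<open>Dividing the relation by \<open>g j\<close> expresses \<open>l j\<close> through the
  other members, with coefficients \<open>e\<close>. The conclusion holds for all families
  \<open>z\<close> with the same \<open>e\<close>, so several coefficient families can be rewritten
  simultaneously.\<close>

lemma dependent_family_eliminate:
 assumes D: "subfield D R" and I: "finite I" "l \<in> I \<rightarrow> carrier R" "g \<in> I \<rightarrow> D"
  and rel: "(\<Oplus>i\<in>I. l i \<otimes> g i) = \<zero>" and j: "j \<in> I" "g j \<noteq> \<zero>"
 obtains e where "e \<in> I \<rightarrow> D"
  "\<And>z. z \<in> I \<rightarrow> carrier R \<Longrightarrow> (\<Oplus>i\<in>I - {j}. l i \<otimes> (z i \<oplus> e i \<otimes> z j)) = (\<Oplus>i\<in>I. l i \<otimes> z i)"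
proof -
 note Dr = subfieldE(1)[OF D] and Dc = subfieldE(3)[OF D]
 define I' where "I' = I - {j}"
 have I': "finite I'" "j \<notin> I'" "I = insert j I'" "I' \<subseteq> I" using I(1) j by (auto simp: I'_def)
 have lc: "l i \<in> carrier R" if "i \<in> I" for i using I(2) that by auto
 have gD: "g i \<in> D" "g i \<in> carrier R" if "i \<in> I" for i using I(3) that Dc by (auto simp: Pi_iff)
 let ?v = "inv (g j)"
 have v: "?v \<in> D" "?v \<in> carrier R" "g j \<otimes> ?v = \<one>"
  using subfield_m_inv(1)[OF D, of "g j"] gD[OF j(1)] j(2) Dc mult_inv by auto
 define e where "e i = \<ominus> (g i \<otimes> ?v)" for i
 have e: "e i \<in> D" "e i \<in> carrier R" if "i \<in> I" for i
  using gD[OF that] v subringE(5,6)[OF Dr] Dc by (auto simp: e_def)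
 have lj: "l j = (\<Oplus>i\<in>I'. l i \<otimes> e i)"
 proof -
  have "(\<Oplus>i\<in>I. l i \<otimes> g i) = l j \<otimes> g j \<oplus> (\<Oplus>i\<in>I'. l i \<otimes> g i)"
   unfolding I'(3) by (rule finsum_insert) (use I' lc gD in auto)
  hence 0: "l j \<otimes> g j \<oplus> (\<Oplus>i\<in>I'. l i \<otimes> g i) = \<zero>" using rel by simp
  have s: "(\<Oplus>i\<in>I'. l i \<otimes> g i) \<in> carrier R" using I' lc gD by (intro finsum_closed) auto
  have "l j \<otimes> g j = \<ominus> (\<Oplus>i\<in>I'. l i \<otimes> g i)"
   using 0 s lc[OF j(1)] gD[OF j(1)] by (intro sum_zero_eq_neg) auto
  hence "l j = \<ominus> (\<Oplus>i\<in>I'. l i \<otimes> g i) \<otimes> ?v"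
   using v lc[OF j(1)] gD[OF j(1)] by (metis m_assoc r_one)
  also have "\<dots> = (\<Oplus>i\<in>I'. l i \<otimes> g i) \<otimes> \<ominus> ?v" using s v by (simp add: l_minus r_minus)
  also have "\<dots> = (\<Oplus>i\<in>I'. l i \<otimes> g i \<otimes> \<ominus> ?v)"
   by (rule finsum_ldistr) (use I' lc gD v in auto)
  also have "\<dots> = (\<Oplus>i\<in>I'. l i \<otimes> e i)"
   by (rule finsum_cong') (use I' lc gD v e in \<open>auto simp: e_def r_minus m_assoc\<close>)
  finally show ?thesis .
 qed
 have red: "(\<Oplus>i\<in>I'. l i \<otimes> (z i \<oplus> e i \<otimes> z j)) = (\<Oplus>i\<in>I. l i \<otimes> z i)"
  if z: "z \<in> I \<rightarrow> carrier R" for z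
 proof -
  have zc: "z i \<in> carrier R" if "i \<in> I" for i using z that by auto
  have "(\<Oplus>i\<in>I'. l i \<otimes> (z i \<oplus> e i \<otimes> z j)) = (\<Oplus>i\<in>I'. l i \<otimes> z i \<oplus> l i \<otimes> e i \<otimes> z j)"
   by (rule finsum_cong') (use I' lc e zc j in \<open>auto simp: r_distr m_assoc\<close>)
  also have "\<dots> = (\<Oplus>i\<in>I'. l i \<otimes> z i) \<oplus> (\<Oplus>i\<in>I'. l i \<otimes> e i \<otimes> z j)"
   by (rule finsum_addf) (use I' lc e zc j in auto)
  also have "(\<Oplus>i\<in>I'. l i \<otimes> e i \<otimes> z j) = l j \<otimes> z j"
   unfolding lj by (rule finsum_ldistr[symmetric]) (use I' lc e zc j in auto)
  also have "(\<Oplus>i\<in>I'. l i \<otimes> z i) \<oplus> l j \<otimes> z j = l j \<otimes> z j \<oplus> (\<Oplus>i\<in>I'. l i \<otimes> z i)"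
   by (rule a_comm) (use I' lc zc j in \<open>auto intro!: finsum_closed\<close>)
  also have "\<dots> = (\<Oplus>i\<in>I. l i \<otimes> z i)"
   unfolding I'(3) by (rule finsum_insert[symmetric]) (use I' lc zc in auto)
  finally show ?thesis .
 qed
 show thesis by (rule that[of e]) (use e red in \<open>auto simp: I'_def\<close>)
qed

end

context differential_field
begin

text \<open>For an independent family, \<open>independent_over_constants\<close> splits the relation
  into \<open>a i = c b i\<close>, and some \<open>b i\<close> is nonzero. A dependent family is
  shortened; the elimination coefficients lie in \<open>D\<close>, so the new \<open>a\<close> and
  \<open>b\<close> do as well.\<close>

lemma constants_ratio:
 assumes L: "subfield L K" "d ` L \<subseteq> L" and D: "subfield D K" "D \<subseteq> constants K d" "L \<inter> constants K d \<subseteq> D"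
  and c: "c \<in> constants K d"
  and "finite I" "l \<in> I \<rightarrow> L" "a \<in> I \<rightarrow> D" "b \<in> I \<rightarrow> D"
  and "(\<Oplus>i\<in>I. l i \<otimes> (a i \<ominus> c \<otimes> b i)) = \<zero>" "(\<Oplus>i\<in>I. l i \<otimes> b i) \<noteq> \<zero>"
 shows "c \<in> D"
 using assms(7-)
proof (induction "card I" arbitrary: I a b rule: less_induct)
 case less
 note Lc = subfieldE(3)[OF L(1)] and Dc = subfieldE(3)[OF D(1)]
 note Dr = subfieldE(1)[OF D(1)] and Lr = subfieldE(1)[OF L(1)]
 have cc: "c \<in> carrier K" using c by (simp add: constants_iff)
 have lc: "l i \<in> carrier K" "a i \<in> carrier K" "b i \<in> carrier K" if "i \<in> I" for i
  using less.prems(2-4) that Lc Dc by (auto simp: Pi_iff)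
 show ?case
 proof (cases "\<forall>g \<in> I \<rightarrow> L \<inter> constants K d. (\<Oplus>i\<in>I. l i \<otimes> g i) = \<zero> \<longrightarrow> (\<forall>i\<in>I. g i = \<zero>)")
  case True
  have CK: "subring (constants K d) K" by (rule subfieldE(1)[OF constants_subfield])
  have "\<forall>i\<in>I. a i \<ominus> c \<otimes> b i = \<zero>"
  proof (rule independent_over_constants[OF L less.prems(1,2)])
   show "(\<lambda>i. a i \<ominus> c \<otimes> b i) \<in> I \<rightarrow> constants K d"
    using less.prems(3,4) D(2) c unfolding a_minus_def
    by (auto simp: Pi_iff intro!: subringE(5,6,7)[OF CK])
  qed (use True less.prems in auto)
  hence e: "a i = c \<otimes> b i" if "i \<in> I" for i
   using that lc[OF that] cc by (metis m_closed r_right_minus_eq)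
  have "\<exists>i\<in>I. b i \<noteq> \<zero>"
  proof (rule ccontr)
   assume "\<not> (\<exists>i\<in>I. b i \<noteq> \<zero>)"
   hence "(\<Oplus>i\<in>I. l i \<otimes> b i) = (\<Oplus>i\<in>I. \<zero>)"
    using lc by (intro finsum_cong') auto
   thus False using less.prems(6) by simp
  qed
  then obtain i where i: "i \<in> I" "b i \<noteq> \<zero>" by auto
  have "c = a i \<otimes> inv (b i)" using e[OF i(1)] lc[OF i(1)] i(2) cc mult_inv inv_closed_nonzero by (simp add: m_assoc)
  also have "\<dots> \<in> D"
   using less.prems(3,4) i subfield_m_inv(1)[OF D(1), of "b i"] by (intro subringE(6)[OF Dr]) auto
  finally show ?thesis .
 next
  case False
  then obtain g j where g: "g \<in> I \<rightarrow> L \<inter> constants K d" "(\<Oplus>i\<in>I. l i \<otimes> g i) = \<zero>"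
   and j: "j \<in> I" "g j \<noteq> \<zero>" by auto
  have "g \<in> I \<rightarrow> D" using g(1) D(3) by auto
  moreover have "l \<in> I \<rightarrow> carrier K" using lc by auto
  ultimately obtain e where e: "e \<in> I \<rightarrow> D"
   and red: "\<And>z. z \<in> I \<rightarrow> carrier K \<Longrightarrow> (\<Oplus>i\<in>I - {j}. l i \<otimes> (z i \<oplus> e i \<otimes> z j)) = (\<Oplus>i\<in>I. l i \<otimes> z i)"
   using dependent_family_eliminate[OF D(1) less.prems(1) _ _ g(2) j, of thesis] that by simp
  have ec: "e i \<in> carrier K" if "i \<in> I" for i using e that Dc by auto
  show ?thesis
  proof (rule less.hyps[of "I - {j}" "\<lambda>i. a i \<oplus> e i \<otimes> a j" "\<lambda>i. b i \<oplus> e i \<otimes> b j"])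
   show "card (I - {j}) < card I" using j(1) less.prems(1) by (metis card_Diff1_less)
   show "(\<lambda>i. a i \<oplus> e i \<otimes> a j) \<in> I - {j} \<rightarrow> D" "(\<lambda>i. b i \<oplus> e i \<otimes> b j) \<in> I - {j} \<rightarrow> D"
    using less.prems(3,4) e j by (auto simp: Pi_iff intro!: subringE(6,7)[OF Dr])
   show "(\<Oplus>i\<in>I - {j}. l i \<otimes> (b i \<oplus> e i \<otimes> b j)) \<noteq> \<zero>"
    using red[of b] lc less.prems(6) by simp
   have "(\<Oplus>i\<in>I - {j}. l i \<otimes> (a i \<oplus> e i \<otimes> a j \<ominus> c \<otimes> (b i \<oplus> e i \<otimes> b j)))
    = (\<Oplus>i\<in>I - {j}. l i \<otimes> (a i \<ominus> c \<otimes> b i \<oplus> e i \<otimes> (a j \<ominus> c \<otimes> b j)))"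
   proof (rule finsum_cong')
    fix i assume "i \<in> I - {j}"
    hence i: "i \<in> I" by auto
    have "a i \<oplus> e i \<otimes> a j \<ominus> c \<otimes> (b i \<oplus> e i \<otimes> b j) = a i \<ominus> c \<otimes> b i \<oplus> e i \<otimes> (a j \<ominus> c \<otimes> b j)"
     using lc[OF i] lc[OF j(1)] ec[OF i] cc by algebra
    thus "l i \<otimes> (a i \<oplus> e i \<otimes> a j \<ominus> c \<otimes> (b i \<oplus> e i \<otimes> b j))
     = l i \<otimes> (a i \<ominus> c \<otimes> b i \<oplus> e i \<otimes> (a j \<ominus> c \<otimes> b j))" by simp
   qed (use lc ec cc j in auto)
   also have "\<dots> = \<zero>"
    using red[of "\<lambda>i. a i \<ominus> c \<otimes> b i"] lc cc less.prems(5) by simp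
   finally show "(\<Oplus>i\<in>I - {j}. l i \<otimes> (a i \<oplus> e i \<otimes> a j \<ominus> c \<otimes> (b i \<oplus> e i \<otimes> b j))) = \<zero>" .
  qed (use less.prems in auto)
 qed
qed

text \<open>An element of the compositum is a quotient of two sums of products from \<open>L\<close>
  and \<open>D\<close>; over a common family \<open>l\<close> this is the situation of
  \<open>constants_ratio\<close>.\<close>

lemma constants_compositum:
 assumes L: "subfield L K" "d ` L \<subseteq> L" and D: "subfield D K" "D \<subseteq> constants K d" "L \<inter> constants K d \<subseteq> D"
  and c: "c \<in> constants K d" "c \<in> generate_field K (L \<union> D)"
 shows "c \<in> D"
proof -
 note Lc = subfieldE(3)[OF L(1)] and Dc = subfieldE(3)[OF D(1)]
 note Dr = subfieldE(1)[OF D(1)] and Lr = subfieldE(1)[OF L(1)]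
 have cc: "c \<in> carrier K" using c by (simp add: constants_iff)
 have LD: "L \<times> D \<subseteq> carrier K \<times> carrier K" using Lc Dc by auto
 obtain s t where st: "s \<in> generate_ring K (L \<union> D)" "t \<in> generate_ring K (L \<union> D)" "t \<noteq> \<zero>" "c \<otimes> t = s"
  using generate_field_fraction[OF _ c(2)] Lc Dc by auto
 obtain xs ys where xs: "set xs \<subseteq> L \<times> D" "s = lcomb xs" and ys: "set ys \<subseteq> L \<times> D" "t = lcomb ys"
  using generate_ring_lcomb[OF Lr Dr st(1)] generate_ring_lcomb[OF Lr Dr st(2)] by auto
 \<comment> \<open>Numerator and denominator over the same elements of \<open>L\<close>: the terms
   of each are padded by the coefficient 0 in the place of the other.\<close>
 define zs where "zs = map (\<lambda>z. (fst z, snd z, \<zero>)) xs @ map (\<lambda>z. (fst z, \<zero>, snd z)) ys"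
 have zs: "set zs \<subseteq> L \<times> D \<times> D"
  using xs(1) ys(1) subringE(2)[OF Dr] unfolding zs_def by auto
 let ?I = "{..<length zs}" and ?l = "\<lambda>i. fst (zs ! i)" and ?a = "\<lambda>i. fst (snd (zs ! i))"
  and ?b = "\<lambda>i. snd (snd (zs ! i))"
 have mem: "?l i \<in> L" "?a i \<in> D" "?b i \<in> D" if "i < length zs" for i
  using nth_mem[OF that] zs by auto
 hence memc: "?l i \<in> carrier K" "?a i \<in> carrier K" "?b i \<in> carrier K" if "i < length zs" for i
  using that Lc Dc by auto
 have zero: "lcomb (map (\<lambda>z. (fst z, \<zero>)) ws) = \<zero>" if "set ws \<subseteq> L \<times> D" for ws
  using that Lc by (induction ws) auto
 have A: "(\<Oplus>i\<in>?I. ?l i \<otimes> ?a i) = s"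
 proof -
  have "set (map (\<lambda>z. (fst z, fst (snd z))) zs) \<subseteq> carrier K \<times> carrier K" using zs Lc Dc by auto
  from lcomb_finsum[OF this] have "(\<Oplus>i\<in>?I. ?l i \<otimes> ?a i) = lcomb (map (\<lambda>z. (fst z, fst (snd z))) zs)"
   using memc by (auto intro!: finsum_cong')
  also have "map (\<lambda>z. (fst z, fst (snd z))) zs = xs @ map (\<lambda>z. (fst z, \<zero>)) ys"
   by (simp add: zs_def o_def)
  also have "lcomb \<dots> = lcomb xs \<oplus> lcomb (map (\<lambda>z. (fst z, \<zero>)) ys)"
   using xs(1) ys(1) LD Lc by (intro lcomb_append) auto
  also have "\<dots> = s" using zero[OF ys(1)] xs LD lcomb_closed[of xs] by simp
  finally show ?thesis .
 qed
 have B: "(\<Oplus>i\<in>?I. ?l i \<otimes> ?b i) = t"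
 proof -
  have "set (map (\<lambda>z. (fst z, snd (snd z))) zs) \<subseteq> carrier K \<times> carrier K" using zs Lc Dc by auto
  from lcomb_finsum[OF this] have "(\<Oplus>i\<in>?I. ?l i \<otimes> ?b i) = lcomb (map (\<lambda>z. (fst z, snd (snd z))) zs)"
   using memc by (auto intro!: finsum_cong')
  also have "map (\<lambda>z. (fst z, snd (snd z))) zs = map (\<lambda>z. (fst z, \<zero>)) xs @ ys"
   by (simp add: zs_def o_def)
  also have "lcomb \<dots> = lcomb (map (\<lambda>z. (fst z, \<zero>)) xs) \<oplus> lcomb ys"
   using xs(1) ys(1) LD Lc by (intro lcomb_append) auto
  also have "\<dots> = t" using zero[OF xs(1)] ys LD lcomb_closed[of ys] by simp
  finally show ?thesis .
 qed
 have tc: "t \<in> carrier K" "s \<in> carrier K"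
  using generate_ring_in_carrier[of "L \<union> D"] st Lc Dc by auto
 have "(\<Oplus>i\<in>?I. ?l i \<otimes> (?a i \<ominus> c \<otimes> ?b i)) = (\<Oplus>i\<in>?I. ?l i \<otimes> ?a i \<oplus> \<ominus> c \<otimes> (?l i \<otimes> ?b i))"
 proof (rule finsum_cong')
  fix i assume "i \<in> ?I"
  hence "?l i \<in> carrier K" "?a i \<in> carrier K" "?b i \<in> carrier K" using memc by auto
  thus "?l i \<otimes> (?a i \<ominus> c \<otimes> ?b i) = ?l i \<otimes> ?a i \<oplus> \<ominus> c \<otimes> (?l i \<otimes> ?b i)"
   using cc by algebra
 qed (use memc cc in auto)
 also have "\<dots> = (\<Oplus>i\<in>?I. ?l i \<otimes> ?a i) \<oplus> (\<Oplus>i\<in>?I. \<ominus> c \<otimes> (?l i \<otimes> ?b i))"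
  by (rule finsum_addf) (use memc cc in auto)
 also have "(\<Oplus>i\<in>?I. \<ominus> c \<otimes> (?l i \<otimes> ?b i)) = \<ominus> c \<otimes> (\<Oplus>i\<in>?I. ?l i \<otimes> ?b i)"
  by (rule finsum_rdistr[symmetric]) (use memc cc in auto)
 also have "(\<Oplus>i\<in>?I. ?l i \<otimes> ?a i) \<oplus> \<ominus> c \<otimes> (\<Oplus>i\<in>?I. ?l i \<otimes> ?b i) = \<zero>"
  unfolding A B using cc tc st(4) by (simp add: l_minus r_neg)
 finally show ?thesis
  by (rule constants_ratio[OF L D c(1), of ?I ?l ?a ?b, rotated 4]) (use mem B st(3) in auto)
qed

end

section \<open>Intermediate fields of finitely generated extensions\<close>

context field
begin

lemma generate_ring_simple:
 assumes S: "subring S R" and x: "x \<in> carrier R"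
 shows "generate_ring R (insert x S) = simple_extension S x"
proof (rule antisym)
 have Sc: "S \<subseteq> carrier R" by (rule subringE(1)[OF S])
 show "generate_ring R (insert x S) \<subseteq> simple_extension S x"
  using simple_extension_is_subring[OF S x] simple_extension_mem[OF S x] simple_extension_incl[OF Sc x] Sc x
  by (intro generate_ring_min_subring1) auto
 show "simple_extension S x \<subseteq> generate_ring R (insert x S)"
  by (rule simple_extension_subring_incl[OF generate_ring_is_subring])
   (use Sc x in \<open>auto intro: generate_ring.incl\<close>)
qed

text \<open>If \<open>x\<close> is transcendental over \<open>M\<close>, then \<open>M = K0\<close>
  by comparison of leading coefficients. Otherwise \<open>M\<close> is generated over
  \<open>K0\<close> by the coefficients of the minimal polynomial of \<open>x\<close> over
  \<open>M\<close>.\<close>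

lemma intermediate_simple:
 assumes M: "subfield M R" and K0: "subfield K0 R" "K0 \<subseteq> M"
  and x: "x \<in> carrier R" and sub: "M \<subseteq> generate_field R (insert x K0)"
 shows "\<exists>Y. finite Y \<and> Y \<subseteq> M \<and> M \<subseteq> generate_field R (K0 \<union> Y)"
proof (cases "(transcendental over M) x")
 case True
 note Mr = subfieldE(1)[OF M] and Kr = subfieldE(1)[OF K0(1)]
 have "M \<subseteq> K0"
 proof
  fix m assume m: "m \<in> M"
  have mc: "m \<in> carrier R" using m subringE(1)[OF Mr] by auto
  show "m \<in> K0"
  proof (cases "m = \<zero>")
   case True thus ?thesis using subringE(2)[OF Kr] by simp
  next
   case False
   have "m \<in> generate_field R (insert x K0)" using sub m by auto
   then obtain s t where st: "s \<in> simple_extension K0 x" "t \<in> simple_extension K0 x" "t \<noteq> \<zero>" "m \<otimes> t = s"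
    using generate_field_fraction[of "insert x K0" m] subringE(1)[OF Kr] x
    unfolding generate_ring_simple[OF Kr x] by auto
   obtain p q where p: "p \<in> carrier (K0[X])" "eval p x = s" and q: "q \<in> carrier (K0[X])" "eval q x = t"
    using st(1,2) unfolding simple_extension_as_eval_img[OF subringE(1)[OF Kr] x] by auto
   have KM: "carrier (K0[X]) \<subseteq> carrier (M[X])"
    using K0(2) by (auto simp: univ_poly_carrier[symmetric] polynomial_def subset_iff)
   have mP: "[m] \<in> carrier (M[X])" using m False by (simp add: univ_poly_carrier[symmetric] polynomial_def)
   have "q \<noteq> []" using q st(3) by auto
   have mq: "poly_mult [m] q = map (\<lambda>b. m \<otimes> b) q"
    by (rule poly_mult_const(1)[OF Mr]) (use q KM m False in \<open>auto simp: univ_poly_carrier\<close>)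
   have mqM: "poly_mult [m] q \<in> carrier (M[X])"
    using ring.ring_simprules(5)[OF univ_poly_is_ring[OF Mr] mP, of q] q KM by (auto simp: univ_poly_mult)
   have "eval (poly_mult [m] q) x = eval [m] x \<otimes> eval q x"
    by (rule eval_poly_mult) (use mc q polynomial_in_carrier[OF Kr] x in \<open>auto simp: univ_poly_carrier[symmetric]\<close>)
   hence "eval (poly_mult [m] q) x = eval p x" using mc st q p by simp
   \<comment> \<open>An equality of polynomials over \<open>M\<close>, because \<open>x\<close> is
     transcendental over \<open>M\<close> and not merely over \<open>K0\<close>. The leading
     coefficients then give \<open>m\<close> as a quotient of elements of \<open>K0\<close>.\<close>
   hence "poly_mult [m] q = p"
    using True mqM p KM unfolding transcendental_def over_def inj_on_def by auto
   hence "m \<otimes> hd q = hd p" "p \<noteq> []" using mq \<open>q \<noteq> []\<close> by (auto simp: hd_map)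
   moreover have "hd q \<in> K0 - {\<zero>}" "hd p \<in> K0"
    using p(1) q(1) \<open>q \<noteq> []\<close> \<open>p \<noteq> []\<close> hd_in_set
    by (auto simp: univ_poly_carrier[symmetric] polynomial_def)
   ultimately have "m = hd p \<otimes> inv (hd q)" "inv (hd q) \<in> K0"
    using mc subringE(1)[OF Kr] subfield_m_inv(1)[OF K0(1), of "hd q"] mult_inv[of "hd q"]
    by (auto simp: m_assoc subset_iff) (metis m_assoc r_one)
   thus ?thesis using subringE(6)[OF Kr] \<open>hd p \<in> K0\<close> by auto
  qed
 qed
 thus ?thesis using subfieldE(3)[OF K0(1)]
  by (intro exI[of _ "{}"]) (auto intro: generate_field.incl)
next
 case False
 hence alg: "(algebraic over M) x" by (simp add: over_def)
 note Mr = subfieldE(1)[OF M] and Kr = subfieldE(1)[OF K0(1)] and Mc = subfieldE(3)[OF M] and Kc = subfieldE(3)[OF K0(1)]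
 define p where "p = Irr M x"
 have p: "p \<in> carrier (M[X])" "p \<noteq> []" "eval p x = \<zero>"
  using IrrE[OF M x alg] univ_poly_zero pirreducibleE(1)[OF Mr] unfolding p_def by (auto simp: pirreducibleE(1)[OF Mr])
 have pset: "set p \<subseteq> M" using p(1) by (auto simp: univ_poly_carrier[symmetric] polynomial_def)
 \<comment> \<open>Since \<open>p\<close> has coefficients in \<open>N\<close>, division by
   \<open>p\<close> writes every \<open>m\<close> in \<open>M\<close> as \<open>r(x)\<close> with
   \<open>r\<close> over \<open>N\<close> of smaller degree than \<open>p\<close>. Then
   \<open>r - m\<close> is a polynomial over \<open>M\<close> whose degree is too small for it to
   vanish at \<open>x\<close> unless it is zero, so \<open>m\<close> is the constant coefficient of
   \<open>r\<close>.\<close>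
 define N where "N = generate_field R (K0 \<union> set p)"
 have N: "subfield N R" unfolding N_def using Kc pset Mc by (intro generate_field_is_subfield) auto
 have NM: "N \<subseteq> M" unfolding N_def using K0(2) pset by (intro generate_field_subset M) auto
 note Nr = subfieldE(1)[OF N]
 have KN: "K0 \<subseteq> N" "set p \<subseteq> N" unfolding N_def by (auto intro: generate_field.incl)
 have pN: "p \<in> carrier (N[X])"
  using p(1,2) KN by (auto simp: univ_poly_carrier[symmetric] polynomial_def)
 have algN: "(algebraic over N) x" by (rule algebraicI[OF pN p(2,3)])
 have "M \<subseteq> N"
 proof
  fix m assume m: "m \<in> M"
  have mc: "m \<in> carrier R" using m Mc by auto
  have "subfield (simple_extension N x) R" using simple_extension_is_subfield[OF N x] algN by simp
  hence "generate_field R (insert x K0) \<subseteq> simple_extension N x"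
   using simple_extension_mem[OF Nr x] simple_extension_incl[OF subringE(1)[OF Nr] x] KN
   by (intro generate_field_subset) auto
  then obtain q where q: "q \<in> carrier (N[X])" "eval q x = m"
   using sub m unfolding simple_extension_as_eval_img[OF subringE(1)[OF Nr] x] by auto
  obtain b r where br: "b \<in> carrier (N[X])" "r \<in> carrier (N[X])" "q = (p \<otimes>\<^bsub>N[X]\<^esub> b) \<oplus>\<^bsub>N[X]\<^esub> r" "r = [] \<or> degree r < degree p"
   using subfield_long_division_theorem_shell[OF N q(1) pN] p(2) by (auto simp: univ_poly_zero)
  have "eval q x = eval p x \<otimes> eval b x \<oplus> eval r x"
   unfolding br(3) using eval_is_hom[OF Nr x] pN br(1,2) ring.ring_simprules(5)[OF univ_poly_is_ring[OF Nr] pN br(1)]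
   by (simp add: ring_hom_def)
  hence rm: "eval r x = m"
   using q(2) p(3) br(1,2) x eval_poly_in_carrier[OF Nr] by (simp add: univ_poly_carrier)
  show "m \<in> N"
  proof (cases "r = []")
   case True
   thus ?thesis using rm subringE(2)[OF Nr] by simp
  next
   case False
   hence deg: "degree r < degree p" using br(4) by auto
   have rs: "set r \<subseteq> N" using br(2) by (auto simp: univ_poly_carrier[symmetric] polynomial_def)
   obtain r' r0 where r: "r = r' @ [r0]" using False by (metis rev_exhaust)
   let ?u = "r' @ [r0 \<ominus> m]"
   have rc: "set r' \<subseteq> carrier R" "r0 \<in> carrier R" "r0 \<in> N" using rs r subringE(1)[OF Nr] by auto
   have um: "set ?u \<subseteq> M" using rs r NM m subringE(5,7)[OF Mr] unfolding a_minus_def by auto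
   have "eval ?u x = eval r' x \<otimes> x \<oplus> (r0 \<ominus> m)"
    by (rule eval_append_aux) (use rc mc x in auto)
   also have "\<dots> = (eval r' x \<otimes> x \<oplus> r0) \<ominus> m"
    using rc mc x eval_in_carrier[OF rc(1) x] by (simp add: a_minus_def a_assoc)
   also have "eval r' x \<otimes> x \<oplus> r0 = m"
    using rm eval_append_aux[OF rc(1,2) x] r by simp
   finally have u0: "eval ?u x = \<zero>" using mc by (simp add: a_minus_def r_neg)
   let ?w = "normalize ?u"
   have w: "?w \<in> carrier (M[X])" using normalize_gives_polynomial[OF um] by (simp add: univ_poly_carrier)
   have w0: "eval ?w x = \<zero>" using eval_normalize[of ?u x] um Mc x u0 by auto
   have "?w = []"
   proof (rule ccontr)
    assume "?w \<noteq> []"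
    have "Irr M x pdivides ?w" by (rule Irr_minimal[OF M x alg w w0])
    hence "degree p \<le> degree ?w"
     using pdivides_imp_degree_le[OF Mr p(1) w \<open>?w \<noteq> []\<close>] unfolding p_def by auto
    moreover have "length ?w \<le> length ?u" by (rule normalize_length_le)
    ultimately show False using deg r by auto
   qed
   hence "coeff ?u = coeff []" using normalize_coeff[of ?u] by simp
   hence "coeff ?u 0 = \<zero>" by simp
   hence "r0 \<ominus> m = \<zero>" using coeff_nth[of 0 ?u] by (simp add: nth_append)
   thus ?thesis using rc mc by (metis r_right_minus_eq)
  qed
 qed
 thus ?thesis using pset unfolding N_def by (intro exI[of _ "set p"]) auto
qed

text \<open>One generator \<open>x\<close> is adjoined to both fields: \<open>M(x)\<close> over
  \<open>K0(x)\<close> is covered by induction, the generators obtained involve finitely many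
  elements \<open>Y\<close> of \<open>M\<close>, and \<open>M\<close> lies between
  \<open>K0(Y)\<close> and \<open>K0(Y)(x)\<close>, which is the simple case.\<close>

theorem intermediate_field_finitely_generated:
 assumes "finite X" "subfield K0 R" "X \<subseteq> carrier R" "subfield M R" "K0 \<subseteq> M"
  "M \<subseteq> generate_field R (K0 \<union> X)"
 shows "\<exists>Y. finite Y \<and> Y \<subseteq> M \<and> M \<subseteq> generate_field R (K0 \<union> Y)"
 using assms
proof (induction X arbitrary: K0 M rule: finite_induct)
 case empty
 thus ?case by (intro exI[of _ "{}"]) auto
next
 case (insert x X)
 note K0 = insert.prems(1) and M = insert.prems(3)
 note Kc = subfieldE(3)[OF K0] and Mc = subfieldE(3)[OF M]
 have x: "x \<in> carrier R" "X \<subseteq> carrier R" using insert.prems(2) by auto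
 define K\<^sub>1 M\<^sub>1 where "K\<^sub>1 = generate_field R (insert x K0)" and "M\<^sub>1 = generate_field R (insert x M)"
 have K\<^sub>1: "subfield K\<^sub>1 R" unfolding K\<^sub>1_def using Kc x by (intro generate_field_is_subfield) auto
 have M\<^sub>1: "subfield M\<^sub>1 R" unfolding M\<^sub>1_def using Mc x by (intro generate_field_is_subfield) auto
 note K1c = subfieldE(3)[OF K\<^sub>1]
 have gf: "subfield (generate_field R (K\<^sub>1 \<union> X)) R"
  using K1c x by (intro generate_field_is_subfield) auto
 have K1i: "insert x K0 \<subseteq> K\<^sub>1" unfolding K\<^sub>1_def by (auto intro: generate_field.incl)
 hence "K0 \<union> insert x X \<subseteq> generate_field R (K\<^sub>1 \<union> X)" by (auto intro: generate_field.incl)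
 hence "M \<subseteq> generate_field R (K\<^sub>1 \<union> X)"
  using generate_field_subset[OF gf] insert.prems(5) by blast
 hence "M\<^sub>1 \<subseteq> generate_field R (K\<^sub>1 \<union> X)"
  unfolding M\<^sub>1_def using K1i by (intro generate_field_subset[OF gf]) (auto intro: generate_field.incl)
 moreover have "K\<^sub>1 \<subseteq> M\<^sub>1"
  unfolding K\<^sub>1_def using M\<^sub>1 insert.prems(4) by (intro generate_field_subset) (auto simp: M\<^sub>1_def intro: generate_field.incl)
 ultimately obtain Y' where Y': "finite Y'" "Y' \<subseteq> M\<^sub>1" "M\<^sub>1 \<subseteq> generate_field R (K\<^sub>1 \<union> Y')"
  using insert.IH[OF K\<^sub>1 x(2) M\<^sub>1] by auto
 have "\<forall>y\<in>Y'. \<exists>Z. finite Z \<and> Z \<subseteq> insert x M \<and> y \<in> generate_field R Z"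
  using Y'(2) generate_field_finitary unfolding M\<^sub>1_def by blast
 then obtain Z where Z: "\<And>y. y \<in> Y' \<Longrightarrow> finite (Z y)" "\<And>y. y \<in> Y' \<Longrightarrow> Z y \<subseteq> insert x M"
  "\<And>y. y \<in> Y' \<Longrightarrow> y \<in> generate_field R (Z y)" by metis
 \<comment> \<open>The generators in \<open>Y'\<close> lie in \<open>M(x)\<close>; collected are
   their finitely many ingredients from \<open>M\<close>.\<close>
 define Y where "Y = (\<Union>y\<in>Y'. Z y) \<inter> M"
 have Y: "finite Y" "Y \<subseteq> M" using Y'(1) Z(1) by (auto simp: Y_def)
 define M\<^sub>0 where "M\<^sub>0 = generate_field R (K0 \<union> Y)"
 have M\<^sub>0: "subfield M\<^sub>0 R" unfolding M\<^sub>0_def using Kc Y Mc by (intro generate_field_is_subfield) auto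
 have M0M: "M\<^sub>0 \<subseteq> M" unfolding M\<^sub>0_def using Y insert.prems(4) by (intro generate_field_subset M) auto
 have M0i: "K0 \<union> Y \<subseteq> M\<^sub>0" unfolding M\<^sub>0_def by (auto intro: generate_field.incl)
 have M0x: "subfield (generate_field R (insert x M\<^sub>0)) R"
  using subfieldE(3)[OF M\<^sub>0] x by (intro generate_field_is_subfield) auto
 have "Y' \<subseteq> generate_field R (insert x M\<^sub>0)"
 proof
  fix y assume y: "y \<in> Y'"
  have "Z y \<subseteq> insert x M\<^sub>0" using Z(2)[OF y] y M0i by (auto simp: Y_def)
  hence "Z y \<subseteq> generate_field R (insert x M\<^sub>0)" by (auto intro: generate_field.incl)
  from generate_field_subset[OF M0x this] show "y \<in> generate_field R (insert x M\<^sub>0)" using Z(3)[OF y] by auto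
 qed
 moreover have "K\<^sub>1 \<subseteq> generate_field R (insert x M\<^sub>0)"
  unfolding K\<^sub>1_def using M0i by (intro generate_field_subset[OF M0x]) (auto intro: generate_field.incl)
 ultimately have "generate_field R (K\<^sub>1 \<union> Y') \<subseteq> generate_field R (insert x M\<^sub>0)"
  by (intro generate_field_subset[OF M0x]) auto
 moreover have "M \<subseteq> M\<^sub>1" unfolding M\<^sub>1_def by (auto intro: generate_field.incl)
 ultimately have "M \<subseteq> generate_field R (insert x M\<^sub>0)" using Y'(3) by auto
 from intermediate_simple[OF M M\<^sub>0 M0M x(1) this] obtain Y2
  where Y2: "finite Y2" "Y2 \<subseteq> M" "M \<subseteq> generate_field R (M\<^sub>0 \<union> Y2)" by auto
 have fin: "subfield (generate_field R (K0 \<union> (Y \<union> Y2))) R"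
  using Kc Y Y2 Mc by (intro generate_field_is_subfield) auto
 have "M\<^sub>0 \<subseteq> generate_field R (K0 \<union> (Y \<union> Y2))"
  unfolding M\<^sub>0_def by (intro generate_field_subset[OF fin]) (auto intro: generate_field.incl)
 hence "generate_field R (M\<^sub>0 \<union> Y2) \<subseteq> generate_field R (K0 \<union> (Y \<union> Y2))"
  by (intro generate_field_subset[OF fin]) (auto intro: generate_field.incl)
 thus ?case using Y Y2 by (intro exI[of _ "Y \<union> Y2"]) auto
qed

end

section \<open>Extending ideals to finitely generated algebras\<close>

context field
begin

lemma simple_extension_add:
 assumes x: "x \<in> carrier R" and P: "P \<subseteq> carrier R" "\<zero> \<in> P" "\<And>a b. a \<in> P \<Longrightarrow> b \<in> P \<Longrightarrow> a \<oplus> b \<in> P"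
  and "a \<in> simple_extension P x" "b \<in> simple_extension P x"
 shows "a \<oplus> b \<in> simple_extension P x"
 using assms(5,6)
proof (induction a arbitrary: b rule: simple_extension.induct)
 case zero
 thus ?case using simple_extension_in_carrier[OF P(1) x] by auto
next
 case (lin k1 k2)
 note c = subsetD[OF simple_extension_in_carrier[OF P(1) x]]
 from lin.prems show ?case
 proof (cases rule: simple_extension.cases)
  case zero
  thus ?thesis using lin.hyps c[OF lin.hyps(1)] P(1) x simple_extension.lin[OF lin.hyps] by auto
 next
  case (lin l1 l2)
  have "k1 \<otimes> x \<oplus> k2 \<oplus> (l1 \<otimes> x \<oplus> l2) = (k1 \<oplus> l1) \<otimes> x \<oplus> (k2 \<oplus> l2)"
   using c[OF \<open>k1 \<in> _\<close>] c[OF lin(2)] \<open>k2 \<in> P\<close> lin(3) P(1) x by (simp add: l_distr a_ac subset_iff)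
  thus ?thesis
   using simple_extension.lin[of "k1 \<oplus> l1" P x "k2 \<oplus> l2"] lin \<open>k2 \<in> P\<close> P(3) \<open>\<And>b. b \<in> _ \<Longrightarrow> k1 \<oplus> b \<in> _\<close>
   by simp
 qed
qed

text \<open>\<open>simple_extension P x\<close> is the set of values at \<open>x\<close> of
  polynomials with coefficients in \<open>P\<close>. Together with
  \<open>simple_extension_add\<close> this makes it the extension of the ideal \<open>P\<close> to
  \<open>S[x]\<close>.\<close>

lemma simple_extension_absorb:
 assumes S: "subring S R" and x: "x \<in> carrier R" and P: "P \<subseteq> S" "\<zero> \<in> P"
  "\<And>a b. a \<in> P \<Longrightarrow> b \<in> P \<Longrightarrow> a \<oplus> b \<in> P" "\<And>a s. a \<in> P \<Longrightarrow> s \<in> S \<Longrightarrow> a \<otimes> s \<in> P"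
  and a: "a \<in> simple_extension P x" and s: "s \<in> simple_extension S x"
 shows "a \<otimes> s \<in> simple_extension P x"
proof -
 note Sc = subringE(1)[OF S]
 have Pc: "P \<subseteq> carrier R" using P(1) Sc by auto
 note cP = subsetD[OF simple_extension_in_carrier[OF Pc x]] and cS = subsetD[OF simple_extension_in_carrier[OF Sc x]]
 have 1: "a \<otimes> s \<in> simple_extension P x" if "a \<in> simple_extension P x" "s \<in> S" for a s
  using that(1)
 proof (induction rule: simple_extension.induct)
  case zero
  thus ?case using that(2) Sc simple_extension.zero[of P x] by (simp add: subset_iff)
 next
  case (lin k1 k2)
  have "(k1 \<otimes> x \<oplus> k2) \<otimes> s = (k1 \<otimes> s) \<otimes> x \<oplus> k2 \<otimes> s"
  proof -
   have "k2 \<in> carrier R" "s \<in> carrier R" using lin(2) Pc that(2) Sc by auto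
   thus ?thesis using cP[OF lin(1)] x by (simp add: l_distr r_distr m_ac)
  qed
  thus ?case using simple_extension.lin[OF lin.IH P(4)[OF lin(2) that(2)]] by simp
 qed
 show ?thesis
  using s
 proof (induction rule: simple_extension.induct)
  case zero
  thus ?case using cP[OF a] simple_extension.zero[of P x] by simp
 next
  case (lin k1 k2)
  have "a \<otimes> (k1 \<otimes> x \<oplus> k2) = ((a \<otimes> k1) \<otimes> x \<oplus> \<zero>) \<oplus> a \<otimes> k2"
   using cP[OF a] cS[OF lin(1)] lin(2) Sc x by (simp add: r_distr m_ac subset_iff)
  thus ?case
   using simple_extension_add[OF x Pc P(2,3) simple_extension.lin[OF lin.IH P(2)] 1[OF a lin(2)]] by simp
 qed
qed

lemma simple_extension_eval:
 assumes "P \<subseteq> carrier R" "x \<in> carrier R" "a \<in> simple_extension P x"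
 shows "\<exists>q. set q \<subseteq> P \<and> eval q x = a"
 using assms(3)
proof (induction rule: simple_extension.induct)
 case zero
 thus ?case by (intro exI[of _ "[]"]) auto
next
 case (lin k1 k2)
 then obtain q where "set q \<subseteq> P" "eval q x = k1" by auto
 thus ?case using eval_append_aux[of q k2 x] assms(1,2) lin
  by (intro exI[of _ "q @ [k2]"]) auto
qed

lemma eval_in_ideal:
 assumes S: "subring S R" and c: "c \<in> S" and P: "P \<subseteq> S" "\<zero> \<in> P"
  "\<And>a b. a \<in> P \<Longrightarrow> b \<in> P \<Longrightarrow> a \<oplus> b \<in> P" "\<And>a s. a \<in> P \<Longrightarrow> s \<in> S \<Longrightarrow> a \<otimes> s \<in> P"
  and q: "set q \<subseteq> P"
 shows "eval q c \<in> P"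
 using q
proof (induction q rule: rev_induct)
 case Nil
 thus ?case using P(2) by simp
next
 case (snoc a q)
 have "set q \<subseteq> carrier R" "a \<in> carrier R" "c \<in> carrier R"
  using snoc.prems P(1) c subringE(1)[OF S] by auto
 thus ?case using eval_append_aux[of q a c] snoc P(3,4) c by auto
qed

lemma eval_map2_diff:
 assumes "length q = length p" "set q \<subseteq> carrier R" "set p \<subseteq> carrier R"
  and "s \<in> carrier R" "a \<in> carrier R" "x \<in> carrier R"
 shows "eval (map2 (\<lambda>b c. s \<otimes> b \<ominus> a \<otimes> c) q p) x = s \<otimes> eval q x \<ominus> a \<otimes> eval p x"
 using assms(1-3)
proof (induction q p rule: list_induct2)
 case Nil
 thus ?case using assms(4-) by (simp add: a_minus_def)
next
 case (Cons b q c p)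
 have e: "eval q x \<in> carrier R" "eval p x \<in> carrier R" "x [^] length q \<in> carrier R"
  using Cons.prems assms(6) by (auto intro!: eval_in_carrier)
 have bc: "b \<in> carrier R" "c \<in> carrier R" using Cons.prems by auto
 have "(s \<otimes> b \<ominus> a \<otimes> c) \<otimes> y \<oplus> (s \<otimes> u \<ominus> a \<otimes> v) = s \<otimes> (b \<otimes> y \<oplus> u) \<ominus> a \<otimes> (c \<otimes> y \<oplus> v)"
  if "y \<in> carrier R" "u \<in> carrier R" "v \<in> carrier R" for y u v
  using that bc assms(4,5) by algebra
 thus ?case using Cons e by simp
qed

text \<open>Pseudo-division by a shortest relation \<open>s # f\<close>: each step costs a factor
  \<open>s\<close> and keeps the coefficients in \<open>P\<close>. Once the list is no longer than
  \<open>f\<close>, subtracting \<open>w\<close> from its last entry produces a relation that is too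
  short to be nontrivial, so \<open>w\<close> equals that entry.\<close>

lemma eval_minimal_reduction:
 assumes S: "subring S R" and x: "x \<in> carrier R" and P: "P \<subseteq> S" "\<zero> \<in> P"
  "\<And>a b. a \<in> P \<Longrightarrow> b \<in> P \<Longrightarrow> a \<oplus> b \<in> P" "\<And>a s. a \<in> P \<Longrightarrow> s \<in> S \<Longrightarrow> a \<otimes> s \<in> P"
  and f: "s \<in> S" "set f \<subseteq> S" "eval (s # f) x = \<zero>"
  and min: "\<And>g. set g \<subseteq> S \<Longrightarrow> eval g x = \<zero> \<Longrightarrow> length g \<le> length f \<Longrightarrow> normalize g = []"
  and q: "set q \<subseteq> P" "eval q x = w" "w \<in> S"
 shows "\<exists>m::nat. s [^] m \<otimes> w \<in> P"
 using q
proof (induction "length q" arbitrary: q w rule: less_induct)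
 case less
 note Sc = subringE(1)[OF S]
 have c: "s \<in> carrier R" "w \<in> carrier R" "set f \<subseteq> carrier R" "set q \<subseteq> carrier R" using f less.prems P(1) Sc by auto
 show ?case
 proof (cases "length q \<le> length f")
  case True
  have "w \<in> P"
  proof (cases q rule: rev_cases)
   case Nil
   thus ?thesis using less.prems P(2) by simp
  next
   case (snoc q' p0)
   have p0: "set q' \<subseteq> carrier R" "p0 \<in> carrier R" "p0 \<in> P" using c less.prems snoc by auto
   let ?g = "q' @ [p0 \<ominus> w]"
   have "eval ?g x = eval q' x \<otimes> x \<oplus> (p0 \<ominus> w)"
    by (rule eval_append_aux) (use p0 c x in auto)
   also have "\<dots> = (eval q' x \<otimes> x \<oplus> p0) \<ominus> w"
    using p0 c x eval_in_carrier[OF p0(1) x] by (simp add: a_minus_def a_assoc)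
   also have "\<dots> = \<zero>"
    using less.prems(2) eval_append_aux[OF p0(1,2) x] snoc c by (simp add: a_minus_def r_neg)
   finally have g0: "eval ?g x = \<zero>" .
   have gS: "set ?g \<subseteq> S"
    using less.prems P(1) snoc subringE(5,7)[OF S] unfolding a_minus_def by auto
   have "normalize ?g = []" by (rule min[OF gS g0]) (use True snoc in auto)
   hence "coeff ?g = coeff []" using normalize_coeff[of ?g] by simp
   hence "coeff ?g 0 = \<zero>" by simp
   hence "p0 \<ominus> w = \<zero>" using coeff_nth[of 0 ?g] by (simp add: nth_append)
   thus ?thesis using p0 c by (metis r_right_minus_eq)
  qed
  thus ?thesis using c by (intro exI[of _ "0::nat"]) simp
 next
  case False
  then obtain a q' where qa: "q = a # q'" by (cases q) auto
  define n where "n = length q' - length f"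
  \<comment> \<open>\<open>f\<close> multiplied by \<open>x^n\<close> and aligned with
    \<open>q'\<close>, so that the leading terms cancel in \<open>s\<close> times
    \<open>a # q'\<close> minus \<open>a x^n\<close> times \<open>s # f\<close>.\<close>
  let ?p = "f @ replicate n \<zero>"
  have len: "length q' = length ?p" using False qa by (simp add: n_def)
  have ac: "a \<in> carrier R" "a \<in> P" "set q' \<subseteq> carrier R" "set q' \<subseteq> P" using qa c less.prems by auto
  let ?r = "map2 (\<lambda>b c. s \<otimes> b \<ominus> a \<otimes> c) q' ?p"
  have pc: "set ?p \<subseteq> carrier R" "set ?p \<subseteq> S" using c f subringE(2)[OF S] by auto
  have ec: "eval q' x \<in> carrier R" "eval ?p x \<in> carrier R" "x [^] length q' \<in> carrier R" "eval f x \<in> carrier R"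
   "x [^] n \<in> carrier R" "x [^] length f \<in> carrier R"
   using ac pc x c by (auto intro!: eval_in_carrier)
  have "set (replicate n \<zero>) \<subseteq> carrier R" by auto
  hence "eval ?p x = eval f x \<otimes> x [^] n \<oplus> eval (replicate n \<zero>) x"
   using eval_append[of f "replicate n \<zero>" x] c x by simp
  also have "eval (replicate n \<zero>) x = \<zero>"
   using eval_replicate[of "[]" x n] x by simp
  finally have ep: "eval ?p x = eval f x \<otimes> x [^] n" using ec by simp
  have lq: "length q' = length f + n" using len by simp
  have "s \<otimes> x [^] length q' \<oplus> eval ?p x = (s \<otimes> x [^] length f \<oplus> eval f x) \<otimes> x [^] n"
   unfolding ep lq using ec c x by (simp add: nat_pow_mult[symmetric] l_distr m_assoc)
  also have "\<dots> = \<zero>" using f(3) ec by simp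
  finally have rel: "s \<otimes> x [^] length q' \<oplus> eval ?p x = \<zero>" .
  hence rel': "eval ?p x = \<ominus> (s \<otimes> x [^] length q')"
   using ec c by (metis a_comm m_closed sum_zero_eq_neg)
  have "eval ?r x = s \<otimes> eval q' x \<ominus> a \<otimes> eval ?p x"
   by (rule eval_map2_diff) (use len ac pc c x in auto)
  also have "\<dots> = s \<otimes> (a \<otimes> x [^] length q' \<oplus> eval q' x)"
   unfolding rel' using ec c ac by (simp add: a_minus_def r_minus r_distr m_ac a_comm)
  also have "a \<otimes> x [^] length q' \<oplus> eval q' x = w" using less.prems(2) qa by simp
  finally have er: "eval ?r x = s \<otimes> w" .
  have "set ?r \<subseteq> P"
  proof
   fix y assume "y \<in> set ?r"
   then obtain b e where ye: "y = s \<otimes> b \<ominus> a \<otimes> e" "(b, e) \<in> set (zip q' ?p)" by auto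
   hence be: "y = s \<otimes> b \<ominus> a \<otimes> e" "b \<in> set q'" "e \<in> set ?p"
    using set_zip_leftD set_zip_rightD by fast+
   have be': "b \<in> P" "e \<in> S" "b \<in> carrier R" "e \<in> carrier R" using be ac pc by auto
   have "y = b \<otimes> s \<oplus> a \<otimes> (\<ominus> e)" using be be' c ac by (simp add: a_minus_def r_minus m_comm)
   thus "y \<in> P" using P(3,4) be' ac(2) f(1) subringE(5)[OF S] by auto
  qed
  moreover have "length ?r < length q" using len qa by simp
  moreover have "s \<otimes> w \<in> S" using f less.prems subringE(6)[OF S] by auto
  ultimately obtain m :: nat where "s [^] m \<otimes> (s \<otimes> w) \<in> P" using less.hyps[of ?r "s \<otimes> w"] er by auto
  thus ?thesis using c by (intro exI[of _ "Suc m"]) (simp add: m_assoc)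
 qed
qed

text \<open>The finitely many coefficients of a polynomial over the fraction field of
  \<open>S\<close> are fractions, and the product of their denominators serves as
  \<open>r\<close>.\<close>

lemma clear_denominators:
 assumes S: "subring S R" and x: "x \<in> carrier R" and "a \<in> simple_extension (generate_field R S) x"
 shows "\<exists>r\<in>S - {\<zero>}. r \<otimes> a \<in> simple_extension S x"
 using assms(3)
proof (induction rule: simple_extension.induct)
 case zero
 thus ?case using subringE(1,3)[OF S] by (intro bexI[of _ \<one>]) auto
next
 case (lin k1 k2)
 note Sc = subringE(1)[OF S]
 have gS: "generate_ring R S = S"
  by (rule antisym) (use generate_ring_min_subring1[OF Sc S] in \<open>auto intro: generate_ring.incl\<close>)
 obtain s t where st: "s \<in> S" "t \<in> S" "t \<noteq> \<zero>" "k2 \<otimes> t = s"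
  using generate_field_fraction[OF Sc lin(2)] unfolding gS by auto
 obtain r where r: "r \<in> S - {\<zero>}" "r \<otimes> k1 \<in> simple_extension S x" using lin.IH by auto
 have gFc: "generate_field R S \<subseteq> carrier R" by (rule generate_field_incl[OF Sc])
 have c: "k1 \<in> carrier R" "k2 \<in> carrier R" "r \<in> carrier R" "t \<in> carrier R"
  using simple_extension_in_carrier[OF gFc x] lin gFc r st Sc by auto
 have Sid: "S \<subseteq> S" "\<zero> \<in> S" "\<And>a b. a \<in> S \<Longrightarrow> b \<in> S \<Longrightarrow> a \<oplus> b \<in> S" "\<And>a b. a \<in> S \<Longrightarrow> b \<in> S \<Longrightarrow> a \<otimes> b \<in> S"
  using subringE(2,6,7)[OF S] by auto
 have "t \<in> simple_extension S x" using simple_extension_incl[OF Sc x] st by auto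
 from simple_extension_absorb[OF S x Sid r(2) this]
 have "(r \<otimes> k1 \<otimes> t) \<otimes> x \<oplus> r \<otimes> s \<in> simple_extension S x"
  using r st Sid by (intro simple_extension.lin) auto
 moreover have "(r \<otimes> t) \<otimes> (k1 \<otimes> x \<oplus> k2) = (r \<otimes> k1 \<otimes> t) \<otimes> x \<oplus> r \<otimes> (k2 \<otimes> t)"
  using c x by (simp add: r_distr m_ac)
 moreover have "r \<otimes> t \<in> S - {\<zero>}" using r st Sid c by (auto simp: integral_iff)
 ultimately show ?case using st(4) by (intro bexI[of _ "r \<otimes> t"]) auto
qed

text \<open>Avoiding the powers of \<open>h\<close> means geometrically that the closed set of
  \<open>P\<close> meets the open set where \<open>h\<close> is nonzero. This condition can be
  passed on to \<open>S[x]\<close>, whereas the extension of a prime ideal may fail to be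
  prime.\<close>

lemma generic_properness_simple:
 assumes S: "subring S R" "infinite S" and x: "x \<in> carrier R"
  and g: "g \<in> simple_extension S x" "g \<noteq> \<zero>"
 shows "\<exists>h\<in>S - {\<zero>}. \<forall>P. ideal P (R\<lparr>carrier := S\<rparr>) \<longrightarrow> (\<forall>m::nat. h [^] m \<notin> P) \<longrightarrow>
  (\<forall>m::nat. g [^] m \<notin> simple_extension P x)"
proof -
 note Sc = subringE(1)[OF S(1)]
 have Pp: "P \<subseteq> S" "\<zero> \<in> P" "\<And>a b. a \<in> P \<Longrightarrow> b \<in> P \<Longrightarrow> a \<oplus> b \<in> P"
  "\<And>a s. a \<in> P \<Longrightarrow> s \<in> S \<Longrightarrow> a \<otimes> s \<in> P" if "ideal P (R\<lparr>carrier := S\<rparr>)" for P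
 proof -
  interpret P: ideal P "R\<lparr>carrier := S\<rparr>" by (rule that)
  show "P \<subseteq> S" using P.a_subset by simp
  show "\<zero> \<in> P" using additive_subgroup.zero_closed[OF P.is_additive_subgroup] by simp
  show "a \<oplus> b \<in> P" if "a \<in> P" "b \<in> P" for a b
   using additive_subgroup.a_closed[OF P.is_additive_subgroup that] by simp
  show "a \<otimes> s \<in> P" if "a \<in> P" "s \<in> S" for a s
   using P.I_r_closed[of a s] that by simp
 qed
 have SP: "s [^] (m::nat) \<in> S" if "s \<in> S" for s m
  using that subringE(3,6)[OF S(1)] by (induction m) auto
 show ?thesis
 proof (cases "(transcendental over S) x")
  case True
  obtain q where q: "q \<in> carrier (S[X])" "eval q x = g"
   using g(1) unfolding simple_extension_as_eval_img[OF Sc x] by auto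
  have qR: "q \<in> carrier (poly_ring R)"
   using q(1) Sc by (auto simp: univ_poly_carrier[symmetric] polynomial_def)
  have "q \<noteq> []" using q g by auto
  \<comment> \<open>In the transcendental case \<open>x\<close> can be specialised to any
    \<open>c\<close> in \<open>S\<close>, and an infinite \<open>S\<close> contains a
    \<open>c\<close> that is no root of \<open>q\<close>. The witness for \<open>h\<close> is the
    value at \<open>c\<close>: a power of \<open>q\<close> with coefficients in \<open>P\<close>
    takes a value in \<open>P\<close>.\<close>
  then obtain c where c: "c \<in> S" "eval q c \<noteq> \<zero>"
   using poly_vanishing[OF qR S(2) Sc] by auto
  have cc: "c \<in> carrier R" using c Sc by auto
  have qs: "set q \<subseteq> S" using q(1) by (auto simp: univ_poly_carrier[symmetric] polynomial_def)
  have hS: "eval q c \<in> S"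
   using qs eval_in_ideal[OF S(1) c(1), of S q] subringE(2,6,7)[OF S(1)] by auto
  show ?thesis
  proof (intro bexI[of _ "eval q c"] allI impI notI)
   fix P and m :: nat
   assume P: "ideal P (R\<lparr>carrier := S\<rparr>)" and h: "\<forall>m::nat. eval q c [^] m \<notin> P"
    and gm: "g [^] m \<in> simple_extension P x"
   note Pp = Pp[OF P]
   have Pc: "P \<subseteq> carrier R" using Pp(1) Sc by auto
   obtain p where p: "set p \<subseteq> P" "eval p x = g [^] m" using simple_extension_eval[OF Pc x gm] by auto
   let ?n = "normalize p"
   have n: "?n \<in> carrier (S[X])" "eval ?n y = eval p y" if "y \<in> carrier R" for y
    using normalize_gives_polynomial[of p S] p(1) Pp(1) Pc eval_normalize[of p y] that
    by (auto simp: univ_poly_carrier subset_iff)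
   interpret SX: ring "S[X]" by (rule univ_poly_is_ring[OF S(1)])
   have hom: "ring_hom_ring (S[X]) R (\<lambda>p. eval p y)" if "y \<in> carrier R" for y
    by (rule eval_ring_hom[OF S(1) that])
   have pw: "eval (q [^]\<^bsub>S[X]\<^esub> m) y = eval q y [^] m" if "y \<in> carrier R" for y
    using ring_hom_ring.hom_nat_pow[OF hom[OF that] q(1)] .
   have "eval (q [^]\<^bsub>S[X]\<^esub> m) x = eval ?n x"
    using pw[OF x] n(2)[OF x] p(2) q(2) by simp
   hence "q [^]\<^bsub>S[X]\<^esub> m = ?n"
    using True n(1)[OF x] SX.nat_pow_closed[OF q(1)] unfolding transcendental_def over_def inj_on_def by auto
   hence "eval q c [^] m = eval p c" using pw[OF cc] n(2)[OF cc] by simp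
   also have "\<dots> \<in> P" by (rule eval_in_ideal[OF S(1) c(1) Pp p(1)])
   finally show False using h by simp
  qed (use hS c in auto)
 next
  case False
  \<comment> \<open>The lengths of nontrivial relations of \<open>x\<close> over \<open>S\<close>.
    As \<open>S\<close> need not be a field, a shortest relation takes the place of the minimal
    polynomial; its leading entry \<open>s\<close> is nonzero but in general not invertible.\<close>
  let ?rel = "\<lambda>l. \<exists>g. set g \<subseteq> S \<and> normalize g \<noteq> [] \<and> eval g x = \<zero> \<and> length g = l"
  have "(algebraic over S) x" using False by (simp add: over_def)
  then obtain p where p: "p \<in> carrier (S[X])" "p \<noteq> []" "eval p x = \<zero>" using algebraicE[OF S(1) x] by auto
  have pp: "polynomial S p" using p(1) by (simp add: univ_poly_carrier)
  have "?rel (length p)"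
   using p pp normalize_polynomial[OF pp] polynomial_incl[OF pp] by auto
  then obtain f where f: "set f \<subseteq> S" "normalize f \<noteq> []" "eval f x = \<zero>" "length f = (LEAST l. ?rel l)"
   using LeastI[of ?rel] by blast
  have min: "normalize g = []" if "set g \<subseteq> S" "eval g x = \<zero>" "length g < length f" for g
   using not_less_Least[of "length g" ?rel] that f(4) by auto
  obtain s f' where sf: "f = s # f'" using f(2) by (cases f) auto
  have sS: "s \<in> S" "set f' \<subseteq> S" using f(1) sf by auto
  have s0: "s \<noteq> \<zero>"
  proof
   assume "s = \<zero>"
   hence "normalize f = normalize f'" "eval f' x = \<zero>"
    using sf f(3) x eval_in_carrier[of f' x] sS Sc by auto
   thus False using min[of f'] sf sS f(2) by auto
  qed
  have Q: "subfield (generate_field R S) R" by (rule generate_field_is_subfield[OF Sc])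
  have SQ: "S \<subseteq> generate_field R S" by (auto intro: generate_field.incl)
  have "(algebraic over generate_field R S) x" by (rule algebraic_mono[OF SQ]) (use False in \<open>simp add: over_def\<close>)
  hence SE: "subfield (simple_extension (generate_field R S) x) R"
   using simple_extension_is_subfield[OF Q x] by simp
  have gc: "g \<in> carrier R" using g simple_extension_in_carrier[OF Sc x] by auto
  have "inv g \<in> simple_extension (generate_field R S) x"
   using subfield_m_inv(1)[OF SE, of g] g mono_simple_extension[OF SQ] by auto
  then obtain r where r: "r \<in> S - {\<zero>}" "r \<otimes> inv g \<in> simple_extension S x"
   using clear_denominators[OF S(1) x] by auto
  have rc: "r \<in> carrier R" "s \<in> carrier R" using r sS Sc by auto
  have gu: "g \<otimes> (r \<otimes> inv g) = r"
   using gc g(2) rc mult_inv[OF gc g(2)] inv_closed_nonzero[OF gc g(2)] m_lcomm[of g r "inv g"] by simp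
  \<comment> \<open>The witness is \<open>r s\<close>: \<open>r\<close> is a multiple of
    \<open>g\<close> in \<open>S[x]\<close>, so a power of \<open>g\<close> in the extended ideal
    yields the same power of \<open>r\<close>, and powers of \<open>s\<close> pay for the
    pseudo-division that brings it down to \<open>P\<close>.\<close>
  show ?thesis
  proof (intro bexI[of _ "r \<otimes> s"] allI impI notI)
   fix P and m :: nat
   assume P: "ideal P (R\<lparr>carrier := S\<rparr>)" and h: "\<forall>m::nat. (r \<otimes> s) [^] m \<notin> P"
    and gm: "g [^] m \<in> simple_extension P x"
   note Pp = Pp[OF P]
   have Pc: "P \<subseteq> carrier R" using Pp(1) Sc by auto
   have SEr: "subring (simple_extension S x) R" by (rule simple_extension_is_subring[OF S(1) x])
   have "(r \<otimes> inv g) [^] m \<in> simple_extension S x"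
    using r(2) subringE(3,6)[OF SEr] by (induction m) auto
   from simple_extension_absorb[OF S(1) x Pp gm this]
   have "r [^] m \<in> simple_extension P x"
    using gu gc rc inv_closed_nonzero[OF gc g(2)] by (simp add: nat_pow_distrib[symmetric])
   then obtain q where q: "set q \<subseteq> P" "eval q x = r [^] m" using simple_extension_eval[OF Pc x] by auto
   have "\<exists>M::nat. s [^] M \<otimes> r [^] m \<in> P"
    by (rule eval_minimal_reduction[OF S(1) x Pp sS _ _ q])
     (use f(3) sf min SP r in \<open>auto simp: less_Suc_eq_le\<close>)
   then obtain M :: nat where M: "s [^] M \<otimes> r [^] m \<in> P" by auto
   have "(r \<otimes> s) [^] (M + m) = (s [^] M \<otimes> r [^] m) \<otimes> (r [^] M \<otimes> s [^] m)"
    using rc by (simp add: nat_pow_distrib nat_pow_mult[symmetric] m_ac)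
   also have "\<dots> \<in> P" using M Pp(4) SP r sS subringE(6)[OF S(1)] by auto
   finally show False using h by simp
  qed (use r s0 sS subringE(6)[OF S(1)] rc in \<open>auto simp: integral_iff\<close>)
 qed
qed

text \<open>This is the generic surjectivity of a dominant morphism of finite type: over the open
  set where \<open>h\<close> is nonzero, a closed set of the base has a nonempty preimage. The
  generators are adjoined one at a time, and the condition \<open>g\<close> for the larger ring is
  pulled down by \<open>generic_properness_simple\<close>.\<close>

theorem generic_properness:
 assumes "finite X" "subring S R" "infinite S" "X \<subseteq> carrier R"
 shows "\<exists>h\<in>S - {\<zero>}. \<forall>P. ideal P (R\<lparr>carrier := S\<rparr>) \<longrightarrow> (\<forall>m::nat. h [^] m \<notin> P) \<longrightarrow>
  (\<forall>zs. set zs \<subseteq> P \<times> generate_ring R (S \<union> X) \<longrightarrow> lcomb zs \<noteq> \<one>)"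
 using assms
proof (induction X arbitrary: S rule: finite_induct)
 case empty
 note S = empty.prems(1) and Sc = subringE(1)[OF empty.prems(1)]
 have gS: "generate_ring R S = S"
  by (rule antisym) (use generate_ring_min_subring1[OF Sc S] in \<open>auto intro: generate_ring.incl\<close>)
 show ?case
 proof (intro bexI[of _ \<one>] allI impI)
  fix P zs assume P: "ideal P (R\<lparr>carrier := S\<rparr>)" and "\<forall>m::nat. \<one> [^] m \<notin> P"
   and zs: "set zs \<subseteq> P \<times> generate_ring R (S \<union> {})"
  interpret P: ideal P "R\<lparr>carrier := S\<rparr>" by (rule P)
  have "lcomb zs \<in> P"
   using zs
  proof (induction zs)
   case Nil
   thus ?case using additive_subgroup.zero_closed[OF P.is_additive_subgroup] by simp
  next
   case (Cons z zs)
   thus ?case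
    using additive_subgroup.a_closed[OF P.is_additive_subgroup] P.I_r_closed gS by auto
  qed
  moreover have "\<one> \<notin> P" using \<open>\<forall>m::nat. \<one> [^] m \<notin> P\<close>[rule_format, of 0] by simp
  ultimately show "lcomb zs \<noteq> \<one>" by auto
 qed (use subringE(3)[OF S] in auto)
next
 case (insert x X)
 note S = insert.prems(1) and Sc = subringE(1)[OF insert.prems(1)]
 have x: "x \<in> carrier R" "X \<subseteq> carrier R" using insert.prems by auto
 define S\<^sub>1 where "S\<^sub>1 = simple_extension S x"
 have S1: "subring S\<^sub>1 R" unfolding S\<^sub>1_def by (rule simple_extension_is_subring[OF S x(1)])
 note S1c = subringE(1)[OF S1]
 have SS1: "S \<subseteq> S\<^sub>1" "x \<in> S\<^sub>1"
  unfolding S\<^sub>1_def using simple_extension_incl[OF Sc x(1)] simple_extension_mem[OF S x(1)] by auto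
 obtain g where g: "g \<in> S\<^sub>1 - {\<zero>}"
  and IH: "\<And>P zs. ideal P (R\<lparr>carrier := S\<^sub>1\<rparr>) \<Longrightarrow> (\<forall>m::nat. g [^] m \<notin> P) \<Longrightarrow>
   set zs \<subseteq> P \<times> generate_ring R (S\<^sub>1 \<union> X) \<Longrightarrow> lcomb zs \<noteq> \<one>"
  using insert.IH[OF S1 _ x(2)] insert.prems(2) SS1(1) finite_subset by metis
 obtain h where h: "h \<in> S - {\<zero>}"
  and hP: "\<And>P m. ideal P (R\<lparr>carrier := S\<rparr>) \<Longrightarrow> (\<forall>m::nat. h [^] m \<notin> P) \<Longrightarrow>
   g [^] (m::nat) \<notin> simple_extension P x"
  using generic_properness_simple[OF S insert.prems(2) x(1), of g] g unfolding S\<^sub>1_def by auto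
 have "generate_ring R (S \<union> insert x X) \<subseteq> generate_ring R (S\<^sub>1 \<union> X)"
  using SS1 x S1c by (intro mono_generate_ring) auto
 note gen = this
 show ?case
 proof (intro bexI[of _ h] allI impI)
  fix P zs assume P: "ideal P (R\<lparr>carrier := S\<rparr>)" and hm: "\<forall>m::nat. h [^] m \<notin> P"
   and zs: "set zs \<subseteq> P \<times> generate_ring R (S \<union> insert x X)"
  interpret P: ideal P "R\<lparr>carrier := S\<rparr>" by (rule P)
  have Pp: "P \<subseteq> S" "\<zero> \<in> P" "\<And>a b. a \<in> P \<Longrightarrow> b \<in> P \<Longrightarrow> a \<oplus> b \<in> P"
   "\<And>a s. a \<in> P \<Longrightarrow> s \<in> S \<Longrightarrow> a \<otimes> s \<in> P"
   using P.a_subset additive_subgroup.zero_closed[OF P.is_additive_subgroup]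
    additive_subgroup.a_closed[OF P.is_additive_subgroup] P.I_r_closed by auto
  have Pc: "P \<subseteq> carrier R" using Pp(1) Sc by auto
  let ?Q = "simple_extension P x"
  note Qc = simple_extension_in_carrier[OF Pc x(1)]
  have abs: "a \<otimes> s \<in> ?Q" if "a \<in> ?Q" "s \<in> S\<^sub>1" for a s
   using simple_extension_absorb[OF S x(1) Pp that(1)] that(2) unfolding S\<^sub>1_def by auto
  have Q: "ideal ?Q (R\<lparr>carrier := S\<^sub>1\<rparr>)"
  proof (rule idealI)
   show "ring (R\<lparr>carrier := S\<^sub>1\<rparr>)" by (rule subring_is_ring[OF S1])
   have "subgroup ?Q (add_monoid R)"
   proof (rule add.subgroupI)
    show "?Q \<subseteq> carrier R" by (rule Qc)
    show "?Q \<noteq> {}" by (auto intro: simple_extension.zero)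
    fix a assume a: "a \<in> ?Q"
    have "\<ominus> a = a \<otimes> \<ominus> \<one>" using a Qc by (auto simp: r_minus)
    also have "\<dots> \<in> ?Q" using a subringE(3,5)[OF S1] by (intro abs) auto
    finally show "\<ominus> a \<in> ?Q" .
   next
    fix a b assume "a \<in> ?Q" "b \<in> ?Q"
    thus "a \<oplus> b \<in> ?Q" using simple_extension_add[OF x(1) Pc Pp(2,3)] by simp
   qed
   moreover have "?Q \<subseteq> S\<^sub>1" unfolding S\<^sub>1_def by (rule mono_simple_extension[OF Pp(1)])
   ultimately show "subgroup ?Q (add_monoid (R\<lparr>carrier := S\<^sub>1\<rparr>))"
    using add.subgroup_incl[of ?Q S\<^sub>1] subring.axioms(1)[OF S1] by simp
   fix a s assume a: "a \<in> ?Q" and s: "s \<in> carrier (R\<lparr>carrier := S\<^sub>1\<rparr>)"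
   thus "a \<otimes>\<^bsub>R\<lparr>carrier := S\<^sub>1\<rparr>\<^esub> s \<in> ?Q" using abs by simp
   with a show "s \<otimes>\<^bsub>R\<lparr>carrier := S\<^sub>1\<rparr>\<^esub> a \<in> ?Q" using a s Qc S1c by (simp add: m_comm subset_iff)
  qed
  have "set zs \<subseteq> ?Q \<times> generate_ring R (S\<^sub>1 \<union> X)"
   using zs gen simple_extension_incl[OF Pc x(1)] by auto
  with IH[OF Q _ this] hP[OF P hm] show "lcomb zs \<noteq> \<one>" by auto
 qed (rule h)
qed

end

section \<open>Square matrices\<close>

definition mmult :: "('a, 'r) ring_scheme \<Rightarrow> nat \<Rightarrow> (nat \<Rightarrow> nat \<Rightarrow> 'a) \<Rightarrow> (nat \<Rightarrow> nat \<Rightarrow> 'a) \<Rightarrow> nat \<Rightarrow> nat \<Rightarrow> 'a" where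
 "mmult R n A B i j = (\<Oplus>\<^bsub>R\<^esub>l\<in>{..<n}. A i l \<otimes>\<^bsub>R\<^esub> B l j)"

definition mone :: "('a, 'r) ring_scheme \<Rightarrow> nat \<Rightarrow> nat \<Rightarrow> 'a" where
 "mone R i j = (if i = j then \<one>\<^bsub>R\<^esub> else \<zero>\<^bsub>R\<^esub>)"

text \<open>A matrix is a function of two indices whose entries are constrained below
  \<open>n\<close> only; equality of matrices is therefore stated entrywise.\<close>

definition mats :: "nat \<Rightarrow> 'a set \<Rightarrow> (nat \<Rightarrow> nat \<Rightarrow> 'a) set" where
 "mats n S = {A. \<forall>i<n. \<forall>j<n. A i j \<in> S}"

definition minverse :: "('a, 'r) ring_scheme \<Rightarrow> nat \<Rightarrow> (nat \<Rightarrow> nat \<Rightarrow> 'a) \<Rightarrow> (nat \<Rightarrow> nat \<Rightarrow> 'a) \<Rightarrow> bool" where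
 "minverse R n A B \<longleftrightarrow> (\<forall>i<n. \<forall>j<n. mmult R n A B i j = mone R i j \<and> mmult R n B A i j = mone R i j)"

lemma matsD: "A \<in> mats n S \<Longrightarrow> i < n \<Longrightarrow> j < n \<Longrightarrow> A i j \<in> S"
 by (simp add: mats_def)

lemma mats_mono: "A \<in> mats n S \<Longrightarrow> S \<subseteq> T \<Longrightarrow> A \<in> mats n T"
 by (auto simp: mats_def)

lemma (in cring) finsum_subring:
 assumes "subring S R" "finite I" "\<And>i. i \<in> I \<Longrightarrow> f i \<in> S"
 shows "(\<Oplus>i\<in>I. f i) \<in> S"
 using assms(2,3)
proof (induction I rule: finite_induct)
 case (insert i I)
 hence "(\<Oplus>i\<in>insert i I. f i) = f i \<oplus> (\<Oplus>i\<in>I. f i)"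
  using subringE(1)[OF assms(1)] by (intro finsum_insert) auto
 thus ?case using insert subringE(7)[OF assms(1)] by auto
qed (use subringE(2)[OF assms(1)] in simp)

lemma (in cring) mmult_in_subring:
 "subring S R \<Longrightarrow> A \<in> mats n S \<Longrightarrow> B \<in> mats n S \<Longrightarrow> mmult R n A B \<in> mats n S"
 unfolding mats_def mmult_def by (auto intro!: finsum_subring subringE(6))

lemma (in cring) mmult_closed:
 "A \<in> mats n (carrier R) \<Longrightarrow> B \<in> mats n (carrier R) \<Longrightarrow> mmult R n A B \<in> mats n (carrier R)"
 by (rule mmult_in_subring[OF carrier_is_subring])

lemma (in cring) mmult_assoc:
 assumes "A \<in> mats n (carrier R)" "B \<in> mats n (carrier R)" "C \<in> mats n (carrier R)" "i < n" "j < n"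
 shows "mmult R n (mmult R n A B) C i j = mmult R n A (mmult R n B C) i j"
proof -
 note c = matsD[OF assms(1)] matsD[OF assms(2)] matsD[OF assms(3)]
 have "mmult R n (mmult R n A B) C i j = (\<Oplus>l\<in>{..<n}. \<Oplus>k\<in>{..<n}. A i k \<otimes> B k l \<otimes> C l j)"
  unfolding mmult_def using assms(4,5) c by (intro finsum_cong' finsum_ldistr) auto
 also have "\<dots> = (\<Oplus>k\<in>{..<n}. \<Oplus>l\<in>{..<n}. A i k \<otimes> B k l \<otimes> C l j)"
  using assms(4,5) c by (intro finsum_finsum_swap) auto
 also have "\<dots> = (\<Oplus>k\<in>{..<n}. \<Oplus>l\<in>{..<n}. A i k \<otimes> (B k l \<otimes> C l j))"
  using assms(4,5) c by (intro finsum_cong') (auto simp: m_assoc)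
 also have "\<dots> = mmult R n A (mmult R n B C) i j"
  unfolding mmult_def using assms(4,5) c by (intro finsum_cong' finsum_rdistr[symmetric]) auto
 finally show ?thesis .
qed

lemma (in cring) finsum_delta:
 assumes "finite I" "k \<in> I" "f \<in> I \<rightarrow> carrier R"
 shows "(\<Oplus>i\<in>I. if k = i then f i else \<zero>) = f k"
 using add.finprod_singleton[of k I f] assms by simp

lemma (in cring) mmult_one:
 assumes "A \<in> mats n (carrier R)" "i < n" "j < n"
 shows "mmult R n A (mone R) i j = A i j" "mmult R n (mone R) A i j = A i j"
proof -
 note c = matsD[OF assms(1)]
 have "mmult R n A (mone R) i j = (\<Oplus>l\<in>{..<n}. if j = l then A i l else \<zero>)"
  unfolding mmult_def mone_def using assms(2,3) c by (intro finsum_cong') auto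
 thus "mmult R n A (mone R) i j = A i j" using assms(2,3) c by (subst (asm) finsum_delta) auto
 have "mmult R n (mone R) A i j = (\<Oplus>l\<in>{..<n}. if i = l then A l j else \<zero>)"
  unfolding mmult_def mone_def using assms(2,3) c by (intro finsum_cong') auto
 thus "mmult R n (mone R) A i j = A i j" using assms(2,3) c by (subst (asm) finsum_delta) auto
qed

lemma mmult_cong:
 "(\<And>l. l < n \<Longrightarrow> A i l = A' i l) \<Longrightarrow> (\<And>l. l < n \<Longrightarrow> B l j = B' l j) \<Longrightarrow>
  (\<And>l. l < n \<Longrightarrow> A' i l \<otimes>\<^bsub>R\<^esub> B' l j \<in> carrier R) \<Longrightarrow> abelian_monoid R \<Longrightarrow> mmult R n A B i j = mmult R n A' B' i j"
 unfolding mmult_def by (rule abelian_monoid.finsum_cong') auto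

lemma mmult_hom:
 assumes "g \<in> ring_hom R S" "cring R" "cring S" "A \<in> mats n (carrier R)" "B \<in> mats n (carrier R)" "i < n" "j < n"
 shows "g (mmult R n A B i j) = mmult S n (\<lambda>i j. g (A i j)) (\<lambda>i j. g (B i j)) i j"
proof -
 interpret ring_hom_cring R S g
  using assms by (intro ring_hom_cring.intro ring_hom_cring_axioms.intro)
 note c = matsD[OF assms(4)] matsD[OF assms(5)]
 have "g (mmult R n A B i j) = (\<Oplus>\<^bsub>S\<^esub>l\<in>{..<n}. (g \<circ> (\<lambda>l. A i l \<otimes>\<^bsub>R\<^esub> B l j)) l)"
  unfolding mmult_def using assms(6,7) c by (intro hom_finsum) auto
 also have "\<dots> = mmult S n (\<lambda>i j. g (A i j)) (\<lambda>i j. g (B i j)) i j"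
  unfolding mmult_def using assms(6,7) c by (intro S.finsum_cong') auto
 finally show ?thesis .
qed

lemma finsum_carrier_update:
 assumes "cring R" "subring S R" "finite I" "\<And>i. i \<in> I \<Longrightarrow> f i \<in> S"
 shows "(\<Oplus>\<^bsub>R\<lparr>carrier := S\<rparr>\<^esub>i\<in>I. f i) = (\<Oplus>\<^bsub>R\<^esub>i\<in>I. f i)"
proof -
 interpret R: cring R by fact
 interpret S: ring "R\<lparr>carrier := S\<rparr>" by (rule R.subring_is_ring[OF assms(2)])
 note Sc = subringE(1)[OF assms(2)]
 show ?thesis
  using assms(3,4)
 proof (induction I rule: finite_induct)
  case (insert i I)
  hence "(\<Oplus>\<^bsub>R\<lparr>carrier := S\<rparr>\<^esub>i\<in>insert i I. f i) = f i \<oplus>\<^bsub>R\<^esub> (\<Oplus>\<^bsub>R\<lparr>carrier := S\<rparr>\<^esub>i\<in>I. f i)"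
   by (subst S.finsum_insert) auto
  also have "\<dots> = (\<Oplus>\<^bsub>R\<^esub>i\<in>insert i I. f i)"
   using insert Sc by (subst R.finsum_insert) auto
  finally show ?case .
 qed (subst S.finsum_empty, simp)
qed

lemma (in cring) minverse_cancel:
 assumes "X \<in> mats n (carrier R)" "W \<in> mats n (carrier R)" "minverse R n X W" "B \<in> mats n (carrier R)" "i < n" "j < n"
 shows "mmult R n X (mmult R n W B) i j = B i j" "mmult R n (mmult R n B X) W i j = B i j"
proof -
 have o: "mone R i j \<in> carrier R" for i j by (simp add: mone_def)
 note c = matsD[OF assms(4)]
 have "mmult R n X (mmult R n W B) i j = mmult R n (mmult R n X W) B i j"
  by (rule mmult_assoc[OF assms(1,2,4-6), symmetric])
 also have "\<dots> = mmult R n (mone R) B i j"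
  by (rule mmult_cong) (use assms(3,5,6) o c abelian_monoid_axioms in \<open>auto simp: minverse_def\<close>)
 finally show "mmult R n X (mmult R n W B) i j = B i j" using mmult_one(2)[OF assms(4-6)] by simp
 have "mmult R n (mmult R n B X) W i j = mmult R n B (mmult R n X W) i j"
  by (rule mmult_assoc[OF assms(4,1,2,5,6)])
 also have "\<dots> = mmult R n B (mone R) i j"
  by (rule mmult_cong) (use assms(3,5,6) o c abelian_monoid_axioms in \<open>auto simp: minverse_def\<close>)
 finally show "mmult R n (mmult R n B X) W i j = B i j" using mmult_one(1)[OF assms(4-6)] by simp
qed

section \<open>Coordinate spaces\<close>

text \<open>A space presented by a bijective linear coordinate map to \<open>L^n\<close>. The module
  laws follow from those of \<open>L\<close> by injectivity; for a base change this replaces their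
  verification on cosets.\<close>

locale coordinate_space = field L for L (structure) +
 fixes V :: "('a, 'c, 'd) module_scheme" and n :: nat and crd :: "nat \<Rightarrow> 'c \<Rightarrow> 'a"
 assumes V_closed: "\<zero>\<^bsub>V\<^esub> \<in> carrier V" "x \<in> carrier V \<Longrightarrow> y \<in> carrier V \<Longrightarrow> x \<oplus>\<^bsub>V\<^esub> y \<in> carrier V"
   "a \<in> carrier L \<Longrightarrow> x \<in> carrier V \<Longrightarrow> a \<odot>\<^bsub>V\<^esub> x \<in> carrier V"
  and crd_closed: "i < n \<Longrightarrow> x \<in> carrier V \<Longrightarrow> crd i x \<in> carrier L"
  and crd_zero: "i < n \<Longrightarrow> crd i \<zero>\<^bsub>V\<^esub> = \<zero>"
  and crd_add: "i < n \<Longrightarrow> x \<in> carrier V \<Longrightarrow> y \<in> carrier V \<Longrightarrow> crd i (x \<oplus>\<^bsub>V\<^esub> y) = crd i x \<oplus> crd i y"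
  and crd_smult: "i < n \<Longrightarrow> a \<in> carrier L \<Longrightarrow> x \<in> carrier V \<Longrightarrow> crd i (a \<odot>\<^bsub>V\<^esub> x) = a \<otimes> crd i x"
  and crd_inj: "x \<in> carrier V \<Longrightarrow> y \<in> carrier V \<Longrightarrow> (\<And>i. i < n \<Longrightarrow> crd i x = crd i y) \<Longrightarrow> x = y"
  and crd_surj: "(\<And>i. i < n \<Longrightarrow> v i \<in> carrier L) \<Longrightarrow> \<exists>x\<in>carrier V. \<forall>i<n. crd i x = v i"
begin

lemma vectorspace: "vectorspace L V"
proof -
 have "abelian_group V"
 proof (rule abelian_groupI)
  fix x assume x: "x \<in> carrier V"
  obtain y where y: "y \<in> carrier V" "\<And>i. i < n \<Longrightarrow> crd i y = \<ominus> crd i x"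
   using crd_surj[of "\<lambda>i. \<ominus> crd i x"] crd_closed[OF _ x] by auto
  have "y \<oplus>\<^bsub>V\<^esub> x = \<zero>\<^bsub>V\<^esub>"
   by (rule crd_inj) (use x y V_closed crd_closed in \<open>auto simp: crd_add crd_zero l_neg\<close>)
  thus "\<exists>y\<in>carrier V. y \<oplus>\<^bsub>V\<^esub> x = \<zero>\<^bsub>V\<^esub>" using y(1) by auto
 next
  show "x \<oplus>\<^bsub>V\<^esub> y \<oplus>\<^bsub>V\<^esub> z = x \<oplus>\<^bsub>V\<^esub> (y \<oplus>\<^bsub>V\<^esub> z)" if "x \<in> carrier V" "y \<in> carrier V" "z \<in> carrier V" for x y z
   by (rule crd_inj) (use that V_closed crd_closed in \<open>auto simp: crd_add a_assoc\<close>)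
  show "x \<oplus>\<^bsub>V\<^esub> y = y \<oplus>\<^bsub>V\<^esub> x" if "x \<in> carrier V" "y \<in> carrier V" for x y
   by (rule crd_inj) (use that V_closed crd_closed in \<open>auto simp: crd_add a_comm\<close>)
  show "\<zero>\<^bsub>V\<^esub> \<oplus>\<^bsub>V\<^esub> x = x" if "x \<in> carrier V" for x
   by (rule crd_inj) (use that V_closed crd_closed in \<open>auto simp: crd_add crd_zero\<close>)
 qed (use V_closed in auto)
 hence "Module.module L V"
 proof (rule Module.moduleI[OF cring_axioms])
  show "(a \<oplus> b) \<odot>\<^bsub>V\<^esub> x = a \<odot>\<^bsub>V\<^esub> x \<oplus>\<^bsub>V\<^esub> b \<odot>\<^bsub>V\<^esub> x"
   if "a \<in> carrier L" "b \<in> carrier L" "x \<in> carrier V" for a b x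
   by (rule crd_inj) (use that V_closed crd_closed in \<open>auto simp: crd_add crd_smult l_distr\<close>)
  show "a \<odot>\<^bsub>V\<^esub> (x \<oplus>\<^bsub>V\<^esub> y) = a \<odot>\<^bsub>V\<^esub> x \<oplus>\<^bsub>V\<^esub> a \<odot>\<^bsub>V\<^esub> y"
   if "a \<in> carrier L" "x \<in> carrier V" "y \<in> carrier V" for a x y
   by (rule crd_inj) (use that V_closed crd_closed in \<open>auto simp: crd_add crd_smult r_distr\<close>)
  show "(a \<otimes> b) \<odot>\<^bsub>V\<^esub> x = a \<odot>\<^bsub>V\<^esub> (b \<odot>\<^bsub>V\<^esub> x)" if "a \<in> carrier L" "b \<in> carrier L" "x \<in> carrier V" for a b x
   by (rule crd_inj) (use that V_closed crd_closed in \<open>auto simp: crd_smult m_assoc\<close>)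
  show "\<one> \<odot>\<^bsub>V\<^esub> x = x" if "x \<in> carrier V" for x
   by (rule crd_inj) (use that V_closed crd_closed in \<open>auto simp: crd_smult\<close>)
 qed (use V_closed in auto)
 thus ?thesis by (intro vectorspace.intro field_axioms)
qed

lemma crd_finsum:
 assumes "finite I" "f \<in> I \<rightarrow> carrier V" "i < n"
 shows "crd i (\<Oplus>\<^bsub>V\<^esub>j\<in>I. f j) = (\<Oplus>j\<in>I. crd i (f j))"
proof -
 interpret V: vectorspace L V by (rule vectorspace)
 show ?thesis
  using assms(1,2)
  by (induction I rule: finite_induct) (use assms(3) in \<open>auto simp: crd_zero crd_add crd_closed Pi_iff\<close>)
qed

lemma crd_lincomb:
 assumes i: "i < n" and inj: "inj_on b {..<n}" and b: "\<And>j. j < n \<Longrightarrow> b j \<in> carrier V"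
  and a: "a \<in> b ` {..<n} \<rightarrow> carrier L"
 shows "crd i (LinearCombinations.module.lincomb V a (b ` {..<n})) = (\<Oplus>j\<in>{..<n}. a (b j) \<otimes> crd i (b j))"
proof -
 interpret V: vectorspace L V by (rule vectorspace)
 have ac: "a (b j) \<in> carrier L" if "j < n" for j using a that by auto
 have "V.lincomb a (b ` {..<n}) = (\<Oplus>\<^bsub>V\<^esub>j\<in>{..<n}. a (b j) \<odot>\<^bsub>V\<^esub> b j)"
  unfolding V.lincomb_def by (rule V.finsum_reindex[OF _ inj]) (use ac b V_closed in auto)
 hence "crd i (V.lincomb a (b ` {..<n})) = (\<Oplus>j\<in>{..<n}. crd i (a (b j) \<odot>\<^bsub>V\<^esub> b j))"
  using crd_finsum[of "{..<n}" "\<lambda>j. a (b j) \<odot>\<^bsub>V\<^esub> b j"] i ac b V_closed by auto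
 also have "\<dots> = (\<Oplus>j\<in>{..<n}. a (b j) \<otimes> crd i (b j))"
  using i ac b crd_closed by (intro finsum_cong') (auto simp: crd_smult)
 finally show ?thesis .
qed

text \<open>The coefficients of \<open>v\<close> with respect to \<open>b\<close> are the entries of
  \<open>W\<close> applied to the coordinate column of \<open>v\<close>, which gives existence and
  uniqueness at once.\<close>

lemma basis_of_invertible:
 assumes X: "X \<in> mats n (carrier L)" and W: "W \<in> mats n (carrier L)" and inv: "minverse L n X W"
  and b: "\<And>j. j < n \<Longrightarrow> b j \<in> carrier V" "\<And>i j. i < n \<Longrightarrow> j < n \<Longrightarrow> crd i (b j) = X i j"
 shows "vectorspace.basis L V (b ` {..<n})"
proof -
 interpret V: vectorspace L V by (rule vectorspace)
 let ?B = "b ` {..<n}"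
 have inv': "minverse L n W X" using inv by (simp add: minverse_def)
 have inj: "inj_on b {..<n}"
 proof (rule inj_onI)
  fix j k assume jk: "j \<in> {..<n}" "k \<in> {..<n}" "b j = b k"
  hence "X i j = X i k" if "i < n" for i using b(2)[OF that, of j] b(2)[OF that, of k] by simp
  hence "mmult L n W X j j = mmult L n W X j k"
   unfolding mmult_def using jk matsD[OF W] matsD[OF X] by (intro finsum_cong') auto
  hence "mone L j j = mone L j k" using inv jk by (simp add: minverse_def)
  thus "j = k" by (simp add: mone_def split: if_splits)
 qed
 have Bc: "finite ?B" "?B \<subseteq> carrier V" using b(1) by auto
 have coeffs: "V.lincomb a ?B = v \<longleftrightarrow> (\<forall>j<n. a (b j) = mmult L n W (\<lambda>i k. crd i v) j j)"
  if a: "a \<in> ?B \<rightarrow> carrier L" and v: "v \<in> carrier V" for a v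
 proof -
  \<comment> \<open>Columns are stored as matrices that do not depend on the second index, so that
    \<open>minverse_cancel\<close> applies to them.\<close>
  let ?C = "\<lambda>j k::nat. a (b j)" and ?v = "\<lambda>i k::nat. crd i v"
  have C: "?C \<in> mats n (carrier L)" "?v \<in> mats n (carrier L)" using a v crd_closed by (auto simp: mats_def)
  have ac: "a (b j) \<in> carrier L" if "j < n" for j using a that by auto
  have crd_lc: "crd i (V.lincomb a ?B) = mmult L n X ?C i i" if i: "i < n" for i
  proof -
   have "crd i (V.lincomb a ?B) = (\<Oplus>j\<in>{..<n}. a (b j) \<otimes> crd i (b j))"
    by (rule crd_lincomb[OF i inj _ a]) (rule b(1))
   thus ?thesis
    unfolding mmult_def using i ac b(2) matsD[OF X i] by (auto intro!: finsum_cong' simp: m_comm)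
  qed
  have "V.lincomb a ?B \<in> carrier V" by (rule V.lincomb_closed[OF Bc(2) a])
  hence "V.lincomb a ?B = v \<longleftrightarrow> (\<forall>i<n. mmult L n X ?C i i = crd i v)"
   using crd_inj[of "V.lincomb a ?B" v] crd_lc v by auto
  also have "\<dots> \<longleftrightarrow> (\<forall>j<n. a (b j) = mmult L n W ?v j j)"
  proof (intro iffI allI impI)
   fix j assume e: "\<forall>i<n. mmult L n X ?C i i = crd i v" and j: "j < n"
   have "a (b j) = mmult L n W (mmult L n X ?C) j j" using minverse_cancel(1)[OF W X inv' C(1) j j] by simp
   also have "\<dots> = mmult L n W ?v j j"
   proof (rule mmult_cong)
    fix l assume l: "l < n"
    show "mmult L n X ?C l j = crd l v" using e l by (simp add: mmult_def)
   qed (use j matsD[OF W] matsD[OF C(2)] abelian_monoid_axioms in auto)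
   finally show "a (b j) = mmult L n W ?v j j" .
  next
   fix i assume e: "\<forall>j<n. a (b j) = mmult L n W ?v j j" and i: "i < n"
   have "mmult L n X ?C i i = mmult L n X (mmult L n W ?v) i i"
   proof (rule mmult_cong)
    fix l assume l: "l < n"
    show "a (b l) = mmult L n W ?v l i" using e l by (simp add: mmult_def)
   qed (use i matsD[OF X] matsD[OF mmult_closed[OF W C(2)]] abelian_monoid_axioms in auto)
   thus "mmult L n X ?C i i = crd i v" using minverse_cancel(1)[OF X W inv C(2) i i] by simp
  qed
  finally show ?thesis .
 qed
 show ?thesis
 proof (subst V.basis_criterion[OF Bc], intro allI impI)
  fix v assume v: "v \<in> carrier V"
  let ?w = "\<lambda>j. mmult L n W (\<lambda>i k. crd i v) j j"
  have "(\<lambda>i k. crd i v) \<in> mats n (carrier L)" using crd_closed[OF _ v] by (simp add: mats_def)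
  hence wc: "?w j \<in> carrier L" if "j < n" for j using matsD[OF mmult_closed[OF W]] that by auto
  show "\<exists>!a. a \<in> ?B \<rightarrow>\<^sub>E carrier L \<and> V.lincomb a ?B = v"
  proof (rule ex_ex1I)
   let ?a = "\<lambda>u\<in>?B. ?w (the_inv_into {..<n} b u)"
   have "?a (b j) = ?w j" if "j < n" for j using that the_inv_into_f_f[OF inj, of j] by auto
   moreover have "?a \<in> ?B \<rightarrow>\<^sub>E carrier L" using wc the_inv_into_f_f[OF inj] by auto
   ultimately show "\<exists>a. a \<in> ?B \<rightarrow>\<^sub>E carrier L \<and> V.lincomb a ?B = v"
    using coeffs[of ?a v] v by (intro exI[of _ ?a]) (simp add: PiE_iff Pi_iff)
  next
   fix a a' assume a: "a \<in> ?B \<rightarrow>\<^sub>E carrier L \<and> V.lincomb a ?B = v" and a': "a' \<in> ?B \<rightarrow>\<^sub>E carrier L \<and> V.lincomb a' ?B = v"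
   have "a \<in> ?B \<rightarrow> carrier L" "a' \<in> ?B \<rightarrow> carrier L" using a a' by auto
   hence "a (b j) = a' (b j)" if "j < n" for j using coeffs[of a v] coeffs[of a' v] a a' v that by simp
   thus "a = a'" using a a' by (intro PiE_ext[of a ?B "\<lambda>_. carrier L" a']) auto
  qed
 qed
qed

end

context field
begin

lemma func_space_coordinates: "coordinate_space R (func_space {..<n}) n (\<lambda>i f. f i)"
proof (intro coordinate_space.intro coordinate_space_axioms.intro field_axioms)
 fix x y :: "nat \<Rightarrow> 'a" assume "x \<in> carrier (func_space {..<n})" "y \<in> carrier (func_space {..<n})" "\<And>i. i < n \<Longrightarrow> x i = y i"
 thus "x = y" by (intro PiE_ext[of x "{..<n}" "\<lambda>_. carrier R" y]) (auto simp: func_space_def)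
next
 fix v assume "\<And>i. i < n \<Longrightarrow> v i \<in> carrier R"
 thus "\<exists>x\<in>carrier (func_space {..<n}). \<forall>i<n. x i = v i"
  by (intro bexI[of _ "restrict v {..<n}"]) (auto simp: func_space_def)
qed (auto simp: func_space_def)

text \<open>The columns are \<open>n\<close> independent vectors in a space of dimension
  \<open>n\<close>, hence a basis. Expanding the unit vectors gives a right inverse
  \<open>W\<close>, and cancelling \<open>M\<close> on the left in \<open>M (W M) = M\<close> shows
  that it is a left inverse.\<close>

lemma minverse_exists:
 assumes M: "M \<in> mats n (carrier R)"
  and indep: "\<And>c. c \<in> {..<n} \<rightarrow> carrier R \<Longrightarrow> (\<And>i. i < n \<Longrightarrow> (\<Oplus>j\<in>{..<n}. M i j \<otimes> c j) = \<zero>) \<Longrightarrow> \<forall>j<n. c j = \<zero>"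
 obtains W where "W \<in> mats n (carrier R)" "minverse R n M W"
proof -
 let ?V = "func_space {..<n}"
 interpret F: coordinate_space R ?V n "\<lambda>i f. f i" by (rule func_space_coordinates)
 interpret V: vectorspace R ?V by (rule F.vectorspace)
 note Mc = matsD[OF M]
 define col where "col A j = (\<lambda>i\<in>{..<n}. A i j)" for A :: "nat \<Rightarrow> nat \<Rightarrow> 'a" and j
 have o: "mone R \<in> mats n (carrier R)" by (auto simp: mats_def mone_def)
 have col: "col A j \<in> carrier ?V" if "A \<in> mats n (carrier R)" "j < n" for A j
  using matsD[OF that(1)] that(2) by (auto simp: func_space_def col_def)
 have equal: "B i j = C i j" if B: "B \<in> mats n (carrier R)" and C: "C \<in> mats n (carrier R)" and ij: "i < n" "j < n"
  and eq: "\<And>i. i < n \<Longrightarrow> mmult R n M B i j = mmult R n M C i j" for B C i j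
 proof -
  note c = matsD[OF B _ ij(2)] matsD[OF C _ ij(2)]
  have "\<forall>l<n. B l j \<ominus> C l j = \<zero>"
  proof (rule indep)
   fix k assume k: "k < n"
   have "mmult R n M B k j = (\<Oplus>l\<in>{..<n}. M k l \<otimes> (B l j \<ominus> C l j) \<oplus> M k l \<otimes> C l j)"
    unfolding mmult_def using Mc[OF k] c
    by (intro finsum_cong') (auto simp: minus_eq a_assoc l_neg simp flip: r_distr)
   also have "\<dots> = (\<Oplus>l\<in>{..<n}. M k l \<otimes> (B l j \<ominus> C l j)) \<oplus> mmult R n M C k j"
    unfolding mmult_def using Mc[OF k] c by (intro finsum_addf) auto
   finally show "(\<Oplus>l\<in>{..<n}. M k l \<otimes> (B l j \<ominus> C l j)) = \<zero>"
    using eq[OF k] Mc[OF k] c matsD[OF mmult_closed[OF M C] k ij(2)] add.l_cancel_one'[of "mmult R n M C k j"]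
    by (simp add: finsum_closed Pi_iff a_comm)
  qed (use c in auto)
  thus ?thesis using c ij(1) by simp
 qed
 have "minverse R n (mone R) (mone R)" using mmult_one[OF o] by (simp add: minverse_def)
 hence ub: "V.basis (col (mone R) ` {..<n})"
  by (rule F.basis_of_invertible[OF o o]) (use col[OF o] in \<open>auto simp: col_def\<close>)
 have "inj_on (col (mone R)) {..<n}"
 proof (rule inj_onI)
  fix j k assume "j \<in> {..<n}" "k \<in> {..<n}" "col (mone R) j = col (mone R) k"
  from this(1) fun_cong[OF this(3), of j] show "j = k" by (simp add: col_def mone_def split: if_splits)
 qed
 hence dim: "V.dim = n" using V.dim_basis[OF _ ub] by (simp add: card_image)
 have fd: "V.fin_dim" using ub unfolding V.fin_dim_def V.basis_def by (intro exI[of _ "col (mone R) ` {..<n}"]) auto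
 have inj: "inj_on (col M) {..<n}"
 proof (rule inj_onI)
  fix j k assume jk: "j \<in> {..<n}" "k \<in> {..<n}" "col M j = col M k"
  hence e: "M i j = M i k" if "i < n" for i 
  proof -
   have "col M j i = col M k i" using jk(3) by (rule fun_cong)
   with that show ?thesis unfolding col_def by simp
  qed
  have "mone R j j = mone R j k"
  proof (rule equal[of "\<lambda>l _. mone R l j" "\<lambda>l _. mone R l k" j j])
   show "mmult R n M (\<lambda>l _. mone R l j) i j = mmult R n M (\<lambda>l _. mone R l k) i j" if "i < n" for i
    using mmult_one(1)[OF M that, of j] mmult_one(1)[OF M that, of k] e[OF that] jk by (simp add: mmult_def)
  qed (use jk in \<open>auto simp: mats_def mone_def\<close>)
  thus "j = k" by (simp add: mone_def split: if_splits)
 qed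
 have crd_lc: "V.lincomb a (col M ` {..<n}) i = mmult R n M (\<lambda>j _. a (col M j)) i k"
  if "a \<in> col M ` {..<n} \<rightarrow> carrier R" "i < n" for a i k
 proof -
  have ac: "a (col M j) \<in> carrier R" if "j < n" for j using \<open>a \<in> col M ` {..<n} \<rightarrow> carrier R\<close> that by auto
  have "V.lincomb a (col M ` {..<n}) i = (\<Oplus>j\<in>{..<n}. a (col M j) \<otimes> col M j i)"
   by (rule F.crd_lincomb[OF that(2) inj _ that(1)]) (rule col[OF M])
  thus ?thesis
   unfolding mmult_def using ac Mc that(2) by (auto intro!: finsum_cong' simp: col_def m_comm)
 qed
 have Bc: "finite (col M ` {..<n})" "col M ` {..<n} \<subseteq> carrier ?V" using col[OF M] by auto
 have "V.basis (col M ` {..<n})"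
 proof (rule V.dim_li_is_basis[OF fd Bc])
  show "V.lin_indpt (col M ` {..<n})"
  proof (rule V.finite_lin_indpt2[OF Bc])
   fix a assume a: "a \<in> col M ` {..<n} \<rightarrow> carrier R" and 0: "V.lincomb a (col M ` {..<n}) = \<zero>\<^bsub>?V\<^esub>"
   have "\<forall>j<n. a (col M j) = \<zero>"
    by (rule indep) (use a crd_lc[OF a] 0 in \<open>auto simp: mmult_def func_space_def\<close>)
   thus "\<forall>v\<in>col M ` {..<n}. a v = \<zero>" by auto
  qed
  show "V.dim \<le> card (col M ` {..<n})" using dim inj by (simp add: card_image)
 qed
 hence "\<exists>a. a \<in> col M ` {..<n} \<rightarrow>\<^sub>E carrier R \<and> V.lincomb a (col M ` {..<n}) = col (mone R) k" if "k < n" for k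
  using V.basis_criterion[OF Bc] col[OF o that] by (metis ex1_implies_ex)
 then obtain a where a: "\<And>k. k < n \<Longrightarrow> a k \<in> col M ` {..<n} \<rightarrow>\<^sub>E carrier R"
  "\<And>k. k < n \<Longrightarrow> V.lincomb (a k) (col M ` {..<n}) = col (mone R) k" by metis
 define W where "W j k = a k (col M j)" for j k
 have W: "W \<in> mats n (carrier R)" unfolding mats_def W_def using a(1) by (auto simp: PiE_iff)
 have MW: "mmult R n M W i k = mone R i k" if "i < n" "k < n" for i k
  using crd_lc[of "a k" i k] a[OF that(2)] that by (auto simp: mmult_def W_def col_def PiE_iff Pi_iff)
 have "mmult R n W M i j = mone R i j" if ij: "i < n" "j < n" for i j
 proof (rule equal[OF mmult_closed[OF W M] o ij])
  fix i assume i: "i < n"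
  have "mmult R n M (mmult R n W M) i j = mmult R n (mmult R n M W) M i j"
   by (rule mmult_assoc[OF M W M i ij(2), symmetric])
  also have "\<dots> = mmult R n (mone R) M i j"
   by (rule mmult_cong) (use MW i ij Mc matsD[OF o] abelian_monoid_axioms in auto)
  also have "\<dots> = mmult R n M (mone R) i j" using mmult_one[OF M i ij(2)] by simp
  finally show "mmult R n M (mmult R n W M) i j = mmult R n M (mone R) i j" .
 qed
 with MW have "minverse R n M W" by (simp add: minverse_def)
 with W show thesis by (rule that)
qed

lemma minverse_unique:
 assumes "A \<in> mats n (carrier R)" "B \<in> mats n (carrier R)" "B' \<in> mats n (carrier R)"
  "minverse R n A B" "minverse R n A B'" "i < n" "j < n"
 shows "B i j = B' i j"
proof -
 have o: "mone R \<in> mats n (carrier R)" by (auto simp: mats_def mone_def)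
 have "B i j = mmult R n B (mone R) i j" by (rule mmult_one(1)[OF assms(2,6,7), symmetric])
 also have "\<dots> = mmult R n B (mmult R n A B') i j"
  by (rule mmult_cong) (use assms matsD[OF assms(2)] matsD[OF mmult_closed[OF assms(1,3)]] abelian_monoid_axioms in \<open>auto simp: minverse_def\<close>)
 also have "\<dots> = mmult R n (mmult R n B A) B' i j" by (rule mmult_assoc[OF assms(2,1,3,6,7), symmetric])
 also have "\<dots> = mmult R n (mone R) B' i j"
  by (rule mmult_cong) (use assms matsD[OF assms(3)] abelian_monoid_axioms in \<open>auto simp: minverse_def mone_def\<close>)
 also have "\<dots> = B' i j" by (rule mmult_one(2)[OF assms(3,6,7)])
 finally show ?thesis .
qed

text \<open>A matrix with an inverse over \<open>R\<close> is injective on columns over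
  \<open>S\<close>, so \<open>minverse_exists\<close> inside \<open>S\<close> gives an inverse over
  \<open>S\<close>; inverses are unique.\<close>

lemma minverse_in_subfield:
 assumes S: "subfield S R" and A: "A \<in> mats n S" and B: "B \<in> mats n (carrier R)" "minverse R n A B"
 shows "B \<in> mats n S"
proof -
 interpret S: field "R\<lparr>carrier := S\<rparr>" by (rule subfield_iff(2)[OF S])
 note Sr = subfieldE(1)[OF S] and Sc = subfieldE(3)[OF S]
 have Ac: "A \<in> mats n (carrier R)" by (rule mats_mono[OF A Sc])
 have fs: "(\<Oplus>\<^bsub>R\<lparr>carrier := S\<rparr>\<^esub>l\<in>{..<n}. f l) = (\<Oplus>l\<in>{..<n}. f l)" if "\<And>l. l < n \<Longrightarrow> f l \<in> S" for f
  by (rule finsum_carrier_update[OF cring_axioms Sr]) (use that in auto)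
 have mm: "mmult (R\<lparr>carrier := S\<rparr>) n C D i j = mmult R n C D i j"
  if "C \<in> mats n S" "D \<in> mats n S" "i < n" "j < n" for C D i j
  unfolding mmult_def using fs[of "\<lambda>l. C i l \<otimes> D l j"] that subringE(6)[OF Sr] by (auto simp: mats_def)
 obtain W where W: "W \<in> mats n (carrier (R\<lparr>carrier := S\<rparr>))" "minverse (R\<lparr>carrier := S\<rparr>) n A W"
 proof (rule S.minverse_exists[of A n])
  show "A \<in> mats n (carrier (R\<lparr>carrier := S\<rparr>))" using A by simp
  fix c assume c: "c \<in> {..<n} \<rightarrow> carrier (R\<lparr>carrier := S\<rparr>)"
   and 0: "\<And>i. i < n \<Longrightarrow> (\<Oplus>\<^bsub>R\<lparr>carrier := S\<rparr>\<^esub>j\<in>{..<n}. A i j \<otimes>\<^bsub>R\<lparr>carrier := S\<rparr>\<^esub> c j) = \<zero>\<^bsub>R\<lparr>carrier := S\<rparr>\<^esub>"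
  have cS: "c j \<in> S" if "j < n" for j using c that by auto
  define C where "C i j = c i" for i j :: nat
  have C: "C \<in> mats n (carrier R)" using cS Sc by (auto simp: mats_def C_def)
  have AC: "mmult R n A C i j = \<zero>" if "i < n" "j < n" for i j
   using 0[OF that(1)] fs[of "\<lambda>j. A i j \<otimes> c j"] cS matsD[OF A that(1)] subringE(6)[OF Sr]
   by (simp add: mmult_def C_def)
  have "c j = \<zero>" if j: "j < n" for j
  proof -
   have "C j j = mmult R n (mone R) C j j" by (rule mmult_one(2)[OF C j j, symmetric])
   also have "\<dots> = mmult R n (mmult R n B A) C j j"
    by (rule mmult_cong) (use B j matsD[OF C] matsD[OF mmult_closed[OF B(1) Ac]] abelian_monoid_axioms in \<open>auto simp: minverse_def mone_def\<close>)
   also have "\<dots> = mmult R n B (mmult R n A C) j j" by (rule mmult_assoc[OF B(1) Ac C j j])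
   also have "\<dots> = (\<Oplus>l\<in>{..<n}. \<zero>)"
    unfolding mmult_def[of R n B] using AC j matsD[OF B(1)] by (intro finsum_cong') auto
   finally show ?thesis by (simp add: C_def)
  qed
  thus "\<forall>j<n. c j = \<zero>\<^bsub>R\<lparr>carrier := S\<rparr>\<^esub>" by simp
 qed (use that in auto)
 have WS: "W \<in> mats n S" using W(1) by simp
 have "minverse R n A W"
  using W(2) mm[OF A WS] mm[OF WS A] by (simp add: minverse_def mone_def)
 hence "B i j = W i j" if "i < n" "j < n" for i j
  using minverse_unique[OF Ac B(1) mats_mono[OF WS Sc] B(2)] that by auto
 thus ?thesis using WS by (auto simp: mats_def)
qed

end

lemma (in rational_functions) common_denominator:
 assumes "finite J" "\<And>j. j \<in> J \<Longrightarrow> c j \<in> carrier R"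
 shows "\<exists>s\<in>pterms (carrier F) V. peval R h x s \<noteq> \<zero>\<^bsub>R\<^esub> \<and>
  (\<forall>j\<in>J. \<exists>t\<in>pterms (carrier F) V. c j \<otimes>\<^bsub>R\<^esub> peval R h x s = peval R h x t)"
 using assms
proof (induction J rule: finite_induct)
 case empty
 show ?case using ring_hom_one[OF hom] by (intro bexI[of _ "PConst \<one>\<^bsub>F\<^esub>"]) auto
next
 case (insert k J)
 then obtain s where s: "s \<in> pterms (carrier F) V" "peval R h x s \<noteq> \<zero>\<^bsub>R\<^esub>"
  "\<And>j. j \<in> J \<Longrightarrow> \<exists>t\<in>pterms (carrier F) V. c j \<otimes>\<^bsub>R\<^esub> peval R h x s = peval R h x t" by auto
 obtain t u where tu: "t \<in> pterms (carrier F) V" "u \<in> pterms (carrier F) V" "peval R h x u \<noteq> \<zero>\<^bsub>R\<^esub>"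
  "c k \<otimes>\<^bsub>R\<^esub> peval R h x u = peval R h x t" using fraction[of "c k"] insert.prems by auto
 note c = ev_closed[OF s(1)] ev_closed[OF tu(2)] ev_closed[OF tu(1)]
 have ck: "c j \<in> carrier R" if "j \<in> insert k J" for j using insert.prems that .
 show ?case
 proof (rule bexI[of _ "PMul s u"], intro conjI ballI)
  show "peval R h x (PMul s u) \<noteq> \<zero>\<^bsub>R\<^esub>" using s tu c by (simp add: R.integral_iff)
  fix j assume j: "j \<in> insert k J"
  show "\<exists>t\<in>pterms (carrier F) V. c j \<otimes>\<^bsub>R\<^esub> peval R h x (PMul s u) = peval R h x t"
  proof (cases "j = k")
   case True
   have "c k \<otimes>\<^bsub>R\<^esub> peval R h x (PMul s u) = peval R h x s \<otimes>\<^bsub>R\<^esub> (c k \<otimes>\<^bsub>R\<^esub> peval R h x u)"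
    using c ck by (simp add: R.m_lcomm)
   thus ?thesis using True s tu by (intro bexI[of _ "PMul s t"]) auto
  next
   case False
   then obtain t' where t': "t' \<in> pterms (carrier F) V" "c j \<otimes>\<^bsub>R\<^esub> peval R h x s = peval R h x t'"
    using s(3) j by auto
   have "c j \<otimes>\<^bsub>R\<^esub> peval R h x (PMul s u) = (c j \<otimes>\<^bsub>R\<^esub> peval R h x s) \<otimes>\<^bsub>R\<^esub> peval R h x u"
    using c ck[OF j] by (simp add: R.m_assoc)
   thus ?thesis using t' tu by (intro bexI[of _ "PMul t' u"]) auto
  qed
 qed (use s tu in auto)
qed

text \<open>If \<open>x c = 0\<close>, then translating \<open>x\<close> by an elementary matrix \<open>e\<^sub>i\<^sub>j\<close> gives \<open>x c' = - e\<^sub>i c'\<^sub>j\<close>;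
 so \<open>c \<noteq> 0\<close> forces all \<open>e\<^sub>i\<close> into the image of \<open>x\<close>.\<close>

lemma generic_matrix_invertible:
 fixes F :: "('f, 'm) ring_scheme" and R :: "('r, 's) ring_scheme"
 assumes "rational_functions F R ({..<n} \<times> {..<n}) h x"
 obtains W where "W \<in> mats n (carrier R)" "minverse R n (\<lambda>i j. x (i, j)) W"
proof -
 define V where V: "V = {..<n} \<times> {..<n}"
 interpret rational_functions F R V h x using assms by (simp add: V)
 let ?X = "\<lambda>i j. x (i, j)"
 have X: "?X \<in> mats n (carrier R)" using vars_closed by (auto simp: V mats_def)
 note xc = matsD[OF X]
 have "\<forall>j<n. c j = \<zero>\<^bsub>R\<^esub>"
  if c: "c \<in> {..<n} \<rightarrow> carrier R" and rel: "\<And>i. i < n \<Longrightarrow> (\<Oplus>\<^bsub>R\<^esub>j\<in>{..<n}. x (i, j) \<otimes>\<^bsub>R\<^esub> c j) = \<zero>\<^bsub>R\<^esub>" for c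
 proof (rule ccontr)
  assume "\<not> (\<forall>j<n. c j = \<zero>\<^bsub>R\<^esub>)"
  then obtain j where j: "j < n" "c j \<noteq> \<zero>\<^bsub>R\<^esub>" by auto
  have cc: "c j \<in> carrier R" if "j < n" for j using c that by auto
  have "\<exists>u. (\<forall>l<n. u l \<in> carrier R) \<and> (\<forall>k<n. (\<Oplus>\<^bsub>R\<^esub>l\<in>{..<n}. x (k, l) \<otimes>\<^bsub>R\<^esub> u l) = mone R k i)" if i: "i < n" for i
  proof -
   \<comment> \<open>The elementary matrix with entry 1 at \<open>(i, j)\<close>. Translation by it
     permutes the points over \<open>F\<close>, so it takes the generic point to a generic
     point.\<close>
   define \<delta> where "\<delta> v = (if v = (i, j) then \<one>\<^bsub>F\<^esub> else \<zero>\<^bsub>F\<^esub>)" for v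
   define y where "y = (\<lambda>v. x v \<oplus>\<^bsub>R\<^esub> h (\<delta> v))"
   have \<delta>: "\<delta> v \<in> carrier F" for v by (simp add: \<delta>_def)
   have y: "y \<in> V \<rightarrow> carrier R" using vars_closed h_closed \<delta> by (auto simp: y_def Pi_iff)
   obtain ev where ev: "ev \<in> ring_hom R R" "\<And>t. t \<in> pterms (carrier F) V \<Longrightarrow> ev (peval R h x t) = peval R h y t"
   proof (rule generic_evaluation[OF R.field_axioms hom y])
    fix t assume t: "t \<in> pterms (carrier F) V" and 0: "peval R h y t = \<zero>\<^bsub>R\<^esub>"
    let ?t = "psubst (\<lambda>v. PAdd (PVar v) (PConst (\<delta> v))) t"
    have "?t \<in> pterms (carrier F) V" by (rule psubst_in_pterms[OF t]) (simp add: \<delta>)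
    from vanishing[OF this] have z: "peval F (\<lambda>c. c) (\<lambda>v. g v \<oplus>\<^bsub>F\<^esub> \<delta> v) t = \<zero>\<^bsub>F\<^esub>" if "g \<in> V \<rightarrow> carrier F" for g
     using 0 that by (simp add: peval_psubst y_def)
    have "peval F (\<lambda>c. c) g t = \<zero>\<^bsub>F\<^esub>" if g: "g \<in> V \<rightarrow> carrier F" for g
    proof -
     have "peval F (\<lambda>c. c) g t = peval F (\<lambda>c. c) (\<lambda>v. (g v \<ominus>\<^bsub>F\<^esub> \<delta> v) \<oplus>\<^bsub>F\<^esub> \<delta> v) t"
      by (rule peval_cong[OF t]) (use g \<delta> in \<open>auto simp: F.minus_eq F.a_assoc F.l_neg Pi_iff\<close>)
     also have "\<dots> = \<zero>\<^bsub>F\<^esub>" by (rule z) (use g \<delta> in auto)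
     finally show ?thesis .
    qed
    thus "peval R h x t = \<zero>\<^bsub>R\<^esub>" using vanishing[OF t] by simp
   qed (use that in auto)
   interpret ev: ring_hom_cring R R ev
    using ev(1) by (intro ring_hom_cring.intro ring_hom_cring_axioms.intro R.cring_axioms)
   have hd: "h (\<delta> (k, l)) = (if j = l \<and> k = i then \<one>\<^bsub>R\<^esub> else \<zero>\<^bsub>R\<^esub>)" for k l
    using ring_hom_one[OF hom] ring_hom_zero[OF hom F.ring_axioms R.ring_axioms] by (auto simp: \<delta>_def)
   have evx: "ev (x (k, l)) = x (k, l) \<oplus>\<^bsub>R\<^esub> h (\<delta> (k, l))" if "k < n" "l < n" for k l
    using ev(2)[of "PVar (k, l)"] that by (simp add: V y_def)
   let ?c = "\<lambda>l. ev (c l)" and ?s = "\<lambda>k. \<Oplus>\<^bsub>R\<^esub>l\<in>{..<n}. x (k, l) \<otimes>\<^bsub>R\<^esub> ev (c l)"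
   have s: "?s k \<in> carrier R" if "k < n" for k using xc[OF that] cc by (auto intro!: R.finsum_closed)
   have rel': "?s k \<oplus>\<^bsub>R\<^esub> (if k = i then ?c j else \<zero>\<^bsub>R\<^esub>) = \<zero>\<^bsub>R\<^esub>" if k: "k < n" for k
   proof -
    have "\<zero>\<^bsub>R\<^esub> = ev (\<Oplus>\<^bsub>R\<^esub>l\<in>{..<n}. x (k, l) \<otimes>\<^bsub>R\<^esub> c l)" using rel[OF k] by simp
    also have "\<dots> = finsum R (ev \<circ> (\<lambda>l. x (k, l) \<otimes>\<^bsub>R\<^esub> c l)) {..<n}"
     by (rule ev.hom_finsum) (use xc[OF k] cc in auto)
    also have "\<dots> = (\<Oplus>\<^bsub>R\<^esub>l\<in>{..<n}. x (k, l) \<otimes>\<^bsub>R\<^esub> ?c l \<oplus>\<^bsub>R\<^esub> (if j = l then if k = i then ?c l else \<zero>\<^bsub>R\<^esub> else \<zero>\<^bsub>R\<^esub>))"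
     by (rule R.finsum_cong') (use xc[OF k] cc k in \<open>auto simp: evx hd R.l_distr\<close>)
    also have "\<dots> = ?s k \<oplus>\<^bsub>R\<^esub> (\<Oplus>\<^bsub>R\<^esub>l\<in>{..<n}. if j = l then if k = i then ?c l else \<zero>\<^bsub>R\<^esub> else \<zero>\<^bsub>R\<^esub>)"
     by (rule R.finsum_addf) (use xc[OF k] cc in auto)
    also have "(\<Oplus>\<^bsub>R\<^esub>l\<in>{..<n}. if j = l then if k = i then ?c l else \<zero>\<^bsub>R\<^esub> else \<zero>\<^bsub>R\<^esub>) = (if k = i then ?c j else \<zero>\<^bsub>R\<^esub>)"
     by (rule R.finsum_delta) (use j cc in auto)
    finally show ?thesis by simp
   qed
   have cj: "?c j \<in> carrier R" "?c j \<noteq> \<zero>\<^bsub>R\<^esub>"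
    using cc j inj_on_eq_iff[OF field_hom_inj[OF R.field_axioms R.field_axioms ev(1)], of "c j" "\<zero>\<^bsub>R\<^esub>"] by auto
   \<comment> \<open>The factor that turns the relation for the translated matrix into an equation
     with the unit vector \<open>e_i\<close> on the right.\<close>
   let ?w = "\<ominus>\<^bsub>R\<^esub> (inv\<^bsub>R\<^esub> ?c j)"
   have w: "?w \<in> carrier R" "?c j \<otimes>\<^bsub>R\<^esub> ?w = \<ominus>\<^bsub>R\<^esub> \<one>\<^bsub>R\<^esub>"
    using R.inv_closed_nonzero[OF cj] R.mult_inv[OF cj] cj by (simp_all add: R.r_minus)
   have "(\<Oplus>\<^bsub>R\<^esub>l\<in>{..<n}. x (k, l) \<otimes>\<^bsub>R\<^esub> (?c l \<otimes>\<^bsub>R\<^esub> ?w)) = mone R k i" if k: "k < n" for k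
   proof -
    have "(\<Oplus>\<^bsub>R\<^esub>l\<in>{..<n}. x (k, l) \<otimes>\<^bsub>R\<^esub> (?c l \<otimes>\<^bsub>R\<^esub> ?w)) = (\<Oplus>\<^bsub>R\<^esub>l\<in>{..<n}. x (k, l) \<otimes>\<^bsub>R\<^esub> ?c l \<otimes>\<^bsub>R\<^esub> ?w)"
     using xc[OF k] cc w by (intro R.finsum_cong') (auto simp: R.m_assoc)
    also have "\<dots> = ?s k \<otimes>\<^bsub>R\<^esub> ?w" by (rule R.finsum_ldistr[symmetric]) (use xc[OF k] cc w in auto)
    also have "?s k = \<ominus>\<^bsub>R\<^esub> (if k = i then ?c j else \<zero>\<^bsub>R\<^esub>)"
     by (rule R.sum_zero_eq_neg[OF s[OF k] _ rel'[OF k]]) (use cj in auto)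
    finally show ?thesis using w cj by (simp add: mone_def R.l_minus)
   qed
   thus ?thesis using cc w by (intro exI[of _ "\<lambda>l. ?c l \<otimes>\<^bsub>R\<^esub> ?w"]) auto
  qed
  \<comment> \<open>The preimages of the unit vectors form a right inverse \<open>U\<close> of
    \<open>x\<close>. So \<open>U\<close> is injective and has an inverse \<open>B\<close>; then
    \<open>B c = x U B c = x c = 0\<close> and \<open>c = U B c = 0\<close>, contrary to the choice
    of \<open>c\<close>.\<close>
  then obtain U where U: "\<And>i l. i < n \<Longrightarrow> l < n \<Longrightarrow> U i l \<in> carrier R"
   "\<And>i k. i < n \<Longrightarrow> k < n \<Longrightarrow> (\<Oplus>\<^bsub>R\<^esub>l\<in>{..<n}. x (k, l) \<otimes>\<^bsub>R\<^esub> U i l) = mone R k i" by metis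
  let ?U = "\<lambda>l i. U i l" and ?C = "\<lambda>l _. c l"
  have UM: "?U \<in> mats n (carrier R)" using U(1) by (simp add: mats_def)
  have XU: "mmult R n ?X ?U k i = mone R k i" if "k < n" "i < n" for k i
   using U(2)[OF that(2,1)] by (simp add: mmult_def)
  have assoc: "mmult R n ?X (mmult R n ?U D) k m = D k m" if D: "D \<in> mats n (carrier R)" "k < n" "m < n" for D k m
  proof -
   have "mmult R n ?X (mmult R n ?U D) k m = mmult R n (mmult R n ?X ?U) D k m"
    by (rule R.mmult_assoc[OF X UM that, symmetric])
   also have "\<dots> = mmult R n (mone R) D k m"
    by (rule mmult_cong) (use XU that matsD[OF D(1)] R.abelian_monoid_axioms in \<open>auto simp: mone_def\<close>)
   finally show ?thesis using R.mmult_one(2)[OF that] by simp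
  qed
  have zero: "mmult R n B D k m = \<zero>\<^bsub>R\<^esub>"
   if "B \<in> mats n (carrier R)" "\<And>l. l < n \<Longrightarrow> D l m = \<zero>\<^bsub>R\<^esub>" "k < n" for B D k m
   unfolding mmult_def using that matsD[OF that(1,3)] by (intro R.add.finprod_one_eqI) auto
  obtain B where B: "B \<in> mats n (carrier R)" "minverse R n ?U B"
  proof (rule R.minverse_exists[OF UM])
   fix b assume b: "b \<in> {..<n} \<rightarrow> carrier R" and 0: "\<And>i. i < n \<Longrightarrow> (\<Oplus>\<^bsub>R\<^esub>l\<in>{..<n}. U l i \<otimes>\<^bsub>R\<^esub> b l) = \<zero>\<^bsub>R\<^esub>"
   have bM: "(\<lambda>l _. b l) \<in> mats n (carrier R)" using b by (auto simp: mats_def)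
   show "\<forall>k<n. b k = \<zero>\<^bsub>R\<^esub>"
   proof (intro allI impI)
    fix k assume k: "k < n"
    have "mmult R n ?X (mmult R n ?U (\<lambda>l _. b l)) k k = \<zero>\<^bsub>R\<^esub>"
     by (rule zero[OF X _ k]) (use 0 in \<open>simp add: mmult_def\<close>)
    thus "b k = \<zero>\<^bsub>R\<^esub>" using assoc[OF bM k k] by simp
   qed
  qed (use that in auto)
  have C: "?C \<in> mats n (carrier R)" using cc by (simp add: mats_def)
  note BC = R.mmult_closed[OF B(1) C]
  have BC0: "mmult R n B ?C l j = \<zero>\<^bsub>R\<^esub>" if l: "l < n" for l
  proof -
   have "mmult R n B ?C l j = mmult R n ?X (mmult R n ?U (mmult R n B ?C)) l j" using assoc[OF BC l j(1)] by simp
   also have "\<dots> = mmult R n ?X ?C l j"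
    by (rule mmult_cong) (use R.minverse_cancel(1)[OF UM B C] j(1) l xc cc R.abelian_monoid_axioms in auto)
   also have "\<dots> = \<zero>\<^bsub>R\<^esub>" using rel[OF l] by (simp add: mmult_def)
   finally show ?thesis .
  qed
  have "c j = mmult R n ?U (mmult R n B ?C) j j" using R.minverse_cancel(1)[OF UM B C j(1) j(1)] by simp
  also have "\<dots> = \<zero>\<^bsub>R\<^esub>" by (rule zero[OF UM _ j(1)]) (rule BC0)
  finally show False using j(2) by simp
 qed
 from R.minverse_exists[OF X this] show thesis using that by auto
qed

section \<open>Specialisation of constants\<close>

lemma (in ring) finsum_Plus:
 assumes "finite I" "finite J" "f \<in> I <+> J \<rightarrow> carrier R"
 shows "(\<Oplus>u\<in>I <+> J. f u) = (\<Oplus>i\<in>I. f (Inl i)) \<oplus> (\<Oplus>j\<in>J. f (Inr j))"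
proof -
 have "(\<Oplus>u\<in>I <+> J. f u) = (\<Oplus>u\<in>Inl ` I. f u) \<oplus> (\<Oplus>u\<in>Inr ` J. f u)"
  unfolding Plus_def by (rule finsum_Un_disjoint) (use assms in auto)
 also have "(\<Oplus>u\<in>Inl ` I. f u) = (\<Oplus>i\<in>I. f (Inl i))" by (subst finsum_reindex) (use assms in auto)
 also have "(\<Oplus>u\<in>Inr ` J. f u) = (\<Oplus>j\<in>J. f (Inr j))" by (subst finsum_reindex) (use assms in auto)
 finally show ?thesis .
qed

text \<open>As \<open>K0\<close> and \<open>A\<close> are linearly disjoint, a point of \<open>A\<close> extends to a retraction \<open>K0[A] \<rightarrow> K0\<close>.\<close>

locale constant_ring = differential_field L d for L (structure) and d +
 fixes K0 A
 assumes K0: "subfield K0 L" "d ` K0 \<subseteq> K0"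
  and A: "subring A L" "A \<subseteq> constants L d" "K0 \<inter> constants L d \<subseteq> A"
begin

abbreviation "k\<^sub>0 \<equiv> K0 \<inter> constants L d"

lemma k\<^sub>0: "subfield k\<^sub>0 L"
 using K0(1) constants_subfield subfield_m_inv(1)[OF K0(1)] subfield_m_inv(1)[OF constants_subfield]
 by (intro subfieldI' subring_inter) (auto intro: subfieldE(1))

lemma carriers: "K0 \<subseteq> carrier L" "A \<subseteq> carrier L"
 using subfieldE(3)[OF K0(1)] subringE(1)[OF A(1)] by auto

text \<open>Independence over \<open>k\<^sub>0\<close>, which for families in \<open>K0\<close> is
  the same as independence over all constants (\<open>indepD\<close>).\<close>

definition indep :: "'i set \<Rightarrow> ('i \<Rightarrow> 'a) \<Rightarrow> bool" where
 "indep I l \<longleftrightarrow> (\<forall>g \<in> I \<rightarrow> k\<^sub>0. (\<Oplus>i\<in>I. l i \<otimes> g i) = \<zero> \<longrightarrow> (\<forall>i\<in>I. g i = \<zero>))"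

lemma indepD:
 assumes "indep I l" "finite I" "l \<in> I \<rightarrow> K0" "c \<in> I \<rightarrow> constants L d" "(\<Oplus>i\<in>I. l i \<otimes> c i) = \<zero>" "i \<in> I"
 shows "c i = \<zero>"
 using independent_over_constants[OF K0 assms(2,3,4) _ assms(5)] assms(1,6) unfolding indep_def by auto

lemma not_indep_eliminate:
 assumes "\<not> indep I l" "finite I" "l \<in> I \<rightarrow> K0"
 obtains j e where "j \<in> I" "e \<in> I \<rightarrow> k\<^sub>0"
  "\<forall>z\<in>I \<rightarrow> carrier L. (\<Oplus>i\<in>I - {j}. l i \<otimes> (z i \<oplus> e i \<otimes> z j)) = (\<Oplus>i\<in>I. l i \<otimes> z i)"
proof -
 obtain g j where g: "g \<in> I \<rightarrow> k\<^sub>0" "(\<Oplus>i\<in>I. l i \<otimes> g i) = \<zero>" "j \<in> I" "g j \<noteq> \<zero>"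
  using assms(1) unfolding indep_def by auto
 show thesis
 proof (rule dependent_family_eliminate[OF k\<^sub>0 assms(2) _ g])
  show "l \<in> I \<rightarrow> carrier L" using assms(3) carriers by auto
 qed (use that g(3) in simp)
qed

lemma sum_in_generated:
 assumes "s \<in> generate_ring L (K0 \<union> A)"
 shows "\<exists>(I::nat set) l c. finite I \<and> l \<in> I \<rightarrow> K0 \<and> c \<in> I \<rightarrow> A \<and> s = (\<Oplus>i\<in>I. l i \<otimes> c i)"
proof -
 obtain zs where zs: "set zs \<subseteq> K0 \<times> A" "s = lcomb zs"
  using generate_ring_lcomb[OF subfieldE(1)[OF K0(1)] A(1) assms] by auto
 have "set zs \<subseteq> carrier L \<times> carrier L" using zs(1) carriers by auto
 moreover have "fst (zs ! i) \<in> K0" "snd (zs ! i) \<in> A" if "i < length zs" for i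
  using nth_mem[OF that] zs(1) by auto
 ultimately show ?thesis using zs(2)
  by (intro exI[of _ "{..<length zs}"] exI[of _ "\<lambda>i. fst (zs ! i)"] exI[of _ "\<lambda>i. snd (zs ! i)"])
   (auto simp: lcomb_finsum)
qed

text \<open>Eliminating dependent members shortens the sum until the family is independent; the
  coefficients stay in \<open>A\<close> because \<open>A\<close> contains
  \<open>k\<^sub>0\<close>.\<close>

lemma independent_sum_in_generated:
 assumes "s \<in> generate_ring L (K0 \<union> A)"
 shows "\<exists>(I::nat set) l c. finite I \<and> l \<in> I \<rightarrow> K0 \<and> c \<in> I \<rightarrow> A \<and> indep I l \<and> s = (\<Oplus>i\<in>I. l i \<otimes> c i)"
proof -
 have reduce: "\<exists>J l c. finite (J::nat set) \<and> l \<in> J \<rightarrow> K0 \<and> c \<in> J \<rightarrow> A \<and> indep J l \<and> s = (\<Oplus>i\<in>J. l i \<otimes> c i)"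
  if "finite I" "l \<in> I \<rightarrow> K0" "c \<in> I \<rightarrow> A" "s = (\<Oplus>i\<in>I. l i \<otimes> c i)" for I :: "nat set" and l c
  using that
 proof (induction "card I" arbitrary: I c rule: less_induct)
  case less
  show ?case
  proof (cases "indep I l")
   case True
   thus ?thesis using less.prems by (intro exI[of _ I] exI[of _ l] exI[of _ c]) simp
  next
   case False
   obtain j e where je: "j \<in> I" "e \<in> I \<rightarrow> k\<^sub>0" and
    red: "\<forall>z\<in>I \<rightarrow> carrier L. (\<Oplus>i\<in>I - {j}. l i \<otimes> (z i \<oplus> e i \<otimes> z j)) = (\<Oplus>i\<in>I. l i \<otimes> z i)"
    by (rule not_indep_eliminate[OF False less.prems(1,2)])
   have "c \<in> I \<rightarrow> carrier L" using less.prems(3) carriers by auto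
   from bspec[OF red this] have "s = (\<Oplus>i\<in>I - {j}. l i \<otimes> (c i \<oplus> e i \<otimes> c j))" using less.prems(4) by simp
   moreover have "card (I - {j}) < card I" using je(1) less.prems(1) by (metis card_Diff1_less)
   moreover have "(\<lambda>i. c i \<oplus> e i \<otimes> c j) \<in> I - {j} \<rightarrow> A"
    using less.prems(3) je A(3) subringE(6,7)[OF A(1)] by (auto simp: Pi_iff)
   ultimately show ?thesis using less.hyps[of "I - {j}"] less.prems by auto
  qed
 qed
 show ?thesis using sum_in_generated[OF assms] by (elim exE conjE) (rule reduce)
qed

end

locale constant_point = constant_ring +
 fixes \<chi>
 assumes \<chi>: "\<chi> \<in> ring_hom (L\<lparr>carrier := A\<rparr>) (L\<lparr>carrier := k\<^sub>0\<rparr>)" "\<And>c. c \<in> k\<^sub>0 \<Longrightarrow> \<chi> c = c"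
begin

lemma \<chi>_closed: "c \<in> A \<Longrightarrow> \<chi> c \<in> k\<^sub>0"
 and \<chi>_add: "a \<in> A \<Longrightarrow> b \<in> A \<Longrightarrow> \<chi> (a \<oplus> b) = \<chi> a \<oplus> \<chi> b"
 and \<chi>_mult: "a \<in> A \<Longrightarrow> b \<in> A \<Longrightarrow> \<chi> (a \<otimes> b) = \<chi> a \<otimes> \<chi> b"
 using \<chi>(1) by (auto simp: ring_hom_def)

text \<open>A relation over an independent family is trivial. A dependent family is shortened by
  coefficients from \<open>k\<^sub>0\<close>; these are fixed by \<open>\<chi>\<close>, so the
  shortening commutes with \<open>\<chi>\<close>.\<close>

lemma point_well_defined:
 assumes "finite I" "l \<in> I \<rightarrow> K0" "c \<in> I \<rightarrow> A" "(\<Oplus>i\<in>I. l i \<otimes> c i) = \<zero>"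
 shows "(\<Oplus>i\<in>I. l i \<otimes> \<chi> (c i)) = \<zero>"
 using assms
proof (induction "card I" arbitrary: I c rule: less_induct)
 case less
 have lc: "l i \<in> carrier L" "c i \<in> carrier L" "c i \<in> A" "\<chi> (c i) \<in> k\<^sub>0" "\<chi> (c i) \<in> carrier L" if "i \<in> I" for i
  using less.prems(2,3) that carriers \<chi>_closed by (auto simp: Pi_iff)
 show ?case
 proof (cases "indep I l")
  case True
  have "c i = \<zero>" if "i \<in> I" for i
   by (rule indepD[OF True less.prems(1,2) _ less.prems(4) that]) (use less.prems(3) A(2) in auto)
  moreover have "\<chi> \<zero> = \<zero>" using \<chi>(2)[of \<zero>] subringE(2)[OF subfieldE(1)[OF k\<^sub>0]] by simp
  ultimately have "(\<Oplus>i\<in>I. l i \<otimes> \<chi> (c i)) = (\<Oplus>i\<in>I. \<zero>)"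
   using lc by (intro finsum_cong') auto
  thus ?thesis by simp
 next
  case False
  obtain j e where je: "j \<in> I" "e \<in> I \<rightarrow> k\<^sub>0" and
   red: "\<forall>z\<in>I \<rightarrow> carrier L. (\<Oplus>i\<in>I - {j}. l i \<otimes> (z i \<oplus> e i \<otimes> z j)) = (\<Oplus>i\<in>I. l i \<otimes> z i)"
   by (rule not_indep_eliminate[OF False less.prems(1,2)])
  have e: "e i \<in> k\<^sub>0" "e i \<in> A" "e i \<in> carrier L" if "i \<in> I" for i using je(2) that A(3) carriers by (auto simp: Pi_iff)
  have "(\<Oplus>i\<in>I - {j}. l i \<otimes> \<chi> (c i \<oplus> e i \<otimes> c j)) = \<zero>"
  proof (rule less.hyps)
   show "card (I - {j}) < card I" using je(1) less.prems(1) by (metis card_Diff1_less)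
   show "(\<lambda>i. c i \<oplus> e i \<otimes> c j) \<in> I - {j} \<rightarrow> A"
    using lc e je(1) subringE(6,7)[OF A(1)] by auto
   show "(\<Oplus>i\<in>I - {j}. l i \<otimes> (c i \<oplus> e i \<otimes> c j)) = \<zero>"
    using bspec[OF red, of c] lc less.prems(4) by auto
  qed (use less.prems in auto)
  moreover have "\<chi> (c i \<oplus> e i \<otimes> c j) = \<chi> (c i) \<oplus> e i \<otimes> \<chi> (c j)" if "i \<in> I" for i
   using lc[OF that] e[OF that] lc[OF je(1)] \<chi>(2) subringE(6)[OF A(1)] by (simp add: \<chi>_add \<chi>_mult)
  ultimately have "(\<Oplus>i\<in>I - {j}. l i \<otimes> (\<chi> (c i) \<oplus> e i \<otimes> \<chi> (c j))) = \<zero>"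
   using lc e je(1) by (subst finsum_cong'[where g = "\<lambda>i. l i \<otimes> \<chi> (c i \<oplus> e i \<otimes> c j)"]) auto
  thus ?thesis using bspec[OF red, of "\<lambda>i. \<chi> (c i)"] lc by auto
 qed
qed

text \<open>The difference of two presentations is a relation over the disjoint union of their index
  sets, to which \<open>point_well_defined\<close> applies.\<close>

lemma point_well_defined2:
 assumes I: "finite I" "l \<in> I \<rightarrow> K0" "c \<in> I \<rightarrow> A" and J: "finite J" "l' \<in> J \<rightarrow> K0" "c' \<in> J \<rightarrow> A"
  and eq: "(\<Oplus>i\<in>I. l i \<otimes> c i) = (\<Oplus>i\<in>J. l' i \<otimes> c' i)"
 shows "(\<Oplus>i\<in>I. l i \<otimes> \<chi> (c i)) = (\<Oplus>i\<in>J. l' i \<otimes> \<chi> (c' i))"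
proof -
 let ?U = "I <+> J"
 let ?l = "case_sum l (\<lambda>i. \<ominus> l' i)" and ?c = "case_sum c c'"
 note Kr = subfieldE(1)[OF K0(1)]
 have sum: "(\<Oplus>u\<in>?U. ?l u \<otimes> f u) = (\<Oplus>i\<in>I. l i \<otimes> f (Inl i)) \<oplus> \<ominus> (\<Oplus>j\<in>J. l' j \<otimes> f (Inr j))"
  if f: "f \<in> ?U \<rightarrow> carrier L" for f
 proof -
  have c: "l i \<in> carrier L" "f (Inl i) \<in> carrier L" if "i \<in> I" for i using I(2) that f carriers by (auto simp: Pi_iff)
  have c': "l' i \<in> carrier L" "f (Inr i) \<in> carrier L" if "i \<in> J" for i using J(2) that f carriers by (auto simp: Pi_iff)
  have "(\<Oplus>u\<in>?U. ?l u \<otimes> f u) = (\<Oplus>i\<in>I. l i \<otimes> f (Inl i)) \<oplus> (\<Oplus>j\<in>J. \<ominus> l' j \<otimes> f (Inr j))"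
   by (subst finsum_Plus) (use I J c c' in auto)
  also have "(\<Oplus>j\<in>J. \<ominus> l' j \<otimes> f (Inr j)) = (\<Oplus>j\<in>J. \<ominus> \<one> \<otimes> (l' j \<otimes> f (Inr j)))"
   by (rule finsum_cong') (use c' in \<open>auto simp: l_minus\<close>)
  also have "\<dots> = \<ominus> \<one> \<otimes> (\<Oplus>j\<in>J. l' j \<otimes> f (Inr j))"
   by (rule finsum_rdistr[symmetric]) (use J c' in auto)
  also have "\<dots> = \<ominus> (\<Oplus>j\<in>J. l' j \<otimes> f (Inr j))"
   using c' by (simp add: l_minus)
  finally show ?thesis .
 qed
 have c: "l i \<in> carrier L" "c i \<in> carrier L" "\<chi> (c i) \<in> carrier L" if "i \<in> I" for i
  using I that carriers \<chi>_closed by (auto simp: Pi_iff)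
 have c': "l' i \<in> carrier L" "c' i \<in> carrier L" "\<chi> (c' i) \<in> carrier L" if "i \<in> J" for i
  using J that carriers \<chi>_closed by (auto simp: Pi_iff)
 have "(\<Oplus>u\<in>?U. ?l u \<otimes> \<chi> (?c u)) = \<zero>"
 proof (rule point_well_defined)
  show "?l \<in> ?U \<rightarrow> K0" using I J subringE(5)[OF Kr] by (auto simp: Pi_iff)
  show "?c \<in> ?U \<rightarrow> A" using I J by auto
  have "?c \<in> ?U \<rightarrow> carrier L" using c c' by auto
  from sum[OF this] show "(\<Oplus>u\<in>?U. ?l u \<otimes> ?c u) = \<zero>" using eq c c' by (simp add: r_neg)
 qed (use I J in auto)
 moreover have "(\<lambda>u. \<chi> (?c u)) \<in> ?U \<rightarrow> carrier L" using c c' by auto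
 ultimately have "(\<Oplus>i\<in>I. l i \<otimes> \<chi> (c i)) \<oplus> \<ominus> (\<Oplus>j\<in>J. l' j \<otimes> \<chi> (c' j)) = \<zero>" using sum by simp
 moreover have "(\<Oplus>i\<in>I. l i \<otimes> \<chi> (c i)) \<in> carrier L" "(\<Oplus>j\<in>J. l' j \<otimes> \<chi> (c' j)) \<in> carrier L"
  using c c' by (auto intro!: finsum_closed)
 ultimately have "(\<Oplus>i\<in>I. l i \<otimes> \<chi> (c i)) = \<ominus> (\<ominus> (\<Oplus>j\<in>J. l' j \<otimes> \<chi> (c' j)))"
  by (intro sum_zero_eq_neg) simp_all
 with \<open>(\<Oplus>j\<in>J. l' j \<otimes> \<chi> (c' j)) \<in> carrier L\<close> show ?thesis by simp
qed

text \<open>The retraction of \<open>K0[A]\<close> onto \<open>K0\<close> that extends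
  \<open>\<chi>\<close>. Index sets consist of natural numbers because a definition cannot quantify
  over index types.\<close>

definition \<psi> where
 "\<psi> s = (SOME b. \<exists>(I::nat set) l c. finite I \<and> l \<in> I \<rightarrow> K0 \<and> c \<in> I \<rightarrow> A \<and> s = (\<Oplus>i\<in>I. l i \<otimes> c i) \<and>
  b = (\<Oplus>i\<in>I. l i \<otimes> \<chi> (c i)))"

lemma \<psi>_sum:
 assumes "finite I" "l \<in> I \<rightarrow> K0" "c \<in> I \<rightarrow> A"
 shows "\<psi> (\<Oplus>i\<in>I. l i \<otimes> c i) = (\<Oplus>i\<in>I. l i \<otimes> \<chi> (c i))"
proof -
 have sc: "l i \<otimes> c i \<in> generate_ring L (K0 \<union> A)" if "i \<in> I" for i
  using assms(2,3) that by (intro generate_ring.eng_mult generate_ring.incl) auto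
 have "(\<Oplus>i\<in>I. l i \<otimes> c i) \<in> generate_ring L (K0 \<union> A)"
  using carriers by (intro finsum_subring generate_ring_is_subring assms sc) auto
 from sum_in_generated[OF this]
 have "\<exists>b. \<exists>(J::nat set) l' c'. finite J \<and> l' \<in> J \<rightarrow> K0 \<and> c' \<in> J \<rightarrow> A \<and>
  (\<Oplus>i\<in>I. l i \<otimes> c i) = (\<Oplus>i\<in>J. l' i \<otimes> c' i) \<and> b = (\<Oplus>i\<in>J. l' i \<otimes> \<chi> (c' i))"
  by (elim exE conjE) (intro exI conjI, assumption+, rule refl)
 from someI_ex[OF this, folded \<psi>_def] obtain J l' c' where
  J: "finite (J :: nat set)" "l' \<in> J \<rightarrow> K0" "c' \<in> J \<rightarrow> A" "(\<Oplus>i\<in>I. l i \<otimes> c i) = (\<Oplus>i\<in>J. l' i \<otimes> c' i)"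
  "\<psi> (\<Oplus>i\<in>I. l i \<otimes> c i) = (\<Oplus>i\<in>J. l' i \<otimes> \<chi> (c' i))" by auto
 show ?thesis unfolding J(5) by (rule point_well_defined2[OF assms J(1-4), symmetric])
qed

lemma \<psi>_product: "a \<in> K0 \<Longrightarrow> c \<in> A \<Longrightarrow> \<psi> (a \<otimes> c) = a \<otimes> \<chi> c"
proof -
 assume a: "a \<in> K0" and c: "c \<in> A"
 have "\<psi> (\<Oplus>i\<in>{0::nat}. a \<otimes> c) = (\<Oplus>i\<in>{0::nat}. a \<otimes> \<chi> c)"
  by (rule \<psi>_sum[of "{0::nat}" "\<lambda>_. a" "\<lambda>_. c"]) (use a c in auto)
 thus ?thesis using a c carriers \<chi>_closed[OF c] by (simp add: subset_iff)
qed

lemma \<psi>_id: "a \<in> K0 \<Longrightarrow> \<psi> a = a"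
 using \<psi>_product[of a \<one>] \<chi>(2)[of \<one>] subringE(3)[OF A(1)] subringE(3)[OF subfieldE(1)[OF k\<^sub>0]] carriers by auto

lemma \<psi>_\<chi>: "c \<in> A \<Longrightarrow> \<psi> c = \<chi> c"
 using \<psi>_product[of \<one> c] subringE(3)[OF subfieldE(1)[OF K0(1)]] carriers \<chi>_closed[of c] by (auto simp: subset_iff)

lemma \<psi>_closed: "s \<in> generate_ring L (K0 \<union> A) \<Longrightarrow> \<psi> s \<in> K0"
proof -
 assume "s \<in> generate_ring L (K0 \<union> A)"
 from sum_in_generated[OF this] obtain I l c where
  I: "finite (I :: nat set)" "l \<in> I \<rightarrow> K0" "c \<in> I \<rightarrow> A" "s = (\<Oplus>i\<in>I. l i \<otimes> c i)" by auto
 note Kr = subfieldE(1)[OF K0(1)]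
 have "l i \<otimes> \<chi> (c i) \<in> K0" if "i \<in> I" for i
  using I(2,3) that \<chi>_closed subringE(6)[OF Kr] by (auto simp: Pi_iff)
 thus "\<psi> s \<in> K0" unfolding I(4) \<psi>_sum[OF I(1-3)] by (intro finsum_subring[OF Kr I(1)])
qed

lemma \<psi>_add:
 assumes "s \<in> generate_ring L (K0 \<union> A)" "t \<in> generate_ring L (K0 \<union> A)"
 shows "\<psi> (s \<oplus> t) = \<psi> s \<oplus> \<psi> t"
proof -
 obtain I l c where I: "finite (I :: nat set)" "l \<in> I \<rightarrow> K0" "c \<in> I \<rightarrow> A" "s = (\<Oplus>i\<in>I. l i \<otimes> c i)"
  using sum_in_generated[OF assms(1)] by auto
 obtain J l' c' where J: "finite (J :: nat set)" "l' \<in> J \<rightarrow> K0" "c' \<in> J \<rightarrow> A" "t = (\<Oplus>i\<in>J. l' i \<otimes> c' i)"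
  using sum_in_generated[OF assms(2)] by auto
 let ?U = "I <+> J"
 let ?l = "case_sum l l'" and ?c = "case_sum c c'"
 have lK: "?l \<in> ?U \<rightarrow> K0" "?c \<in> ?U \<rightarrow> A" "finite ?U" using I J by auto
 have sum: "(\<Oplus>u\<in>?U. ?l u \<otimes> f u) = (\<Oplus>i\<in>I. l i \<otimes> f (Inl i)) \<oplus> (\<Oplus>j\<in>J. l' j \<otimes> f (Inr j))"
  if f: "f \<in> ?U \<rightarrow> carrier L" for f
 proof -
  have c: "l i \<in> carrier L" "f (Inl i) \<in> carrier L" if "i \<in> I" for i using I(2) that f carriers by (auto simp: Pi_iff)
  have c': "l' i \<in> carrier L" "f (Inr i) \<in> carrier L" if "i \<in> J" for i using J(2) that f carriers by (auto simp: Pi_iff)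
  show ?thesis by (subst finsum_Plus) (use I J c c' in auto)
 qed
 have cc: "?c \<in> ?U \<rightarrow> carrier L" "(\<lambda>u. \<chi> (?c u)) \<in> ?U \<rightarrow> carrier L"
  using lK(2) carriers \<chi>_closed by (auto simp: Pi_iff)
 show ?thesis
  using \<psi>_sum[OF lK(3,1,2)] sum[OF cc(1)] sum[OF cc(2)] I(4) J(4) \<psi>_sum[OF I(1-3)] \<psi>_sum[OF J(1-3)] by simp
qed

lemma \<psi>_mult:
 assumes "s \<in> generate_ring L (K0 \<union> A)" "t \<in> generate_ring L (K0 \<union> A)"
 shows "\<psi> (s \<otimes> t) = \<psi> s \<otimes> \<psi> t"
proof -
 obtain I l c where I: "finite (I :: nat set)" "l \<in> I \<rightarrow> K0" "c \<in> I \<rightarrow> A" "s = (\<Oplus>i\<in>I. l i \<otimes> c i)"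
  using sum_in_generated[OF assms(1)] by auto
 obtain J l' c' where J: "finite (J :: nat set)" "l' \<in> J \<rightarrow> K0" "c' \<in> J \<rightarrow> A" "t = (\<Oplus>i\<in>J. l' i \<otimes> c' i)"
  using sum_in_generated[OF assms(2)] by auto
 note Kr = subfieldE(1)[OF K0(1)]
 have KA: "a \<otimes> b \<in> generate_ring L (K0 \<union> A)" if "a \<in> K0" "b \<in> A" for a b
  using that by (intro generate_ring.eng_mult generate_ring.incl) auto
 have GR: "subring (generate_ring L (K0 \<union> A)) L" using carriers by (intro generate_ring_is_subring) auto
 have \<psi>_finsum: "\<psi> (\<Oplus>i\<in>N. f i) = (\<Oplus>i\<in>N. \<psi> (f i))"
  if "finite N" "\<And>i. i \<in> N \<Longrightarrow> f i \<in> generate_ring L (K0 \<union> A)" for N :: "nat set" and f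
  using that
 proof (induction N rule: finite_induct)
  case empty
  thus ?case using \<psi>_id[of \<zero>] subringE(2)[OF Kr] by simp
 next
  case (insert i N)
  have fc: "f j \<in> carrier L" "\<psi> (f j) \<in> carrier L" if "j \<in> insert i N" for j
   using insert.prems[OF that] subringE(1)[OF GR] \<psi>_closed carriers by auto
  have "(\<Oplus>j\<in>N. f j) \<in> generate_ring L (K0 \<union> A)"
   by (rule finsum_subring[OF GR insert.hyps(1)]) (use insert.prems in auto)
  thus ?case using insert fc by (simp add: \<psi>_add)
 qed
 have ic: "l i \<in> carrier L" "c i \<in> carrier L" "\<chi> (c i) \<in> carrier L" "l i \<in> K0" "c i \<in> A" if "i \<in> I" for i
  using I that carriers \<chi>_closed by (auto simp: Pi_iff)
 have jc: "l' i \<in> carrier L" "c' i \<in> carrier L" "\<chi> (c' i) \<in> carrier L" "l' i \<in> K0" "c' i \<in> A" if "i \<in> J" for i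
  using J that carriers \<chi>_closed by (auto simp: Pi_iff)
 have 1: "\<psi> (a \<otimes> b \<otimes> t) = a \<otimes> \<chi> b \<otimes> \<psi> t" if ab: "a \<in> K0" "b \<in> A" for a b
 proof -
  have abc: "a \<in> carrier L" "b \<in> carrier L" "\<chi> b \<in> carrier L" using ab carriers \<chi>_closed by auto
  have "a \<otimes> b \<otimes> t = (\<Oplus>j\<in>J. (a \<otimes> l' j) \<otimes> (b \<otimes> c' j))"
   unfolding J(4) using J(1) abc jc
   by (subst finsum_rdistr) (auto intro!: finsum_cong' simp: m_ac)
  also have "\<psi> \<dots> = (\<Oplus>j\<in>J. (a \<otimes> l' j) \<otimes> \<chi> (b \<otimes> c' j))"
   using ab jc subringE(6)[OF Kr] subringE(6)[OF A(1)] by (intro \<psi>_sum J(1)) auto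
  also have "\<dots> = (\<Oplus>j\<in>J. a \<otimes> \<chi> b \<otimes> (l' j \<otimes> \<chi> (c' j)))"
   using abc ab jc by (intro finsum_cong') (auto simp: \<chi>_mult m_ac)
  also have "\<dots> = a \<otimes> \<chi> b \<otimes> \<psi> t"
   unfolding J(4) \<psi>_sum[OF J(1-3)] using abc jc J(1) by (intro finsum_rdistr[symmetric]) auto
  finally show ?thesis .
 qed
 have tc: "t \<in> carrier L" "\<psi> t \<in> carrier L" using assms(2) subringE(1)[OF GR] \<psi>_closed carriers by auto
 have "s \<otimes> t = (\<Oplus>i\<in>I. l i \<otimes> c i \<otimes> t)"
  unfolding I(4) using I(1) ic tc by (intro finsum_ldistr) auto
 also have "\<psi> \<dots> = (\<Oplus>i\<in>I. \<psi> (l i \<otimes> c i \<otimes> t))"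
  using ic KA subringE(6)[OF GR _ assms(2)] by (intro \<psi>_finsum I(1)) simp
 also have "\<dots> = (\<Oplus>i\<in>I. l i \<otimes> \<chi> (c i) \<otimes> \<psi> t)"
  using ic tc by (intro finsum_cong') (auto simp: 1)
 also have "\<dots> = \<psi> s \<otimes> \<psi> t"
  unfolding I(4) \<psi>_sum[OF I(1-3)] using I(1) ic tc by (intro finsum_ldistr[symmetric]) auto
 finally show ?thesis .
qed

text \<open>All \<open>c i\<close> and all \<open>\<chi> (c i)\<close> are constants, so before and
  after specialisation \<open>d\<close> acts on the factors \<open>l i\<close> alone.\<close>

lemma \<psi>_d:
 assumes "s \<in> generate_ring L (K0 \<union> A)"
 shows "d s \<in> generate_ring L (K0 \<union> A)" "\<psi> (d s) = d (\<psi> s)"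
proof -
 obtain I l c where I: "finite (I :: nat set)" "l \<in> I \<rightarrow> K0" "c \<in> I \<rightarrow> A" "s = (\<Oplus>i\<in>I. l i \<otimes> c i)"
  using sum_in_generated[OF assms] by auto
 have ic: "l i \<in> carrier L" "c i \<in> carrier L" "\<chi> (c i) \<in> carrier L" "l i \<in> K0" "c i \<in> A"
  "d (c i) = \<zero>" "d (\<chi> (c i)) = \<zero>" "d (l i) \<in> K0" "d (l i) \<in> carrier L" if "i \<in> I" for i
  using d_closed[of "l i"] I that carriers \<chi>_closed[of "c i"] A(2) K0(2) by (auto simp: Pi_iff constants_iff)
 have ds: "d s = (\<Oplus>i\<in>I. d (l i) \<otimes> c i)"
  unfolding I(4) using I(1) ic
  by (subst d_finsum) (auto intro!: finsum_cong' simp: d_mult)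
 show "d s \<in> generate_ring L (K0 \<union> A)"
  unfolding ds using carriers ic(4,5,8) I(1)
  by (intro finsum_subring generate_ring_is_subring generate_ring.eng_mult) (simp_all add: generate_ring.incl)
 have "\<psi> (d s) = (\<Oplus>i\<in>I. d (l i) \<otimes> \<chi> (c i))"
  unfolding ds using ic by (intro \<psi>_sum I(1)) auto
 also have "\<dots> = d (\<psi> s)"
  unfolding I(4) \<psi>_sum[OF I(1-3)] using I(1) ic
  by (subst d_finsum) (auto intro!: finsum_cong' simp: d_mult)
 finally show "\<psi> (d s) = d (\<psi> s)" .
qed

lemma \<psi>_nonzero:
 assumes "finite I" "l \<in> I \<rightarrow> K0" "c \<in> I \<rightarrow> A" "indep I l" "i \<in> I" "\<chi> (c i) \<noteq> \<zero>"
 shows "\<psi> (\<Oplus>i\<in>I. l i \<otimes> c i) \<noteq> \<zero>"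
proof
 assume "\<psi> (\<Oplus>i\<in>I. l i \<otimes> c i) = \<zero>"
 hence 0: "(\<Oplus>i\<in>I. l i \<otimes> \<chi> (c i)) = \<zero>" using \<psi>_sum[OF assms(1-3)] by simp
 have "(\<lambda>i. \<chi> (c i)) \<in> I \<rightarrow> constants L d" using assms(3) \<chi>_closed by auto
 from indepD[OF assms(4,1,2) this 0 assms(5)] show False using assms(6) by simp
qed

end

text \<open>\<open>g\<close> is a nonzero coefficient of \<open>h\<close> with respect to an
  independent family. If its image is nonzero, the specialised sum has a nonzero coefficient over
  the same family and cannot vanish. An open condition on \<open>K0[A]\<close> is thus replaced by
  one on the constants.\<close>

lemma (in constant_ring) generic_nonvanishing:
 assumes "h \<in> generate_ring L (K0 \<union> A)" "h \<noteq> \<zero>"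
 obtains g where "g \<in> A" "g \<noteq> \<zero>"
  "\<And>\<chi>. constant_point L d K0 A \<chi> \<Longrightarrow> \<chi> g \<noteq> \<zero> \<Longrightarrow> constant_point.\<psi> L K0 A \<chi> h \<noteq> \<zero>"
proof -
 obtain I l c where I: "finite (I :: nat set)" "l \<in> I \<rightarrow> K0" "c \<in> I \<rightarrow> A" "indep I l" "h = (\<Oplus>i\<in>I. l i \<otimes> c i)"
  using independent_sum_in_generated[OF assms(1)] by auto
 have "\<exists>i\<in>I. c i \<noteq> \<zero>"
 proof (rule ccontr)
  assume "\<not> (\<exists>i\<in>I. c i \<noteq> \<zero>)"
  hence "h = (\<Oplus>i\<in>I. \<zero>)"
   unfolding I(5) using I(2) carriers by (intro finsum_cong') (auto simp: Pi_iff)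
  with assms(2) show False by simp
 qed
 then obtain i where i: "i \<in> I" "c i \<noteq> \<zero>" by auto
 show thesis
 proof (rule that[of "c i"])
  fix \<chi> assume "constant_point L d K0 A \<chi>" and nz: "\<chi> (c i) \<noteq> \<zero>"
  then interpret constant_point L d K0 A \<chi> by simp
  show "\<psi> h \<noteq> \<zero>" unfolding I(5) by (rule \<psi>_nonzero[OF I(1-4) i(1) nz])
 qed (use i I(3) in auto)
qed

section \<open>Fundamental matrices with generic coefficients\<close>

text \<open>In the applications \<open>B\<close> is mostly the image of the constants of
  \<open>K\<close>: identities over \<open>E\<close> are tested, and points of nonvanishing are
  found, at constant matrices.\<close>

lemma (in rational_functions) ev_eq_iff:
 assumes s: "s \<in> pterms (carrier F) V" and t: "t \<in> pterms (carrier F) V" and B: "infinite B" "B \<subseteq> carrier F"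
 shows "peval R h x s = peval R h x t \<longleftrightarrow> (\<forall>y\<in>V \<rightarrow> B. peval F (\<lambda>c. c) y s = peval F (\<lambda>c. c) y t)"
proof -
 interpret H: ring_hom_cring F R h
  using hom by (intro ring_hom_cring.intro ring_hom_cring_axioms.intro F.cring_axioms R.cring_axioms)
 let ?u = "PAdd s (PMul (PConst (\<ominus>\<^bsub>F\<^esub> \<one>\<^bsub>F\<^esub>)) t)"
 have u: "?u \<in> pterms (carrier F) V" using s t by simp
 have r: "peval R h x ?u = \<zero>\<^bsub>R\<^esub> \<longleftrightarrow> peval R h x s = peval R h x t"
  using ev_closed[OF s] ev_closed[OF t] R.r_right_minus_eq[of "peval R h x s" "peval R h x t"]
  by (simp add: R.l_minus R.minus_eq)
 have f: "peval F (\<lambda>c. c) y ?u = \<zero>\<^bsub>F\<^esub> \<longleftrightarrow> peval F (\<lambda>c. c) y s = peval F (\<lambda>c. c) y t"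
  if y: "y \<in> V \<rightarrow> carrier F" for y
  using F.peval_closed[OF s _ y, of "\<lambda>c. c"] F.peval_closed[OF t _ y, of "\<lambda>c. c"]
   F.r_right_minus_eq[of "peval F (\<lambda>c. c) y s" "peval F (\<lambda>c. c) y t"]
  by (simp add: F.l_minus F.minus_eq)
 have yB: "y \<in> V \<rightarrow> carrier F" if "y \<in> V \<rightarrow> B" for y using that B(2) by auto
 show ?thesis
 proof
  assume "peval R h x s = peval R h x t"
  hence "peval F (\<lambda>c. c) y ?u = \<zero>\<^bsub>F\<^esub>" if "y \<in> V \<rightarrow> carrier F" for y
   using vanishing[OF u] r that by simp
  thus "\<forall>y\<in>V \<rightarrow> B. peval F (\<lambda>c. c) y s = peval F (\<lambda>c. c) y t" using f yB by simp
 next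
  assume "\<forall>y\<in>V \<rightarrow> B. peval F (\<lambda>c. c) y s = peval F (\<lambda>c. c) y t"
  hence "peval F (\<lambda>c. c) y ?u = \<zero>\<^bsub>F\<^esub>" if "y \<in> V \<rightarrow> B" for y using f[OF yB[OF that]] that by simp
  hence "peval F (\<lambda>c. c) y ?u = \<zero>\<^bsub>F\<^esub>" if "y \<in> V \<rightarrow> carrier F" for y
   using F.peval_vanishing[OF B finite_vars u, of "\<lambda>c. c" y] that by simp
  thus "peval R h x s = peval R h x t" using vanishing[OF u] r by simp
 qed
qed

lemma (in field) generate_field_pterms:
 assumes F: "ring F" "subring C F" "h \<in> ring_hom F R" and x: "x \<in> V \<rightarrow> carrier R"
  and a: "a \<in> generate_field R (h ` C \<union> x ` V)"
 shows "\<exists>P\<in>pterms C V. \<exists>Q\<in>pterms C V. peval R h x Q \<noteq> \<zero> \<and> a \<otimes> peval R h x Q = peval R h x P"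
proof -
 interpret F: ring F by (rule F(1))
 interpret H: ring_hom_ring F R h
  using F(3) by (intro ring_hom_ringI2 F.ring_axioms ring_axioms)
 have Cc: "C \<subseteq> carrier F" by (rule subringE(1)[OF F(2)])
 have hC: "h \<in> C \<rightarrow> carrier R" using Cc H.hom_closed by auto
 have gen: "\<exists>P\<in>pterms C V. b = peval R h x P" if "b \<in> generate_ring R (h ` C \<union> x ` V)" for b
  using that
 proof induction
  case one
  show ?case using subringE(3)[OF F(2)] by (intro bexI[of _ "PConst \<one>\<^bsub>F\<^esub>"]) auto
 next
  case (incl b)
  then consider c where "c \<in> C" "b = h c" | v where "v \<in> V" "b = x v" by auto
  thus ?case
  proof cases
   case 1
   thus ?thesis by (intro bexI[of _ "PConst c"]) auto
  next
   case 2
   thus ?thesis by (intro bexI[of _ "PVar v"]) auto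
  qed
 next
  case (a_inv b)
  then obtain P where P: "P \<in> pterms C V" "b = peval R h x P" by auto
  have "b \<in> carrier R" unfolding P(2) by (rule peval_closed[OF P(1) hC x])
  thus ?case using P subringE(3,5)[OF F(2)]
   by (intro bexI[of _ "PMul (PConst (\<ominus>\<^bsub>F\<^esub> \<one>\<^bsub>F\<^esub>)) P"]) (auto simp: l_minus)
 next
  case (eng_add a b)
  then obtain P Q where "P \<in> pterms C V" "a = peval R h x P" "Q \<in> pterms C V" "b = peval R h x Q" by auto
  thus ?case by (intro bexI[of _ "PAdd P Q"]) auto
 next
  case (eng_mult a b)
  then obtain P Q where "P \<in> pterms C V" "a = peval R h x P" "Q \<in> pterms C V" "b = peval R h x Q" by auto
  thus ?case by (intro bexI[of _ "PMul P Q"]) auto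
 qed
 have "h ` C \<union> x ` V \<subseteq> carrier R" using hC x by auto
 from generate_field_fraction[OF this a] obtain s t where
  st: "s \<in> generate_ring R (h ` C \<union> x ` V)" "t \<in> generate_ring R (h ` C \<union> x ` V)" "t \<noteq> \<zero>" "a \<otimes> t = s" by auto
 obtain P Q where "P \<in> pterms C V" "s = peval R h x P" "Q \<in> pterms C V" "t = peval R h x Q"
  using gen[OF st(1)] gen[OF st(2)] by auto
 thus ?thesis using st(3,4) by auto
qed

text \<open>The entries of the product \<open>A x\<close> as polynomials in the entries of
  \<open>x\<close>; they prescribe the derivation of the generic solution. The argument
  \<open>z\<close> is the zero that \<open>psum\<close> asks for.\<close>

definition mterm :: "'a \<Rightarrow> nat \<Rightarrow> (nat \<Rightarrow> nat \<Rightarrow> 'a) \<Rightarrow> nat \<times> nat \<Rightarrow> ('a, nat \<times> nat) pterm" where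
 "mterm z n A = (\<lambda>(i, j). psum z (\<lambda>l. PMul (PConst (A i l)) (PVar (l, j))) n)"

lemma mterm_in_pterms:
 "z \<in> S \<Longrightarrow> A \<in> mats n S \<Longrightarrow> v \<in> {..<n} \<times> {..<n} \<Longrightarrow> mterm z n A v \<in> pterms S ({..<n} \<times> {..<n})"
 by (auto simp: mterm_def mats_def intro!: psum_in_pterms)

lemma peval_mterm:
 assumes "cring G" "f z = \<zero>\<^bsub>G\<^esub>" "\<And>i j. i < n \<Longrightarrow> j < n \<Longrightarrow> f (A i j) \<in> carrier G" "y \<in> {..<n} \<times> {..<n} \<rightarrow> carrier G"
  "i < n" "j < n"
 shows "peval G f y (mterm z n A (i, j)) = mmult G n (\<lambda>i j. f (A i j)) (curry y) i j"
proof -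
 interpret cring G by (rule assms(1))
 show ?thesis unfolding mterm_def mmult_def using assms(2-) by (auto simp: peval_psum Pi_iff)
qed

text \<open>The polynomial \<open>t(X z)\<close> in the entries of \<open>z\<close>, with the
  coefficients of \<open>t\<close> moved to \<open>E\<close> by \<open>b\<close>.\<close>

definition left_translate :: "('b, 's) ring_scheme \<Rightarrow> ('a \<Rightarrow> 'b) \<Rightarrow> nat \<Rightarrow> (nat \<Rightarrow> nat \<Rightarrow> 'b) \<Rightarrow>
  ('a, nat \<times> nat) pterm \<Rightarrow> ('b, nat \<times> nat) pterm" where
 "left_translate E b n X t = psubst (mterm \<zero>\<^bsub>E\<^esub> n X) (map_pterm b id t)"

lemma left_translate_in_pterms:
 assumes "ring E" "t \<in> pterms A ({..<n} \<times> {..<n})" "b \<in> A \<rightarrow> carrier E" "X \<in> mats n (carrier E)"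
 shows "left_translate E b n X t \<in> pterms (carrier E) ({..<n} \<times> {..<n})"
proof -
 interpret ring E by (rule assms(1))
 have "map_pterm b id t \<in> pterms (carrier E) ({..<n} \<times> {..<n})"
  by (rule pterms_map[OF assms(2)]) (use assms(3) in auto)
 thus ?thesis unfolding left_translate_def
  by (rule psubst_in_pterms) (rule mterm_in_pterms[OF zero_closed assms(4)])
qed

lemma peval_left_translate:
 assumes "cring E" "cring G" "f \<in> ring_hom E G" "t \<in> pterms A ({..<n} \<times> {..<n})" "X \<in> mats n (carrier E)"
  "z \<in> {..<n} \<times> {..<n} \<rightarrow> carrier G"
 shows "peval G f z (left_translate E b n X t) =
  peval G (f \<circ> b) (case_prod (mmult G n (\<lambda>i j. f (X i j)) (curry z))) t"
proof -
 interpret E: cring E by (rule assms(1))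
 interpret G: cring G by (rule assms(2))
 have f0: "f \<zero>\<^bsub>E\<^esub> = \<zero>\<^bsub>G\<^esub>" using ring_hom_zero[OF assms(3) E.ring_axioms G.ring_axioms] .
 show ?thesis
  unfolding left_translate_def peval_psubst peval_map
 proof (rule peval_cong[OF assms(4)])
  fix v assume "v \<in> {..<n} \<times> {..<n}"
  then obtain i j where v: "v = (i, j)" "i < n" "j < n" by auto
  have fX: "f (X i j) \<in> carrier G" if "i < n" "j < n" for i j
   using ring_hom_closed[OF assms(3) matsD[OF assms(5) that]] .
  show "peval G f z (mterm \<zero>\<^bsub>E\<^esub> n X v) = case_prod (mmult G n (\<lambda>i j. f (X i j)) (curry z)) v"
   unfolding v(1) case_prod_conv
   by (rule peval_mterm[where f = f, OF assms(2) f0 _ assms(6) v(2,3)]) (rule fX)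
 qed simp
qed

locale fundamental_matrix = differential_field_extension K dK E dE h
 for K :: "('a, 'r) ring_scheme" and dK and E :: "('b, 's) ring_scheme" and dE h +
 fixes n :: nat and A :: "nat \<Rightarrow> nat \<Rightarrow> 'a" and X W :: "nat \<Rightarrow> nat \<Rightarrow> 'b"
 assumes A: "A \<in> mats n (carrier K)"
  and X: "X \<in> mats n (carrier E)" and W: "W \<in> mats n (carrier E)" and inverse: "minverse E n X W"
  and dX: "i < n \<Longrightarrow> j < n \<Longrightarrow> dE (X i j) = mmult E n (\<lambda>i j. h (A i j)) X i j"

text \<open>Torsor property: for a fundamental matrix \<open>X\<close> over \<open>E\<close> and a generic matrix \<open>Z\<close> of constants, \<open>X Z\<close> is a generic fundamental matrix.\<close>

lemma (in fundamental_matrix) generic_embedding: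
 assumes RL: "rational_functions K L ({..<n} \<times> {..<n}) hL x"
  and dL: "differential_field_extension K dK L dL hL"
   "\<And>i j. i < n \<Longrightarrow> j < n \<Longrightarrow> dL (x (i, j)) = mmult L n (\<lambda>i j. hL (A i j)) (curry x) i j"
  and RR: "rational_functions E R ({..<n} \<times> {..<n}) hR z"
  and dR: "differential_field_extension E dE R dR hR" "\<And>v. v \<in> {..<n} \<times> {..<n} \<Longrightarrow> dR (z v) = \<zero>\<^bsub>R\<^esub>"
 obtains f where "f \<in> ring_hom L R"
  "\<And>t. t \<in> pterms (carrier K) ({..<n} \<times> {..<n}) \<Longrightarrow> f (peval L hL x t) = peval R hR z (left_translate E h n X t)"
  "\<And>c. c \<in> carrier K \<Longrightarrow> f (hL c) = hR (h c)"
  "\<And>i j. i < n \<Longrightarrow> j < n \<Longrightarrow> f (x (i, j)) = mmult R n (\<lambda>i j. hR (X i j)) (curry z) i j"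
  "\<And>a. a \<in> carrier L \<Longrightarrow> f (dL a) = dR (f a)"
proof -
 let ?V = "{..<n} \<times> {..<n}"
 interpret L: rational_functions K L ?V hL x by (rule RL)
 interpret R: rational_functions E R ?V hR z by (rule RR)
 interpret dR: differential_field_extension E dE R dR hR by (rule dR(1))
 let ?f = "hR \<circ> h"
 let ?Y = "mmult R n (\<lambda>i j. hR (X i j)) (curry z)"
 let ?y = "case_prod ?Y"
 have fh: "?f \<in> ring_hom K R" by (rule ring_hom_trans[OF hom R.hom])
 have hX: "(\<lambda>i j. hR (X i j)) \<in> mats n (carrier R)" using X ring_hom_closed[OF R.hom] by (auto simp: mats_def)
 have zM: "curry z \<in> mats n (carrier R)" using R.vars_closed by (auto simp: mats_def)
 have YM: "?Y \<in> mats n (carrier R)" by (rule R.R.mmult_closed[OF hX zM])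
 have y: "?y \<in> ?V \<rightarrow> carrier R" using YM by (auto simp: mats_def)
 have lt: "left_translate E h n X t \<in> pterms (carrier E) ?V" if "t \<in> pterms (carrier K) ?V" for t
  by (rule left_translate_in_pterms[OF L.ring_axioms that _ X]) (use ring_hom_closed[OF hom] in auto)
 have plt: "peval R hR z (left_translate E h n X t) = peval R ?f ?y t" if "t \<in> pterms (carrier K) ?V" for t
  by (rule peval_left_translate[OF L.cring_axioms R.R.cring_axioms R.hom that X R.vars_closed])
 have ext: "differential_field_extension K dK R dR ?f"
  using fh hom_d dR.hom_d ring_hom_closed[OF hom]
  by (intro differential_field_extension.intro differential_field_extension_axioms.intro)
   (auto intro: K.differential_field_axioms dR.L.differential_field_axioms)
 obtain f where f: "f \<in> ring_hom L R" "\<And>t. t \<in> pterms (carrier K) ?V \<Longrightarrow> f (peval L hL x t) = peval R ?f ?y t"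
 proof (rule L.generic_evaluation[OF R.R.field_axioms fh y])
  fix t assume t: "t \<in> pterms (carrier K) ?V" and "peval R ?f ?y t = \<zero>\<^bsub>R\<^esub>"
  hence 0: "peval E (\<lambda>c. c) g (left_translate E h n X t) = \<zero>\<^bsub>E\<^esub>" if "g \<in> ?V \<rightarrow> carrier E" for g
   using R.vanishing[OF lt[OF t]] plt[OF t] that by simp
  have "peval K (\<lambda>c. c) g t = \<zero>\<^bsub>K\<^esub>" if g: "g \<in> ?V \<rightarrow> carrier K" for g
  proof -
   \<comment> \<open>Every point \<open>g\<close> over \<open>K\<close> is of the form
     \<open>X z\<close> with \<open>z = W g\<close>. So if \<open>t(X z)\<close> vanishes
     identically in \<open>z\<close>, then \<open>t\<close> vanishes at all points over
     \<open>K\<close>.\<close>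
   let ?G = "\<lambda>i j. h (g (i, j))"
   have G: "?G \<in> mats n (carrier E)" using g ring_hom_closed[OF hom] by (auto simp: mats_def)
   let ?g = "case_prod (mmult E n W ?G)"
   have WG: "?g \<in> ?V \<rightarrow> carrier E" using L.mmult_closed[OF W G] by (auto simp: mats_def)
   have "peval E ((\<lambda>c. c) \<circ> h) (case_prod (mmult E n (\<lambda>i j. X i j) (curry ?g))) t = \<zero>\<^bsub>E\<^esub>"
    using 0[OF WG] peval_left_translate[OF L.cring_axioms L.cring_axioms _ t X WG, of "\<lambda>c. c" h]
    by (simp add: ring_hom_def)
   also have "peval E ((\<lambda>c. c) \<circ> h) (case_prod (mmult E n (\<lambda>i j. X i j) (curry ?g))) t = peval E (h \<circ> (\<lambda>c. c)) (h \<circ> g) t"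
    by (rule peval_cong[OF t]) (auto simp: L.minverse_cancel(1)[OF X W inverse G])
   also have "\<dots> = h (peval K (\<lambda>c. c) g t)"
    by (rule peval_hom[OF hom K.ring_axioms t _ g, symmetric]) simp
   finally have "h (peval K (\<lambda>c. c) g t) = h \<zero>\<^bsub>K\<^esub>"
    using ring_hom_zero[OF hom K.ring_axioms L.ring_axioms] by simp
   thus ?thesis
    by (rule inj_onD[OF field_hom_inj[OF K.field_axioms L.field_axioms hom]])
     (use K.peval_closed[OF t _ g] in auto)
  qed
  thus "peval L hL x t = \<zero>\<^bsub>L\<^esub>" using L.vanishing[OF t] by simp
 qed (use that in auto)
 let ?w = "mterm \<zero>\<^bsub>K\<^esub> n A"
 have w: "?w v \<in> pterms (carrier K) ?V" if "v \<in> ?V" for v by (rule mterm_in_pterms[OF K.zero_closed A that])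
 have hA: "?f (A i j) \<in> carrier R" "hL (A i j) \<in> carrier L" if "i < n" "j < n" for i j
  using ring_hom_closed[OF fh matsD[OF A that]] ring_hom_closed[OF L.hom matsD[OF A that]] by auto
 have fA: "(\<lambda>i j. ?f (A i j)) \<in> mats n (carrier R)" using hA by (auto simp: mats_def)
 \<comment> \<open>The entries of \<open>z\<close> are constants, so the derivative of
   \<open>X z\<close> is \<open>X' z = (A X) z\<close>.\<close>
 have dY: "dR (?Y i j) = mmult R n (\<lambda>i j. ?f (A i j)) ?Y i j" if ij: "i < n" "j < n" for i j
 proof -
  have Xc: "hR (X i l) \<in> carrier R" "z (l, j) \<in> carrier R" "dR (hR (X i l)) \<in> carrier R" if "l < n" for l
   using matsD[OF hX ij(1) that] matsD[OF zM that ij(2)] dR.L.d_closed by auto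
  have "dR (?Y i j) = (\<Oplus>\<^bsub>R\<^esub>l\<in>{..<n}. dR (hR (X i l) \<otimes>\<^bsub>R\<^esub> z (l, j)))"
   unfolding mmult_def using Xc by (subst dR.L.d_finsum) auto
  also have "\<dots> = (\<Oplus>\<^bsub>R\<^esub>l\<in>{..<n}. dR (hR (X i l)) \<otimes>\<^bsub>R\<^esub> z (l, j))"
   using Xc dR(2) ij by (intro R.R.finsum_cong') (auto simp: dR.L.d_mult)
  also have "\<dots> = mmult R n (mmult R n (\<lambda>i j. ?f (A i j)) (\<lambda>i j. hR (X i j))) (curry z) i j"
  proof -
   have "dR (hR (X i l)) = mmult R n (\<lambda>i j. ?f (A i j)) (\<lambda>i j. hR (X i j)) i l" if l: "l < n" for l
   proof -
    have "(\<lambda>i j. h (A i j)) \<in> mats n (carrier E)" using A ring_hom_closed[OF hom] by (auto simp: mats_def)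
    from mmult_hom[OF R.hom L.cring_axioms R.R.cring_axioms this X ij(1) l]
    show ?thesis using dR.hom_d[OF matsD[OF X ij(1) l]] dX[OF ij(1) l] by simp
   qed
   thus ?thesis unfolding mmult_def[of R n _ "curry z"]
    using Xc by (intro R.R.finsum_cong') auto
  qed
  also have "\<dots> = mmult R n (\<lambda>i j. ?f (A i j)) ?Y i j" by (rule R.R.mmult_assoc[OF fA hX zM ij])
  finally show ?thesis .
 qed
 have fx: "f (x (i, j)) = ?Y i j" if "i < n" "j < n" for i j using f(2)[of "PVar (i, j)"] that by simp
 have f0: "?f \<zero>\<^bsub>K\<^esub> = \<zero>\<^bsub>R\<^esub>" "hL \<zero>\<^bsub>K\<^esub> = \<zero>\<^bsub>L\<^esub>"
  using ring_hom_zero[OF fh K.ring_axioms R.R.ring_axioms] ring_hom_zero[OF L.hom K.ring_axioms L.R.ring_axioms] by auto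
 have d: "f (dL a) = dR (f a)" if "a \<in> carrier L" for a
 proof (rule generic_evaluation_derivation[OF RL dL(1) w _ ext y _ f that])
  fix v assume "v \<in> ?V"
  then obtain i j where v: "v = (i, j)" "i < n" "j < n" by auto
  show "dL (x v) = peval L hL x (?w v)"
   using peval_mterm[where f = hL, OF L.R.cring_axioms f0(2) hA(2) L.vars_closed v(2,3)] dL(2) v by simp
  have "curry ?y = ?Y" by (simp add: fun_eq_iff)
  thus "dR (?y v) = peval R ?f ?y (?w v)"
   using peval_mterm[where f = ?f, OF R.R.cring_axioms f0(1) hA(1) y v(2,3)] dY[OF v(2,3)] v(1) by simp
 qed
 show thesis
 proof (rule that[of f])
  show "f (hL c) = hR (h c)" if "c \<in> carrier K" for c using f(2)[of "PConst c"] that by simp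
 qed (use f plt fx d in auto)
qed

lemma (in field) fraction_in_subfield:
 assumes "subfield D R" "q \<in> D" "q \<noteq> \<zero>" "c \<in> carrier R" "c \<otimes> q \<in> D"
 shows "c \<in> D"
proof (rule subfield_m_inv_simprule[OF assms(1) _ assms(4)])
 show "q \<in> D - {\<zero>}" using assms(2,3) by simp
 have "q \<in> carrier R" using assms(2) subfieldE(3)[OF assms(1)] by auto
 thus "q \<otimes> c \<in> D" using assms(5) m_comm[OF assms(4)] by simp
qed

lemma image_subfield:
 assumes "field F" "field R" "f \<in> ring_hom F R" "subfield D F"
 shows "subfield (f ` D) R"
proof -
 interpret F: field F by fact
 interpret R: field R by fact
 interpret ring_hom_ring F R f
  using assms(3) by (intro ring_hom_ringI2 F.ring_axioms R.ring_axioms)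
 show ?thesis by (rule img_is_subfield(2)[OF assms(4)]) simp
qed

lemma vimage_subfield:
 assumes "field F" "field R" "f \<in> ring_hom F R" "subfield D R"
 shows "subfield {a \<in> carrier F. f a \<in> D} F"
proof -
 interpret F: field F by fact
 interpret R: field R by fact
 interpret ring_hom_ring F R f
  using assms(3) by (intro ring_hom_ringI2 F.ring_axioms R.ring_axioms)
 note Dr = subfieldE(1)[OF assms(4)]
 note D = subringE[OF Dr]
 show ?thesis
 proof (intro F.subfieldI' F.subringI)
  fix a assume a: "a \<in> {a \<in> carrier F. f a \<in> D} - {\<zero>\<^bsub>F\<^esub>}"
  hence ac: "a \<in> carrier F" "a \<noteq> \<zero>\<^bsub>F\<^esub>" "f a \<in> D" by auto
  note ic = F.inv_closed_nonzero[OF ac(1,2)]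
  have 1: "f (inv\<^bsub>F\<^esub> a) \<otimes>\<^bsub>R\<^esub> f a = \<one>\<^bsub>R\<^esub>"
   using F.inv_mult[OF ac(1,2)] ic ac by (simp flip: hom_mult)
  hence "f a \<noteq> \<zero>\<^bsub>R\<^esub>" using ic ac by auto
  hence "f (inv\<^bsub>F\<^esub> a) \<in> D"
   using R.fraction_in_subfield[OF assms(4) ac(3), of "f (inv\<^bsub>F\<^esub> a)"] ic 1 D(3) by simp
  with ic show "inv\<^bsub>F\<^esub> a \<in> {a \<in> carrier F. f a \<in> D}" by simp
 qed (use D in auto)
qed

lemma (in rational_functions) generate_field_carrier:
 "generate_field R (h ` carrier F \<union> x ` V) = carrier R"
proof
 let ?D = "generate_field R (h ` carrier F \<union> x ` V)"
 have Hc: "h ` carrier F \<union> x ` V \<subseteq> carrier R" using h_closed vars_closed by auto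
 show "?D \<subseteq> carrier R" by (rule R.generate_field_incl[OF Hc])
 have D: "subfield ?D R" by (rule R.generate_field_is_subfield[OF Hc])
 have ev: "peval R h x t \<in> ?D" if "t \<in> pterms (carrier F) V" for t
  by (rule R.peval_in_subring[OF subfieldE(1)[OF D] that]) (auto intro: generate_field.incl)
 show "carrier R \<subseteq> ?D"
 proof
  fix a assume a: "a \<in> carrier R"
  from fraction[OF a] obtain s t where st: "s \<in> pterms (carrier F) V" "t \<in> pterms (carrier F) V"
   "peval R h x t \<noteq> \<zero>\<^bsub>R\<^esub>" "a \<otimes>\<^bsub>R\<^esub> peval R h x t = peval R h x s" by auto
  show "a \<in> ?D" by (rule R.fraction_in_subfield[OF D ev[OF st(2)] st(3) a]) (simp add: st(4) ev[OF st(1)])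
 qed
qed

lemma (in differential_field_extension) hom_constant_iff:
 assumes "a \<in> carrier K" shows "h a \<in> constants L dL \<longleftrightarrow> a \<in> constants K dK"
proof -
 have "dL (h a) = \<zero>\<^bsub>L\<^esub> \<longleftrightarrow> h (dK a) = h \<zero>\<^bsub>K\<^esub>"
  using hom_d[OF assms] ring_hom_zero[OF hom K.ring_axioms L.ring_axioms] by simp
 also have "\<dots> \<longleftrightarrow> dK a = \<zero>\<^bsub>K\<^esub>"
  using inj_on_eq_iff[OF field_hom_inj[OF K.field_axioms L.field_axioms hom], of "dK a" "\<zero>\<^bsub>K\<^esub>"]
   K.d_closed[OF assms] by simp
 finally show ?thesis using assms ring_hom_closed[OF hom assms] by (simp add: K.constants_iff L.constants_iff)
qed

lemma (in differential_field_extension) constants_image: "h ` carrier K \<inter> constants L dL = h ` constants K dK"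
 using hom_constant_iff by (auto simp: K.constants_iff)

lemma (in differential_field_extension) image_differential_subfield:
 "subfield (h ` carrier K) L" "dL ` h ` carrier K \<subseteq> h ` carrier K"
 using image_subfield[OF K.field_axioms L.field_axioms hom K.carrier_is_subfield] hom_d[symmetric] K.d_closed
 by auto

text \<open>With \<open>C\<close> the constants of \<open>L\<close>, the intermediate field
  \<open>K(C)\<close> is finitely generated over \<open>K\<close>, and its generators involve a
  finite set \<open>E\<close> of constants. So \<open>C\<close> lies in the compositum of
  \<open>K\<close> and \<open>k(E)\<close>, whose constants belong to \<open>k(E)\<close> by
  \<open>constants_compositum\<close>.\<close>

lemma (in differential_field_extension) constants_finitely_generated:
 assumes X: "finite X" "X \<subseteq> carrier L" "carrier L \<subseteq> generate_field L (h ` carrier K \<union> X)"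
 obtains Y where "finite Y" "Y \<subseteq> constants L dL" "constants L dL = generate_field L (h ` constants K dK \<union> Y)"
proof -
 let ?K = "h ` carrier K" and ?C = "constants L dL"
 note K0 = image_differential_subfield
 have Kc: "?K \<subseteq> carrier L" and Cc: "?C \<subseteq> carrier L"
  using subfieldE(3)[OF K0(1)] subfieldE(3)[OF L.constants_subfield] by auto
 let ?M = "generate_field L (?K \<union> ?C)"
 have M: "subfield ?M L" using Kc Cc by (intro L.generate_field_is_subfield) auto
 have KM: "?K \<subseteq> ?M" by (auto intro: generate_field.incl)
 have MX: "?M \<subseteq> generate_field L (?K \<union> X)" using subfieldE(3)[OF M] X(3) by auto
 obtain Y where Y: "finite Y" "Y \<subseteq> ?M" "?M \<subseteq> generate_field L (?K \<union> Y)"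
  using L.intermediate_field_finitely_generated[OF X(1) K0(1) X(2) M KM MX] by auto
 have "\<forall>y\<in>Y. \<exists>Z. finite Z \<and> Z \<subseteq> ?K \<union> ?C \<and> y \<in> generate_field L Z"
  using Y(2) L.generate_field_finitary by auto
 then obtain Z where Z: "\<And>y. y \<in> Y \<Longrightarrow> finite (Z y) \<and> Z y \<subseteq> ?K \<union> ?C \<and> y \<in> generate_field L (Z y)" by metis
 define E where "E = (\<Union>y\<in>Y. Z y) \<inter> ?C"
 have E: "finite E" "E \<subseteq> ?C" using Y(1) Z by (auto simp: E_def)
 let ?D = "generate_field L (h ` constants K dK \<union> E)"
 have kC: "h ` constants K dK \<subseteq> ?C" using constants_image by auto
 have Hc: "h ` constants K dK \<union> E \<subseteq> carrier L" using kC E Cc by auto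
 have D: "subfield ?D L" by (rule L.generate_field_is_subfield[OF Hc])
 have DC: "?D \<subseteq> ?C" by (rule L.generate_field_subset[OF L.constants_subfield]) (use kC E in auto)
 have KDc: "?K \<union> ?D \<subseteq> carrier L" using Kc subfieldE(3)[OF D] by auto
 let ?N = "generate_field L (?K \<union> ?D)"
 have N: "subfield ?N L" by (rule L.generate_field_is_subfield[OF KDc])
 have KDN: "?K \<union> ?D \<subseteq> ?N" by (auto intro: generate_field.incl)
 have ZN: "Z y \<subseteq> ?N" if "y \<in> Y" for y
 proof -
  have "Z y \<subseteq> ?K \<union> E" using Z[OF that] that by (auto simp: E_def)
  moreover have "E \<subseteq> ?D" by (auto intro: generate_field.incl)
  moreover have "?K \<subseteq> ?N" "?D \<subseteq> ?N" using KDN by simp_all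
  ultimately show ?thesis by (meson Un_least order_trans)
 qed
 have "Y \<subseteq> ?N"
 proof
  fix y assume y: "y \<in> Y"
  show "y \<in> ?N" using subsetD[OF L.generate_field_subset[OF N ZN[OF y]]] Z[OF y] by simp
 qed
 hence "generate_field L (?K \<union> Y) \<subseteq> ?N" using KDN by (intro L.generate_field_subset[OF N]) auto
 hence CN: "c \<in> ?N" if "c \<in> ?C" for c
  using Y(3) generate_field.incl[of c "?K \<union> ?C" L] that by auto
 have "?K \<inter> ?C \<subseteq> ?D" unfolding constants_image by (auto intro: generate_field.incl)
 hence "c \<in> ?D" if "c \<in> ?C" for c
  using L.constants_compositum[OF K0 D DC _ that CN[OF that]] by simp
 hence "?C = ?D" using DC by auto
 thus thesis using that E by simp
qed

text \<open>A rational function \<open>c = p / q\<close> of the generic matrix \<open>x\<close> is a function on the solutions; the pair expresses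
 \<open>c (X y) = P (y) / Q (y)\<close> for all matrices \<open>y\<close> with entries in \<open>Y\<close>.\<close>

definition coaction_pair where
 "coaction_pair K L n hL x c E h X Y P Q \<longleftrightarrow>
  (\<forall>p\<in>pterms (carrier K) ({..<n} \<times> {..<n}). \<forall>q\<in>pterms (carrier K) ({..<n} \<times> {..<n}).
   c \<otimes>\<^bsub>L\<^esub> peval L hL x q = peval L hL x p \<longrightarrow>
   (\<forall>y\<in>{..<n} \<times> {..<n} \<rightarrow> Y.
    peval E (\<lambda>a. a) y P \<otimes>\<^bsub>E\<^esub> peval E h (case_prod (mmult E n X (curry y))) q =
    peval E (\<lambda>a. a) y Q \<otimes>\<^bsub>E\<^esub> peval E h (case_prod (mmult E n X (curry y))) p))"

text \<open>The embedding \<open>f\<close> with \<open>x\<close> going to \<open>x z\<close> maps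
  constants of \<open>E\<close> to constants of \<open>E(z)\<close>, and these lie in
  \<open>C(z)\<close>, with \<open>C\<close> the constants of \<open>E\<close>, by
  \<open>constants_compositum\<close>. So \<open>f c\<close> is a quotient \<open>P / Q\<close> over
  \<open>C\<close>; comparing it with the image of \<open>c = p / q\<close> and substituting
  \<open>y\<close> for \<open>z\<close> gives the identity.\<close>

lemma (in fundamental_matrix) coaction:
 assumes inf: "infinite (constants K dK)" and RE: "rational_functions K E ({..<n} \<times> {..<n}) h x"
  and x: "\<And>i j. i < n \<Longrightarrow> j < n \<Longrightarrow> x (i, j) = X i j"
  and c: "c \<in> constants E dE"
 obtains P Q g where "P \<in> pterms (constants E dE) ({..<n} \<times> {..<n})" "Q \<in> pterms (constants E dE) ({..<n} \<times> {..<n})"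
  "g \<in> {..<n} \<times> {..<n} \<rightarrow> h ` constants K dK" "peval E (\<lambda>a. a) g Q \<noteq> \<zero>\<^bsub>E\<^esub>"
  "coaction_pair K E n h x c E h X (carrier E) P Q"
proof -
 let ?V = "{..<n} \<times> {..<n}" and ?C = "constants E dE"
 interpret E: rational_functions K E ?V h x by (rule RE)
 have Cc: "?C \<subseteq> carrier E" using L.constants_iff by auto
 have "constants K dK \<subseteq> carrier K" using K.constants_iff by auto
 hence "infinite (h ` constants K dK)"
  using inf finite_imageD[OF _ inj_on_subset[OF field_hom_inj[OF K.field_axioms L.field_axioms hom]]] by metis
 moreover have kE: "h ` constants K dK \<subseteq> carrier E" using constants_image Cc by auto
 ultimately have infE: "infinite (carrier E)" and infk: "infinite (h ` constants K dK)"
  using finite_subset by auto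
 obtain R :: "(nat \<times> nat, 'b) ratfun ring" and dR hR z
  where RR: "rational_functions E R ?V hR z" and dR: "differential_field_extension E dE R dR hR"
   and "\<And>v. v \<in> ?V \<Longrightarrow> dR (z v) = peval R hR z (PConst \<zero>\<^bsub>E\<^esub>)"
  by (rule rational_functions_exist[OF L.differential_field_axioms infE, of ?V "\<lambda>_. PConst \<zero>\<^bsub>E\<^esub>"]) auto
 interpret R: rational_functions E R ?V hR z by (rule RR)
 interpret dR: differential_field_extension E dE R dR hR by (rule dR)
 have dz: "dR (z v) = \<zero>\<^bsub>R\<^esub>" if "v \<in> ?V" for v
  using \<open>v \<in> ?V \<Longrightarrow> dR (z v) = peval R hR z (PConst \<zero>\<^bsub>E\<^esub>)\<close> that
   ring_hom_zero[OF R.hom L.ring_axioms R.R.ring_axioms] by simp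
 have dx: "dE (x (i, j)) = mmult E n (\<lambda>i j. h (A i j)) (curry x) i j" if ij: "i < n" "j < n" for i j
 proof -
  have "h (A i l) \<in> carrier E" if "l < n" for l using ring_hom_closed[OF hom matsD[OF A ij(1) that]] .
  thus ?thesis unfolding x[OF ij] dX[OF ij]
   by (intro mmult_cong) (use ij x matsD[OF X] L.abelian_monoid_axioms in auto)
 qed
 have ext: "differential_field_extension K dK E dE h" by unfold_locales
 obtain f where f: "f \<in> ring_hom E R"
  "\<And>t. t \<in> pterms (carrier K) ?V \<Longrightarrow> f (peval E h x t) = peval R hR z (left_translate E h n X t)"
  "\<And>a. a \<in> carrier E \<Longrightarrow> f (dE a) = dR (f a)"
  by (rule generic_embedding[OF RE ext dx RR dR dz]) auto
 have zc: "z ` ?V \<subseteq> carrier R" "hR ` ?C \<subseteq> carrier R" using R.vars_closed R.h_closed Cc by auto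
 let ?D = "generate_field R (hR ` ?C \<union> z ` ?V)"
 have D: "subfield ?D R" using zc by (intro R.R.generate_field_is_subfield) auto
 have hC: "hR ` ?C \<subseteq> constants R dR" using dR.constants_image by auto
 have DC: "?D \<subseteq> constants R dR"
  by (rule R.R.generate_field_subset[OF dR.L.constants_subfield])
   (use hC dz R.vars_closed in \<open>auto simp: dR.L.constants_iff\<close>)
 have ID: "hR ` carrier E \<inter> constants R dR \<subseteq> ?D"
  unfolding dR.constants_image by (auto intro: generate_field.incl)
 have cE: "c \<in> carrier E" "dE c = \<zero>\<^bsub>E\<^esub>" using c by (auto simp: L.constants_iff)
 have fcR: "f c \<in> carrier R" by (rule ring_hom_closed[OF f(1) cE(1)])
 have fc: "f c \<in> constants R dR"
  using f(3)[OF cE(1)] cE fcR ring_hom_zero[OF f(1) L.ring_axioms R.R.ring_axioms]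
  by (simp add: dR.L.constants_iff)
 have zD: "hR ` carrier E \<union> z ` ?V \<subseteq> hR ` carrier E \<union> ?D" by (auto intro: generate_field.incl)
 have "hR ` carrier E \<union> ?D \<subseteq> carrier R" using R.h_closed subfieldE(3)[OF D] by auto
 from R.R.mono_generate_field[OF zD this]
 have "generate_field R (hR ` carrier E \<union> z ` ?V) \<subseteq> generate_field R (hR ` carrier E \<union> ?D)" .
 hence "f c \<in> generate_field R (hR ` carrier E \<union> ?D)" using fcR R.generate_field_carrier by auto
 hence "f c \<in> ?D"
  by (rule dR.L.constants_compositum[OF dR.image_differential_subfield D DC ID fc])
 from R.R.generate_field_pterms[OF L.ring_axioms subfieldE(1)[OF L.constants_subfield] R.hom R.vars_closed this]
 obtain P Q where PQ: "P \<in> pterms ?C ?V" "Q \<in> pterms ?C ?V" "peval R hR z Q \<noteq> \<zero>\<^bsub>R\<^esub>"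
  "f c \<otimes>\<^bsub>R\<^esub> peval R hR z Q = peval R hR z P" by auto
 have PQE: "P \<in> pterms (carrier E) ?V" "Q \<in> pterms (carrier E) ?V"
  using pterms_mono[OF PQ(1) Cc] pterms_mono[OF PQ(2) Cc] by auto
 have h0: "hR \<zero>\<^bsub>E\<^esub> = \<zero>\<^bsub>R\<^esub>" by (rule ring_hom_zero[OF R.hom L.ring_axioms R.R.ring_axioms])
 \<comment> \<open>\<open>Q\<close> is a nonzero polynomial, so it has a nonzero value at some
   matrix over the infinite field \<open>k\<close>. The matrix is recorded because this value has to
   stay nonzero under specialisation.\<close>
 have "\<exists>g\<in>?V \<rightarrow> h ` constants K dK. peval E (\<lambda>a. a) g Q \<noteq> \<zero>\<^bsub>E\<^esub>"
  using R.ev_eq_iff[OF PQE(2) _ infk kE, of "PConst \<zero>\<^bsub>E\<^esub>"] PQ(3) h0 by auto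
 then obtain g where g: "g \<in> ?V \<rightarrow> h ` constants K dK" "peval E (\<lambda>a. a) g Q \<noteq> \<zero>\<^bsub>E\<^esub>" by auto
 have "peval E (\<lambda>a. a) y P \<otimes>\<^bsub>E\<^esub> peval E h (case_prod (mmult E n X (curry y))) q =
   peval E (\<lambda>a. a) y Q \<otimes>\<^bsub>E\<^esub> peval E h (case_prod (mmult E n X (curry y))) p"
  if p: "p \<in> pterms (carrier K) ?V" and q: "q \<in> pterms (carrier K) ?V"
   and cqp: "c \<otimes>\<^bsub>E\<^esub> peval E h x q = peval E h x p" and y: "y \<in> ?V \<rightarrow> carrier E" for p q y
 proof -
  let ?l = "left_translate E h n X"
  have l: "?l t \<in> pterms (carrier E) ?V" if "t \<in> pterms (carrier K) ?V" for t
   by (rule left_translate_in_pterms[OF L.ring_axioms that _ X]) (use ring_hom_closed[OF hom] in auto)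
  have pl: "peval E (\<lambda>a. a) y (?l t) = peval E h (case_prod (mmult E n X (curry y))) t"
   if "t \<in> pterms (carrier K) ?V" for t
   using peval_left_translate[OF L.cring_axioms L.cring_axioms _ that X y, of "\<lambda>a. a" h]
   by (simp add: ring_hom_def o_def)
  have "f c \<otimes>\<^bsub>R\<^esub> f (peval E h x q) = f (peval E h x p)"
   using ring_hom_mult[OF f(1) cE(1) E.ev_closed[OF q]] cqp by simp
  hence e: "f c \<otimes>\<^bsub>R\<^esub> peval R hR z (?l q) = peval R hR z (?l p)" using f(2) p q by simp
  have "peval R hR z (PMul P (?l q)) = (f c \<otimes>\<^bsub>R\<^esub> peval R hR z Q) \<otimes>\<^bsub>R\<^esub> peval R hR z (?l q)"
   by (simp add: PQ(4))
  also have "\<dots> = peval R hR z Q \<otimes>\<^bsub>R\<^esub> (f c \<otimes>\<^bsub>R\<^esub> peval R hR z (?l q))"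
   using fcR R.ev_closed[OF PQE(2)] R.ev_closed[OF l[OF q]] by (simp add: R.R.m_ac)
  also have "\<dots> = peval R hR z (PMul Q (?l p))" unfolding e by simp
  finally have "peval R hR z (PMul P (?l q)) = peval R hR z (PMul Q (?l p))" .
  hence "peval E (\<lambda>a. a) y (PMul P (?l q)) = peval E (\<lambda>a. a) y (PMul Q (?l p))"
   using R.ev_eq_iff[of "PMul P (?l q)" "PMul Q (?l p)" "carrier E"] PQE l p q infE y by simp
  thus ?thesis using pl[OF p] pl[OF q] by simp
 qed
 hence "coaction_pair K E n h x c E h X (carrier E) P Q" by (simp add: coaction_pair_def)
 thus thesis by (rule that[OF PQ(1,2) g])
qed

text \<open>At a suitable point over \<open>F\<close> all fractions in \<open>E\<close> and also
  \<open>1 / a\<close> are defined. Evaluation there maps \<open>k[E, 1 / a]\<close> into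
  \<open>F\<close>, and existential closedness retracts the image to \<open>k\<close>. Since
  \<open>1 / a\<close> takes part, the value of \<open>a\<close> is a unit.\<close>

lemma (in rational_functions) specialization:
 assumes ec: "existentially_closed_in k F" and E: "finite E" "E \<subseteq> carrier R"
  and a: "a \<in> generate_ring R (h ` k \<union> E)" "a \<noteq> \<zero>\<^bsub>R\<^esub>"
 obtains \<chi> where "\<chi> \<in> ring_hom (R\<lparr>carrier := generate_ring R (h ` k \<union> E)\<rparr>) (F\<lparr>carrier := k\<rparr>)"
  "\<And>c. c \<in> k \<Longrightarrow> \<chi> (h c) = c" "\<chi> a \<noteq> \<zero>\<^bsub>F\<^esub>"
proof -
 have k: "subfield k F" using ec by (simp add: existentially_closed_in_def)
 note kr = subfieldE(1)[OF k] and kc = subfieldE(3)[OF k]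
 have kE: "h ` k \<union> E \<subseteq> carrier R" using h_closed kc E(2) by auto
 have ac: "a \<in> carrier R" by (rule R.generate_ring_in_carrier[OF kE a(1)])
 let ?J = "insert (inv\<^bsub>R\<^esub> a) E"
 have J: "finite ?J" "b \<in> carrier R" if "b \<in> ?J" for b using that E R.inv_closed_nonzero[OF ac a(2)] by auto
 obtain s where s: "s \<in> pterms (carrier F) V" "peval R h x s \<noteq> \<zero>\<^bsub>R\<^esub>"
  "\<And>b. b \<in> ?J \<Longrightarrow> \<exists>t\<in>pterms (carrier F) V. b \<otimes>\<^bsub>R\<^esub> peval R h x s = peval R h x t"
  using common_denominator[of ?J "\<lambda>b. b"] J E(1) by auto
 obtain y where y: "y \<in> V \<rightarrow> carrier F" "peval F (\<lambda>c. c) y s \<noteq> \<zero>\<^bsub>F\<^esub>"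
  using vanishing[OF s(1)] s(2) by auto
 have id: "(\<lambda>c. c) \<in> ring_hom F F" by (simp add: ring_hom_def)
 obtain O\<^sub>y ev where O: "subring O\<^sub>y R" "ev \<in> ring_hom (R\<lparr>carrier := O\<^sub>y\<rparr>) F"
  and ev: "\<And>a s t. \<lbrakk>a \<in> carrier R; s \<in> pterms (carrier F) V; t \<in> pterms (carrier F) V; peval F (\<lambda>c. c) y t \<noteq> \<zero>\<^bsub>F\<^esub>;
   a \<otimes>\<^bsub>R\<^esub> peval R h x t = peval R h x s\<rbrakk> \<Longrightarrow>
   a \<in> O\<^sub>y \<and> ev a \<otimes>\<^bsub>F\<^esub> peval F (\<lambda>c. c) y t = peval F (\<lambda>c. c) y s"
  by (rule local_evaluation[OF F.field_axioms id y(1)]) metis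
 have JO: "b \<in> O\<^sub>y" if b: "b \<in> ?J" for b
 proof -
  obtain t where "t \<in> pterms (carrier F) V" "b \<otimes>\<^bsub>R\<^esub> peval R h x s = peval R h x t" using s(3)[OF b] by auto
  with ev[OF J(2)[OF b] _ s(1) y(2)] show ?thesis by simp
 qed
 have hO: "h c \<in> O\<^sub>y" "ev (h c) = c" if c: "c \<in> carrier F" for c
 proof -
  have "h c \<in> carrier R" using h_closed c by auto
  moreover have "h \<one>\<^bsub>F\<^esub> = \<one>\<^bsub>R\<^esub>" by (rule ring_hom_one[OF hom])
  ultimately have *: "h c \<in> O\<^sub>y \<and> ev (h c) \<otimes>\<^bsub>F\<^esub> \<one>\<^bsub>F\<^esub> = c" using ev[of "h c" "PConst c" "PConst \<one>\<^bsub>F\<^esub>"] c by simp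
  thus "h c \<in> O\<^sub>y" by simp
  hence "ev (h c) \<in> carrier F" using ring_hom_closed[OF O(2), of "h c"] by simp
  with * show "ev (h c) = c" by simp
 qed
 let ?S = "ev ` ?J"
 have evc: "ev b \<in> carrier F" if "b \<in> O\<^sub>y" for b using ring_hom_closed[OF O(2), of b] that by simp
 have ev_mult: "ev (b \<otimes>\<^bsub>R\<^esub> c) = ev b \<otimes>\<^bsub>F\<^esub> ev c" "ev (b \<oplus>\<^bsub>R\<^esub> c) = ev b \<oplus>\<^bsub>F\<^esub> ev c" if "b \<in> O\<^sub>y" "c \<in> O\<^sub>y" for b c
  using ring_hom_mult[OF O(2), of b c] ring_hom_add[OF O(2), of b c] that by auto
 have ev1: "ev \<one>\<^bsub>R\<^esub> = \<one>\<^bsub>F\<^esub>" using ring_hom_one[OF O(2)] by simp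
 have Sc: "?S \<subseteq> carrier F" "finite ?S" using JO evc E(1) by auto
 obtain \<phi> where \<phi>: "\<phi> \<in> ring_hom (F\<lparr>carrier := generate_ring F (k \<union> ?S)\<rparr>) (F\<lparr>carrier := k\<rparr>)"
  "\<And>c. c \<in> k \<Longrightarrow> \<phi> c = c"
  using ec Sc unfolding existentially_closed_in_def by meson
 have GF: "subring (generate_ring F (k \<union> ?S)) F" using Sc kc by (intro F.generate_ring_is_subring) auto
 have gen: "b \<in> O\<^sub>y \<and> ev b \<in> generate_ring F (k \<union> ?S)" if "b \<in> generate_ring R (h ` k \<union> ?J)" for b
  using that
 proof induction
  case one
  show ?case using subringE(3)[OF O(1)] ev1 by (auto intro: generate_ring.one)
 next
  case (incl b)
  thus ?case using JO hO kc by (auto intro!: generate_ring.incl)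
 next
  case (a_inv b)
  let ?m = "\<ominus>\<^bsub>F\<^esub> \<one>\<^bsub>F\<^esub>"
  have m: "h ?m = \<ominus>\<^bsub>R\<^esub> \<one>\<^bsub>R\<^esub>"
   using ring_hom_cring.hom_a_inv[of F R h "\<one>\<^bsub>F\<^esub>"] hom ring_hom_one[OF hom]
   by (simp add: ring_hom_cring_def ring_hom_cring_axioms_def F.cring_axioms R.cring_axioms)
  have bc: "b \<in> carrier R" using a_inv.IH subringE(1)[OF O(1)] by auto
  have eq: "\<ominus>\<^bsub>R\<^esub> b = h ?m \<otimes>\<^bsub>R\<^esub> b" using bc m by (simp add: R.l_minus)
  have "ev (\<ominus>\<^bsub>R\<^esub> b) = \<ominus>\<^bsub>F\<^esub> ev b"
   unfolding eq using a_inv.IH hO[of ?m] evc[of b] by (simp add: ev_mult F.l_minus)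
  thus ?case using a_inv.IH subringE(5)[OF O(1)] by (auto intro: generate_ring.a_inv)
 next
  case (eng_add b c)
  thus ?case using subringE(7)[OF O(1)] by (auto simp: ev_mult intro: generate_ring.eng_add)
 next
  case (eng_mult b c)
  thus ?case using subringE(6)[OF O(1)] by (auto simp: ev_mult intro: generate_ring.eng_mult)
 qed
 have sub: "generate_ring R (h ` k \<union> E) \<subseteq> generate_ring R (h ` k \<union> ?J)"
  using kE J(2) by (intro R.mono_generate_ring) auto
 have \<phi>c: "\<phi> b \<in> k" if "b \<in> generate_ring F (k \<union> ?S)" for b using ring_hom_closed[OF \<phi>(1), of b] that by simp
 have \<phi>m: "\<phi> (b \<otimes>\<^bsub>F\<^esub> c) = \<phi> b \<otimes>\<^bsub>F\<^esub> \<phi> c" "\<phi> (b \<oplus>\<^bsub>F\<^esub> c) = \<phi> b \<oplus>\<^bsub>F\<^esub> \<phi> c"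
  if "b \<in> generate_ring F (k \<union> ?S)" "c \<in> generate_ring F (k \<union> ?S)" for b c
  using ring_hom_mult[OF \<phi>(1), of b c] ring_hom_add[OF \<phi>(1), of b c] that by auto
 have \<phi>1: "\<phi> \<one>\<^bsub>F\<^esub> = \<one>\<^bsub>F\<^esub>" using ring_hom_one[OF \<phi>(1)] by simp
 note gen' = gen[OF subsetD[OF sub]]
 show thesis
 proof (rule that[of "\<phi> \<circ> ev"])
  show "\<phi> \<circ> ev \<in> ring_hom (R\<lparr>carrier := generate_ring R (h ` k \<union> E)\<rparr>) (F\<lparr>carrier := k\<rparr>)"
   unfolding ring_hom_def using gen' \<phi>c \<phi>m \<phi>1 ev1 by (auto simp: ev_mult)
  show "(\<phi> \<circ> ev) (h c) = c" if "c \<in> k" for c using hO[of c] kc \<phi>(2) that by auto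
  have i: "inv\<^bsub>R\<^esub> a \<in> generate_ring R (h ` k \<union> ?J)" by (auto intro: generate_ring.incl)
  have "\<phi> (ev a) \<otimes>\<^bsub>F\<^esub> \<phi> (ev (inv\<^bsub>R\<^esub> a)) = \<one>\<^bsub>F\<^esub>"
   using gen[OF i] gen'[OF a(1)] R.mult_inv[OF ac a(2)] \<phi>1 ev1 by (simp flip: \<phi>m ev_mult)
  thus "(\<phi> \<circ> ev) a \<noteq> \<zero>\<^bsub>F\<^esub>" using \<phi>c[of "ev (inv\<^bsub>R\<^esub> a)"] gen[OF i] kc F.one_not_zero by auto
 qed
qed

text \<open>By hypothesis \<open>f\<close> takes the generators \<open>Y\<close>, hence all
  constants of \<open>L\<close>, into \<open>k(z)\<close>. So the compositum of \<open>f(L)\<close>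
  and \<open>k(z)\<close> has no constants outside \<open>k(z)\<close>. It contains
  \<open>X z\<close> and \<open>z\<close>, thus \<open>X\<close> and all of \<open>E\<close>; a
  constant of \<open>E\<close> is therefore a rational function of \<open>z\<close> over
  \<open>k\<close>.\<close>

lemma (in fundamental_matrix) no_new_constants:
 assumes inf: "infinite (constants K dK)"
  and gen: "carrier E \<subseteq> generate_field E (h ` carrier K \<union> case_prod X ` ({..<n} \<times> {..<n}))"
  and RL: "rational_functions K L ({..<n} \<times> {..<n}) hL x"
  and dL: "differential_field_extension K dK L dL hL"
   "\<And>i j. i < n \<Longrightarrow> j < n \<Longrightarrow> dL (x (i, j)) = mmult L n (\<lambda>i j. hL (A i j)) (curry x) i j"
  and Y: "Y \<subseteq> constants L dL" "constants L dL = generate_field L (hL ` constants K dK \<union> Y)"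
  and coact: "\<And>c. c \<in> Y \<Longrightarrow> \<exists>P\<in>pterms (h ` constants K dK) ({..<n} \<times> {..<n}). \<exists>Q\<in>pterms (h ` constants K dK) ({..<n} \<times> {..<n}).
   \<exists>g\<in>{..<n} \<times> {..<n} \<rightarrow> carrier E. peval E (\<lambda>a. a) g Q \<noteq> \<zero>\<^bsub>E\<^esub> \<and> coaction_pair K L n hL x c E h X (h ` constants K dK) P Q"
 shows "constants E dE = h ` constants K dK"
proof -
 let ?V = "{..<n} \<times> {..<n}" and ?k = "h ` constants K dK"
 interpret RL: rational_functions K L ?V hL x by (rule RL)
 interpret dL: differential_field_extension K dK L dL hL by (rule dL(1))
 have kc: "constants K dK \<subseteq> carrier K" using K.constants_iff by auto
 have infk: "infinite ?k"
  using inf finite_imageD[OF _ inj_on_subset[OF field_hom_inj[OF K.field_axioms L.field_axioms hom] kc]] by auto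
 have kE: "?k \<subseteq> carrier E" using kc ring_hom_closed[OF hom] by auto
 have kC: "?k \<subseteq> constants E dE" using constants_image by auto
 have ksub: "subfield ?k E" by (rule image_subfield[OF K.field_axioms L.field_axioms hom K.constants_subfield])
 have infE: "infinite (carrier E)" using infk kE finite_subset by auto
 obtain R :: "(nat \<times> nat, 'b) ratfun ring" and dR hR z
  where RR: "rational_functions E R ?V hR z" and dR: "differential_field_extension E dE R dR hR"
   and dz0: "\<And>v. v \<in> ?V \<Longrightarrow> dR (z v) = peval R hR z (PConst \<zero>\<^bsub>E\<^esub>)"
  by (rule rational_functions_exist[OF L.differential_field_axioms infE, of ?V "\<lambda>_. PConst \<zero>\<^bsub>E\<^esub>"]) auto
 interpret R: rational_functions E R ?V hR z by (rule RR)
 interpret dR: differential_field_extension E dE R dR hR by (rule dR)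
 have h0: "hR \<zero>\<^bsub>E\<^esub> = \<zero>\<^bsub>R\<^esub>" by (rule ring_hom_zero[OF R.hom L.ring_axioms R.R.ring_axioms])
 have dz: "dR (z v) = \<zero>\<^bsub>R\<^esub>" if "v \<in> ?V" for v using dz0[OF that] h0 by simp
 obtain f where f: "f \<in> ring_hom L R"
  "\<And>t. t \<in> pterms (carrier K) ?V \<Longrightarrow> f (peval L hL x t) = peval R hR z (left_translate E h n X t)"
  "\<And>c. c \<in> carrier K \<Longrightarrow> f (hL c) = hR (h c)"
  "\<And>i j. i < n \<Longrightarrow> j < n \<Longrightarrow> f (x (i, j)) = mmult R n (\<lambda>i j. hR (X i j)) (curry z) i j"
  "\<And>a. a \<in> carrier L \<Longrightarrow> f (dL a) = dR (f a)"
  by (rule generic_embedding[OF RL dL RR dR dz]) auto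
 let ?l = "left_translate E h n X"
 have l: "?l t \<in> pterms (carrier E) ?V" if "t \<in> pterms (carrier K) ?V" for t
  by (rule left_translate_in_pterms[OF L.ring_axioms that _ X]) (use ring_hom_closed[OF hom] in auto)
 have pl: "peval E (\<lambda>a. a) y (?l t) = peval E h (case_prod (mmult E n X (curry y))) t"
  if "t \<in> pterms (carrier K) ?V" "y \<in> ?V \<rightarrow> carrier E" for t y
  using peval_left_translate[OF L.cring_axioms L.cring_axioms _ that(1) X that(2), of "\<lambda>a. a" h]
  by (simp add: ring_hom_def o_def)
 have fext: "differential_field_extension L dL R dR f"
  using f(1,5)
  by (intro differential_field_extension.intro differential_field_extension_axioms.intro)
   (auto intro: dL.L.differential_field_axioms dR.L.differential_field_axioms)
 interpret f: differential_field_extension L dL R dR f by (rule fext)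
 let ?H = "hR ` ?k \<union> z ` ?V"
 let ?D = "generate_field R ?H"
 have Hc: "?H \<subseteq> carrier R" using R.vars_closed R.h_closed kE by (auto simp: Pi_iff)
 have D: "subfield ?D R" by (rule R.R.generate_field_is_subfield[OF Hc])
 have HD: "?H \<subseteq> ?D" by (auto intro: generate_field.incl)
 have DC: "?D \<subseteq> constants R dR"
  by (rule R.R.generate_field_subset[OF dR.L.constants_subfield])
   (use kC dR.constants_image dz R.vars_closed in \<open>auto simp: dR.L.constants_iff\<close>)
 have evk: "peval R hR z t \<in> ?D" if "t \<in> pterms ?k ?V" for t
  by (rule R.R.peval_in_subring[OF subfieldE(1)[OF D] that]) (use HD in auto)
 have ptk: "t \<in> pterms (carrier E) ?V" if "t \<in> pterms ?k ?V" for t by (rule pterms_mono[OF that kE]) simp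
 have fY: "f c \<in> ?D" if c: "c \<in> Y" for c
 proof -
  from coact[OF c] obtain P Q g where PQ: "P \<in> pterms ?k ?V" "Q \<in> pterms ?k ?V"
   and g: "g \<in> ?V \<rightarrow> carrier E" "peval E (\<lambda>a. a) g Q \<noteq> \<zero>\<^bsub>E\<^esub>" and
   id: "coaction_pair K L n hL x c E h X ?k P Q" by auto
  have cL: "c \<in> carrier L" using Y(1) c dL.L.constants_iff by auto
  obtain p q where pq: "p \<in> pterms (carrier K) ?V" "q \<in> pterms (carrier K) ?V"
   "peval L hL x q \<noteq> \<zero>\<^bsub>L\<^esub>" "c \<otimes>\<^bsub>L\<^esub> peval L hL x q = peval L hL x p"
   using RL.fraction[OF cL] by auto
  \<comment> \<open>Both sides are polynomials in \<open>z\<close> over \<open>E\<close>. The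
    hypothesis gives their agreement at matrices over \<open>k\<close>, which suffices because
    \<open>k\<close> is infinite.\<close>
  have eq: "peval R hR z (PMul P (?l q)) = peval R hR z (PMul Q (?l p))"
  proof (rule iffD2[OF R.ev_eq_iff[OF _ _ infk kE]])
   show "\<forall>y\<in>?V \<rightarrow> ?k. peval E (\<lambda>c. c) y (PMul P (?l q)) = peval E (\<lambda>c. c) y (PMul Q (?l p))"
   proof
    fix y assume y: "y \<in> ?V \<rightarrow> ?k"
    hence "y \<in> ?V \<rightarrow> carrier E" using kE by auto
    thus "peval E (\<lambda>c. c) y (PMul P (?l q)) = peval E (\<lambda>c. c) y (PMul Q (?l p))"
     using id pq y pl unfolding coaction_pair_def by simp
   qed
  qed (use PQ ptk l pq in simp_all)
  have "f c \<otimes>\<^bsub>R\<^esub> f (peval L hL x q) = f (peval L hL x p)"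
   using ring_hom_mult[OF f(1) cL RL.ev_closed[OF pq(2)]] pq(4) by simp
  hence e: "f c \<otimes>\<^bsub>R\<^esub> peval R hR z (?l q) = peval R hR z (?l p)" using f(2) pq by simp
  have qn: "peval R hR z (?l q) \<noteq> \<zero>\<^bsub>R\<^esub>"
  proof
   assume "peval R hR z (?l q) = \<zero>\<^bsub>R\<^esub>"
   hence "f (peval L hL x q) = f \<zero>\<^bsub>L\<^esub>"
    using f(2)[OF pq(2)] ring_hom_zero[OF f(1) RL.R.ring_axioms R.R.ring_axioms] by simp
   from inj_onD[OF field_hom_inj[OF RL.R.field_axioms R.R.field_axioms f(1)] this]
   show False using pq(3) RL.ev_closed[OF pq(2)] by simp
  qed
  have Qn: "peval R hR z Q \<noteq> \<zero>\<^bsub>R\<^esub>" using R.vanishing[OF ptk[OF PQ(2)]] g by auto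
  have fc: "f c \<in> carrier R" by (rule ring_hom_closed[OF f(1) cL])
  note cc = fc R.ev_closed[OF ptk[OF PQ(2)]] R.ev_closed[OF ptk[OF PQ(1)]] R.ev_closed[OF l[OF pq(2)]]
  have "peval R hR z (?l q) \<otimes>\<^bsub>R\<^esub> (f c \<otimes>\<^bsub>R\<^esub> peval R hR z Q) = peval R hR z Q \<otimes>\<^bsub>R\<^esub> (f c \<otimes>\<^bsub>R\<^esub> peval R hR z (?l q))"
   using cc by (simp add: R.R.m_ac)
  also have "\<dots> = peval R hR z (?l q) \<otimes>\<^bsub>R\<^esub> peval R hR z P" using eq cc unfolding e by (simp add: R.R.m_ac)
  finally have "f c \<otimes>\<^bsub>R\<^esub> peval R hR z Q = peval R hR z P" using R.R.m_lcancel[OF qn] cc by simp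
  thus ?thesis
   using R.R.fraction_in_subfield[OF D evk[OF PQ(2)] Qn fc] evk[OF PQ(1)] by simp
 qed
 have fD: "f c \<in> ?D" if "c \<in> constants L dL" for c
 proof -
  have "generate_field L (hL ` constants K dK \<union> Y) \<subseteq> {a \<in> carrier L. f a \<in> ?D}"
  proof (rule RL.R.generate_field_subset[OF vimage_subfield[OF RL.R.field_axioms R.R.field_axioms f(1) D]])
   have "f (hL c) \<in> ?D" if "c \<in> constants K dK" for c
    using f(3)[of c] kc HD that subsetD[OF HD, of "hR (h c)"] by auto
   moreover have "hL c \<in> carrier L" if "c \<in> constants K dK" for c using ring_hom_closed[OF dL.hom, of c] kc that by auto
   ultimately show "hL ` constants K dK \<union> Y \<subseteq> {a \<in> carrier L. f a \<in> ?D}"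
    using fY Y(1) dL.L.constants_iff by auto
  qed
  thus ?thesis using that Y(2) by auto
 qed
 have ID: "f ` carrier L \<inter> constants R dR \<subseteq> ?D" unfolding f.constants_image using fD by auto
 have fLc: "f ` carrier L \<union> ?D \<subseteq> carrier R" using ring_hom_closed[OF f(1)] subfieldE(3)[OF D] by auto
 let ?N = "generate_field R (f ` carrier L \<union> ?D)"
 have N: "subfield ?N R" by (rule R.R.generate_field_is_subfield[OF fLc])
 note NR = subfieldE(1)[OF N]
 have sN: "f ` carrier L \<subseteq> ?N" "?D \<subseteq> ?N" by (auto intro: generate_field.incl)
 have zM: "curry z \<in> mats n ?N"
  unfolding mats_def using subsetD[OF sN(2) subsetD[OF HD], of "z (i, j)" for i j] by simp
 obtain U where U: "U \<in> mats n (carrier R)" "minverse R n (curry z) U"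
  using generic_matrix_invertible[OF RR] unfolding curry_def by metis
 have UN: "U \<in> mats n ?N" by (rule R.R.minverse_in_subfield[OF N zM U])
 have hX: "(\<lambda>i j. hR (X i j)) \<in> mats n (carrier R)" using X ring_hom_closed[OF R.hom] by (auto simp: mats_def)
 have zMc: "curry z \<in> mats n (carrier R)" using R.vars_closed by (auto simp: mats_def)
 \<comment> \<open>\<open>X\<close> is recovered as \<open>(X z)\<close> times the inverse of
   \<open>z\<close>; the first factor comes from \<open>f(L)\<close>, and the second has its entries
   in the compositum because \<open>z\<close> does.\<close>
 have hXN: "hR (X i j) \<in> ?N" if ij: "i < n" "j < n" for i j
 proof -
  have "mmult R n (\<lambda>i j. hR (X i j)) (curry z) \<in> mats n ?N"
   using f(4) sN(1) RL.vars_closed by (auto simp: mats_def simp flip: f(4))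
  hence "mmult R n (mmult R n (\<lambda>i j. hR (X i j)) (curry z)) U i j \<in> ?N"
   by (rule matsD[OF R.R.mmult_in_subring[OF NR _ UN] ij])
  thus ?thesis using R.R.minverse_cancel(2)[OF zMc U hX ij] by simp
 qed
 have hN: "hR a \<in> ?N" if "a \<in> carrier E" for a
 proof -
  have "generate_field E (h ` carrier K \<union> case_prod X ` ?V) \<subseteq> {a \<in> carrier E. hR a \<in> ?N}"
  proof (rule L.generate_field_subset[OF vimage_subfield[OF L.field_axioms R.R.field_axioms R.hom N]])
   have "hR (h c) \<in> ?N" if "c \<in> carrier K" for c
    using f(3)[OF that] sN(1) ring_hom_closed[OF dL.hom that] by (auto simp flip: f(3))
   thus "h ` carrier K \<union> case_prod X ` ?V \<subseteq> {a \<in> carrier E. hR a \<in> ?N}"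
    using hXN matsD[OF X] ring_hom_closed[OF hom] by auto
  qed
  thus ?thesis using gen that by auto
 qed
 show ?thesis
 proof (intro equalityI subsetI)
  fix c assume c: "c \<in> constants E dE"
  hence cE: "c \<in> carrier E" by (simp add: L.constants_iff)
  have hc: "hR c \<in> constants R dR" using dR.constants_image c cE by auto
  have "hR c \<in> ?D"
   by (rule dR.L.constants_compositum[OF f.image_differential_subfield D DC ID hc hN[OF cE]])
  from R.R.generate_field_pterms[OF L.ring_axioms subfieldE(1)[OF ksub] R.hom R.vars_closed this]
  obtain P Q where PQ: "P \<in> pterms ?k ?V" "Q \<in> pterms ?k ?V" "peval R hR z Q \<noteq> \<zero>\<^bsub>R\<^esub>"
   "hR c \<otimes>\<^bsub>R\<^esub> peval R hR z Q = peval R hR z P" by auto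
  \<comment> \<open>\<open>c Q = P\<close> is evaluated at a matrix over \<open>k\<close> where
    \<open>Q\<close> does not vanish. As \<open>c\<close> does not involve \<open>z\<close>, it
    becomes a quotient of two elements of \<open>k\<close>.\<close>
  obtain g where g: "g \<in> ?V \<rightarrow> ?k" "peval E (\<lambda>a. a) g Q \<noteq> \<zero>\<^bsub>E\<^esub>"
   using R.ev_eq_iff[OF ptk[OF PQ(2)] _ infk kE, of "PConst \<zero>\<^bsub>E\<^esub>"] PQ(3) h0 by auto
  have "peval R hR z (PMul (PConst c) Q) = peval R hR z P" using PQ(4) by simp
  hence "peval E (\<lambda>a. a) g (PMul (PConst c) Q) = peval E (\<lambda>a. a) g P"
   using R.ev_eq_iff[of "PMul (PConst c) Q" P, OF _ ptk[OF PQ(1)] infk kE] ptk[OF PQ(2)] cE g(1) by simp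
  hence e: "c \<otimes>\<^bsub>E\<^esub> peval E (\<lambda>a. a) g Q = peval E (\<lambda>a. a) g P" by simp
  have in_k: "peval E (\<lambda>a. a) g t \<in> ?k" if "t \<in> pterms ?k ?V" for t
   by (rule L.peval_in_subring[OF subfieldE(1)[OF ksub] that]) (use g(1) in auto)
  show "c \<in> ?k"
   by (rule L.fraction_in_subfield[OF ksub in_k[OF PQ(2)] g(2) cE]) (simp add: e in_k[OF PQ(1)])
 qed (use kC in auto)
qed

section \<open>Differential ideals of the coordinate ring\<close>

text \<open>The ideal of \<open>B\<close> generated by \<open>P\<close>, in the form of the sums for
  which \<open>generic_properness\<close> excludes the value 1.\<close>

lemma (in cring) lcomb_ideal:
 assumes B: "subring B R" and P: "P \<subseteq> B"
 shows "ideal {lcomb zs | zs. set zs \<subseteq> P \<times> B} (R\<lparr>carrier := B\<rparr>)"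
proof -
 note Bc = subringE(1)[OF B]
 interpret B: ring "R\<lparr>carrier := B\<rparr>" by (rule subring_is_ring[OF B])
 let ?I = "{lcomb zs | zs. set zs \<subseteq> P \<times> B}"
 have inB: "lcomb zs \<in> B" if "set zs \<subseteq> P \<times> B" for zs
  using that P subringE(2,6,7)[OF B] by (induction zs) auto
 have mul: "b \<otimes> lcomb zs = lcomb (map (\<lambda>z. (fst z, b \<otimes> snd z)) zs)" if "b \<in> B" "set zs \<subseteq> P \<times> B" for b zs
  using that(2)
 proof (induction zs)
  case (Cons z zs)
  hence "fst z \<in> carrier R" "snd z \<in> carrier R" "b \<in> carrier R" "lcomb zs \<in> carrier R"
   using P Bc that(1) inB[of zs] by auto
  thus ?case using Cons by (simp add: r_distr m_lcomm)
 qed (use that(1) Bc in auto)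
 have mulI: "b \<otimes> a \<in> ?I" if "b \<in> B" "a \<in> ?I" for a b
 proof -
  obtain zs where zs: "set zs \<subseteq> P \<times> B" "a = lcomb zs" using \<open>a \<in> ?I\<close> by auto
  have "set (map (\<lambda>z. (fst z, b \<otimes> snd z)) zs) \<subseteq> P \<times> B" using zs(1) that(1) subringE(6)[OF B] by auto
  thus ?thesis unfolding zs(2) mul[OF that(1) zs(1)] by blast
 qed
 have m1: "\<ominus> \<one> \<in> B" using subringE(3,5)[OF B] by simp
 show ?thesis
 proof (rule idealI)
  show "ring (R\<lparr>carrier := B\<rparr>)" by (rule B.ring_axioms)
  show "subgroup ?I (add_monoid (R\<lparr>carrier := B\<rparr>))"
  proof (rule group.subgroupI[OF B.add.is_group])
   show "?I \<subseteq> carrier (add_monoid (R\<lparr>carrier := B\<rparr>))" using inB by auto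
   show "?I \<noteq> {}" by (auto intro: exI[of _ "[]"])
   fix a assume a: "a \<in> ?I"
   hence aB: "a \<in> B" "a \<in> carrier R" using inB Bc by auto
   have mB: "\<ominus> a \<in> B" using subringE(5)[OF B] aB by simp
   have "\<ominus>\<^bsub>R\<lparr>carrier := B\<rparr>\<^esub> a = \<ominus> a"
    by (rule B.minus_equality) (use aB mB in \<open>simp_all add: l_neg\<close>)
   also have "\<dots> = \<ominus> \<one> \<otimes> a" using aB by (simp add: l_minus)
   finally show "inv\<^bsub>add_monoid (R\<lparr>carrier := B\<rparr>)\<^esub> a \<in> ?I" using mulI[OF m1 a] by (simp add: a_inv_def)
  next
   fix a b assume "a \<in> ?I" "b \<in> ?I"
   then obtain zs ws where z: "set zs \<subseteq> P \<times> B" "a = lcomb zs" and w: "set ws \<subseteq> P \<times> B" "b = lcomb ws" by auto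
   have "P \<times> B \<subseteq> carrier R \<times> carrier R" using P Bc by auto
   hence "a \<oplus> b = lcomb (zs @ ws)" using z w by (simp add: lcomb_append)
   moreover have "set (zs @ ws) \<subseteq> P \<times> B" using z w by auto
   ultimately show "a \<otimes>\<^bsub>add_monoid (R\<lparr>carrier := B\<rparr>)\<^esub> b \<in> ?I"
    by (simp only: mem_Collect_eq, intro exI[of _ "zs @ ws"]) simp
  qed
  fix a b assume ab: "a \<in> ?I" "b \<in> carrier (R\<lparr>carrier := B\<rparr>)"
  thus "b \<otimes>\<^bsub>R\<lparr>carrier := B\<rparr>\<^esub> a \<in> ?I" using mulI by simp
  have "a \<in> carrier R" "b \<in> carrier R" using ab inB Bc by auto
  thus "a \<otimes>\<^bsub>R\<lparr>carrier := B\<rparr>\<^esub> b \<in> ?I" using ab mulI[of b a] m_comm by simp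
 qed
qed

lemma (in differential_field) generate_ring_differential:
 assumes "H \<subseteq> carrier K" "\<And>a. a \<in> H \<Longrightarrow> d a \<in> generate_ring K H" "a \<in> generate_ring K H"
 shows "d a \<in> generate_ring K H"
 using assms(3)
proof induction
 case one
 show ?case using derivation_one[OF derivation_d] ring.zero_in_generate[OF ring_axioms] by simp
next
 case (a_inv a)
 thus ?case
  using derivation_a_inv[OF derivation_d, of a] generate_ring_in_carrier[OF assms(1)] by (auto intro: generate_ring.a_inv)
next
 case (eng_add a b)
 thus ?case using generate_ring_in_carrier[OF assms(1)] by (auto simp: d_add intro: generate_ring.eng_add)
next
 case (eng_mult a b)
 thus ?case using generate_ring_in_carrier[OF assms(1)]
  by (auto simp: d_mult intro: generate_ring.eng_add generate_ring.eng_mult)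
qed (use assms(2) in auto)

text \<open>Differentiating \<open>X W = 1\<close> gives \<open>W' = - W X' W\<close>, whose factors
  have entries in \<open>B\<close>.\<close>

lemma (in differential_field) minverse_derivation:
 assumes B: "subring B K" and X: "X \<in> mats n B" and W: "W \<in> mats n B" and inv: "minverse K n X W"
  and dX: "(\<lambda>i j. d (X i j)) \<in> mats n B" and ij: "i < n" "j < n"
 shows "d (W i j) \<in> B"
proof -
 note Bc = subringE(1)[OF B]
 have Xc: "X \<in> mats n (carrier K)" and Wc: "W \<in> mats n (carrier K)" using mats_mono[OF X Bc] mats_mono[OF W Bc] .
 have dWc: "(\<lambda>i j. d (W i j)) \<in> mats n (carrier K)" "(\<lambda>i j. d (X i j)) \<in> mats n (carrier K)"
  using matsD[OF Wc] matsD[OF Xc] d_closed by (auto simp: mats_def)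
 let ?N = "mmult K n (\<lambda>i j. d (X i j)) W" and ?XD = "mmult K n X (\<lambda>i j. d (W i j))"
 have N: "?N \<in> mats n B" by (rule mmult_in_subring[OF B dX W])
 have XD: "?XD i j = \<ominus> ?N i j" if ij: "i < n" "j < n" for i j
 proof -
  have c: "X i l \<in> carrier K" "W l j \<in> carrier K" "d (X i l) \<in> carrier K" "d (W l j) \<in> carrier K" if "l < n" for l
   using matsD[OF Xc ij(1) that] matsD[OF Wc that ij(2)] d_closed by auto
  have "d (mmult K n X W i j) = (\<Oplus>l\<in>{..<n}. d (X i l \<otimes> W l j))"
   unfolding mmult_def using c by (subst d_finsum) auto
  also have "\<dots> = (\<Oplus>l\<in>{..<n}. X i l \<otimes> d (W l j) \<oplus> d (X i l) \<otimes> W l j)"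
   using c by (intro finsum_cong') (auto simp: d_mult a_comm)
  also have "\<dots> = ?XD i j \<oplus> ?N i j"
   unfolding mmult_def using c by (intro finsum_addf) auto
  finally have "?XD i j \<oplus> ?N i j = d (mone K i j)" using inv ij by (simp add: minverse_def)
  also have "\<dots> = \<zero>" using derivation_zero[OF derivation_d] derivation_one[OF derivation_d] by (simp add: mone_def)
  finally show ?thesis
   using matsD[OF mmult_closed[OF Xc dWc(1)] ij] matsD[OF N ij] Bc by (intro sum_zero_eq_neg) auto
 qed
 have inv': "minverse K n W X" using inv by (simp add: minverse_def)
 have NB: "(\<lambda>i j. \<ominus> ?N i j) \<in> mats n B" using N subringE(5)[OF B] by (auto simp: mats_def)
 have "d (W i j) = mmult K n W ?XD i j"
  using minverse_cancel(1)[OF Wc Xc inv' dWc(1) ij] by simp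
 also have "\<dots> = mmult K n W (\<lambda>i j. \<ominus> ?N i j) i j"
  using XD ij matsD[OF Wc] matsD[OF mats_mono[OF NB Bc]] abelian_monoid_axioms by (intro mmult_cong) auto
 finally show ?thesis using matsD[OF mmult_in_subring[OF B W NB] ij] by simp
qed

lemma mmult_hom_on_subring:
 assumes "subring B R" "cring R" "cring S" "g \<in> ring_hom (R\<lparr>carrier := B\<rparr>) S" "X \<in> mats n B" "Y \<in> mats n B" "i < n" "j < n"
 shows "g (mmult R n X Y i j) = mmult S n (\<lambda>i j. g (X i j)) (\<lambda>i j. g (Y i j)) i j"
proof -
 interpret R: cring R by fact
 have "cring (R\<lparr>carrier := B\<rparr>)"
  using R.subcring_iff[of B] R.subcringI'[OF assms(1)] subringE(1)[OF assms(1)] by simp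
 moreover have "mmult R n X Y i j = mmult (R\<lparr>carrier := B\<rparr>) n X Y i j"
  unfolding mmult_def using finsum_carrier_update[OF assms(2,1), of "{..<n}" "\<lambda>l. X i l \<otimes>\<^bsub>R\<^esub> Y l j"]
   matsD[OF assms(5,7)] matsD[OF assms(6) _ assms(8)] subringE(6)[OF assms(1)] by simp
 ultimately show ?thesis using mmult_hom[OF assms(4) _ assms(3), of X n Y i j] assms by simp
qed

context constant_point
begin

abbreviation "S \<equiv> generate_ring L (K0 \<union> A)"

definition kernel where "kernel = {s \<in> S. \<psi> s = \<zero>}"

lemma S: "subring S L" "K0 \<subseteq> S" "A \<subseteq> S"
 using carriers by (auto intro: generate_ring_is_subring generate_ring.incl)

lemma kernel_ideal: "ideal kernel (L\<lparr>carrier := S\<rparr>)"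
proof -
 have "ring_hom_ring (L\<lparr>carrier := S\<rparr>) L \<psi>"
 proof (rule ring_hom_ringI2)
  show "\<psi> \<in> ring_hom (L\<lparr>carrier := S\<rparr>) L"
   unfolding ring_hom_def using \<psi>_closed carriers \<psi>_add \<psi>_mult \<psi>_id[of \<one>] subringE(3)[OF subfieldE(1)[OF K0(1)]]
   by auto
 qed (use subring_is_ring[OF S(1)] ring_axioms in auto)
 from ring_hom_ring.kernel_is_ideal[OF this] show ?thesis by (simp add: a_kernel_def' kernel_def)
qed

lemma kernel_d: "s \<in> kernel \<Longrightarrow> d s \<in> kernel"
 using \<psi>_d derivation_zero[OF derivation_d] by (auto simp: kernel_def)

text \<open>Modulo the kernel every element of \<open>S\<close> is congruent to its value in
  \<open>K0\<close>; this is why the constants in \<open>A\<close> become elements of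
  \<open>k\<close> in the quotient.\<close>

lemma \<psi>_minus: "s \<in> S \<Longrightarrow> s \<oplus> \<ominus> \<psi> s \<in> kernel"
proof -
 assume s: "s \<in> S"
 have m: "\<ominus> \<psi> s \<in> K0" using \<psi>_closed[OF s] subringE(5)[OF subfieldE(1)[OF K0(1)]] by simp
 have mS: "\<ominus> \<psi> s \<in> S" using m S(2) by auto
 have "\<psi> s \<in> carrier L" using \<psi>_closed[OF s] carriers by auto
 thus ?thesis
  using \<psi>_add[OF s mS] \<psi>_id[OF m] subringE(7)[OF S(1) s mS] by (simp add: kernel_def r_neg)
qed

text \<open>Powers of a nonzero value in the field \<open>K0\<close> are nonzero. This supplies the
  hypothesis on powers in \<open>generic_properness\<close>.\<close>

lemma kernel_pow:
 assumes "a \<in> S" "\<psi> a \<noteq> \<zero>" shows "a [^] (m::nat) \<notin> kernel"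
proof -
 have "a [^] m \<in> S \<and> \<psi> (a [^] m) \<noteq> \<zero>"
 proof (induction m)
  case 0
  show ?case using subringE(3)[OF S(1)] \<psi>_id[of \<one>] subringE(3)[OF subfieldE(1)[OF K0(1)]] by simp
 next
  case (Suc m)
  have "\<psi> a \<in> carrier L" "\<psi> (a [^] m) \<in> carrier L" using Suc assms(1) \<psi>_closed carriers by auto
  thus ?case using Suc assms subringE(6)[OF S(1)] by (simp add: \<psi>_mult integral_iff)
 qed
 thus ?thesis by (simp add: kernel_def)
qed

end

lemma (in ring) add_pow_subring: "[n] \<cdot>\<^bsub>R\<lparr>carrier := S\<rparr>\<^esub> a = [(n::nat)] \<cdot> a"
 by (induction n) (auto simp: add_pow_def nat_pow_def)

lemma (in ring) add_pow_eq_zero_diff: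
 assumes "[m] \<cdot> \<one> = [n] \<cdot> \<one>" "m \<le> n" shows "[(n - m :: nat)] \<cdot> \<one> = \<zero>"
proof -
 have "[(n - m)] \<cdot> \<one> \<oplus> [m] \<cdot> \<one> = [n] \<cdot> \<one>" using add.nat_pow_mult[of \<one> "n - m" m] assms(2) by simp
 hence "[(n - m)] \<cdot> \<one> \<oplus> [m] \<cdot> \<one> = \<zero> \<oplus> [m] \<cdot> \<one>" using assms(1) by simp
 thus ?thesis by (subst (asm) add.r_cancel) auto
qed

text \<open>Infinitely many constants are needed to test polynomial identities on them, and nonzero
  positive integers to cancel the coefficients in the Taylor argument for prime differential
  ideals.\<close>

lemma (in differential_field) char_zero_constants:
 assumes "char_zero (K\<lparr>carrier := constants K d\<rparr>)"
 shows "infinite (constants K d)" "\<And>n::nat. n > 0 \<Longrightarrow> [n] \<cdot> \<one> \<noteq> \<zero>"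
proof -
 show nz: "[n] \<cdot> \<one> \<noteq> \<zero>" if "n > 0" for n :: nat
  using assms that by (simp add: char_zero_def add_pow_subring)
 have "[n] \<cdot> \<one> \<in> constants K d" for n :: nat
 proof (induction n)
  case (Suc n)
  thus ?case
   using subringE(3,7)[OF subfieldE(1)[OF constants_subfield]] by simp
 qed (simp add: subringE(2)[OF subfieldE(1)[OF constants_subfield]])
 moreover have "inj (\<lambda>n::nat. [n] \<cdot> \<one>)"
 proof (rule injI)
  fix m n :: nat assume e: "[m] \<cdot> \<one> = [n] \<cdot> \<one>"
  show "m = n"
  proof (rule ccontr)
   assume "m \<noteq> n"
   then consider "m < n" | "n < m" by linarith
   thus False
    using add_pow_eq_zero_diff[of m n] add_pow_eq_zero_diff[of n m] e nz[of "n - m"] nz[of "m - n"]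
    by cases auto
  qed
 qed
 ultimately show "infinite (constants K d)" using infinite_UNIV_nat by (metis finite_imageD finite_subset image_subsetI)
qed

theorem fundamental_matrix_exists:
 fixes K :: "('a, 'r) ring_scheme"
 assumes K: "differential_field K dK" and char: "char_zero (K\<lparr>carrier := constants K dK\<rparr>)"
  and ec: "existentially_closed_in (constants K dK) K" and A: "A \<in> mats n (carrier K)"
 obtains E :: "((nat \<times> nat, 'a) ratfun set \<times> (nat \<times> nat, 'a) ratfun set) set ring" and dE h X W
 where "fundamental_matrix K dK E dE h n A X W" "constants E dE = h ` constants K dK"
  "carrier E \<subseteq> generate_field E (h ` carrier K \<union> case_prod X ` ({..<n} \<times> {..<n}))"
proof -
 let ?V = "{..<n} \<times> {..<n}" and ?k = "constants K dK"
 interpret K: differential_field K dK by (rule K)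
 note infk = K.char_zero_constants(1)[OF char] and nz = K.char_zero_constants(2)[OF char]
 have kK: "?k \<subseteq> carrier K" by (auto simp: K.constants_iff)
 have infK: "infinite (carrier K)" using infk kK finite_subset by auto
 have w: "mterm \<zero>\<^bsub>K\<^esub> n A v \<in> pterms (carrier K) ?V" if "v \<in> ?V" for v
  by (rule mterm_in_pterms[OF K.zero_closed A that])
 obtain L :: "(nat \<times> nat, 'a) ratfun ring" and dL hL x
  where RL: "rational_functions K L ?V hL x" and extL: "differential_field_extension K dK L dL hL"
   and dxL: "\<And>v. v \<in> ?V \<Longrightarrow> dL (x v) = peval L hL x (mterm \<zero>\<^bsub>K\<^esub> n A v)"
  by (rule rational_functions_exist[OF K infK _ w]) auto
 interpret R: rational_functions K L ?V hL x by (rule RL)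
 interpret extL: differential_field_extension K dK L dL hL by (rule extL)
 have hL0: "hL \<zero>\<^bsub>K\<^esub> = \<zero>\<^bsub>L\<^esub>" by (rule ring_hom_zero[OF R.hom K.ring_axioms R.R.ring_axioms])
 have hAc: "hL (A i j) \<in> carrier L" if "i < n" "j < n" for i j by (rule ring_hom_closed[OF R.hom matsD[OF A that]])
 have dx: "dL (x (i, j)) = mmult L n (\<lambda>i j. hL (A i j)) (curry x) i j" if "i < n" "j < n" for i j
  using dxL[of "(i, j)"] that peval_mterm[where f = hL, OF R.R.cring_axioms hL0 hAc R.vars_closed that] by simp
 obtain W where W: "W \<in> mats n (carrier L)" "minverse L n (curry x) W"
  using generic_matrix_invertible[OF RL] unfolding curry_def by metis
 have xM: "curry x \<in> mats n (carrier L)" using R.vars_closed by (auto simp: mats_def)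
 \<comment> \<open>The generic field is itself an extension with a fundamental matrix, namely
   \<open>x\<close>, so \<open>coaction\<close> applies to its own constants.\<close>
 interpret M: fundamental_matrix K dK L dL hL n A "curry x" W
  by unfold_locales (use A xM W dx in auto)
 let ?C = "constants L dL" and ?K0 = "hL ` carrier K"
 have Cc: "?C \<subseteq> carrier L" by (auto simp: extL.L.constants_iff)
 note Cf = extL.L.constants_subfield
 have hkC: "hL ` ?k \<subseteq> ?C" using extL.constants_image by auto
 obtain Y where Y: "finite Y" "Y \<subseteq> ?C" "?C = generate_field L (hL ` ?k \<union> Y)"
  by (rule extL.constants_finitely_generated[of "x ` ?V"]) (use R.vars_closed R.generate_field_carrier in auto)
 have "\<exists>P Q g. P \<in> pterms ?C ?V \<and> Q \<in> pterms ?C ?V \<and> g \<in> ?V \<rightarrow> hL ` ?k \<and> peval L (\<lambda>a. a) g Q \<noteq> \<zero>\<^bsub>L\<^esub> \<and>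
   coaction_pair K L n hL x c L hL (curry x) (carrier L) P Q" if "c \<in> Y" for c
  by (rule M.coaction[OF infk RL _ subsetD[OF Y(2) that]], simp) (intro exI conjI; assumption)
 then obtain P Q g where coD: "\<And>c. c \<in> Y \<Longrightarrow> P c \<in> pterms ?C ?V" "\<And>c. c \<in> Y \<Longrightarrow> Q c \<in> pterms ?C ?V"
  "\<And>c. c \<in> Y \<Longrightarrow> g c \<in> ?V \<rightarrow> hL ` ?k" "\<And>c. c \<in> Y \<Longrightarrow> peval L (\<lambda>a. a) (g c) (Q c) \<noteq> \<zero>\<^bsub>L\<^esub>"
  "\<And>c. c \<in> Y \<Longrightarrow> coaction_pair K L n hL x c L hL (curry x) (carrier L) (P c) (Q c)" by metis
 \<comment> \<open>The value of \<open>Q c\<close> at the chosen constant matrix. Adjoining its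
   inverse to the ring that is specialised prevents this value, and with it \<open>Q c\<close>, from
   becoming zero.\<close>
 define Qg where "Qg c = peval L (\<lambda>a. a) (g c) (Q c)" for c
 have Qg: "Qg c \<in> ?C" "inv\<^bsub>L\<^esub> Qg c \<in> ?C" "Qg c \<otimes>\<^bsub>L\<^esub> inv\<^bsub>L\<^esub> Qg c = \<one>\<^bsub>L\<^esub>" if c: "c \<in> Y" for c
 proof -
  show 1: "Qg c \<in> ?C" unfolding Qg_def
   by (rule R.R.peval_in_subring[OF subfieldE(1)[OF Cf] coD(2)[OF c]]) (use coD(3)[OF c] hkC in auto)
  have "Qg c \<noteq> \<zero>\<^bsub>L\<^esub>" using coD(4)[OF c] by (simp add: Qg_def)
  thus "inv\<^bsub>L\<^esub> Qg c \<in> ?C" "Qg c \<otimes>\<^bsub>L\<^esub> inv\<^bsub>L\<^esub> Qg c = \<one>\<^bsub>L\<^esub>"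
   using R.R.subfield_m_inv[OF Cf, of "Qg c"] 1 by auto
 qed
 \<comment> \<open>All that has to survive specialisation: the generators of the constants, the
   coefficients of \<open>P c\<close> and \<open>Q c\<close>, and the inverses of the values
   \<open>Qg c\<close>.\<close>
 define Y' where "Y' = Y \<union> (\<Union>c\<in>Y. tconsts (P c) \<union> tconsts (Q c)) \<union> (\<lambda>c. inv\<^bsub>L\<^esub> Qg c) ` Y"
 have finY': "finite Y'" using Y(1) finite_tconsts by (auto simp: Y'_def)
 have "tconsts (P c) \<subseteq> ?C" "tconsts (Q c) \<subseteq> ?C" if "c \<in> Y" for c
  using coD(1,2)[OF that] by (simp_all add: pterms_def)
 hence Y'C: "Y' \<subseteq> ?C" unfolding Y'_def using Y(2) Qg(2) by (intro Un_least UN_least image_subsetI)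
 let ?A = "generate_ring L (hL ` ?k \<union> Y')"
 have HA: "hL ` ?k \<union> Y' \<subseteq> carrier L" using hkC Y'C Cc by auto
 have Ar: "subring ?A L" by (rule R.R.generate_ring_is_subring[OF HA])
 have AC: "?A \<subseteq> ?C"
  by (rule R.R.generate_ring_min_subring1[OF HA subfieldE(1)[OF Cf]]) (use hkC Y'C in auto)
 have inA: "hL ` ?k \<subseteq> ?A" "Y' \<subseteq> ?A" by (auto intro: generate_ring.incl)
 interpret CR: constant_ring L dL ?K0 ?A
 proof (intro constant_ring.intro constant_ring_axioms.intro extL.L.differential_field_axioms
   extL.image_differential_subfield Ar AC)
  show "?K0 \<inter> ?C \<subseteq> ?A" unfolding extL.constants_image by (rule inA(1))
 qed
 let ?S = "generate_ring L (?K0 \<union> ?A)"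
 have Sc: "?K0 \<union> ?A \<subseteq> carrier L" using CR.carriers by auto
 have Sr: "subring ?S L" by (rule R.R.generate_ring_is_subring[OF Sc])
 have inS: "?K0 \<subseteq> ?S" "?A \<subseteq> ?S" by (auto intro: generate_ring.incl)
 have "infinite ?K0" using infK finite_imageD[OF _ field_hom_inj[OF K.field_axioms R.R.field_axioms R.hom]] by auto
 hence infS: "infinite ?S" using inS finite_subset by auto
 \<comment> \<open>The entries of \<open>x\<close> and of its inverse. With the inverse in the ring,
   the fundamental matrix stays invertible in every quotient.\<close>
 let ?X = "x ` ?V \<union> case_prod W ` ?V"
 have Xc: "finite ?X" "?X \<subseteq> carrier L" using R.vars_closed W(1) by (auto simp: mats_def)
 \<comment> \<open>An ideal of \<open>?S\<close> that contains no power of this \<open>h\<close>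
   generates a proper ideal of the coordinate ring.\<close>
 obtain h where hS: "h \<in> ?S - {\<zero>\<^bsub>L\<^esub>}" and
  proper: "\<forall>P. ideal P (L\<lparr>carrier := ?S\<rparr>) \<longrightarrow> (\<forall>m::nat. h [^]\<^bsub>L\<^esub> m \<notin> P) \<longrightarrow>
   (\<forall>zs. set zs \<subseteq> P \<times> generate_ring L (?S \<union> ?X) \<longrightarrow> R.R.lcomb zs \<noteq> \<one>\<^bsub>L\<^esub>)"
  by (rule bexE[OF R.R.generic_properness[OF Xc(1) Sr infS Xc(2)]])
 have h: "h \<in> ?S" "h \<noteq> \<zero>\<^bsub>L\<^esub>" using hS by simp_all
 \<comment> \<open>The condition on \<open>h\<close> lives in \<open>K0[A]\<close>, but only
   constants are specialised; \<open>u\<close> is a constant that controls it.\<close>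
 obtain u where u: "u \<in> ?A" "u \<noteq> \<zero>\<^bsub>L\<^esub>" and
  nonvanishing: "\<And>\<chi>. constant_point L dL ?K0 ?A \<chi> \<Longrightarrow> \<chi> u \<noteq> \<zero>\<^bsub>L\<^esub> \<Longrightarrow> constant_point.\<psi> L ?K0 ?A \<chi> h \<noteq> \<zero>\<^bsub>L\<^esub>"
  using CR.generic_nonvanishing[OF h] by metis
 obtain \<chi> where \<chi>: "\<chi> \<in> ring_hom (L\<lparr>carrier := ?A\<rparr>) (K\<lparr>carrier := ?k\<rparr>)"
  "\<And>c. c \<in> ?k \<Longrightarrow> \<chi> (hL c) = c" "\<chi> u \<noteq> \<zero>\<^bsub>K\<^esub>"
  using R.specialization[OF ec finY' _ u] Y'C Cc by blast
 have \<chi>k: "\<chi> a \<in> ?k" if "a \<in> ?A" for a using ring_hom_closed[OF \<chi>(1), of a] that by simp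
 \<comment> \<open>\<open>\<chi>\<close> takes values in \<open>K\<close>; \<open>\<omega>\<close>
   is the same map read inside \<open>L\<close>, as \<open>constant_point\<close> demands.\<close>
 define \<omega> where "\<omega> = hL \<circ> \<chi>"
 have hom\<omega>: "\<omega> \<in> ring_hom (L\<lparr>carrier := ?A\<rparr>) (L\<lparr>carrier := ?K0 \<inter> ?C\<rparr>)"
  unfolding extL.constants_image \<omega>_def using \<chi>k kK ring_hom_add[OF \<chi>(1)] ring_hom_mult[OF \<chi>(1)] ring_hom_one[OF \<chi>(1)]
   ring_hom_add[OF R.hom] ring_hom_mult[OF R.hom] ring_hom_one[OF R.hom]
  by (auto simp: ring_hom_def subset_iff)
 interpret CP: constant_point L dL ?K0 ?A \<omega>
 proof (intro constant_point.intro constant_point_axioms.intro CR.constant_ring_axioms hom\<omega>)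
  fix c assume "c \<in> ?K0 \<inter> ?C"
  thus "\<omega> c = c" unfolding \<omega>_def extL.constants_image using \<chi>(2) by auto
 qed
 have "\<omega> u \<noteq> \<zero>\<^bsub>L\<^esub>"
 proof
  assume "\<omega> u = \<zero>\<^bsub>L\<^esub>"
  hence "hL (\<chi> u) = hL \<zero>\<^bsub>K\<^esub>" using hL0 by (simp add: \<omega>_def)
  from inj_onD[OF field_hom_inj[OF K.field_axioms R.R.field_axioms R.hom] this]
  show False using \<chi>(3) \<chi>k[OF u(1)] kK by auto
 qed
 hence \<psi>h: "CP.\<psi> h \<noteq> \<zero>\<^bsub>L\<^esub>" by (rule nonvanishing[OF CP.constant_point_axioms])
 define BB where "BB = generate_ring L (?S \<union> ?X)"
 have HB: "?S \<union> ?X \<subseteq> carrier L" using subringE(1)[OF Sr] Xc(2) by auto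
 have Br: "subring BB L" unfolding BB_def by (rule R.R.generate_ring_is_subring[OF HB])
 note Bc = subringE(1)[OF Br]
 have inB: "?S \<subseteq> BB" "?X \<subseteq> BB" unfolding BB_def by (auto intro: generate_ring.incl)
 have K0B: "hL a \<in> BB" if "a \<in> carrier K" for a using inB(1) inS(1) that by blast
 have xB: "curry x \<in> mats n BB" and WB: "W \<in> mats n BB" using inB(2) by (auto simp: mats_def)
 have hAB: "(\<lambda>i j. hL (A i j)) \<in> mats n BB" using K0B matsD[OF A] by (simp add: mats_def)
 have dxB: "(\<lambda>i j. dL (curry x i j)) \<in> mats n BB"
  using matsD[OF R.R.mmult_in_subring[OF Br hAB xB]] by (simp add: mats_def dx)
 have dB: "dL b \<in> BB" if "b \<in> BB" for b
  unfolding BB_def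
 proof (rule extL.L.generate_ring_differential[OF HB _ that[unfolded BB_def]], fold BB_def)
  fix a assume "a \<in> ?S \<union> ?X"
  then consider "a \<in> ?S" | i j where "i < n" "j < n" "a = x (i, j)" | i j where "i < n" "j < n" "a = W i j" by auto
  thus "dL a \<in> BB"
  proof cases
   case 1
   thus ?thesis using CP.\<psi>_d(1) inB(1) by blast
  next
   case 2
   thus ?thesis using matsD[OF dxB 2(1,2)] by simp
  next
   case 3
   thus ?thesis using extL.L.minverse_derivation[OF Br xB WB W(2) dxB 3(1,2)] by simp
  qed
 qed
 let ?RB = "L\<lparr>carrier := BB\<rparr>"
 have Bcr: "cring ?RB" using R.R.subcring_iff[OF Bc] R.R.subcringI'[OF Br] by simp
 interpret B: cring ?RB by (rule Bcr)
 have derB: "derivation ?RB dL"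
  using dB Bc extL.L.derivation_d by (auto simp: derivation_def subset_iff)
 \<comment> \<open>The ideal of the coordinate ring generated by the kernel of
   \<open>CP.\<psi>\<close>. It is differential because the kernel is, and proper by the choice of
   \<open>h\<close>.\<close>
 let ?I = "{R.R.lcomb zs |zs. set zs \<subseteq> CP.kernel \<times> BB}"
 have kerS: "CP.kernel \<subseteq> ?S" by (auto simp: CP.kernel_def)
 have kerB: "CP.kernel \<subseteq> BB" using kerS inB(1) by blast
 have idI: "ideal ?I ?RB" by (rule R.R.lcomb_ideal[OF Br kerB])
 have oneI: "\<one>\<^bsub>?RB\<^esub> \<notin> ?I"
  using proper[folded BB_def, rule_format, OF CP.kernel_ideal CP.kernel_pow[OF h(1) \<psi>h]] by (simp, metis)
 have dI: "dL a \<in> ?I" if "a \<in> ?I" for a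
 proof -
  have step: "\<exists>ws. set ws \<subseteq> CP.kernel \<times> BB \<and> dL (R.R.lcomb zs) = R.R.lcomb ws" if "set zs \<subseteq> CP.kernel \<times> BB" for zs
   using that
  proof (induction zs)
   case Nil
   show ?case using R.R.derivation_zero[OF extL.L.derivation_d] by (intro exI[of _ "[]"]) simp
  next
   case (Cons z zs)
   then obtain ws where ws: "set ws \<subseteq> CP.kernel \<times> BB" "dL (R.R.lcomb zs) = R.R.lcomb ws" by auto
   have kBL: "CP.kernel \<times> BB \<subseteq> carrier L \<times> carrier L" using kerB Bc by auto
   have z: "fst z \<in> CP.kernel" "snd z \<in> BB" "fst z \<in> carrier L" "snd z \<in> carrier L"
    using Cons.prems kerB Bc by auto
   have c: "R.R.lcomb zs \<in> carrier L" "R.R.lcomb ws \<in> carrier L"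
    using Cons.prems ws(1) kBL by (auto intro!: R.R.lcomb_closed)
   have "dL (R.R.lcomb (z # zs)) = R.R.lcomb ((dL (fst z), snd z) # (fst z, dL (snd z)) # ws)"
    using z c ws(2) extL.L.d_closed by (simp add: extL.L.d_add extL.L.d_mult R.R.a_assoc)
   thus ?case using z ws(1) CP.kernel_d dB
    by (intro exI[of _ "(dL (fst z), snd z) # (fst z, dL (snd z)) # ws"]) simp
  qed
  from that obtain zs where zs: "set zs \<subseteq> CP.kernel \<times> BB" "a = R.R.lcomb zs"
   by (simp only: mem_Collect_eq) (elim exE conjE, rule that)
  from step[OF zs(1)] obtain ws where ws: "set ws \<subseteq> CP.kernel \<times> BB" "dL (R.R.lcomb zs) = R.R.lcomb ws"
   by (elim exE conjE) (rule that)
  show ?thesis unfolding zs(2) mem_Collect_eq using ws by (intro exI[of _ ws] conjI)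
 qed
 \<comment> \<open>Positive integers are invertible in \<open>K\<close>, and the image of
   \<open>K\<close> lies in \<open>BB\<close>.\<close>
 have units: "\<exists>u\<in>carrier ?RB. u \<otimes>\<^bsub>?RB\<^esub> [m] \<cdot>\<^bsub>?RB\<^esub> \<one>\<^bsub>?RB\<^esub> = \<one>\<^bsub>?RB\<^esub>" if "m > 0" for m :: nat
 proof -
  have "hL ([m] \<cdot>\<^bsub>K\<^esub> \<one>\<^bsub>K\<^esub>) = [m] \<cdot>\<^bsub>L\<^esub> \<one>\<^bsub>L\<^esub>" for m :: nat
  proof (induction m)
   case (Suc m)
   thus ?case using ring_hom_one[OF R.hom] ring_hom_add[OF R.hom, of "[m] \<cdot>\<^bsub>K\<^esub> \<one>\<^bsub>K\<^esub>" "\<one>\<^bsub>K\<^esub>"] by simp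
  qed (simp add: hL0)
  moreover have n0: "[m] \<cdot>\<^bsub>K\<^esub> \<one>\<^bsub>K\<^esub> \<in> carrier K" "[m] \<cdot>\<^bsub>K\<^esub> \<one>\<^bsub>K\<^esub> \<noteq> \<zero>\<^bsub>K\<^esub>" using nz[OF that] by auto
  note i = K.inv_closed_nonzero[OF n0] K.inv_mult[OF n0]
  ultimately have "hL (inv\<^bsub>K\<^esub> ([m] \<cdot>\<^bsub>K\<^esub> \<one>\<^bsub>K\<^esub>)) \<otimes>\<^bsub>L\<^esub> [m] \<cdot>\<^bsub>L\<^esub> \<one>\<^bsub>L\<^esub> = \<one>\<^bsub>L\<^esub>"
   using ring_hom_mult[OF R.hom i(1) n0(1)] ring_hom_one[OF R.hom] by simp
  thus ?thesis using K0B[OF i(1)] by (intro bexI[of _ "hL (inv\<^bsub>K\<^esub> ([m] \<cdot>\<^bsub>K\<^esub> \<one>\<^bsub>K\<^esub>))"]) (simp_all add: R.R.add_pow_subring)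
 qed
 \<comment> \<open>The absence of new constants will come from the specialisation; the prime ideal
   is there to make the quotient a domain with a derivation.\<close>
 obtain Q' where Q': "primeideal Q' ?RB" "?I \<subseteq> Q'" "\<And>a. a \<in> Q' \<Longrightarrow> dL a \<in> Q'"
 proof (rule B.exists_prime_differential_ideal[OF derB idI oneI dI units])
  fix P assume "primeideal P ?RB" "?I \<subseteq> P" "\<And>a. a \<in> P \<Longrightarrow> dL a \<in> P"
  thus thesis by (rule that)
 qed
 obtain E :: "((nat \<times> nat, 'a) ratfun set \<times> (nat \<times> nat, 'a) ratfun set) set ring" and dE \<pi>
  where E: "differential_field E dE" and \<pi>: "\<pi> \<in> ring_hom ?RB E"
  and \<pi>0: "\<And>a. a \<in> carrier ?RB \<Longrightarrow> \<pi> a = \<zero>\<^bsub>E\<^esub> \<longleftrightarrow> a \<in> Q'"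
  and \<pi>d: "\<And>a. a \<in> carrier ?RB \<Longrightarrow> \<pi> (dL a) = dE (\<pi> a)"
  and Efrac: "\<And>e. e \<in> carrier E \<Longrightarrow> \<exists>a\<in>carrier ?RB. \<exists>s\<in>carrier ?RB - Q'. e \<otimes>\<^bsub>E\<^esub> \<pi> s = \<pi> a"
 proof (rule residue_field[OF Q'(1) derB Q'(3)])
  fix E :: "((nat \<times> nat, 'a) ratfun set \<times> (nat \<times> nat, 'a) ratfun set) set ring" and dE \<pi>
  assume "differential_field E dE" "\<pi> \<in> ring_hom ?RB E"
   "\<And>a. a \<in> carrier ?RB \<Longrightarrow> \<pi> a = \<zero>\<^bsub>E\<^esub> \<longleftrightarrow> a \<in> Q'"
   "\<And>a. a \<in> carrier ?RB \<Longrightarrow> \<pi> (dL a) = dE (\<pi> a)"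
   "\<And>e. e \<in> carrier E \<Longrightarrow> \<exists>a\<in>carrier ?RB. \<exists>s\<in>carrier ?RB - Q'. e \<otimes>\<^bsub>E\<^esub> \<pi> s = \<pi> a"
  thus thesis by (rule that)
 qed
 interpret E: differential_field E dE by (rule E)
 have \<pi>_simps: "\<pi> (a \<oplus>\<^bsub>L\<^esub> b) = \<pi> a \<oplus>\<^bsub>E\<^esub> \<pi> b" "\<pi> (a \<otimes>\<^bsub>L\<^esub> b) = \<pi> a \<otimes>\<^bsub>E\<^esub> \<pi> b"
  if "a \<in> BB" "b \<in> BB" for a b
  using ring_hom_add[OF \<pi>, of a b] ring_hom_mult[OF \<pi>, of a b] that by auto
 have \<pi>c: "\<pi> a \<in> carrier E" if "a \<in> BB" for a using ring_hom_closed[OF \<pi>, of a] that by simp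
 have \<pi>1: "\<pi> \<one>\<^bsub>L\<^esub> = \<one>\<^bsub>E\<^esub>" using ring_hom_one[OF \<pi>] by simp
 define hE where "hE = \<pi> \<circ> hL"
 have hE: "hE \<in> ring_hom K E"
  using K0B \<pi>_simps \<pi>c \<pi>1 ring_hom_add[OF R.hom] ring_hom_mult[OF R.hom] ring_hom_one[OF R.hom]
  by (simp add: ring_hom_def hE_def)
 \<comment> \<open>\<open>s\<close> minus its value under \<open>CP.\<psi>\<close> lies in the
   kernel and so in \<open>Q'\<close>. On \<open>?S\<close> the map \<open>\<pi>\<close> therefore
   factors through \<open>CP.\<psi>\<close>: it takes \<open>?S\<close> to the image of
   \<open>K\<close> and the constants in \<open>?A\<close> to the image of
   \<open>?k\<close>.\<close>
 have \<pi>S: "\<pi> s \<in> hE ` carrier K" "s \<in> ?A \<Longrightarrow> \<pi> s \<in> hE ` ?k" if s: "s \<in> ?S" for s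
 proof -
  have \<psi>K: "CP.\<psi> s \<in> ?K0" by (rule CP.\<psi>_closed[OF s])
  hence c: "CP.\<psi> s \<in> BB" "s \<in> BB" "CP.\<psi> s \<in> carrier L" "s \<in> carrier L" using s inB inS Bc by auto
  have "s \<oplus>\<^bsub>L\<^esub> \<ominus>\<^bsub>L\<^esub> CP.\<psi> s \<in> CP.kernel" by (rule CP.\<psi>_minus[OF s])
  hence ker: "set [(s \<oplus>\<^bsub>L\<^esub> \<ominus>\<^bsub>L\<^esub> CP.\<psi> s, \<one>\<^bsub>L\<^esub>)] \<subseteq> CP.kernel \<times> BB" using subringE(3)[OF Br] by simp
  have m: "s \<oplus>\<^bsub>L\<^esub> \<ominus>\<^bsub>L\<^esub> CP.\<psi> s \<in> BB" using kerB ker by auto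
  have "R.R.lcomb [(s \<oplus>\<^bsub>L\<^esub> \<ominus>\<^bsub>L\<^esub> CP.\<psi> s, \<one>\<^bsub>L\<^esub>)] = s \<oplus>\<^bsub>L\<^esub> \<ominus>\<^bsub>L\<^esub> CP.\<psi> s" using c by simp
  hence "s \<oplus>\<^bsub>L\<^esub> \<ominus>\<^bsub>L\<^esub> CP.\<psi> s \<in> ?I" using ker by (metis (mono_tags, lifting) mem_Collect_eq)
  hence 0: "\<pi> (s \<oplus>\<^bsub>L\<^esub> \<ominus>\<^bsub>L\<^esub> CP.\<psi> s) = \<zero>\<^bsub>E\<^esub>" using \<pi>0 m Q'(2) by auto
  have "s = (s \<oplus>\<^bsub>L\<^esub> \<ominus>\<^bsub>L\<^esub> CP.\<psi> s) \<oplus>\<^bsub>L\<^esub> CP.\<psi> s" using c by (simp add: R.R.a_assoc R.R.l_neg)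
  hence "\<pi> s = \<pi> ((s \<oplus>\<^bsub>L\<^esub> \<ominus>\<^bsub>L\<^esub> CP.\<psi> s) \<oplus>\<^bsub>L\<^esub> CP.\<psi> s)" by (rule arg_cong)
  also have "\<dots> = \<pi> (CP.\<psi> s)" using \<pi>_simps(1)[OF m c(1)] 0 \<pi>c[OF c(1)] by simp
  finally have *: "\<pi> s = \<pi> (CP.\<psi> s)" .
  thus "\<pi> s \<in> hE ` carrier K" using \<psi>K by (auto simp: hE_def)
  show "\<pi> s \<in> hE ` ?k" if "s \<in> ?A" using CP.\<psi>_\<chi>[OF that] \<chi>k[OF that] * by (simp add: hE_def \<omega>_def)
 qed
 let ?XE = "\<lambda>i j. \<pi> (x (i, j))" and ?WE = "\<lambda>i j. \<pi> (W i j)"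
 have XE: "?XE \<in> mats n (carrier E)" "?WE \<in> mats n (carrier E)"
  using matsD[OF xB] matsD[OF WB] \<pi>c by (auto simp: mats_def)
 have \<pi>mm: "\<pi> (mmult L n U U' i j) = mmult E n (\<lambda>i j. \<pi> (U i j)) (\<lambda>i j. \<pi> (U' i j)) i j"
  if "U \<in> mats n BB" "U' \<in> mats n BB" "i < n" "j < n" for U U' i j
  by (rule mmult_hom_on_subring[OF Br R.R.cring_axioms E.cring_axioms \<pi> that])
 have \<pi>zero: "\<pi> \<zero>\<^bsub>L\<^esub> = \<zero>\<^bsub>E\<^esub>"
  using ring_hom_zero[OF \<pi> B.ring_axioms E.ring_axioms] by simp
 have invE: "minverse E n ?XE ?WE"
  unfolding minverse_def
 proof (intro allI impI)
  fix i j assume ij: "i < n" "j < n"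
  have o: "\<pi> (mone L i j) = mone E i j" using \<pi>1 \<pi>zero by (simp add: mone_def)
  have "mmult L n (curry x) W i j = mone L i j" "mmult L n W (curry x) i j = mone L i j"
   using W(2) ij by (simp_all add: minverse_def)
  thus "mmult E n ?XE ?WE i j = mone E i j \<and> mmult E n ?WE ?XE i j = mone E i j"
   using \<pi>mm[OF xB WB ij] \<pi>mm[OF WB xB ij] o by simp
 qed
 interpret ME: fundamental_matrix K dK E dE hE n A ?XE ?WE
 proof unfold_locales
  show "hE (dK a) = dE (hE a)" if "a \<in> carrier K" for a
   using extL.hom_d[OF that] \<pi>d[of "hL a"] K0B[OF that] by (simp add: hE_def)
  show "dE (\<pi> (x (i, j))) = mmult E n (\<lambda>i j. hE (A i j)) ?XE i j" if "i < n" "j < n" for i j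
   using \<pi>mm[OF hAB xB that] \<pi>d[of "x (i, j)"] matsD[OF xB that] dx[OF that] by (simp add: hE_def)
 qed (use hE A XE invE in auto)
 let ?G = "generate_field E (hE ` carrier K \<union> case_prod ?XE ` ?V)"
 have HG: "hE ` carrier K \<union> case_prod ?XE ` ?V \<subseteq> carrier E"
  using ring_hom_closed[OF hE] matsD[OF XE(1)] by auto
 have G: "subfield ?G E" by (rule E.generate_field_is_subfield[OF HG])
 note Gr = subringE[OF subfieldE(1)[OF G]]
 have inG: "hE a \<in> ?G" if "a \<in> carrier K" for a using that by (auto intro: generate_field.incl)
 have XG: "?XE \<in> mats n ?G"
 proof -
  have "\<pi> (x (i, j)) \<in> case_prod ?XE ` ?V" if "i < n" "j < n" for i j
   by (rule image_eqI[of _ _ "(i, j)"]) (use that in auto)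
  thus ?thesis by (simp add: mats_def generate_field.incl)
 qed
 have WG: "?WE \<in> mats n ?G" by (rule E.minverse_in_subfield[OF G XG XE(2) invE])
 \<comment> \<open>The generators of \<open>BB\<close> are mapped into \<open>?G\<close>: those from
   \<open>?S\<close> to elements of \<open>K\<close>, the entries of \<open>x\<close> by
   construction, and those of \<open>W\<close> because the inverse of a matrix over a subfield is a
   matrix over it.\<close>
 have \<pi>G: "\<pi> b \<in> ?G" if "b \<in> BB" for b
  using that[unfolded BB_def]
 proof induction
  case one
  show ?case using \<pi>1 Gr(3) by simp
 next
  case (incl b)
  then consider "b \<in> ?S" | i j where "i < n" "j < n" "b = x (i, j)" | i j where "i < n" "j < n" "b = W i j" by auto
  thus ?case
  proof cases
   case 1
   thus ?thesis using \<pi>S(1)[OF 1] inG by auto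
  qed (use matsD[OF XG] matsD[OF WG] in auto)
 next
  case (a_inv b)
  let ?m = "\<ominus>\<^bsub>K\<^esub> \<one>\<^bsub>K\<^esub>"
  have m: "hL ?m = \<ominus>\<^bsub>L\<^esub> \<one>\<^bsub>L\<^esub>"
   using ring_hom_cring.hom_a_inv[of K L hL "\<one>\<^bsub>K\<^esub>"] R.hom ring_hom_one[OF R.hom]
   by (simp add: ring_hom_cring_def ring_hom_cring_axioms_def K.cring_axioms R.R.cring_axioms)
  have "\<ominus>\<^bsub>L\<^esub> b = hL ?m \<otimes>\<^bsub>L\<^esub> b" using a_inv.hyps[folded BB_def] Bc m by (simp add: R.R.l_minus subset_iff)
  hence "\<pi> (\<ominus>\<^bsub>L\<^esub> b) = hE ?m \<otimes>\<^bsub>E\<^esub> \<pi> b" using \<pi>_simps(2)[OF K0B[of ?m] a_inv.hyps[folded BB_def]] by (simp add: hE_def)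
  thus ?case using Gr(6)[OF inG[of ?m] a_inv.IH] by simp
 qed (use Gr(6,7) \<pi>_simps in \<open>auto simp flip: BB_def\<close>)
 have genE: "carrier E \<subseteq> ?G"
 proof
  fix e assume e: "e \<in> carrier E"
  from Efrac[OF e] obtain a s where as: "a \<in> BB" "s \<in> BB" "s \<notin> Q'" "e \<otimes>\<^bsub>E\<^esub> \<pi> s = \<pi> a" by auto
  have sn: "\<pi> s \<noteq> \<zero>\<^bsub>E\<^esub>" using \<pi>0[of s] as by simp
  show "e \<in> ?G" by (rule E.fraction_in_subfield[OF G \<pi>G[OF as(2)] sn e]) (unfold as(4), rule \<pi>G[OF as(1)])
 qed
 have const: "constants E dE = hE ` ?k"
 proof (rule ME.no_new_constants[OF infk genE RL extL dx Y(2,3)])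
  fix c assume c: "c \<in> Y"
  \<comment> \<open>The coaction polynomials with specialised coefficients, now in the image of
    \<open>?k\<close>.\<close>
  let ?P = "map_pterm \<pi> id (P c)" and ?Q = "map_pterm \<pi> id (Q c)"
  have tA: "P c \<in> pterms ?A ?V" "Q c \<in> pterms ?A ?V"
   using coD(1,2)[OF c] inA(2) c by (auto simp: pterms_def Y'_def)
  have AB: "?A \<subseteq> BB" using inS(2) inB(1) by (rule order_trans)
  have \<pi>A: "\<pi> ` ?A \<subseteq> hE ` ?k"
  proof
   fix b assume "b \<in> \<pi> ` ?A"
   then obtain a where a: "a \<in> ?A" "b = \<pi> a" by auto
   show "b \<in> hE ` ?k" unfolding a(2) by (rule \<pi>S(2)[OF subsetD[OF inS(2) a(1)] a(1)])
  qed
  have PQ: "?P \<in> pterms (hE ` ?k) ?V" "?Q \<in> pterms (hE ` ?k) ?V" using pterms_map[OF tA(1) \<pi>A] pterms_map[OF tA(2) \<pi>A] .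
  have hkB: "hL a \<in> BB" if "a \<in> ?k" for a using K0B kK that by auto
  have \<pi>ev: "\<pi> (peval L (\<lambda>a. a) y t) = peval E (\<lambda>a. a) (\<pi> \<circ> y) (map_pterm \<pi> id t)"
   if "t \<in> pterms ?A ?V" "y \<in> ?V \<rightarrow> BB" for t y
   using peval_hom_on_subring[OF Br R.R.ring_axioms \<pi> that(1) _ that(2), of "\<lambda>a. a"] AB
   by (auto simp: peval_map o_def)
  have "hL ` ?k \<subseteq> BB" using hkB by (rule image_subsetI)
  hence gB: "g c \<in> ?V \<rightarrow> BB" using coD(3)[OF c] unfolding Pi_iff by (meson subsetD)
  have "peval E (\<lambda>a. a) (\<pi> \<circ> g c) ?Q = \<pi> (Qg c)" unfolding Qg_def by (rule \<pi>ev[OF tA(2) gB, symmetric])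
  moreover have "\<pi> (Qg c) \<noteq> \<zero>\<^bsub>E\<^esub>"
  proof
   have "inv\<^bsub>L\<^esub> Qg c \<in> Y'" using c by (simp add: Y'_def)
   hence B1: "inv\<^bsub>L\<^esub> Qg c \<in> BB" using inA(2) AB by blast
   have B2: "Qg c \<in> BB" unfolding Qg_def
    by (rule R.R.peval_in_subring[OF Br tA(2) _ gB]) (use AB in auto)
   assume "\<pi> (Qg c) = \<zero>\<^bsub>E\<^esub>"
   thus False using \<pi>_simps(2)[OF B2 B1] Qg(3)[OF c] \<pi>1 \<pi>c[OF B1] E.one_not_zero by simp
  qed
  ultimately have gQ: "peval E (\<lambda>a. a) (\<pi> \<circ> g c) ?Q \<noteq> \<zero>\<^bsub>E\<^esub>" by simp
  have gE: "\<pi> \<circ> g c \<in> ?V \<rightarrow> carrier E" using gB \<pi>c by (simp add: Pi_iff)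
  have id: "peval E (\<lambda>a. a) y ?P \<otimes>\<^bsub>E\<^esub> peval E hE (case_prod (mmult E n ?XE (curry y))) q =
      peval E (\<lambda>a. a) y ?Q \<otimes>\<^bsub>E\<^esub> peval E hE (case_prod (mmult E n ?XE (curry y))) p"
   if p: "p \<in> pterms (carrier K) ?V" and q: "q \<in> pterms (carrier K) ?V"
    and e: "c \<otimes>\<^bsub>L\<^esub> peval L hL x q = peval L hL x p" and y: "y \<in> ?V \<rightarrow> hE ` ?k" for p q y
  proof -
   \<comment> \<open>A matrix over the image of \<open>?k\<close> in \<open>E\<close> lifts to a
     constant matrix over \<open>L\<close>, where the identity of \<open>coaction_pair\<close> is
     known; \<open>\<pi>\<close> carries it over. A general matrix over \<open>E\<close> would have
     no lift, which is why \<open>coaction_pair\<close> takes the set of admissible entries as an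
     argument.\<close>
   have "\<forall>v\<in>?V. \<exists>a\<in>?k. y v = hE a" using y by auto
   then obtain y0 where y0: "\<And>v. v \<in> ?V \<Longrightarrow> y0 v \<in> ?k \<and> y v = hE (y0 v)" by metis
   let ?y = "hL \<circ> y0"
   have yB: "?y \<in> ?V \<rightarrow> BB" using y0 hkB by (simp add: Pi_iff)
   have yL: "?y \<in> ?V \<rightarrow> carrier L" using yB Bc by auto
   let ?M = "case_prod (mmult L n (curry x) (curry ?y))"
   have eq: "peval L (\<lambda>a. a) ?y (P c) \<otimes>\<^bsub>L\<^esub> peval L hL ?M q = peval L (\<lambda>a. a) ?y (Q c) \<otimes>\<^bsub>L\<^esub> peval L hL ?M p"
    using coD(5)[OF c] p q e yL by (simp add: coaction_pair_def)
   have yM: "curry ?y \<in> mats n BB" using yB by (simp add: mats_def Pi_iff)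
   have MB: "?M \<in> ?V \<rightarrow> BB" using matsD[OF R.R.mmult_in_subring[OF Br xB yM]] by auto
   have 1: "peval L (\<lambda>a. a) ?y t \<in> BB" "\<pi> (peval L (\<lambda>a. a) ?y t) = peval E (\<lambda>a. a) y (map_pterm \<pi> id t)"
    if t: "t \<in> pterms ?A ?V" for t
   proof -
    show "peval L (\<lambda>a. a) ?y t \<in> BB" by (rule R.R.peval_in_subring[OF Br t _ yB]) (use AB in auto)
    show "\<pi> (peval L (\<lambda>a. a) ?y t) = peval E (\<lambda>a. a) y (map_pterm \<pi> id t)"
     unfolding \<pi>ev[OF t yB]
     by (rule peval_cong[OF pterms_map[OF t \<pi>A]]) (use y0 in \<open>auto simp: hE_def\<close>)
   qed
   have 2: "peval L hL ?M t \<in> BB" "\<pi> (peval L hL ?M t) = peval E hE (case_prod (mmult E n ?XE (curry y))) t"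
    if t: "t \<in> pterms (carrier K) ?V" for t
   proof -
    have hB: "hL \<in> carrier K \<rightarrow> BB" using K0B by simp
    show "peval L hL ?M t \<in> BB" by (rule R.R.peval_in_subring[OF Br t hB MB])
    have "\<pi> (peval L hL ?M t) = peval E (\<pi> \<circ> hL) (\<pi> \<circ> ?M) t"
     by (rule peval_hom_on_subring[OF Br R.R.ring_axioms \<pi> t hB MB])
    also have "\<dots> = peval E hE (case_prod (mmult E n ?XE (curry y))) t"
    proof (rule peval_cong[OF t])
     fix v assume "v \<in> ?V"
     then obtain i j where v: "v = (i, j)" "i < n" "j < n" by auto
     have "\<pi> (mmult L n (curry x) (curry ?y) i j) = mmult E n (\<lambda>i j. \<pi> (curry x i j)) (\<lambda>i j. \<pi> (curry ?y i j)) i j"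
      by (rule \<pi>mm[OF xB yM v(2,3)])
     also have "\<dots> = mmult E n ?XE (curry y) i j"
      by (rule mmult_cong)
       (use v y0 XE(1) yB \<pi>c E.abelian_monoid_axioms in \<open>auto simp: hE_def mats_def Pi_iff\<close>)
     finally show "(\<pi> \<circ> ?M) v = case_prod (mmult E n ?XE (curry y)) v" using v(1) by simp
    qed (simp add: hE_def)
    finally show "\<pi> (peval L hL ?M t) = peval E hE (case_prod (mmult E n ?XE (curry y))) t" .
   qed
   from arg_cong[OF eq, of \<pi>] show ?thesis
    using \<pi>_simps(2) 1[OF tA(1)] 1[OF tA(2)] 2[OF p] 2[OF q] by simp
  qed
  show "\<exists>P\<in>pterms (hE ` ?k) ?V. \<exists>Q\<in>pterms (hE ` ?k) ?V. \<exists>g\<in>?V \<rightarrow> carrier E. peval E (\<lambda>a. a) g Q \<noteq> \<zero>\<^bsub>E\<^esub> \<and>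
   coaction_pair K L n hL x c E hE ?XE (hE ` ?k) P Q"
   by (rule bexI[OF _ PQ(1)], rule bexI[OF _ PQ(2)], rule bexI[OF _ gE]) (use gQ id in \<open>simp add: coaction_pair_def\<close>)
 qed
 show thesis by (rule that[OF ME.fundamental_matrix_axioms const genE])
qed

section \<open>Transport to the element type of the base field\<close>

text \<open>An infinite type is in bijection with its pairs, so a term can be coded by nested pairs;
  the elements \<open>e 0\<close> to \<open>e 3\<close> tag the constructors.\<close>

lemma pterm_encoding:
 assumes "infinite (UNIV :: 'a set)"
 obtains p :: "'a \<Rightarrow> 'a \<Rightarrow> 'a" and enc :: "('a, nat \<times> nat) pterm \<Rightarrow> 'a"
 where "\<And>a b a' b'. p a b = p a' b' \<longleftrightarrow> a = a' \<and> b = b'" "inj enc"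
proof -
 obtain q :: "'a \<times> 'a \<Rightarrow> 'a" where "bij_betw q (UNIV \<times> UNIV) UNIV"
  using card_of_Times_same_infinite[OF assms, folded card_of_ordIso] by auto
 hence q: "inj q" by (simp add: bij_betw_def)
 obtain e :: "nat \<Rightarrow> 'a" where e: "inj e" using infinite_countable_subset[OF assms] by auto
 define p where "p a b = q (a, b)" for a b
 have p: "p a b = p a' b' \<longleftrightarrow> a = a' \<and> b = b'" for a b a' b' using q by (auto simp: p_def dest: injD)
 have e_eq: "e i = e j \<longleftrightarrow> i = j" for i j using e by (auto dest: injD)
 define enc :: "('a, nat \<times> nat) pterm \<Rightarrow> 'a" where
  "enc = rec_pterm (\<lambda>c. p (e 0) c) (\<lambda>v. p (e 1) (p (e (fst v)) (e (snd v))))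
   (\<lambda>_ _ s t. p (e 2) (p s t)) (\<lambda>_ _ s t. p (e 3) (p s t))"
 have enc: "enc (PConst c) = p (e 0) c" "enc (PVar v) = p (e 1) (p (e (fst v)) (e (snd v)))"
  "enc (PAdd s t) = p (e 2) (p (enc s) (enc t))" "enc (PMul s t) = p (e 3) (p (enc s) (enc t))" for c v s t
  by (simp_all add: enc_def)
 have "enc s = enc t \<Longrightarrow> s = t" for s t
 proof (induction s arbitrary: t)
  case (PConst c)
  thus ?case by (cases t) (simp_all add: enc p e_eq)
 next
  case (PVar v)
  thus ?case by (cases t) (simp_all add: enc p e_eq prod_eq_iff)
 next
  case (PAdd s1 s2)
  from PAdd.prems show ?case
   by (cases t) (auto simp: enc p e_eq intro: PAdd.IH)
 next
  case (PMul s1 s2)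
  from PMul.prems show ?case
   by (cases t) (auto simp: enc p e_eq intro: PMul.IH)
 qed
 hence "inj enc" by (rule injI)
 with p show thesis by (rule that)
qed

lemma (in fundamental_matrix) transport:
 assumes \<phi>: "inj_on \<phi> (carrier E)"
  and const: "constants E dE = h ` constants K dK"
  and gen: "carrier E \<subseteq> generate_field E (h ` carrier K \<union> case_prod X ` ({..<n} \<times> {..<n}))"
 defines "E' \<equiv> image_ring \<phi> E" and "dE' \<equiv> \<phi> \<circ> dE \<circ> inv_into (carrier E) \<phi>"
  and "X' \<equiv> \<lambda>i j. \<phi> (X i j)" and "W' \<equiv> \<lambda>i j. \<phi> (W i j)"
 shows "fundamental_matrix K dK E' dE' (\<phi> \<circ> h) n A X' W'" "constants E' dE' = (\<phi> \<circ> h) ` constants K dK"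
  "carrier E' \<subseteq> generate_field E' ((\<phi> \<circ> h) ` carrier K \<union> case_prod X' ` ({..<n} \<times> {..<n}))"
proof -
 have iso: "\<phi> \<in> ring_iso E E'" unfolding E'_def by (rule inj_imp_image_ring_iso[OF \<phi>])
 hence hom\<phi>: "\<phi> \<in> ring_hom E E'" by (simp add: ring_iso_def)
 have car: "carrier E' = \<phi> ` carrier E" unfolding E'_def by (rule image_ring_carrier)
 interpret E': field E' unfolding E'_def by (rule L.inj_imp_image_ring_is_field[OF \<phi>])
 have inv: "inv_into (carrier E) \<phi> (\<phi> a) = a" if "a \<in> carrier E" for a by (rule inv_into_f_f[OF \<phi> that])
 have d\<phi>: "dE' (\<phi> a) = \<phi> (dE a)" if "a \<in> carrier E" for a using inv[OF that] by (simp add: dE'_def)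
 have dE': "differential_field E' dE'"
 proof (intro differential_field.intro differential_field_axioms.intro E'.field_axioms)
  fix a assume "a \<in> carrier E'"
  then obtain a' where "a' \<in> carrier E" "a = \<phi> a'" by (auto simp: car)
  thus "dE' a \<in> carrier E'" using L.d_closed by (auto simp: d\<phi> car)
  fix b assume "b \<in> carrier E'"
  then obtain b' where b: "b' \<in> carrier E" "b = \<phi> b'" by (auto simp: car)
  note a = \<open>a' \<in> carrier E\<close> \<open>a = \<phi> a'\<close>
  show "dE' (a \<oplus>\<^bsub>E'\<^esub> b) = dE' a \<oplus>\<^bsub>E'\<^esub> dE' b"
   using a b L.d_closed by (simp add: d\<phi> L.d_add flip: ring_hom_add[OF hom\<phi>])
  show "dE' (a \<otimes>\<^bsub>E'\<^esub> b) = dE' a \<otimes>\<^bsub>E'\<^esub> b \<oplus>\<^bsub>E'\<^esub> a \<otimes>\<^bsub>E'\<^esub> dE' b"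
   using a b L.d_closed by (simp add: d\<phi> L.d_mult flip: ring_hom_add[OF hom\<phi>] ring_hom_mult[OF hom\<phi>])
 qed
 interpret dE': differential_field E' dE' by (rule dE')
 have h': "\<phi> \<circ> h \<in> ring_hom K E'" by (rule ring_hom_trans[OF hom hom\<phi>])
 have hA: "(\<lambda>i j. h (A i j)) \<in> mats n (carrier E)" using A ring_hom_closed[OF hom] by (auto simp: mats_def)
 have X': "X' \<in> mats n (carrier E')" and W': "W' \<in> mats n (carrier E')"
  using X W by (auto simp: mats_def X'_def W'_def car)
 have \<phi>0: "\<phi> \<zero>\<^bsub>E\<^esub> = \<zero>\<^bsub>E'\<^esub>" "\<phi> \<one>\<^bsub>E\<^esub> = \<one>\<^bsub>E'\<^esub>"
  using ring_hom_zero[OF hom\<phi> L.ring_axioms E'.ring_axioms] ring_hom_one[OF hom\<phi>] .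
 note mm = mmult_hom[OF hom\<phi> L.cring_axioms E'.cring_axioms]
 have m1: "\<phi> (mone E i j) = mone E' i j" for i j using \<phi>0 by (simp add: mone_def)
 have inv': "minverse E' n X' W'"
  using inverse by (simp add: minverse_def X'_def W'_def m1 flip: mm[OF X W] mm[OF W X])
 show fm: "fundamental_matrix K dK E' dE' (\<phi> \<circ> h) n A X' W'"
 proof (intro fundamental_matrix.intro differential_field_extension.intro
   differential_field_extension_axioms.intro fundamental_matrix_axioms.intro
   K.differential_field_axioms dE' h' A X' W' inv')
  show "(\<phi> \<circ> h) (dK a) = dE' ((\<phi> \<circ> h) a)" if "a \<in> carrier K" for a
   using ring_hom_closed[OF hom that] by (simp add: d\<phi> hom_d[OF that])
  show "dE' (X' i j) = mmult E' n (\<lambda>i j. (\<phi> \<circ> h) (A i j)) X' i j" if "i < n" "j < n" for i j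
   using mm[OF hA X that] matsD[OF X that] dX[OF that] by (simp add: X'_def d\<phi>)
 qed
 interpret \<phi>: differential_field_extension E dE E' dE' \<phi>
  by (intro differential_field_extension.intro differential_field_extension_axioms.intro
    L.differential_field_axioms dE' hom\<phi>) (simp add: d\<phi>)
 have "constants E' dE' \<subseteq> \<phi> ` carrier E" by (auto simp: constants_def car)
 hence "constants E' dE' = \<phi> ` constants E dE" using \<phi>.constants_image by auto
 thus "constants E' dE' = (\<phi> \<circ> h) ` constants K dK" by (simp add: const image_comp)
 let ?H = "h ` carrier K \<union> case_prod X ` ({..<n} \<times> {..<n})"
 let ?G = "generate_field E' (\<phi> ` ?H)"
 have Hc: "?H \<subseteq> carrier E" using ring_hom_closed[OF hom] matsD[OF X] by auto
 hence "\<phi> ` ?H \<subseteq> carrier E'" by (auto simp: car)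
 hence G: "subfield ?G E'" by (rule E'.generate_field_is_subfield)
 have "?H \<subseteq> {a \<in> carrier E. \<phi> a \<in> ?G}" using Hc generate_field.incl[of _ "\<phi> ` ?H" E'] by auto
 hence "generate_field E ?H \<subseteq> {a \<in> carrier E. \<phi> a \<in> ?G}"
  by (rule L.generate_field_subset[OF vimage_subfield[OF L.field_axioms E'.field_axioms hom\<phi> G]])
 hence "carrier E' \<subseteq> ?G" using gen by (auto simp: car)
 also have "\<phi> ` ?H = (\<phi> \<circ> h) ` carrier K \<union> case_prod X' ` ({..<n} \<times> {..<n})"
  by (simp add: image_Un image_comp X'_def case_prod_beta' o_def)
 finally show "carrier E' \<subseteq> generate_field E' ((\<phi> \<circ> h) ` carrier K \<union> case_prod X' ` ({..<n} \<times> {..<n}))" .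
qed

text \<open>An element of \<open>E\<close> is determined by a numerator and a denominator, which are
  terms over \<open>K\<close>; their codes give an injection into the element type of
  \<open>K\<close>.\<close>

lemma (in fundamental_matrix) encoding:
 assumes inf: "infinite (UNIV :: 'a set)"
  and gen: "carrier E \<subseteq> generate_field E (h ` carrier K \<union> case_prod X ` ({..<n} \<times> {..<n}))"
 obtains \<phi> :: "'b \<Rightarrow> 'a" where "inj_on \<phi> (carrier E)"
proof -
 let ?V = "{..<n} \<times> {..<n}"
 obtain p :: "'a \<Rightarrow> 'a \<Rightarrow> 'a" and enc :: "('a, nat \<times> nat) pterm \<Rightarrow> 'a" where
  p: "\<And>a b a' b'. p a b = p a' b' \<longleftrightarrow> a = a' \<and> b = b'" and enc: "inj enc"
  by (rule pterm_encoding[OF inf]) auto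
 have Xv: "case_prod X \<in> ?V \<rightarrow> carrier E" using matsD[OF X] by auto
 have "\<exists>P\<in>pterms (carrier K) ?V. \<exists>Q\<in>pterms (carrier K) ?V. peval E h (case_prod X) Q \<noteq> \<zero>\<^bsub>E\<^esub> \<and>
   a \<otimes>\<^bsub>E\<^esub> peval E h (case_prod X) Q = peval E h (case_prod X) P" if "a \<in> carrier E" for a
  by (rule L.generate_field_pterms[OF K.ring_axioms K.carrier_is_subring hom Xv]) (use gen that in auto)
 then obtain P Q where PQ: "\<And>a. a \<in> carrier E \<Longrightarrow> Q a \<in> pterms (carrier K) ?V \<and> peval E h (case_prod X) (Q a) \<noteq> \<zero>\<^bsub>E\<^esub> \<and>
   a \<otimes>\<^bsub>E\<^esub> peval E h (case_prod X) (Q a) = peval E h (case_prod X) (P a)" by metis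
 have "inj_on (\<lambda>a. p (enc (P a)) (enc (Q a))) (carrier E)"
 proof (rule inj_onI)
  fix a b assume ab: "a \<in> carrier E" "b \<in> carrier E" and "p (enc (P a)) (enc (Q a)) = p (enc (P b)) (enc (Q b))"
  hence e: "P a = P b" "Q a = Q b" using p enc by (auto dest: injD)
  have "h \<in> carrier K \<rightarrow> carrier E" using ring_hom_closed[OF hom] by auto
  hence "peval E h (case_prod X) (Q a) \<in> carrier E" using PQ[OF ab(1)] L.peval_closed[OF _ _ Xv] by auto
  thus "a = b" using L.m_rcancel[of "peval E h (case_prod X) (Q a)" a b] PQ[OF ab(1)] PQ[OF ab(2)] ab e by simp
 qed
 thus thesis by (rule that)
qed

corollary fundamental_matrix_exists_on_type:
 fixes K :: "('a, 'r) ring_scheme"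
 assumes K: "differential_field K dK" and char: "char_zero (K\<lparr>carrier := constants K dK\<rparr>)"
  and ec: "existentially_closed_in (constants K dK) K" and A: "A \<in> mats n (carrier K)"
 obtains E :: "'a ring" and dE h X W where "fundamental_matrix K dK E dE h n A X W" "constants E dE = h ` constants K dK"
  "carrier E \<subseteq> generate_field E (h ` carrier K \<union> case_prod X ` ({..<n} \<times> {..<n}))"
proof (rule fundamental_matrix_exists[OF K char ec A])
 fix E :: "((nat \<times> nat, 'a) ratfun set \<times> (nat \<times> nat, 'a) ratfun set) set ring" and dE h X W
 assume fm: "fundamental_matrix K dK E dE h n A X W" and E: "constants E dE = h ` constants K dK"
  "carrier E \<subseteq> generate_field E (h ` carrier K \<union> case_prod X ` ({..<n} \<times> {..<n}))"
 interpret fundamental_matrix K dK E dE h n A X W by (rule fm)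
 have "infinite (UNIV :: 'a set)"
  using differential_field.char_zero_constants(1)[OF K char] finite_subset[OF subset_UNIV] by auto
 then obtain \<phi> :: "_ \<Rightarrow> 'a" where \<phi>: "inj_on \<phi> (carrier E)" using encoding[OF _ E(2)] by auto
 show thesis by (rule that[OF transport[OF \<phi> E]])
qed

lemma (in vectorspace) finite_basis_coordinates:
 assumes e: "inj_on e {..<n}" and basis: "basis (e ` {..<n})"
 obtains crd where "coordinate_space K V n crd"
  "\<And>i j. i < n \<Longrightarrow> j < n \<Longrightarrow> crd i (e j) = (if i = j then \<one>\<^bsub>K\<^esub> else \<zero>\<^bsub>K\<^esub>)"
proof -
 let ?B = "e ` {..<n}"
 have Bc: "finite ?B" "?B \<subseteq> carrier V" using basis by (auto simp: basis_def)
 have uniq: "\<exists>!a. a \<in> ?B \<rightarrow>\<^sub>E carrier K \<and> lincomb a ?B = v" if "v \<in> carrier V" for v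
  using basis_criterion[OF Bc] basis that by auto
 define coef where "coef v = (THE a. a \<in> ?B \<rightarrow>\<^sub>E carrier K \<and> lincomb a ?B = v)" for v
 have coef: "coef v \<in> ?B \<rightarrow>\<^sub>E carrier K" "lincomb (coef v) ?B = v" if "v \<in> carrier V" for v
  using theI'[OF uniq[OF that]] by (auto simp: coef_def)
 have coefc: "coef v \<in> ?B \<rightarrow> carrier K" if "v \<in> carrier V" for v using coef(1)[OF that] by auto
 \<comment> \<open>Uniqueness in \<open>basis_criterion\<close> concerns extensional functions, so
   an arbitrary family of coefficients is compared through its restriction.\<close>
 have coefI: "coef (lincomb a ?B) u = a u" if a: "a \<in> ?B \<rightarrow> carrier K" and u: "u \<in> ?B" for a u
 proof -
  have "lincomb (restrict a ?B) ?B = lincomb a ?B"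
   unfolding lincomb_def using a Bc(2) by (intro finsum_cong') (auto simp: Pi_iff)
  moreover have "restrict a ?B \<in> ?B \<rightarrow>\<^sub>E carrier K" using a by auto
  ultimately have "coef (lincomb a ?B) = restrict a ?B"
   unfolding coef_def using uniq[OF lincomb_closed[OF Bc(2) a]] by (intro the1_equality) auto
  thus ?thesis using u by simp
 qed
 define crd where "crd i v = coef v (e i)" for i v
 have eB: "e i \<in> ?B" if "i < n" for i using that by auto
 have "coordinate_space K V n crd"
 proof (intro coordinate_space.intro coordinate_space_axioms.intro)
  show "field K" ..
  fix i x assume ix: "i < n" "x \<in> carrier V"
  show "crd i x \<in> carrier K" using coefc[OF ix(2)] eB[OF ix(1)] by (auto simp: crd_def)
 next
  fix i assume i: "i < n"
  have "lincomb (\<lambda>_. \<zero>\<^bsub>K\<^esub>) ?B = (\<Oplus>\<^bsub>V\<^esub>v\<in>?B. \<zero>\<^bsub>V\<^esub>)"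
   unfolding lincomb_def using Bc(2) by (intro finsum_cong') auto
  hence "lincomb (\<lambda>_. \<zero>\<^bsub>K\<^esub>) ?B = \<zero>\<^bsub>V\<^esub>" by simp
  thus "crd i \<zero>\<^bsub>V\<^esub> = \<zero>\<^bsub>K\<^esub>" using coefI[of "\<lambda>_. \<zero>\<^bsub>K\<^esub>" "e i"] eB[OF i] by (simp add: crd_def)
  fix x y assume xy: "x \<in> carrier V" "y \<in> carrier V"
  have "lincomb (\<lambda>u. coef x u \<oplus>\<^bsub>K\<^esub> coef y u) ?B = x \<oplus>\<^bsub>V\<^esub> y"
   using lincomb_sum[OF Bc coefc[OF xy(1)] coefc[OF xy(2)]] coef(2) xy by simp
  thus "crd i (x \<oplus>\<^bsub>V\<^esub> y) = crd i x \<oplus>\<^bsub>K\<^esub> crd i y"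
   using coefI[of "\<lambda>u. coef x u \<oplus>\<^bsub>K\<^esub> coef y u" "e i"] coefc[OF xy(1)] coefc[OF xy(2)] eB[OF i]
   by (simp add: crd_def Pi_iff)
 next
  fix i a x assume i: "i < n" and a: "a \<in> carrier K" and x: "x \<in> carrier V"
  have "lincomb (\<lambda>u. a \<otimes>\<^bsub>K\<^esub> coef x u) ?B = a \<odot>\<^bsub>V\<^esub> x"
   using lincomb_smult[OF Bc(2) coefc[OF x] a] coef(2)[OF x] by simp
  thus "crd i (a \<odot>\<^bsub>V\<^esub> x) = a \<otimes>\<^bsub>K\<^esub> crd i x"
   using coefI[of "\<lambda>u. a \<otimes>\<^bsub>K\<^esub> coef x u" "e i"] coefc[OF x] a eB[OF i] by (simp add: crd_def Pi_iff)
 next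
  fix x y assume xy: "x \<in> carrier V" "y \<in> carrier V" and "\<And>i. i < n \<Longrightarrow> crd i x = crd i y"
  hence "coef x = coef y"
   by (intro PiE_ext[OF coef(1)[OF xy(1)] coef(1)[OF xy(2)]]) (auto simp: crd_def)
  hence "lincomb (coef x) ?B = lincomb (coef y) ?B" by (rule arg_cong)
  thus "x = y" unfolding coef(2)[OF xy(1)] coef(2)[OF xy(2)] .
 next
  fix v assume v: "\<And>i. i < n \<Longrightarrow> v i \<in> carrier K"
  let ?a = "\<lambda>u. v (the_inv_into {..<n} e u)"
  have a: "?a (e i) = v i" if "i < n" for i using the_inv_into_f_f[OF e, of i] that by simp
  hence ac: "?a \<in> ?B \<rightarrow> carrier K" using v by auto
  show "\<exists>x\<in>carrier V. \<forall>i<n. crd i x = v i"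
   using coefI[OF ac] a eB lincomb_closed[OF Bc(2) ac] by (intro bexI[of _ "lincomb ?a ?B"]) (auto simp: crd_def)
 qed (simp_all)
 moreover have "crd i (e j) = (if i = j then \<one>\<^bsub>K\<^esub> else \<zero>\<^bsub>K\<^esub>)" if ij: "i < n" "j < n" for i j
 proof -
  let ?a = "\<lambda>u. if u = e j then \<one>\<^bsub>K\<^esub> else \<zero>\<^bsub>K\<^esub>"
  have "lincomb ?a ?B = (\<Oplus>\<^bsub>V\<^esub>u\<in>?B. if e j = u then u else \<zero>\<^bsub>V\<^esub>)"
   unfolding lincomb_def using Bc(2) by (intro finsum_cong') auto
  also have "\<dots> = e j"
   using add.finprod_singleton[of "e j" ?B "\<lambda>u. u"] Bc eB[OF ij(2)] by auto
  finally have "crd i (e j) = ?a (e i)" using coefI[of ?a "e i"] eB[OF ij(1)] by (simp add: crd_def)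
  thus ?thesis using inj_on_eq_iff[OF e, of i j] ij by simp
 qed
 ultimately show thesis by (rule that)
qed

section \<open>Base change in coordinates\<close>

lemma (in coordinate_space) expansion:
 assumes e: "\<And>j. j < n \<Longrightarrow> e j \<in> carrier V" "\<And>i j. i < n \<Longrightarrow> j < n \<Longrightarrow> crd i (e j) = (if i = j then \<one> else \<zero>)"
  and x: "x \<in> carrier V"
 shows "x = (\<Oplus>\<^bsub>V\<^esub>j\<in>{..<n}. crd j x \<odot>\<^bsub>V\<^esub> e j)"
proof -
 interpret V: vectorspace L V by (rule vectorspace)
 have c: "(\<lambda>j. crd j x \<odot>\<^bsub>V\<^esub> e j) \<in> {..<n} \<rightarrow> carrier V" using e(1) crd_closed[OF _ x] V_closed by auto
 show ?thesis
 proof (rule crd_inj[OF x])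
  show "(\<Oplus>\<^bsub>V\<^esub>j\<in>{..<n}. crd j x \<odot>\<^bsub>V\<^esub> e j) \<in> carrier V" using c by (rule V.finsum_closed)
  fix i assume i: "i < n"
  have "crd i (\<Oplus>\<^bsub>V\<^esub>j\<in>{..<n}. crd j x \<odot>\<^bsub>V\<^esub> e j) = (\<Oplus>j\<in>{..<n}. crd i (crd j x \<odot>\<^bsub>V\<^esub> e j))"
   by (rule crd_finsum[OF _ c i]) simp
  also have "\<dots> = (\<Oplus>j\<in>{..<n}. if i = j then crd j x else \<zero>)"
   using i e crd_closed[OF _ x] by (intro finsum_cong') (auto simp: crd_smult)
  also have "\<dots> = crd i x" using i crd_closed[OF _ x] by (intro finsum_delta) auto
  finally show "crd i x = crd i (\<Oplus>\<^bsub>V\<^esub>j\<in>{..<n}. crd j x \<odot>\<^bsub>V\<^esub> e j)" by simp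
 qed
qed

locale base_change_space = coordinate_space K M n crd + L: field L + H: ring_hom_cring K L h
 for K :: "('a, 'r) ring_scheme" and M :: "('a, 'm, 't) module_scheme" and n crd
  and L :: "('b, 's) ring_scheme" and h +
 fixes e :: "nat \<Rightarrow> 'm"
 assumes e: "j < n \<Longrightarrow> e j \<in> carrier M" "i < n \<Longrightarrow> j < n \<Longrightarrow> crd i (e j) = (if i = j then \<one>\<^bsub>K\<^esub> else \<zero>\<^bsub>K\<^esub>)"
begin

abbreviation "G \<equiv> tensor_free L M"
abbreviation "N \<equiv> tensor_null K L h M"
abbreviation "C w \<equiv> N #>\<^bsub>G\<^esub> w"

sublocale M: vectorspace K M by (rule vectorspace)

declare carrier_free_Abelian_group_iff [simp del]

lemma G_iff: "w \<in> carrier G \<longleftrightarrow> Poly_Mapping.keys w \<subseteq> carrier L \<times> carrier M"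
 by (rule carrier_free_Abelian_group_iff)

lemma G: "comm_group G" "group G"
 using abelian_free_Abelian_group comm_group.axioms(2) by blast+

text \<open>The \<open>i\<close>-th coordinate, still on the free group: the additive map with value
  \<open>a h(crd i x)\<close> on the generator \<open>(a, x)\<close>. The universal property
  provides it by an existence statement, hence the choice operator.\<close>

definition \<theta> :: "nat \<Rightarrow> ('b \<times> 'm \<Rightarrow>\<^sub>0 int) \<Rightarrow> 'b" where
 "\<theta> i = (SOME t. t \<in> hom G (add_monoid L) \<and>
  (\<forall>a\<in>carrier L. \<forall>x\<in>carrier M. t (frag_of (a, x)) = a \<otimes>\<^bsub>L\<^esub> h (crd i x)))"

lemma \<theta>: assumes "i < n"
 shows "\<theta> i \<in> hom G (add_monoid L)" "\<And>a x. a \<in> carrier L \<Longrightarrow> x \<in> carrier M \<Longrightarrow> \<theta> i (frag_of (a, x)) = a \<otimes>\<^bsub>L\<^esub> h (crd i x)"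
proof -
 have "(\<lambda>(a, x). a \<otimes>\<^bsub>L\<^esub> h (crd i x)) ` (carrier L \<times> carrier M) \<subseteq> carrier (add_monoid L)"
  using crd_closed[OF assms] by auto
 then obtain t where "t \<in> hom G (add_monoid L)" "\<And>p. p \<in> carrier L \<times> carrier M \<Longrightarrow> t (frag_of p) = (\<lambda>(a, x). a \<otimes>\<^bsub>L\<^esub> h (crd i x)) p"
  using comm_group.free_Abelian_group_universal[OF L.a_comm_group] by metis
 hence "\<exists>t. t \<in> hom G (add_monoid L) \<and>
  (\<forall>a\<in>carrier L. \<forall>x\<in>carrier M. t (frag_of (a, x)) = a \<otimes>\<^bsub>L\<^esub> h (crd i x))" by auto
 from someI_ex[OF this, folded \<theta>_def] show "\<theta> i \<in> hom G (add_monoid L)"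
  "\<And>a x. a \<in> carrier L \<Longrightarrow> x \<in> carrier M \<Longrightarrow> \<theta> i (frag_of (a, x)) = a \<otimes>\<^bsub>L\<^esub> h (crd i x)" by auto
qed

lemma G_closed: "0 \<in> carrier G" "u \<in> carrier G \<Longrightarrow> w \<in> carrier G \<Longrightarrow> u + w \<in> carrier G"
 "u \<in> carrier G \<Longrightarrow> w \<in> carrier G \<Longrightarrow> u - w \<in> carrier G" "u \<in> carrier G \<Longrightarrow> - u \<in> carrier G"
 "a \<in> carrier L \<Longrightarrow> x \<in> carrier M \<Longrightarrow> frag_of (a, x) \<in> carrier G"
proof -
 interpret group G by (rule G)
 show "0 \<in> carrier G" by (simp add: G_iff)
 show add: "u + w \<in> carrier G" if "u \<in> carrier G" "w \<in> carrier G" for u w using m_closed[OF that] by simp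
 show neg: "- u \<in> carrier G" if "u \<in> carrier G" for u using that by (simp add: G_iff)
 show "u - w \<in> carrier G" if "u \<in> carrier G" "w \<in> carrier G" for u w using add[OF that(1) neg[OF that(2)]] by simp
 show "frag_of (a, x) \<in> carrier G" if "a \<in> carrier L" "x \<in> carrier M" for a x using that by simp
qed

lemma hom_simps:
 assumes t: "t \<in> hom G (add_monoid L)"
 shows "u \<in> carrier G \<Longrightarrow> t u \<in> carrier L"
  "u \<in> carrier G \<Longrightarrow> w \<in> carrier G \<Longrightarrow> t (u + w) = t u \<oplus>\<^bsub>L\<^esub> t w"
  "u \<in> carrier G \<Longrightarrow> w \<in> carrier G \<Longrightarrow> t (u - w) = t u \<ominus>\<^bsub>L\<^esub> t w" "t 0 = \<zero>\<^bsub>L\<^esub>"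
proof -
 interpret h: group_hom G "add_monoid L" t
  using t G L.a_group by (simp add: group_hom_def group_hom_axioms_def)
 show c: "t u \<in> carrier L" if "u \<in> carrier G" for u using h.hom_closed[OF that] by simp
 show add: "t (u + w) = t u \<oplus>\<^bsub>L\<^esub> t w" if "u \<in> carrier G" "w \<in> carrier G" for u w
  using h.hom_mult[OF that] by simp
 show 0: "t 0 = \<zero>\<^bsub>L\<^esub>" using h.hom_one by simp
 show "t (u - w) = t u \<ominus>\<^bsub>L\<^esub> t w" if uw: "u \<in> carrier G" "w \<in> carrier G" for u w
 proof -
  have "t u = t (u - w) \<oplus>\<^bsub>L\<^esub> t w" using add[OF G_closed(3)[OF uw] uw(2)] by simp
  thus ?thesis using c[OF G_closed(3)[OF uw]] c[OF uw(2)] by (simp add: L.minus_eq L.a_assoc L.r_neg)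
 qed
qed

lemmas \<theta>_simps = hom_simps[OF \<theta>(1)]

text \<open>Coordinates of an induced map can be computed on generators; this is used for scaling
  and for the connection.\<close>

lemma extend:
 assumes f: "\<And>a x. a \<in> carrier L \<Longrightarrow> x \<in> carrier M \<Longrightarrow> f (a, x) \<in> carrier G" and w: "w \<in> carrier G"
 shows "frag_extend f w \<in> carrier G"
  "s \<in> hom G (add_monoid L) \<Longrightarrow> t \<in> hom G (add_monoid L) \<Longrightarrow>
   (\<And>a x. a \<in> carrier L \<Longrightarrow> x \<in> carrier M \<Longrightarrow> s (f (a, x)) = t (frag_of (a, x))) \<Longrightarrow> s (frag_extend f w) = t w"
proof -
 have k: "Poly_Mapping.keys w \<subseteq> carrier L \<times> carrier M" using w by (simp add: G_iff)
 have c: "frag_extend f w \<in> carrier G" if "Poly_Mapping.keys w \<subseteq> carrier L \<times> carrier M" for w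
  using that by (induction w rule: free_Abelian_group_induct[consumes 1]) (auto simp: frag_extend_diff f G_closed)
 thus "frag_extend f w \<in> carrier G" using k .
 assume st: "s \<in> hom G (add_monoid L)" "t \<in> hom G (add_monoid L)"
  "\<And>a x. a \<in> carrier L \<Longrightarrow> x \<in> carrier M \<Longrightarrow> s (f (a, x)) = t (frag_of (a, x))"
 show "s (frag_extend f w) = t w"
  using k
  by (induction w rule: free_Abelian_group_induct[consumes 1])
   (auto simp: frag_extend_diff hom_simps[OF st(1)] hom_simps[OF st(2)] st(3) c G_iff[symmetric])
qed

lemma relator_cases:
 assumes "w \<in> tensor_relators K L h M"
 obtains (sum_left) a b x where "a \<in> carrier L" "b \<in> carrier L" "x \<in> carrier M"
   "w = frag_of (a \<oplus>\<^bsub>L\<^esub> b, x) - frag_of (a, x) - frag_of (b, x)"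
  | (sum_right) a x y where "a \<in> carrier L" "x \<in> carrier M" "y \<in> carrier M"
   "w = frag_of (a, x \<oplus>\<^bsub>M\<^esub> y) - frag_of (a, x) - frag_of (a, y)"
  | (scalar) a c x where "a \<in> carrier L" "c \<in> carrier K" "x \<in> carrier M"
   "w = frag_of (a \<otimes>\<^bsub>L\<^esub> h c, x) - frag_of (a, c \<odot>\<^bsub>M\<^esub> x)"
 using assms unfolding tensor_relators_def Un_iff mem_Collect_eq
 by (elim disjE exE conjE) ((rule that(1); assumption) | (rule that(2); assumption) | (rule that(3); assumption))+

lemma relators_closed: "tensor_relators K L h M \<subseteq> carrier G"
proof
 fix w assume "w \<in> tensor_relators K L h M"
 thus "w \<in> carrier G"
 proof (cases rule: relator_cases)
  case (sum_left a b x)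
  show ?thesis unfolding sum_left(4) by (intro G_closed) (use sum_left in auto)
 next
  case (sum_right a x y)
  show ?thesis unfolding sum_right(4) by (intro G_closed) (use sum_right in auto)
 next
  case (scalar a c x)
  show ?thesis unfolding scalar(4) by (intro G_closed) (use scalar in auto)
 qed
qed

lemma N_subgroup: "subgroup N G"
 unfolding tensor_null_def by (rule group.generate_is_subgroup[OF G(2) relators_closed])

lemma N_carrier: "w \<in> N \<Longrightarrow> w \<in> carrier G"
 using subgroup.subset[OF N_subgroup] by auto

lemma N_closed: "0 \<in> N" "u \<in> N \<Longrightarrow> w \<in> N \<Longrightarrow> u + w \<in> N" "u \<in> N \<Longrightarrow> - u \<in> N" "u \<in> N \<Longrightarrow> w \<in> N \<Longrightarrow> u - w \<in> N"
proof -
 show "0 \<in> N" using subgroup.one_closed[OF N_subgroup] by simp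
 show add: "u + w \<in> N" if "u \<in> N" "w \<in> N" for u w using subgroup.m_closed[OF N_subgroup that] by simp
 show neg: "- u \<in> N" if "u \<in> N" for u
  using subgroup.m_inv_closed[OF N_subgroup that] N_carrier[OF that] by (simp add: G_iff)
 show "u - w \<in> N" if "u \<in> N" "w \<in> N" for u w using add[OF that(1) neg[OF that(2)]] by simp
qed

lemma N_sum: "finite I \<Longrightarrow> (\<And>i. i \<in> I \<Longrightarrow> f i \<in> N) \<Longrightarrow> (\<Sum>i\<in>I. f i) \<in> N"
 by (induction I rule: finite_induct) (auto intro: N_closed)

lemma N_relators:
 "a \<in> carrier L \<Longrightarrow> b \<in> carrier L \<Longrightarrow> x \<in> carrier M \<Longrightarrow> frag_of (a \<oplus>\<^bsub>L\<^esub> b, x) - frag_of (a, x) - frag_of (b, x) \<in> N"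
 "a \<in> carrier L \<Longrightarrow> x \<in> carrier M \<Longrightarrow> y \<in> carrier M \<Longrightarrow> frag_of (a, x \<oplus>\<^bsub>M\<^esub> y) - frag_of (a, x) - frag_of (a, y) \<in> N"
 "a \<in> carrier L \<Longrightarrow> c \<in> carrier K \<Longrightarrow> x \<in> carrier M \<Longrightarrow> frag_of (a \<otimes>\<^bsub>L\<^esub> h c, x) - frag_of (a, c \<odot>\<^bsub>M\<^esub> x) \<in> N"
 unfolding tensor_null_def by (rule generate.incl, simp add: tensor_relators_def, metis)+

lemma N_zero: "x \<in> carrier M \<Longrightarrow> frag_of (\<zero>\<^bsub>L\<^esub>, x) \<in> N" "a \<in> carrier L \<Longrightarrow> frag_of (a, \<zero>\<^bsub>M\<^esub>) \<in> N"
 using N_closed(3)[OF N_relators(1)[of "\<zero>\<^bsub>L\<^esub>" "\<zero>\<^bsub>L\<^esub>" x]] N_closed(3)[OF N_relators(2)[of a "\<zero>\<^bsub>M\<^esub>" "\<zero>\<^bsub>M\<^esub>"]] by auto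

lemma \<theta>_null: "w \<in> N \<Longrightarrow> i < n \<Longrightarrow> \<theta> i w = \<zero>\<^bsub>L\<^esub>"
proof -
 assume w: "w \<in> N" and i: "i < n"
 interpret h: group_hom G "add_monoid L" "\<theta> i"
  using \<theta>(1)[OF i] G L.a_group by (simp add: group_hom_def group_hom_axioms_def)
 have cancel: "p \<oplus>\<^bsub>L\<^esub> q \<ominus>\<^bsub>L\<^esub> p = q" if "p \<in> carrier L" "q \<in> carrier L" for p q
  using that by (simp add: L.minus_eq L.a_assoc L.a_comm[of q "\<ominus>\<^bsub>L\<^esub> p"] L.r_neg L.r_neg2)
 have "r \<in> kernel G (add_monoid L) (\<theta> i)" if r: "r \<in> tensor_relators K L h M" for r
 proof -
  from r have "\<theta> i r = \<zero>\<^bsub>L\<^esub>"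
  proof (cases rule: relator_cases)
   case (sum_left a b x)
   have "h (crd i x) \<in> carrier L" using crd_closed[OF i sum_left(3)] by simp
   thus ?thesis unfolding sum_left(4) using sum_left(1-3)
    by (simp add: \<theta>_simps(3)[OF i] \<theta>(2)[OF i] G_closed)
     (simp add: L.l_distr cancel)
  next
   case (sum_right a x y)
   have "h (crd i x) \<in> carrier L" "h (crd i y) \<in> carrier L" using crd_closed[OF i] sum_right by simp_all
   thus ?thesis unfolding sum_right(4) using sum_right(1-3) V_closed crd_closed[OF i]
    by (simp add: \<theta>_simps(3)[OF i] \<theta>(2)[OF i] G_closed crd_add[OF i])
     (simp add: L.r_distr cancel)
  next
   case (scalar a c x)
   have "h (crd i x) \<in> carrier L" using crd_closed[OF i scalar(3)] by simp
   thus ?thesis unfolding scalar(4) using scalar(1-3) V_closed crd_closed[OF i]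
    by (simp add: \<theta>_simps(3)[OF i] \<theta>(2)[OF i] G_closed crd_smult[OF i])
     (simp add: L.m_assoc)
  qed
  thus ?thesis using relators_closed r by (auto simp: kernel_def)
 qed
 hence "N \<subseteq> kernel G (add_monoid L) (\<theta> i)"
  unfolding tensor_null_def by (intro group.generate_subgroup_incl[OF G(2)] h.subgroup_kernel subsetI)
 thus "\<theta> i w = \<zero>\<^bsub>L\<^esub>" using w by (auto simp: kernel_def)
qed

text \<open>An element of the free group with prescribed coordinates; for the coordinates of
  \<open>w\<close> it is a normal form of \<open>w\<close> modulo the relators.\<close>

definition sect :: "(nat \<Rightarrow> 'b) \<Rightarrow> ('b \<times> 'm \<Rightarrow>\<^sub>0 int)" where
 "sect v = (\<Sum>i<n. frag_of (v i, e i))"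

lemma sect_closed: "(\<And>i. i < n \<Longrightarrow> v i \<in> carrier L) \<Longrightarrow> sect v \<in> carrier G"
 unfolding sect_def by (rule sum_closed_free_Abelian_group) (use e(1) G_closed in auto)

lemma \<theta>_sum:
 assumes "i < n" "finite I" "\<And>j. j \<in> I \<Longrightarrow> f j \<in> carrier G"
 shows "\<theta> i (\<Sum>j\<in>I. f j) = (\<Oplus>\<^bsub>L\<^esub>j\<in>I. \<theta> i (f j))"
 using assms(2,3)
proof (induction I rule: finite_induct)
 case (insert j I)
 have "(\<Sum>j\<in>I. f j) \<in> carrier G" by (rule sum_closed_free_Abelian_group) (use insert.prems in auto)
 thus ?case using insert assms(1) by (simp add: \<theta>_simps Pi_iff)
qed (simp add: \<theta>_simps[OF assms(1)])

lemma \<theta>_sect: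
 assumes i: "i < n" and v: "\<And>i. i < n \<Longrightarrow> v i \<in> carrier L"
 shows "\<theta> i (sect v) = v i"
proof -
 have "\<theta> i (sect v) = (\<Oplus>\<^bsub>L\<^esub>j\<in>{..<n}. \<theta> i (frag_of (v j, e j)))"
  unfolding sect_def by (rule \<theta>_sum[OF i]) (use v e(1) G_closed in auto)
 also have "\<dots> = (\<Oplus>\<^bsub>L\<^esub>j\<in>{..<n}. if i = j then v j else \<zero>\<^bsub>L\<^esub>)"
  using i v e \<theta>(2)[OF i] by (intro L.finsum_cong') auto
 also have "\<dots> = v i" by (rule L.finsum_delta) (use i v in auto)
 finally show ?thesis .
qed

text \<open>Modulo the relators every element of the free group is determined by its coordinates.\<close>

lemma sect_\<theta>:
 assumes "w \<in> carrier G" shows "w - sect (\<lambda>i. \<theta> i w) \<in> N"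
proof -
 have "Poly_Mapping.keys w \<subseteq> carrier L \<times> carrier M" using assms by (simp add: G_iff)
 thus ?thesis
 proof (induction w rule: free_Abelian_group_induct[consumes 1])
  case 1
  have "sect (\<lambda>i. \<theta> i 0) = (\<Sum>i<n. frag_of (\<zero>\<^bsub>L\<^esub>, e i))" unfolding sect_def by (simp add: \<theta>_simps)
  hence "sect (\<lambda>i. \<theta> i 0) \<in> N" using e(1) N_zero(1) by (auto intro: N_sum)
  thus ?case using N_closed(3) by simp
 next
  case (2 u w)
  have uw: "u \<in> carrier G" "w \<in> carrier G" using 2 by (auto simp: G_iff)
  \<comment> \<open>\<open>sect\<close> is additive only modulo the relators, and the
    \<open>?r i\<close> are the corrections.\<close>
  let ?r = "\<lambda>i. frag_of (\<theta> i u, e i) - frag_of (\<theta> i (u - w), e i) - frag_of (\<theta> i w, e i)"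
  have "?r i \<in> N" if i: "i < n" for i
  proof -
   have "\<theta> i (u - w) \<oplus>\<^bsub>L\<^esub> \<theta> i w = \<theta> i u"
    using \<theta>_simps(1,3)[OF i] uw by (simp add: L.minus_eq L.a_assoc L.l_neg)
   thus ?thesis
    using N_relators(1)[of "\<theta> i (u - w)" "\<theta> i w" "e i"] \<theta>_simps(1)[OF i] G_closed(3)[OF uw] uw e(1)[OF i] by simp
  qed
  hence "(\<Sum>i<n. ?r i) \<in> N" by (intro N_sum) auto
  also have "(\<Sum>i<n. ?r i) = sect (\<lambda>i. \<theta> i u) - sect (\<lambda>i. \<theta> i (u - w)) - sect (\<lambda>i. \<theta> i w)"
   unfolding sect_def by (simp add: sum_subtractf)
  finally have "(u - sect (\<lambda>i. \<theta> i u)) - (w - sect (\<lambda>i. \<theta> i w)) +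
    (sect (\<lambda>i. \<theta> i u) - sect (\<lambda>i. \<theta> i (u - w)) - sect (\<lambda>i. \<theta> i w)) \<in> N"
   by (rule N_closed(2)[OF N_closed(4)[OF 2(3,4)]])
  thus ?case by simp
 next
  case (3 p)
  then obtain a x where p: "p = (a, x)" "a \<in> carrier L" "x \<in> carrier M" by auto
  have sum: "frag_of (a, \<Oplus>\<^bsub>M\<^esub>i\<in>I. f i) - (\<Sum>i\<in>I. frag_of (a, f i)) \<in> N"
   if "finite I" "\<And>i. i \<in> I \<Longrightarrow> f i \<in> carrier M" for I :: "nat set" and f
   using that
  proof (induction I rule: finite_induct)
   case empty
   thus ?case using N_zero(2)[OF p(2)] by simp
  next
   case (insert i I)
   have "frag_of (a, f i \<oplus>\<^bsub>M\<^esub> (\<Oplus>\<^bsub>M\<^esub>i\<in>I. f i)) - frag_of (a, f i) - frag_of (a, \<Oplus>\<^bsub>M\<^esub>i\<in>I. f i) \<in> N"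
    by (rule N_relators(2)) (use p insert.prems in \<open>auto intro!: M.finsum_closed\<close>)
   from N_closed(2)[OF this insert.IH]
   show ?case using insert by (simp add: Pi_iff algebra_simps)
  qed
  let ?f = "\<lambda>i. crd i x \<odot>\<^bsub>M\<^esub> e i"
  have fc: "?f i \<in> carrier M" if "i < n" for i using e(1)[OF that] crd_closed[OF that p(3)] by simp
  \<comment> \<open>Two corrections: here \<open>x\<close> is expanded in the basis and the tensor
    distributed over the sum; next the coefficients from \<open>K\<close> are moved across the
    tensor sign.\<close>
  have 1: "frag_of (a, x) - (\<Sum>i<n. frag_of (a, ?f i)) \<in> N"
   using sum[of "{..<n}" ?f] fc expansion[of e, OF e p(3)] by simp
  have 2: "(\<Sum>i<n. frag_of (a \<otimes>\<^bsub>L\<^esub> h (crd i x), e i) - frag_of (a, ?f i)) \<in> N"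
   by (rule N_sum) (use p e(1) crd_closed[OF _ p(3)] in \<open>auto intro!: N_relators(3)\<close>)
  have "sect (\<lambda>i. \<theta> i (frag_of (a, x))) = (\<Sum>i<n. frag_of (a \<otimes>\<^bsub>L\<^esub> h (crd i x), e i))"
   unfolding sect_def using \<theta>(2) p by simp
  thus ?case using N_closed(4)[OF 1 2] unfolding p(1) by (simp add: sum_subtractf)
 qed
qed

text \<open>If all coordinates vanish, the normal form is a sum of tensors with first factor zero
  and lies in \<open>N\<close>; so does \<open>w\<close>, by \<open>sect_\<theta>\<close>.\<close>

lemma null_iff: assumes "w \<in> carrier G" shows "w \<in> N \<longleftrightarrow> (\<forall>i<n. \<theta> i w = \<zero>\<^bsub>L\<^esub>)"
proof
 assume "\<forall>i<n. \<theta> i w = \<zero>\<^bsub>L\<^esub>"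
 hence "sect (\<lambda>i. \<theta> i w) = (\<Sum>i<n. frag_of (\<zero>\<^bsub>L\<^esub>, e i))" unfolding sect_def by simp
 hence "sect (\<lambda>i. \<theta> i w) \<in> N" using e(1) N_zero(1) by (auto intro: N_sum)
 from N_closed(2)[OF sect_\<theta>[OF assms] this] show "w \<in> N" by simp
qed (use \<theta>_null in auto)

lemma C_eq_iff:
 assumes "u \<in> carrier G" "w \<in> carrier G" shows "C u = C w \<longleftrightarrow> (\<forall>i<n. \<theta> i u = \<theta> i w)"
proof -
 interpret group G by (rule G)
 have "C u = C w \<longleftrightarrow> u \<in> C w"
  using repr_independence[of u N w] rcos_self[OF assms(1) N_subgroup] assms N_subgroup by auto
 also have "\<dots> \<longleftrightarrow> u - w \<in> N"
  using subgroup.rcos_module[OF N_subgroup is_group assms(2,1)] assms(2) by (simp add: G_iff)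
 also have "\<dots> \<longleftrightarrow> (\<forall>i<n. \<theta> i u = \<theta> i w)"
  using null_iff[OF G_closed(3)[OF assms]] \<theta>_simps(1,3) assms by simp
 finally show ?thesis .
qed

text \<open>An additive map that preserves \<open>N\<close> sends a coset into a coset, and the
  summand \<open>N\<close> in \<open>tensor_induced\<close> fills it up.\<close>

lemma C_induced:
 assumes F: "\<And>u. u \<in> carrier G \<Longrightarrow> frag_extend f u \<in> carrier G" "\<And>u. u \<in> N \<Longrightarrow> frag_extend f u \<in> N"
  and w: "w \<in> carrier G"
 shows "tensor_induced K L h M f (C w) = C (frag_extend f w)"
proof -
 have "tensor_induced K L h M f (C w) = {u + frag_extend f (v + w) | u v. u \<in> N \<and> v \<in> N}"
  unfolding tensor_induced_def set_mult_def r_coset_def by auto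
 also have "\<dots> = {u + frag_extend f w | u. u \<in> N}"
 proof (intro equalityI subsetI)
  fix y assume "y \<in> {u + frag_extend f (v + w) | u v. u \<in> N \<and> v \<in> N}"
  then obtain u v where uv: "u \<in> N" "v \<in> N" "y = u + frag_extend f (v + w)" by auto
  hence "y = (u + frag_extend f v) + frag_extend f w" by (simp add: frag_extend_add)
  thus "y \<in> {u + frag_extend f w | u. u \<in> N}" using N_closed(2)[OF uv(1) F(2)[OF uv(2)]] by auto
 next
  fix y assume "y \<in> {u + frag_extend f w | u. u \<in> N}"
  then obtain u where "u \<in> N" "y = u + frag_extend f (0 + w)" by auto
  thus "y \<in> {u + frag_extend f (v + w) | u v. u \<in> N \<and> v \<in> N}" using N_closed(1) by blast
 qed
 also have "\<dots> = C (frag_extend f w)" unfolding r_coset_def by auto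
 finally show ?thesis .
qed

abbreviation "BC \<equiv> base_change K L h M"

lemma BC_carrier: "carrier BC = C ` carrier G"
 by (simp add: base_change_def Let_def carrier_FactGroup)

lemma BC_zero: "\<zero>\<^bsub>BC\<^esub> = C 0"
proof -
 interpret group G by (rule G)
 have "C 0 = N" using coset_mult_one[of N] subgroup.subset[OF N_subgroup] by simp
 thus ?thesis by (simp add: base_change_def Let_def)
qed

lemma BC_add: assumes "u \<in> carrier G" "w \<in> carrier G" shows "C u \<oplus>\<^bsub>BC\<^esub> C w = C (u + w)"
proof -
 interpret comm_group G by (rule G)
 interpret normal N G by (rule subgroup_imp_normal[OF N_subgroup])
 show ?thesis using rcos_sum[OF assms] by (simp add: base_change_def Let_def)
qed

lemma scaling:
 assumes a: "a \<in> carrier L" and w: "w \<in> carrier G"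
 defines "F \<equiv> frag_extend (\<lambda>(b, x). frag_of (a \<otimes>\<^bsub>L\<^esub> b, x))"
 shows "F w \<in> carrier G" "i < n \<Longrightarrow> \<theta> i (F w) = a \<otimes>\<^bsub>L\<^esub> \<theta> i w"
proof -
 show "F w \<in> carrier G" unfolding F_def by (rule extend(1)[OF _ w]) (use a G_closed(5) in auto)
 assume i: "i < n"
 show "\<theta> i (F w) = a \<otimes>\<^bsub>L\<^esub> \<theta> i w"
  unfolding F_def
 proof (rule extend(2)[OF _ w \<theta>(1)[OF i]])
  show "(\<lambda>w. a \<otimes>\<^bsub>L\<^esub> \<theta> i w) \<in> hom G (add_monoid L)"
   by (rule homI) (use a \<theta>_simps[OF i] in \<open>auto simp: L.r_distr\<close>)
 qed (use a i \<theta>(2)[OF i] G_closed(5) crd_closed[OF i] in \<open>auto simp: L.m_assoc\<close>)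
qed

lemma BC_smult:
 assumes a: "a \<in> carrier L" and w: "w \<in> carrier G"
 shows "a \<odot>\<^bsub>BC\<^esub> C w = C (frag_extend (\<lambda>(b, x). frag_of (a \<otimes>\<^bsub>L\<^esub> b, x)) w)"
proof -
 have "frag_extend (\<lambda>(b, x). frag_of (a \<otimes>\<^bsub>L\<^esub> b, x)) u \<in> N" if "u \<in> N" for u
  using null_iff[OF scaling(1)[OF a N_carrier[OF that]]] scaling(2)[OF a N_carrier[OF that]] \<theta>_null[OF that] a by simp
 from C_induced[OF scaling(1)[OF a] this w]
 show ?thesis by (simp add: base_change_def Let_def)
qed

definition bcrd :: "nat \<Rightarrow> ('b \<times> 'm \<Rightarrow>\<^sub>0 int) set \<Rightarrow> 'b" where
 "bcrd i X = \<theta> i (SOME w. w \<in> carrier G \<and> X = C w)"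

lemma bcrd: assumes "w \<in> carrier G" "i < n" shows "bcrd i (C w) = \<theta> i w"
proof -
 define u where "u = (SOME u. u \<in> carrier G \<and> C w = C u)"
 have "u \<in> carrier G \<and> C w = C u" unfolding u_def by (rule someI[of _ w]) (rule conjI[OF assms(1) refl])
 note u = conjunct1[OF this] conjunct2[OF this]
 have "\<forall>i<n. \<theta> i w = \<theta> i u" by (rule iffD1[OF C_eq_iff[OF assms(1) u(1)] u(2)])
 thus ?thesis using assms(2) unfolding bcrd_def u_def[symmetric] by simp
qed

sublocale BC: coordinate_space L BC n bcrd
proof (intro coordinate_space.intro coordinate_space_axioms.intro L.field_axioms)
 show "\<zero>\<^bsub>BC\<^esub> \<in> carrier BC" unfolding BC_zero BC_carrier using G_closed(1) by blast
 fix i assume i: "i < n"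
 show "bcrd i \<zero>\<^bsub>BC\<^esub> = \<zero>\<^bsub>L\<^esub>" unfolding BC_zero using bcrd[OF G_closed(1) i] \<theta>_simps(4)[OF i] by simp
next
 fix X Y assume "X \<in> carrier BC" "Y \<in> carrier BC"
 then obtain u w where uw: "u \<in> carrier G" "X = C u" "w \<in> carrier G" "Y = C w" unfolding BC_carrier by blast
 show "X \<oplus>\<^bsub>BC\<^esub> Y \<in> carrier BC" unfolding uw(2,4) BC_add[OF uw(1,3)] BC_carrier using G_closed(2)[OF uw(1,3)] by blast
 show "bcrd i (X \<oplus>\<^bsub>BC\<^esub> Y) = bcrd i X \<oplus>\<^bsub>L\<^esub> bcrd i Y" if "i < n" for i
  unfolding uw(2,4) BC_add[OF uw(1,3)] using bcrd[OF _ that] G_closed(2)[OF uw(1,3)] uw \<theta>_simps(2)[OF that] by simp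
 show "X = Y" if "\<And>i. i < n \<Longrightarrow> bcrd i X = bcrd i Y"
  using that bcrd uw C_eq_iff[OF uw(1,3)] by simp
next
 fix a X assume a: "a \<in> carrier L" and "X \<in> carrier BC"
 then obtain u where u: "u \<in> carrier G" "X = C u" unfolding BC_carrier by blast
 show "a \<odot>\<^bsub>BC\<^esub> X \<in> carrier BC" unfolding u(2) BC_smult[OF a u(1)] BC_carrier using scaling(1)[OF a u(1)] by blast
 show "bcrd i (a \<odot>\<^bsub>BC\<^esub> X) = a \<otimes>\<^bsub>L\<^esub> bcrd i X" if "i < n" for i
  unfolding u(2) BC_smult[OF a u(1)] using bcrd[OF scaling(1)[OF a u(1)] that] bcrd[OF u(1) that] scaling(2)[OF a u(1) that] by simp
next
 fix i X assume i: "i < n" and "X \<in> carrier BC"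
 then obtain u where u: "u \<in> carrier G" "X = C u" unfolding BC_carrier by blast
 show "bcrd i X \<in> carrier L" unfolding u(2) bcrd[OF u(1) i] by (rule \<theta>_simps(1)[OF i u(1)])
next
 fix v assume v: "\<And>i. i < n \<Longrightarrow> v i \<in> carrier L"
 have s: "sect v \<in> carrier G" using sect_closed[of v] v by simp
 show "\<exists>x\<in>carrier BC. \<forall>i<n. bcrd i x = v i"
 proof (rule bexI[of _ "C (sect v)"])
  show "\<forall>i<n. bcrd i (C (sect v)) = v i" using bcrd[OF s] \<theta>_sect[of _ v] v by simp
  show "C (sect v) \<in> carrier BC" unfolding BC_carrier using s by blast
 qed
qed

lemma tensor_closed: "a \<in> carrier L \<Longrightarrow> x \<in> carrier M \<Longrightarrow> tensor K L h M a x \<in> carrier BC"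
 unfolding tensor_def BC_carrier using G_closed(5) by blast

lemma bcrd_tensor: "a \<in> carrier L \<Longrightarrow> x \<in> carrier M \<Longrightarrow> i < n \<Longrightarrow> bcrd i (tensor K L h M a x) = a \<otimes>\<^bsub>L\<^esub> h (crd i x)"
 unfolding tensor_def using bcrd[OF G_closed(5)] \<theta>(2) by simp

text \<open>The formula is additive in the representative, so it is checked on generators
  \<open>(a, x)\<close> by expanding \<open>nab x\<close> in the basis. Its right-hand side vanishes
  when all coordinates do, hence the map on the free group preserves \<open>N\<close> and descends
  to classes.\<close>

lemma bcrd_nab:
 assumes ext: "differential_field_extension K dK L dL h" and nab: "differential_module K dK M nab"
  and X: "X \<in> carrier BC" and i: "i < n"
 shows "base_change_nab K L dL h M nab X \<in> carrier BC"
  "bcrd i (base_change_nab K L dL h M nab X) =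
   dL (bcrd i X) \<oplus>\<^bsub>L\<^esub> (\<Oplus>\<^bsub>L\<^esub>j\<in>{..<n}. h (crd i (nab (e j))) \<otimes>\<^bsub>L\<^esub> bcrd j X)"
proof -
 interpret ext: differential_field_extension K dK L dL h by (rule ext)
 interpret nab: differential_module K dK M nab by (rule nab)
 have nabc: "nab x \<in> carrier M" if "x \<in> carrier M" for x using nab.nab_closed[OF that] .
 have Nc: "h (crd i (nab (e j))) \<in> carrier L" if "i < n" "j < n" for i j
  using crd_closed[OF that(1) nabc[OF e(1)[OF that(2)]]] by simp
 have nab_finsum: "nab (\<Oplus>\<^bsub>M\<^esub>j\<in>I. f j) = (\<Oplus>\<^bsub>M\<^esub>j\<in>I. nab (f j))"
  if "finite I" "\<And>j. j \<in> I \<Longrightarrow> f j \<in> carrier M" for I :: "nat set" and f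
  using that
 proof (induction I rule: finite_induct)
  case empty
  have "nab \<zero>\<^bsub>M\<^esub> \<oplus>\<^bsub>M\<^esub> nab \<zero>\<^bsub>M\<^esub> = nab \<zero>\<^bsub>M\<^esub> \<oplus>\<^bsub>M\<^esub> \<zero>\<^bsub>M\<^esub>" using nab.nab_add[of "\<zero>\<^bsub>M\<^esub>" "\<zero>\<^bsub>M\<^esub>"] nabc by simp
  hence "nab \<zero>\<^bsub>M\<^esub> = \<zero>\<^bsub>M\<^esub>" using nabc[of "\<zero>\<^bsub>M\<^esub>"] by (subst (asm) M.add.l_cancel) auto
  thus ?case by simp
 next
  case (insert j I)
  thus ?case using nabc M.finsum_closed[of f I] by (simp add: nab.nab_add Pi_iff)
 qed
 have crd_nab: "crd i (nab x) = dK (crd i x) \<oplus>\<^bsub>K\<^esub> (\<Oplus>\<^bsub>K\<^esub>j\<in>{..<n}. crd j x \<otimes>\<^bsub>K\<^esub> crd i (nab (e j)))"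
  if x: "x \<in> carrier M" and i: "i < n" for x i
 proof -
  have c: "crd j x \<in> carrier K" "e j \<in> carrier M" "nab (e j) \<in> carrier M" "dK (crd j x) \<in> carrier K"
    "crd i (nab (e j)) \<in> carrier K" if "j < n" for j
   using crd_closed[OF that x] e(1)[OF that] nabc[OF e(1)[OF that]] ext.K.d_closed crd_closed[OF i] by auto
  have "nab x = nab (\<Oplus>\<^bsub>M\<^esub>j\<in>{..<n}. crd j x \<odot>\<^bsub>M\<^esub> e j)" using expansion[of e, OF e x] by simp
  also have "\<dots> = (\<Oplus>\<^bsub>M\<^esub>j\<in>{..<n}. nab (crd j x \<odot>\<^bsub>M\<^esub> e j))" by (rule nab_finsum) (use c in auto)
  also have "crd i \<dots> = (\<Oplus>\<^bsub>K\<^esub>j\<in>{..<n}. crd i (nab (crd j x \<odot>\<^bsub>M\<^esub> e j)))"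
   by (rule crd_finsum) (use c i nabc in auto)
  also have "\<dots> = (\<Oplus>\<^bsub>K\<^esub>j\<in>{..<n}. (if i = j then dK (crd j x) else \<zero>\<^bsub>K\<^esub>) \<oplus>\<^bsub>K\<^esub> crd j x \<otimes>\<^bsub>K\<^esub> crd i (nab (e j)))"
   using c i e(2) by (intro finsum_cong') (auto simp: nab.nab_smult crd_add crd_smult)
  also have "\<dots> = (\<Oplus>\<^bsub>K\<^esub>j\<in>{..<n}. if i = j then dK (crd j x) else \<zero>\<^bsub>K\<^esub>) \<oplus>\<^bsub>K\<^esub>
    (\<Oplus>\<^bsub>K\<^esub>j\<in>{..<n}. crd j x \<otimes>\<^bsub>K\<^esub> crd i (nab (e j)))"
   by (rule finsum_addf) (use c in auto)
  also have "(\<Oplus>\<^bsub>K\<^esub>j\<in>{..<n}. if i = j then dK (crd j x) else \<zero>\<^bsub>K\<^esub>) = dK (crd i x)"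
   by (rule finsum_delta) (use c i in auto)
  finally show ?thesis .
 qed
 define F where "F = frag_extend (\<lambda>(a, x). frag_of (dL a, x) + frag_of (a, nab x))"
 let ?R = "\<lambda>i w. dL (\<theta> i w) \<oplus>\<^bsub>L\<^esub> (\<Oplus>\<^bsub>L\<^esub>j\<in>{..<n}. h (crd i (nab (e j))) \<otimes>\<^bsub>L\<^esub> \<theta> j w)"
 have dL0: "dL \<zero>\<^bsub>L\<^esub> = \<zero>\<^bsub>L\<^esub>" using L.derivation_zero[OF ext.L.derivation_d] .
 have gen: "frag_of (dL a, x) + frag_of (a, nab x) \<in> carrier G" if "a \<in> carrier L" "x \<in> carrier M" for a x
  using that nabc ext.L.d_closed by (intro G_closed) auto
 have Rhom: "?R i \<in> hom G (add_monoid L)" if i: "i < n" for i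
 proof (rule homI)
  fix u w assume uw: "u \<in> carrier G" "w \<in> carrier G"
  have t: "\<theta> j u \<in> carrier L" "\<theta> j w \<in> carrier L" "\<theta> j (u + w) = \<theta> j u \<oplus>\<^bsub>L\<^esub> \<theta> j w" "h (crd i (nab (e j))) \<in> carrier L"
   if "j < n" for j using \<theta>_simps(1,2)[OF that] uw Nc[OF i that] by auto
  let ?s = "\<lambda>w. \<Oplus>\<^bsub>L\<^esub>j\<in>{..<n}. h (crd i (nab (e j))) \<otimes>\<^bsub>L\<^esub> \<theta> j w"
  have sc: "?s u \<in> carrier L" "?s w \<in> carrier L" using t by (auto intro!: L.finsum_closed)
  have dt: "dL (\<theta> i u) \<in> carrier L" "dL (\<theta> i w) \<in> carrier L" using t[OF i] ext.L.d_closed by auto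
  show "?R i u \<in> carrier (add_monoid L)" using sc dt by simp
  have "?s (u + w) = (\<Oplus>\<^bsub>L\<^esub>j\<in>{..<n}. h (crd i (nab (e j))) \<otimes>\<^bsub>L\<^esub> \<theta> j u \<oplus>\<^bsub>L\<^esub> h (crd i (nab (e j))) \<otimes>\<^bsub>L\<^esub> \<theta> j w)"
   by (rule L.finsum_cong') (use t in \<open>auto simp: L.r_distr\<close>)
  also have "\<dots> = ?s u \<oplus>\<^bsub>L\<^esub> ?s w" by (rule L.finsum_addf) (use t in auto)
  finally have "?s (u + w) = ?s u \<oplus>\<^bsub>L\<^esub> ?s w" .
  thus "?R i (u \<otimes>\<^bsub>G\<^esub> w) = ?R i u \<otimes>\<^bsub>add_monoid L\<^esub> ?R i w"
   using sc dt t[OF i] by (simp add: ext.L.d_add L.a_ac)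
 qed
 have base: "\<theta> i (frag_of (dL a, x) + frag_of (a, nab x)) = ?R i (frag_of (a, x))"
  if i: "i < n" and p: "a \<in> carrier L" "x \<in> carrier M" for i a x
 proof -
  have c: "dL a \<in> carrier L" "nab x \<in> carrier M" using p nabc ext.L.d_closed by auto
  have xc: "crd j x \<in> carrier K" "crd i (nab (e j)) \<in> carrier K" if "j < n" for j
   using crd_closed[OF that p(2)] crd_closed[OF i nabc[OF e(1)[OF that]]] .
  have hs: "h (\<Oplus>\<^bsub>K\<^esub>j\<in>{..<n}. crd j x \<otimes>\<^bsub>K\<^esub> crd i (nab (e j))) = (\<Oplus>\<^bsub>L\<^esub>j\<in>{..<n}. h (crd j x) \<otimes>\<^bsub>L\<^esub> h (crd i (nab (e j))))"
   using xc by (subst H.hom_finsum) (auto intro!: L.finsum_cong')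
  have sc: "(\<Oplus>\<^bsub>L\<^esub>j\<in>{..<n}. h (crd j x) \<otimes>\<^bsub>L\<^esub> h (crd i (nab (e j)))) \<in> carrier L"
   using xc by (auto intro!: L.finsum_closed)
  have sK: "(\<Oplus>\<^bsub>K\<^esub>j\<in>{..<n}. crd j x \<otimes>\<^bsub>K\<^esub> crd i (nab (e j))) \<in> carrier K"
   using xc by (auto intro!: finsum_closed)
  have d: "dK (crd i x) \<in> carrier K" "dL (h (crd i x)) = h (dK (crd i x))"
   using ext.K.d_closed[OF xc(1)[OF i]] ext.hom_d[OF xc(1)[OF i]] by auto
  have "\<theta> i (frag_of (dL a, x) + frag_of (a, nab x)) = dL a \<otimes>\<^bsub>L\<^esub> h (crd i x) \<oplus>\<^bsub>L\<^esub> a \<otimes>\<^bsub>L\<^esub> h (crd i (nab x))"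
   using \<theta>_simps(2)[OF i G_closed(5)[OF c(1) p(2)] G_closed(5)[OF p(1) c(2)]] \<theta>(2)[OF i] c p by simp
  also have "\<dots> = dL (a \<otimes>\<^bsub>L\<^esub> h (crd i x)) \<oplus>\<^bsub>L\<^esub> a \<otimes>\<^bsub>L\<^esub> (\<Oplus>\<^bsub>L\<^esub>j\<in>{..<n}. h (crd j x) \<otimes>\<^bsub>L\<^esub> h (crd i (nab (e j))))"
   unfolding crd_nab[OF p(2) i] using p c d xc(1)[OF i] sc sK
   by (simp add: hs ext.L.d_mult L.r_distr L.a_assoc)
  also have "a \<otimes>\<^bsub>L\<^esub> (\<Oplus>\<^bsub>L\<^esub>j\<in>{..<n}. h (crd j x) \<otimes>\<^bsub>L\<^esub> h (crd i (nab (e j)))) =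
    (\<Oplus>\<^bsub>L\<^esub>j\<in>{..<n}. a \<otimes>\<^bsub>L\<^esub> (h (crd j x) \<otimes>\<^bsub>L\<^esub> h (crd i (nab (e j)))))"
   by (rule L.finsum_rdistr) (use p xc in auto)
  also have "\<dots> = (\<Oplus>\<^bsub>L\<^esub>j\<in>{..<n}. h (crd i (nab (e j))) \<otimes>\<^bsub>L\<^esub> \<theta> j (frag_of (a, x)))"
   using p xc \<theta>(2) by (intro L.finsum_cong') (auto simp: L.m_ac)
  finally show ?thesis using p \<theta>(2)[OF i] by simp
 qed
 have F: "F w \<in> carrier G \<and> (\<forall>i<n. \<theta> i (F w) = ?R i w)" if w: "w \<in> carrier G" for w
 proof (intro conjI allI impI)
  show "F w \<in> carrier G" unfolding F_def by (rule extend(1)[OF _ w]) (use gen in simp)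
  show "\<theta> i (F w) = ?R i w" if i: "i < n" for i
   unfolding F_def by (rule extend(2)[OF _ w \<theta>(1)[OF i] Rhom[OF i]]) (use gen base[OF i] in simp_all)
 qed
 have FN: "F u \<in> N" if "u \<in> N" for u
 proof -
  note uG = N_carrier[OF that]
  have "\<theta> i (F u) = \<zero>\<^bsub>L\<^esub>" if i: "i < n" for i
  proof -
   have "(\<Oplus>\<^bsub>L\<^esub>j\<in>{..<n}. h (crd i (nab (e j))) \<otimes>\<^bsub>L\<^esub> \<theta> j u) = (\<Oplus>\<^bsub>L\<^esub>j\<in>{..<n}. \<zero>\<^bsub>L\<^esub>)"
    using Nc[OF i] \<theta>_null[OF \<open>u \<in> N\<close>] by (intro L.finsum_cong') auto
   thus ?thesis using F[OF uG] i \<theta>_null[OF \<open>u \<in> N\<close> i] by (simp add: dL0)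
  qed
  thus ?thesis using null_iff F[OF uG] by blast
 qed
 obtain w where w: "w \<in> carrier G" "X = C w" using X unfolding BC_carrier by blast
 have nX: "base_change_nab K L dL h M nab X = C (F w)"
  unfolding base_change_nab_def w(2) F_def
  by (rule C_induced[OF _ _ w(1)]) (use F FN in \<open>simp_all add: F_def\<close>)
 show "base_change_nab K L dL h M nab X \<in> carrier BC" unfolding nX BC_carrier using F[OF w(1)] by blast
 have Fw: "F w \<in> carrier G" using F[OF w(1)] by simp
 have "(\<Oplus>\<^bsub>L\<^esub>j\<in>{..<n}. h (crd i (nab (e j))) \<otimes>\<^bsub>L\<^esub> bcrd j X) = (\<Oplus>\<^bsub>L\<^esub>j\<in>{..<n}. h (crd i (nab (e j))) \<otimes>\<^bsub>L\<^esub> \<theta> j w)"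
  unfolding w(2) using Nc[OF i] bcrd[OF w(1)] \<theta>_simps(1)[OF _ w(1)] by (intro L.finsum_cong') auto
 thus "bcrd i (base_change_nab K L dL h M nab X) =
   dL (bcrd i X) \<oplus>\<^bsub>L\<^esub> (\<Oplus>\<^bsub>L\<^esub>j\<in>{..<n}. h (crd i (nab (e j))) \<otimes>\<^bsub>L\<^esub> bcrd j X)"
  unfolding nX bcrd[OF Fw i] using F[OF w(1)] i bcrd[OF w(1) i] w(2) by simp
qed

end

section \<open>Existence of Picard--Vessiot extensions\<close>

theorem theorem2p2:
  fixes K :: "('a, 'r) ring_scheme"
    and d :: "'a \<Rightarrow> 'a"
    and M :: "('a, 'm, 't) module_scheme"
    and nab :: "'m \<Rightarrow> 'm"
  assumes "differential_field K d"
    and "char_zero (K\<lparr>carrier := constants K d\<rparr>)"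
    and "existentially_closed_in (constants K d) K"
    and "differential_module K d M nab"
  shows "\<exists>(L :: 'a ring) (dL :: 'a \<Rightarrow> 'a) (h :: 'a \<Rightarrow> 'a).
           picard_vessiot_extension K d M nab L dL h"
proof -
 interpret DM: differential_module K d M nab by (rule assms(4))
 obtain \<beta> where \<beta>: "finite \<beta>" "DM.V.basis \<beta>" using DM.V.finite_basis_exists[OF DM.finite_dimensional] by auto
 define n where "n = card \<beta>"
 obtain e where "bij_betw e {..<n} \<beta>" using ex_bij_betw_nat_finite[OF \<beta>(1)] by (auto simp: n_def atLeast0LessThan)
 hence e: "inj_on e {..<n}" "e ` {..<n} = \<beta>" by (simp_all add: bij_betw_def)
 obtain crd where cs: "coordinate_space K M n crd" and
  delta: "\<And>i j. i < n \<Longrightarrow> j < n \<Longrightarrow> crd i (e j) = (if i = j then \<one>\<^bsub>K\<^esub> else \<zero>\<^bsub>K\<^esub>)"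
  using DM.V.finite_basis_coordinates[OF e(1), unfolded e(2), OF \<beta>(2)] by auto
 interpret cs: coordinate_space K M n crd by (rule cs)
 have eM: "e j \<in> carrier M" if "j < n" for j using \<beta>(2) e(2) that by (auto simp: DM.V.basis_def)
 \<comment> \<open>In coordinates a vector is horizontal when \<open>x' + N x = 0\<close>, with
   \<open>N\<close> the matrix of \<open>nab\<close>; the sign turns this into
   \<open>x' = A x\<close>.\<close>
 define A where "A i j = \<ominus>\<^bsub>K\<^esub> crd i (nab (e j))" for i j
 have crdN: "crd i (nab (e j)) \<in> carrier K" if "i < n" "j < n" for i j
  using cs.crd_closed[OF that(1) DM.nab_closed[OF eM[OF that(2)]]] .
 hence A: "A \<in> mats n (carrier K)" by (simp add: mats_def A_def)
 obtain L :: "'a ring" and dL h X W where fm: "fundamental_matrix K d L dL h n A X W"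
  and const: "constants L dL = h ` constants K d"
  and gen: "carrier L \<subseteq> generate_field L (h ` carrier K \<union> case_prod X ` ({..<n} \<times> {..<n}))"
  using fundamental_matrix_exists_on_type[OF assms(1-3) A] by metis
 interpret fm: fundamental_matrix K d L dL h n A X W by (rule fm)
 have ext: "differential_field_extension K d L dL h" by unfold_locales
 interpret bc: base_change_space K M n crd L h e
  by (intro base_change_space.intro base_change_space_axioms.intro cs fm.L.field_axioms
    ring_hom_cring.intro ring_hom_cring_axioms.intro DM.cring_axioms fm.L.cring_axioms fm.hom eM delta)
 interpret BC: vectorspace L bc.BC by (rule bc.BC.vectorspace)
 \<comment> \<open>The columns of the fundamental matrix as coordinates of vectors in the base
   change.\<close>
 have "\<exists>b\<in>carrier bc.BC. \<forall>i<n. bc.bcrd i b = X i j" if "j < n" for j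
  by (rule bc.BC.crd_surj) (use matsD[OF fm.X] that in auto)
 then obtain b where b: "\<And>j. j < n \<Longrightarrow> b j \<in> carrier bc.BC" "\<And>i j. i < n \<Longrightarrow> j < n \<Longrightarrow> bc.bcrd i (b j) = X i j"
  by metis
 let ?B = "b ` {..<n}"
 have basis: "vectorspace.basis L bc.BC ?B"
  by (rule bc.BC.basis_of_invertible[OF fm.X fm.W fm.inverse b])
 have horizontal: "base_change_nab K L dL h M nab (b j) = \<zero>\<^bsub>bc.BC\<^esub>" if j: "j < n" for j
 proof (rule bc.BC.crd_inj)
  have c: "h (crd i (nab (e l))) \<in> carrier L" if "i < n" "l < n" for i l
   using ring_hom_closed[OF fm.hom crdN[OF that]] .
  show "base_change_nab K L dL h M nab (b j) \<in> carrier bc.BC"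
   by (rule bc.bcrd_nab(1)[OF ext assms(4) b(1)[OF j] j])
  fix i assume i: "i < n"
  let ?s = "\<Oplus>\<^bsub>L\<^esub>l\<in>{..<n}. h (crd i (nab (e l))) \<otimes>\<^bsub>L\<^esub> X l j"
  have sc: "?s \<in> carrier L" using c[OF i] matsD[OF fm.X] j by (auto intro!: fm.L.finsum_closed)
  have "dL (X i j) = mmult L n (\<lambda>i j. h (A i j)) X i j" by (rule fm.dX[OF i j])
  also have "\<dots> = (\<Oplus>\<^bsub>L\<^esub>l\<in>{..<n}. \<ominus>\<^bsub>L\<^esub> \<one>\<^bsub>L\<^esub> \<otimes>\<^bsub>L\<^esub> (h (crd i (nab (e l))) \<otimes>\<^bsub>L\<^esub> X l j))"
   unfolding mmult_def A_def using c[OF i] crdN[OF i] matsD[OF fm.X] j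
   by (intro fm.L.finsum_cong') (auto simp: bc.H.hom_a_inv fm.L.l_minus)
  also have "\<dots> = \<ominus>\<^bsub>L\<^esub> \<one>\<^bsub>L\<^esub> \<otimes>\<^bsub>L\<^esub> ?s"
   by (rule fm.L.finsum_rdistr[symmetric]) (use c[OF i] matsD[OF fm.X] j in auto)
  finally have dX: "dL (X i j) = \<ominus>\<^bsub>L\<^esub> ?s" using sc by (simp add: fm.L.l_minus)
  have "bc.bcrd i (base_change_nab K L dL h M nab (b j)) =
    dL (bc.bcrd i (b j)) \<oplus>\<^bsub>L\<^esub> (\<Oplus>\<^bsub>L\<^esub>l\<in>{..<n}. h (crd i (nab (e l))) \<otimes>\<^bsub>L\<^esub> bc.bcrd l (b j))"
   by (rule bc.bcrd_nab(2)[OF ext assms(4) b(1)[OF j] i])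
  also have "(\<Oplus>\<^bsub>L\<^esub>l\<in>{..<n}. h (crd i (nab (e l))) \<otimes>\<^bsub>L\<^esub> bc.bcrd l (b j)) = ?s"
   using c[OF i] matsD[OF fm.X] j b(2) by (intro fm.L.finsum_cong') auto
  finally show "bc.bcrd i (base_change_nab K L dL h M nab (b j)) = bc.bcrd i \<zero>\<^bsub>bc.BC\<^esub>"
   using b(2)[OF i j] dX sc by (simp add: fm.L.l_neg bc.BC.crd_zero[OF i])
 qed (rule bc.BC.V_closed(1))
 have minimal: "F = carrier L"
  if F: "differential_subfield F L dL" "h ` carrier K \<subseteq> F" "coordinates K L h M \<beta> ?B \<subseteq> F" for F
 proof -
  have Fs: "subfield F L" using F(1) by (simp add: differential_subfield_def)
  have XF: "X i j \<in> F" if ij: "i < n" "j < n" for i j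
  proof -
   \<comment> \<open>Column \<open>j\<close> of \<open>X\<close>, indexed by basis vectors instead
     of numbers. The sum of the tensors \<open>c u \<otimes> u\<close> is \<open>b j\<close>, so
     every entry of \<open>X\<close> occurs among the coordinates.\<close>
   let ?c = "\<lambda>u. X (the_inv_into {..<n} e u) j"
   have ce: "?c (e l) = X l j" if "l < n" for l using the_inv_into_f_f[OF e(1), of l] that by simp
   have cc: "?c \<in> \<beta> \<rightarrow> carrier L" unfolding e(2)[symmetric] using ce matsD[OF fm.X] ij by auto
   have tc: "tensor K L h M (X l j) (e l) \<in> carrier bc.BC" if "l < n" for l
    by (rule bc.tensor_closed[OF matsD[OF fm.X that ij(2)] eM[OF that]])
   have "(\<Oplus>\<^bsub>bc.BC\<^esub>u\<in>\<beta>. tensor K L h M (?c u) u) = (\<Oplus>\<^bsub>bc.BC\<^esub>l\<in>{..<n}. tensor K L h M (?c (e l)) (e l))"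
    unfolding e(2)[symmetric] by (rule BC.finsum_reindex[OF _ e(1)]) (use ce tc in auto)
   also have "\<dots> = (\<Oplus>\<^bsub>bc.BC\<^esub>l\<in>{..<n}. tensor K L h M (X l j) (e l))"
    using ce tc by (intro BC.finsum_cong') auto
   also have "\<dots> = b j"
   proof (rule bc.BC.crd_inj)
    show "(\<Oplus>\<^bsub>bc.BC\<^esub>l\<in>{..<n}. tensor K L h M (X l j) (e l)) \<in> carrier bc.BC"
     using tc by (intro BC.finsum_closed) auto
    fix i assume i: "i < n"
    have "bc.bcrd i (\<Oplus>\<^bsub>bc.BC\<^esub>l\<in>{..<n}. tensor K L h M (X l j) (e l)) =
      (\<Oplus>\<^bsub>L\<^esub>l\<in>{..<n}. bc.bcrd i (tensor K L h M (X l j) (e l)))"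
     by (rule bc.BC.crd_finsum) (use tc i in auto)
    also have "\<dots> = (\<Oplus>\<^bsub>L\<^esub>l\<in>{..<n}. if i = l then X l j else \<zero>\<^bsub>L\<^esub>)"
     using bc.bcrd_tensor[OF matsD[OF fm.X] eM i] ij(2) matsD[OF fm.X] delta[OF i]
     by (intro fm.L.finsum_cong') auto
    also have "\<dots> = X i j" by (rule fm.L.finsum_delta) (use i ij matsD[OF fm.X] in auto)
    finally show "bc.bcrd i (\<Oplus>\<^bsub>bc.BC\<^esub>l\<in>{..<n}. tensor K L h M (X l j) (e l)) = bc.bcrd i (b j)"
     using b(2)[OF i ij(2)] by simp
   qed (rule b(1)[OF ij(2)])
   finally have "(\<Oplus>\<^bsub>bc.BC\<^esub>u\<in>\<beta>. tensor K L h M (?c u) u) \<in> ?B" using ij by simp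
   moreover have "e i \<in> \<beta>" using e(2) ij by auto
   ultimately have "?c (e i) \<in> coordinates K L h M \<beta> ?B"
    unfolding coordinates_def mem_Collect_eq using cc by (intro exI[of _ ?c] exI[of _ "e i"] conjI refl)
   thus ?thesis using F(3) ce[OF ij(1)] by auto
  qed
  have "generate_field L (h ` carrier K \<union> case_prod X ` ({..<n} \<times> {..<n})) \<subseteq> F"
   by (rule fm.L.generate_field_subset[OF Fs]) (use F(2) XF in auto)
  thus ?thesis using gen subfieldE(3)[OF Fs] by auto
 qed
 have "picard_vessiot_extension K d M nab L dL h"
  unfolding picard_vessiot_extension_def
  using ext const basis horizontal \<beta>(2) minimal by (intro conjI exI[of _ ?B] exI[of _ \<beta>]) auto
 thus ?thesis by blast
qed

end
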